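(* Let $d\ge 2$ and let $\phi:\mathbb{R}^d\to\mathbb{R}$ satisfy: (1) $\int_{\mathbb{R}^d}e^{-\phi}\,dx=1$ and $\int_{\mathbb{R}^d}x\,e^{-\phi(x)}\,dx=0$; (2) $\phi\in C^2(\mathbb{R}^d;\mathbb{R})$ and for every $\varepsilon>0$ there is a constant $C_\varepsilon$ such that $|D^2\phi(x)|\le\varepsilon|\nabla\phi(x)|^2+C_\varepsilon$ for all $x\in\mathbb{R}^d$; (3) the Poincaré inequality with (optimal) constant $C_P$: $\int_{\mathbb{R}^d}|f-\langle f\rangle|^2e^{-\phi}\,dx\le C_P\int_{\mathbb{R}^d}|\nabla f|^2e^{-\phi}\,dx$ for all $f\in C_c^\infty(\mathbb{R}^d;\mathbb{R})$. Then there are constants $C_K'$ (precised Korn) and $C_{PK}'$ (precised Poincaré-Korn) such that for all vector fields $u\in H^1$: $$\inf_{R\in\mathcal{R}_\phi}\|u-R\|^2=\|u-\mathbb{P}_\phi(u)\|^2\le C_{PK}'\,\|D^su\|^2+2\,C_{RV}\,\|\nabla\phi\cdot u\|^2,$$ $$\inf_{R\in\mathcal{R}_\phi}\|D(u-R)\|^2=\|Du-\mathfrak{P}_\phi(Du)\|^2\le C_K'\,\|D^su\|^2+2\,C_{RD}\,\|\nabla\phi\cdot u\|^2.$$ Moreover $C_{PK}'$ and $C_K'$ have explicit bounds depending only on $C_P$, $C_\phi$, $C_\phi'$, $C_{RD}$ and $C_{RV}$.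
   Context: $|\cdot|$ is the Euclidean norm on $\mathbb{R}$, $\mathbb{R}^d$ and on the set $\mathfrak{M}$ of real $d\times d$ matrices (seen as vectors of $\mathbb{R}^{d^2}$, with the corresponding scalar product $A:B$). $\|\cdot\|$ is the norm of $L^2=L^2(e^{-\phi}dx)$ for functions with values in $\mathbb{R}$, $\mathbb{R}^d$ or $\mathfrak{M}$, i.e. $\|f\|^2=\int_{\mathbb{R}^d}|f|^2e^{-\phi}dx$. $\langle f\rangle=\int_{\mathbb{R}^d} f\,e^{-\phi}dx$. $H^1$ is the space of vector fields $u:\mathbb{R}^d\to\mathbb{R}^d$ with $u\in L^2$ and $Du\in L^2$. $Du=(\partial_ju_i)_{i,j}$, and $(D^su)_{ij}=\frac12(\partial_ju_i+\partial_iu_j)$. $\mathfrak{M}^a$ is the space of skew-symmetric $d\times d$ real matrices; $\mathcal{R}=\{x\mapsto Ax: A\in\mathfrak{M}^a\}$; $\mathcal{R}_\phi=\{R\in\mathcal{R}:\ \nabla\phi(x)\cdot R(x)=0\ \ \forall x\in\mathbb{R}^d\}$; $\mathcal{R}_\phi^c$ is the orthogonal complement of $\mathcal{R}_\phi$ in $\mathcal{R}$ for the $L^2$ scalar product. $\mathbb{P}_\phi$ is the $L^2$-orthogonal projection of vector fields onto $\mathcal{R}_\phi$. $\mathfrak{M}_\phi=D\mathcal{R}_\phi=\{A\in\mathfrak{M}^a: (x\mapsto Ax)\in\mathcal{R}_\phi\}$; $\mathfrak{M}_\phi^c$ is the orthogonal complement of $\mathfrak{M}_\phi$ in $\mathfrak{M}^a$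 for the matrix scalar product $A:B$. $\mathfrak{P}_\phi$ is the $L^2$-orthogonal projection of matrix-valued functions onto the constant matrices in $\mathfrak{M}_\phi$. Rigidity constants: $$C_{RV}^{-1}=\min_{(x\mapsto Ax+b)\in(\mathcal{R}_\phi^c\oplus\mathbb{R}^d)\setminus\{0\}}\frac{\|\nabla\phi(x)\cdot(Ax+b)\|^2}{\|Ax+b\|^2}\quad\text{if }\mathcal{R}_\phi^c\ne\{0\},\qquad C_{RV}=0\ \text{ if }\mathcal{R}_\phi^c=\{0\},$$ where $\mathbb{R}^d$ stands for the constant vector fields, and $$C_{RD}^{-1}=\min_{(A,b)\in(\mathfrak{M}_\phi^c\times\mathbb{R}^d)\setminus\{(0,0)\}}\frac{\|\nabla\phi(x)\cdot(Ax+b)\|^2}{|A|^2+|b|^2}\quad\text{if }\mathfrak{M}_\phi^c\ne\{0\},\qquad C_{RD}=0\ \text{ if }\mathfrak{M}_\phi^c=\{0\}.$$ The first (respectively second) minimum is positive when $\mathcal{R}_\phi^c\ne\{0\}$ (respectively $\mathfrak{M}_\phi^c\ne\{0\}$). $C_\phi>8$ and $C_\phi'>C_\phi$ are constants (which exist by hypothesis (2)) such that for all $x\in\mathbb{R}^d$: $4\sqrt d\,|D^2\phi(x)|\le|\nabla\phi(x)|^2+C_\phi-1$ and $4|D^2\phi(x)|\le C_\phi^{-1/2}\big(|\nabla\phi(x)|^2+C_\phi'\big)$. For $u\in H^1$ one has $\nabla\phi\cdot u\in L^2$.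
   Formalization: When R_φ^c={0} (φ radial, so C_RV=0) the first inequality fails for nonzero constant fields u (left side |u|², right side 0); in that case only, it is proved just for u with ⟨u⟩=0. Both identities and the second inequality hold for all u in H^1. *)

theory Defs
  imports "HOL-Analysis.Analysis"
begin

text \<open>
  The dimension is a natural number rather than an index type, because constants are claimed that are
  uniform in it. A point of d-space is an extensional function on \<open>{..<d}\<close>, i.e. an element of the
  space of the product measure \<open>PiM {..<d} (\<lambda>_. lborel)\<close>, and functions on d-space are only ever
  evaluated there. Of a vector or matrix only the components with indices below d are used;
  those that are members of a set of vectors, matrices or rigid fields below are zero elsewhere, so that
  equality (in particular with zero) has its usual meaning.
\<close>

type_synonym point = "nat \<Rightarrow> real"
type_synonym mat = "nat \<Rightarrow> nat \<Rightarrow> real"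
type_synonym vfield = "point \<Rightarrow> nat \<Rightarrow> real"
type_synonym mfield = "point \<Rightarrow> mat"

definition Rn :: "nat \<Rightarrow> point set" where
  "Rn d = PiE {..<d} (\<lambda>_. UNIV)"

definition leb :: "nat \<Rightarrow> point measure" where
  "leb d = PiM {..<d} (\<lambda>_. lborel)"

definition mu :: "nat \<Rightarrow> (point \<Rightarrow> real) \<Rightarrow> point measure" where
  "mu d \<phi> = density (leb d) (\<lambda>x. ennreal (exp (- \<phi> x)))"

definition mean :: "nat \<Rightarrow> (point \<Rightarrow> real) \<Rightarrow> (point \<Rightarrow> real) \<Rightarrow> real" where
  "mean d \<phi> f = integral\<^sup>L (mu d \<phi>) f"

definition vsq :: "nat \<Rightarrow> (nat \<Rightarrow> real) \<Rightarrow> real" where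
  "vsq d v = (\<Sum>i<d. (v i)\<^sup>2)"

definition msq :: "nat \<Rightarrow> mat \<Rightarrow> real" where
  "msq d M = (\<Sum>i<d. \<Sum>j<d. (M i j)\<^sup>2)"

definition mdot :: "nat \<Rightarrow> mat \<Rightarrow> mat \<Rightarrow> real" where
  "mdot d M N = (\<Sum>i<d. \<Sum>j<d. M i j * N i j)"


subsection \<open>Classical derivatives\<close>

definition pd :: "nat \<Rightarrow> (point \<Rightarrow> real) \<Rightarrow> point \<Rightarrow> real" where
  "pd j f x = deriv (\<lambda>t. f (x(j := t))) (x j)"

definition grad :: "(point \<Rightarrow> real) \<Rightarrow> vfield" where
  "grad f x = (\<lambda>i. pd i f x)"

definition hess :: "(point \<Rightarrow> real) \<Rightarrow> mfield" where
  "hess f x = (\<lambda>i j. pd i (pd j f) x)"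

text \<open>Continuity is that of the product topology, which on \<open>Rn d\<close> is the Euclidean one.\<close>

fun Ck :: "nat \<Rightarrow> nat \<Rightarrow> (point \<Rightarrow> real) \<Rightarrow> bool" where
  "Ck d 0 f \<longleftrightarrow> continuous_on (Rn d) f"
| "Ck d (Suc k) f \<longleftrightarrow> continuous_on (Rn d) f \<and>
     (\<forall>j<d. (\<forall>x\<in>Rn d. (\<lambda>t. f (x(j := t))) differentiable (at (x j))) \<and> Ck d k (pd j f))"

definition test_fun :: "nat \<Rightarrow> (point \<Rightarrow> real) \<Rightarrow> bool" where
  "test_fun d f \<longleftrightarrow> (\<forall>k. Ck d k f) \<and>
     (\<exists>r. \<forall>x\<in>Rn d. (\<exists>i<d. \<bar>x i\<bar> > r) \<longrightarrow> f x = 0)"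


subsection \<open>The weighted spaces\<close>

definition sq_int :: "nat \<Rightarrow> (point \<Rightarrow> real) \<Rightarrow> (point \<Rightarrow> real) \<Rightarrow> bool" where
  "sq_int d \<phi> f \<longleftrightarrow> f \<in> borel_measurable (mu d \<phi>) \<and> integrable (mu d \<phi>) (\<lambda>x. (f x)\<^sup>2)"

definition norm2 :: "nat \<Rightarrow> (point \<Rightarrow> real) \<Rightarrow> (point \<Rightarrow> real) \<Rightarrow> real" where
  "norm2 d \<phi> f = (\<integral>x. (f x)\<^sup>2 \<partial>mu d \<phi>)"

definition vnorm2 :: "nat \<Rightarrow> (point \<Rightarrow> real) \<Rightarrow> vfield \<Rightarrow> real" where
  "vnorm2 d \<phi> u = (\<integral>x. vsq d (u x) \<partial>mu d \<phi>)"

definition mnorm2 :: "nat \<Rightarrow> (point \<Rightarrow> real) \<Rightarrow> mfield \<Rightarrow> real" where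
  "mnorm2 d \<phi> G = (\<integral>x. msq d (G x) \<partial>mu d \<phi>)"

definition vinner :: "nat \<Rightarrow> (point \<Rightarrow> real) \<Rightarrow> vfield \<Rightarrow> vfield \<Rightarrow> real" where
  "vinner d \<phi> u v = (\<integral>x. (\<Sum>i<d. u x i * v x i) \<partial>mu d \<phi>)"

definition minner :: "nat \<Rightarrow> (point \<Rightarrow> real) \<Rightarrow> mfield \<Rightarrow> mfield \<Rightarrow> real" where
  "minner d \<phi> G H = (\<integral>x. mdot d (G x) (H x) \<partial>mu d \<phi>)"

definition loc_int :: "nat \<Rightarrow> (point \<Rightarrow> real) \<Rightarrow> bool" where
  "loc_int d f \<longleftrightarrow> (\<forall>r. set_integrable (leb d) {x \<in> Rn d. \<forall>i<d. \<bar>x i\<bar> \<le> r} f)"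

definition weak_pd :: "nat \<Rightarrow> nat \<Rightarrow> (point \<Rightarrow> real) \<Rightarrow> (point \<Rightarrow> real) \<Rightarrow> bool" where
  "weak_pd d j f g \<longleftrightarrow> loc_int d f \<and> loc_int d g \<and>
     (\<forall>\<psi>. test_fun d \<psi> \<longrightarrow> (\<integral>x. f x * pd j \<psi> x \<partial>leb d) = - (\<integral>x. g x * \<psi> x \<partial>leb d))"

definition weak_jacobian :: "nat \<Rightarrow> vfield \<Rightarrow> mfield \<Rightarrow> bool" where
  "weak_jacobian d u G \<longleftrightarrow> (\<forall>i<d. \<forall>j<d. weak_pd d j (\<lambda>x. u x i) (\<lambda>x. G x i j))"

text \<open>The weak Jacobian is determined up to a null set only; any version is chosen.\<close>

definition D :: "nat \<Rightarrow> vfield \<Rightarrow> mfield" where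
  "D d u = (SOME G. weak_jacobian d u G)"

definition Ds :: "nat \<Rightarrow> vfield \<Rightarrow> mfield" where
  "Ds d u x = (\<lambda>i j. (D d u x i j + D d u x j i) / 2)"

definition H1 :: "nat \<Rightarrow> (point \<Rightarrow> real) \<Rightarrow> vfield set" where
  "H1 d \<phi> = {u. (\<forall>i<d. sq_int d \<phi> (\<lambda>x. u x i)) \<and> (\<exists>G. weak_jacobian d u G) \<and>
     (\<forall>i<d. \<forall>j<d. sq_int d \<phi> (\<lambda>x. D d u x i j))}"

definition gdot :: "nat \<Rightarrow> (point \<Rightarrow> real) \<Rightarrow> vfield \<Rightarrow> point \<Rightarrow> real" where
  "gdot d \<phi> u x = (\<Sum>i<d. grad \<phi> x i * u x i)"


subsection \<open>Rigid motions\<close>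

definition vecs :: "nat \<Rightarrow> (nat \<Rightarrow> real) set" where
  "vecs d = {b. \<forall>i\<ge>d. b i = 0}"

definition skew :: "nat \<Rightarrow> mat set" where
  "skew d = {A. (\<forall>i j. A i j = - A j i) \<and> (\<forall>i j. d \<le> i \<or> d \<le> j \<longrightarrow> A i j = 0)}"

definition lin :: "nat \<Rightarrow> mat \<Rightarrow> vfield" where
  "lin d A x = (\<lambda>i. \<Sum>j<d. A i j * x j)"

definition affine_field :: "nat \<Rightarrow> mat \<Rightarrow> (nat \<Rightarrow> real) \<Rightarrow> vfield" where
  "affine_field d A b x = (\<lambda>i. lin d A x i + b i)"

definition Rot :: "nat \<Rightarrow> vfield set" where
  "Rot d = lin d ` skew d"

definition Rot_phi :: "nat \<Rightarrow> (point \<Rightarrow> real) \<Rightarrow> vfield set" where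
  "Rot_phi d \<phi> = {R \<in> Rot d. \<forall>x\<in>Rn d. gdot d \<phi> R x = 0}"

definition Rot_phi_c :: "nat \<Rightarrow> (point \<Rightarrow> real) \<Rightarrow> vfield set" where
  "Rot_phi_c d \<phi> = {R \<in> Rot d. \<forall>S\<in>Rot_phi d \<phi>. vinner d \<phi> R S = 0}"

definition M_phi :: "nat \<Rightarrow> (point \<Rightarrow> real) \<Rightarrow> mat set" where
  "M_phi d \<phi> = {A \<in> skew d. lin d A \<in> Rot_phi d \<phi>}"

definition M_phi_c :: "nat \<Rightarrow> (point \<Rightarrow> real) \<Rightarrow> mat set" where
  "M_phi_c d \<phi> = {A \<in> skew d. \<forall>B\<in>M_phi d \<phi>. mdot d A B = 0}"

definition P_phi :: "nat \<Rightarrow> (point \<Rightarrow> real) \<Rightarrow> vfield \<Rightarrow> vfield" where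
  "P_phi d \<phi> u = (THE R. R \<in> Rot_phi d \<phi> \<and>
     (\<forall>S\<in>Rot_phi d \<phi>. vinner d \<phi> (\<lambda>x i. u x i - R x i) S = 0))"

definition MP_phi :: "nat \<Rightarrow> (point \<Rightarrow> real) \<Rightarrow> mfield \<Rightarrow> mat" where
  "MP_phi d \<phi> G = (THE A. A \<in> M_phi d \<phi> \<and>
     (\<forall>B\<in>M_phi d \<phi>. minner d \<phi> (\<lambda>x i j. G x i j - A i j) (\<lambda>x. B) = 0))"


subsection \<open>Constants\<close>

definition poincare :: "nat \<Rightarrow> (point \<Rightarrow> real) \<Rightarrow> real \<Rightarrow> bool" where
  "poincare d \<phi> C \<longleftrightarrow> (\<forall>f. test_fun d f \<longrightarrow>
     norm2 d \<phi> (\<lambda>x. f x - mean d \<phi> f) \<le> C * vnorm2 d \<phi> (grad f))"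

definition optimal_poincare :: "nat \<Rightarrow> (point \<Rightarrow> real) \<Rightarrow> real \<Rightarrow> bool" where
  "optimal_poincare d \<phi> C \<longleftrightarrow> poincare d \<phi> C \<and> (\<forall>C'. poincare d \<phi> C' \<longrightarrow> C \<le> C')"

text \<open>
  The minima in the rigidity constants run over homogeneous quotients on finite-dimensional spaces
  and are attained, so they are written as infima. Equality to zero of a field \<open>R + b\<close> is
  equality of functions; as only the coordinates below d of the argument enter \<open>affine_field\<close>, this
  is the same as equality on \<open>Rn d\<close>.

  Pitfall: with the convention \<open>C_RV = 0\<close> when \<open>Rot_phi_c\<close> is trivial (\<open>\<phi>\<close> radially symmetric), a bound by
  \<open>C * mnorm2 d \<phi> (Ds d u) + 2 * C_RV d \<phi> * norm2 d \<phi> (gdot d \<phi> u)\<close> fails for nonzero constant fields u,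
  for which that bound is zero. In that case only it can be claimed for fields u of zero mean only.
\<close>

definition C_RV :: "nat \<Rightarrow> (point \<Rightarrow> real) \<Rightarrow> real" where
  "C_RV d \<phi> = (if Rot_phi_c d \<phi> = {\<lambda>x i. 0} then 0 else
     inverse (INF w \<in> {affine_field d A b | A b. A \<in> skew d \<and> lin d A \<in> Rot_phi_c d \<phi> \<and> b \<in> vecs d}
                       - {\<lambda>x i. 0}.
       norm2 d \<phi> (gdot d \<phi> w) / vnorm2 d \<phi> w))"

definition C_RD :: "nat \<Rightarrow> (point \<Rightarrow> real) \<Rightarrow> real" where
  "C_RD d \<phi> = (if M_phi_c d \<phi> = {\<lambda>i j. 0} then 0 else
     inverse (INF (A, b) \<in> M_phi_c d \<phi> \<times> vecs d - {(\<lambda>i j. 0, \<lambda>i. 0)}.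
       norm2 d \<phi> (gdot d \<phi> (affine_field d A b)) / (msq d A + vsq d b)))"

end

theory Submission
  imports Defs "HOL-Computational_Algebra.Polynomial"
begin

text \<open>
  Let \<open>S = Ds u\<close>, let A be the mean of the skew part of \<open>D u\<close> and W that skew part minus A. By the Poincare
  inequality and a Weyl lemma, the images \<open>Lap \<psi>\<close> of test functions under the weighted Laplacian
  \<open>Lap \<psi> = grad \<phi> \<cdot> grad \<psi> - \<Delta> \<psi>\<close> are dense among the square-integrable functions of zero mean, so W can be tested
  with them. Since \<open>\<partial>\<^sub>k W\<^sub>i\<^sub>j = \<partial>\<^sub>j S\<^sub>i\<^sub>k - \<partial>\<^sub>i S\<^sub>j\<^sub>k\<close>, two integrations by parts pair S with second derivatives of
  \<open>\<psi>\<close>, which the Bochner identity bounds by \<open>Lap \<psi>\<close>; the Hessian of \<open>\<phi>\<close> appearing there is absorbed by the two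
  pointwise hypotheses on it. This gives Korn's inequality for \<open>D u - A\<close>.

  With b the mean of u, the field \<open>v = u - (A x + b)\<close> is small by Korn and Poincare, and so is \<open>grad \<phi> \<cdot> v\<close>. Hence
  \<open>grad \<phi> \<cdot> (A x + b)\<close> is \<open>grad \<phi> \<cdot> u\<close> up to a small error, and the rigidity constants bound b and the
  component of A transversal to the symmetries of \<open>\<phi>\<close>. Their positivity is a compactness argument in finite
  dimension.
\<close>

subsection \<open>Square-integrable functions\<close>

text \<open>The obstacle is that the test matrices are not gradients. When the entries of W are
  replaced by \<open>Lap (\<psi> i j)\<close>, the integrations by parts pair the symmetric part
  with sums over j of \<open>adj j (pd k (\<psi> i j))\<close>, the weighted divergence of a field
  that is in general no gradient. So the Bochner identity serves twice: for an arbitrary field it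
  bounds the weighted divergence by all first derivatives (\<open>divergence_bound\<close>); for a
  gradient, by symmetry of the second derivatives, it bounds them by \<open>Lap\<close>
  (\<open>second_derivative_bound\<close>). The Hessian of \<phi> can be absorbed because its
  coefficient \<open>th = 2 / sqrt Cphi\<close> is below 1. No step loses a factor depending on d:
  the only such factor, sqrt d, is part of the first hypothesis on the Hessian.

  As \<phi> is merely C2, the Weyl lemma does not go through elliptic regularity. A function
  orthogonal to the range of \<open>Lap\<close> is mollified together with the weight, the resulting
  commutator tends to 0 in L2, and the Poincare inequality for the localised function shows that its
  variance vanishes once the cut-off is removed.\<close>

definition sqi :: "'a measure \<Rightarrow> ('a \<Rightarrow> real) \<Rightarrow> bool" where
  "sqi M f \<longleftrightarrow> f \<in> borel_measurable M \<and> integrable M (\<lambda>x. (f x)\<^sup>2)"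

text \<open>Functions are not identified when they agree almost everywhere, so convergence in L2 is
  a relation between functions rather than a limit in a quotient space. Square integrability of all
  members is included, so that \<open>L2c_inner\<close> applies without side conditions.\<close>

definition L2c :: "'a measure \<Rightarrow> (nat \<Rightarrow> 'a \<Rightarrow> real) \<Rightarrow> ('a \<Rightarrow> real) \<Rightarrow> bool" where
  "L2c M fs f \<longleftrightarrow> (\<forall>n. sqi M (fs n)) \<and> sqi M f \<and> (\<lambda>n. \<integral>x. (fs n x - f x)\<^sup>2 \<partial>M) \<longlonglongrightarrow> 0"

lemma sqiD: "sqi M f \<Longrightarrow> f \<in> borel_measurable M" "sqi M f \<Longrightarrow> integrable M (\<lambda>x. (f x)\<^sup>2)"
  by (auto simp: sqi_def)

lemma sqi_mult_integrable:
  assumes "sqi M f" "sqi M g"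
  shows "integrable M (\<lambda>x. f x * g x)"
proof (rule Bochner_Integration.integrable_bound)
  show "integrable M (\<lambda>x. (f x)\<^sup>2 + (g x)\<^sup>2)"
    using assms by (intro Bochner_Integration.integrable_add sqiD)
  show "(\<lambda>x. f x * g x) \<in> borel_measurable M"
    using assms by (auto simp: sqi_def)
  have "\<bar>a * b\<bar> \<le> a\<^sup>2 + b\<^sup>2" for a b :: real
  proof -
    have "2 * (\<bar>a\<bar> * \<bar>b\<bar>) \<le> a\<^sup>2 + b\<^sup>2"
      using sum_squares_bound[of "\<bar>a\<bar>" "\<bar>b\<bar>"] by simp
    moreover have "0 \<le> \<bar>a\<bar> * \<bar>b\<bar>" by simp
    ultimately show ?thesis unfolding abs_mult by linarith
  qed
  then show "AE x in M. norm (f x * g x) \<le> norm ((f x)\<^sup>2 + (g x)\<^sup>2)" by simp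
qed

lemma sqi_cmult: "sqi M f \<Longrightarrow> sqi M (\<lambda>x. c * f x)"
  by (auto simp: sqi_def power_mult_distrib)

lemma sqi_zero [simp]: "sqi M (\<lambda>x. 0)"
  by (simp add: sqi_def)

lemma sqi_add:
  assumes "sqi M f" "sqi M g" shows "sqi M (\<lambda>x. f x + g x)"
proof -
  have "integrable M (\<lambda>x. (f x)\<^sup>2 + (g x)\<^sup>2 + 2 * (f x * g x))"
    using assms by (intro Bochner_Integration.integrable_add integrable_mult_right sqiD sqi_mult_integrable)
  moreover have "(\<lambda>x. f x + g x) \<in> borel_measurable M"
    by (intro borel_measurable_add sqiD assms)
  ultimately show ?thesis by (simp add: sqi_def power2_sum mult.assoc)
qed

lemma sqi_uminus: "sqi M f \<Longrightarrow> sqi M (\<lambda>x. - f x)"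
  using sqi_cmult[of M f "-1"] by simp

lemma sqi_diff:
  assumes "sqi M f" "sqi M g" shows "sqi M (\<lambda>x. f x - g x)"
  using sqi_add[OF assms(1) sqi_uminus[OF assms(2)]] by simp

lemma sqi_sum: "(\<And>i. i \<in> I \<Longrightarrow> sqi M (f i)) \<Longrightarrow> sqi M (\<lambda>x. \<Sum>i\<in>I. f i x)"
  by (induction I rule: infinite_finite_induct) (auto intro: sqi_add)

lemma sqi_bound:
  assumes "sqi M g" "f \<in> borel_measurable M" "\<And>x. x \<in> space M \<Longrightarrow> \<bar>f x\<bar> \<le> C * \<bar>g x\<bar>"
  shows "sqi M f"
proof -
  have "integrable M (\<lambda>x. (C * g x)\<^sup>2)"
    using sqi_cmult[OF assms(1)] by (simp add: sqi_def)
  then have "integrable M (\<lambda>x. (f x)\<^sup>2)"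
  proof (rule Bochner_Integration.integrable_bound)
    show "AE x in M. norm ((f x)\<^sup>2) \<le> norm ((C * g x)\<^sup>2)"
    proof (rule AE_I2)
      fix x assume "x \<in> space M"
      then have "\<bar>f x\<bar> \<le> \<bar>C * g x\<bar>"
        using assms(3)[of x] by (metis abs_ge_self abs_mult abs_abs mult_right_mono abs_ge_zero order_trans)
      then show "norm ((f x)\<^sup>2) \<le> norm ((C * g x)\<^sup>2)"
        by (simp add: abs_le_square_iff)
    qed
  qed (use assms in auto)
  then show ?thesis using assms by (simp add: sqi_def)
qed

lemma sqi_mult_bdd:
  assumes "sqi M f" "c \<in> borel_measurable M" "\<And>x. x \<in> space M \<Longrightarrow> \<bar>c x\<bar> \<le> C"
  shows "sqi M (\<lambda>x. c x * f x)"
proof (rule sqi_bound[OF assms(1)])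
  show "(\<lambda>x. c x * f x) \<in> borel_measurable M" using assms by (auto simp: sqi_def)
  show "\<bar>c x * f x\<bar> \<le> C * \<bar>f x\<bar>" if "x \<in> space M" for x
    using assms(3)[OF that] by (simp add: abs_mult mult_right_mono)
qed

lemma sqi_bounded:
  assumes "finite_measure M" "f \<in> borel_measurable M" "\<And>x. x \<in> space M \<Longrightarrow> \<bar>f x\<bar> \<le> C"
  shows "sqi M f"
proof (rule sqi_bound[of M "\<lambda>_. 1"])
  interpret finite_measure M by fact
  show "sqi M (\<lambda>_. 1)" by (simp add: sqi_def)
qed (use assms in auto)

lemma sqi_integrable:
  assumes "finite_measure M" "sqi M f" shows "integrable M f"
proof -
  interpret finite_measure M by fact
  have "sqi M (\<lambda>_. 1)" by (simp add: sqi_def)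
  from sqi_mult_integrable[OF assms(2) this] show ?thesis by simp
qed

lemma sqi_cong:
  assumes "\<And>x. x \<in> space M \<Longrightarrow> f x = g x" shows "sqi M f = sqi M g"
  unfolding sqi_def using assms
  by (metis (mono_tags, lifting) measurable_cong Bochner_Integration.integrable_cong)

lemma CS_integral:
  assumes f: "sqi M f" and g: "sqi M g"
  shows "(\<integral>x. f x * g x \<partial>M)\<^sup>2 \<le> (\<integral>x. (f x)\<^sup>2 \<partial>M) * (\<integral>x. (g x)\<^sup>2 \<partial>M)"
proof -
  define a b c where "a = (\<integral>x. (f x)\<^sup>2 \<partial>M)" and "b = (\<integral>x. f x * g x \<partial>M)" and "c = (\<integral>x. (g x)\<^sup>2 \<partial>M)"
  have q: "0 \<le> a + 2 * t * b + t\<^sup>2 * c" for t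
  proof -
    have "0 \<le> (\<integral>x. (f x + t * g x)\<^sup>2 \<partial>M)" by (rule integral_nonneg_AE) simp
    also have "(\<integral>x. (f x + t * g x)\<^sup>2 \<partial>M) = (\<integral>x. (f x)\<^sup>2 + 2 * t * (f x * g x) + t\<^sup>2 * (g x)\<^sup>2 \<partial>M)"
      by (simp add: power2_sum power_mult_distrib algebra_simps)
    also have "\<dots> = a + 2 * t * b + t\<^sup>2 * c"
      using f g sqi_mult_integrable[OF f g] by (simp add: sqi_def a_def b_def c_def)
    finally show ?thesis .
  qed
  have c0: "0 \<le> c" unfolding c_def by (rule integral_nonneg_AE) simp
  have "b\<^sup>2 \<le> a * c"
  proof (cases "c = 0")
    case True
    show ?thesis
    proof (rule ccontr)
      assume "\<not> ?thesis"
      then have "b \<noteq> 0" using True by auto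
      \<comment> \<open>For \<open>c = 0\<close> the polynomial is affine in t, and at this t its
        value is -1.\<close>
      then show False using q[of "- (a + 1) / (2 * b)"] True by (simp add: field_simps)
    qed
  next
    case False
    have "0 \<le> a + 2 * (- b / c) * b + (- b / c)\<^sup>2 * c" by (rule q)
    also have "\<dots> = a - b\<^sup>2 / c" using False by (simp add: field_simps power2_eq_square)
    finally show ?thesis using False c0 by (simp add: field_simps)
  qed
  then show ?thesis by (simp add: a_def b_def c_def)
qed

lemma CS_integral_sqrt:
  assumes "sqi M f" "sqi M g"
  shows "\<bar>\<integral>x. f x * g x \<partial>M\<bar> \<le> sqrt (\<integral>x. (f x)\<^sup>2 \<partial>M) * sqrt (\<integral>x. (g x)\<^sup>2 \<partial>M)"
  using CS_integral[OF assms] by (metis real_sqrt_abs real_sqrt_le_iff real_sqrt_mult)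

lemma integral_sq_sum_le:
  assumes f: "sqi M f" and g: "sqi M g"
  shows "(\<integral>x. (f x + g x)\<^sup>2 \<partial>M) \<le> 2 * (\<integral>x. (f x)\<^sup>2 \<partial>M) + 2 * (\<integral>x. (g x)\<^sup>2 \<partial>M)"
proof -
  have "(\<integral>x. (f x + g x)\<^sup>2 \<partial>M) \<le> (\<integral>x. 2 * (f x)\<^sup>2 + 2 * (g x)\<^sup>2 \<partial>M)"
  proof (rule integral_mono)
    show "integrable M (\<lambda>x. (f x + g x)\<^sup>2)" using sqi_add[OF f g] by (simp add: sqi_def)
    show "integrable M (\<lambda>x. 2 * (f x)\<^sup>2 + 2 * (g x)\<^sup>2)" using f g by (simp add: sqi_def)
    show "(f x + g x)\<^sup>2 \<le> 2 * (f x)\<^sup>2 + 2 * (g x)\<^sup>2" for x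
      using sum_squares_bound[of "f x" "g x"] by (simp add: power2_sum)
  qed
  then show ?thesis using f g by (simp add: sqi_def)
qed

section \<open>Convergence in L2\<close>

lemma L2cD:
  assumes "L2c M fs f"
  shows "sqi M (fs n)" "sqi M f" "(\<lambda>n. \<integral>x. (fs n x - f x)\<^sup>2 \<partial>M) \<longlonglongrightarrow> 0"
  using assms by (auto simp: L2c_def)

lemma integral_sq_nonneg [simp]: "0 \<le> (\<integral>x. (f x)\<^sup>2 \<partial>M)" for f :: "'a \<Rightarrow> real"
  by (rule integral_nonneg_AE) simp

lemma L2cI_le:
  assumes "\<And>n. sqi M (fs n)" "sqi M f" "\<And>n. (\<integral>x. (fs n x - f x)\<^sup>2 \<partial>M) \<le> e n" "e \<longlonglongrightarrow> 0"
  shows "L2c M fs f"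
  unfolding L2c_def using assms(1,2)
  by (auto intro!: tendsto_sandwich[OF _ _ tendsto_const assms(4), of "\<lambda>n. \<integral>x. (fs n x - f x)\<^sup>2 \<partial>M"] simp: assms(3))

lemma L2c_const: "sqi M f \<Longrightarrow> L2c M (\<lambda>_. f) f"
  by (simp add: L2c_def)

lemma L2c_add:
  assumes f: "L2c M fs f" and g: "L2c M gs g"
  shows "L2c M (\<lambda>n x. fs n x + gs n x) (\<lambda>x. f x + g x)"
proof (rule L2cI_le)
  show "(\<integral>x. (fs n x + gs n x - (f x + g x))\<^sup>2 \<partial>M)
     \<le> 2 * (\<integral>x. (fs n x - f x)\<^sup>2 \<partial>M) + 2 * (\<integral>x. (gs n x - g x)\<^sup>2 \<partial>M)" for n
    using integral_sq_sum_le[OF sqi_diff[OF L2cD(1)[OF f, of n] L2cD(2)[OF f]]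
        sqi_diff[OF L2cD(1)[OF g, of n] L2cD(2)[OF g]]]
    by (simp add: algebra_simps)
  show "(\<lambda>n. 2 * (\<integral>x. (fs n x - f x)\<^sup>2 \<partial>M) + 2 * (\<integral>x. (gs n x - g x)\<^sup>2 \<partial>M)) \<longlonglongrightarrow> 0"
    using tendsto_add[OF tendsto_mult[OF tendsto_const L2cD(3)[OF f], of 2] tendsto_mult[OF tendsto_const L2cD(3)[OF g], of 2]]
    by simp
qed (use f g in \<open>auto intro: sqi_add L2cD\<close>)

lemma L2c_mult_bdd:
  assumes f: "L2c M fs f" and c: "c \<in> borel_measurable M" "\<And>x. x \<in> space M \<Longrightarrow> \<bar>c x\<bar> \<le> C"
  shows "L2c M (\<lambda>n x. c x * fs n x) (\<lambda>x. c x * f x)"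
proof (rule L2cI_le)
  show s1: "sqi M (\<lambda>x. c x * fs n x)" for n by (rule sqi_mult_bdd[OF L2cD(1)[OF f] c])
  show s2: "sqi M (\<lambda>x. c x * f x)" by (rule sqi_mult_bdd[OF L2cD(2)[OF f] c])
  show "(\<integral>x. (c x * fs n x - c x * f x)\<^sup>2 \<partial>M) \<le> C\<^sup>2 * (\<integral>x. (fs n x - f x)\<^sup>2 \<partial>M)" for n
  proof -
    have "(\<integral>x. (c x * fs n x - c x * f x)\<^sup>2 \<partial>M) \<le> (\<integral>x. C\<^sup>2 * (fs n x - f x)\<^sup>2 \<partial>M)"
    proof (rule integral_mono)
      show "integrable M (\<lambda>x. (c x * fs n x - c x * f x)\<^sup>2)" using sqi_diff[OF s1 s2] by (simp add: sqi_def)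
      show "integrable M (\<lambda>x. C\<^sup>2 * (fs n x - f x)\<^sup>2)"
        using sqi_diff[OF L2cD(1)[OF f, of n] L2cD(2)[OF f]] by (simp add: sqi_def)
      fix x assume "x \<in> space M"
      then have "(c x)\<^sup>2 \<le> C\<^sup>2" using c(2)[of x] by (metis abs_ge_zero power2_abs power_mono)
      then show "(c x * fs n x - c x * f x)\<^sup>2 \<le> C\<^sup>2 * (fs n x - f x)\<^sup>2"
        by (simp add: right_diff_distrib[symmetric] power_mult_distrib mult_right_mono)
    qed
    then show ?thesis by simp
  qed
  show "(\<lambda>n. C\<^sup>2 * (\<integral>x. (fs n x - f x)\<^sup>2 \<partial>M)) \<longlonglongrightarrow> 0"
    using tendsto_mult[OF tendsto_const L2cD(3)[OF f], of "C\<^sup>2"] by simp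
qed

lemma L2c_cmult: "L2c M fs f \<Longrightarrow> L2c M (\<lambda>n x. c * fs n x) (\<lambda>x. c * f x)"
  by (rule L2c_mult_bdd[where C = "\<bar>c\<bar>"]) auto

lemma L2c_diff:
  assumes f: "L2c M fs f" and g: "L2c M gs g"
  shows "L2c M (\<lambda>n x. fs n x - gs n x) (\<lambda>x. f x - g x)"
  using L2c_add[OF f L2c_cmult[OF g, of "-1"]] by simp

lemma L2c_inner:
  assumes f: "L2c M fs f" and g: "L2c M gs g"
  shows "(\<lambda>n. \<integral>x. fs n x * gs n x \<partial>M) \<longlonglongrightarrow> (\<integral>x. f x * g x \<partial>M)"
proof -
  define a where "a n = (\<integral>x. (fs n x - f x)\<^sup>2 \<partial>M)" for n
  define b where "b n = (\<integral>x. (gs n x - g x)\<^sup>2 \<partial>M)" for n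
  have a: "a \<longlonglongrightarrow> 0" and b: "b \<longlonglongrightarrow> 0" unfolding a_def b_def using f g by (auto dest: L2cD)
  define e where "e n = sqrt (a n) * sqrt (b n) + sqrt (a n) * sqrt (\<integral>x. (g x)\<^sup>2 \<partial>M) + sqrt (\<integral>x. (f x)\<^sup>2 \<partial>M) * sqrt (b n)" for n
  have "e \<longlonglongrightarrow> sqrt 0 * sqrt 0 + sqrt 0 * sqrt (\<integral>x. (g x)\<^sup>2 \<partial>M) + sqrt (\<integral>x. (f x)\<^sup>2 \<partial>M) * sqrt 0"
    unfolding e_def by (intro tendsto_intros a b)
  then have e0: "e \<longlonglongrightarrow> 0" by simp
  have "\<bar>(\<integral>x. fs n x * gs n x \<partial>M) - (\<integral>x. f x * g x \<partial>M)\<bar> \<le> e n" for n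
  proof -
    note s = L2cD(1)[OF f, of n] L2cD(2)[OF f] L2cD(1)[OF g, of n] L2cD(2)[OF g]
    note d = sqi_diff[OF s(1,2)] sqi_diff[OF s(3,4)]
    have "(\<integral>x. fs n x * gs n x \<partial>M) - (\<integral>x. f x * g x \<partial>M) = (\<integral>x. fs n x * gs n x - f x * g x \<partial>M)"
      by (intro Bochner_Integration.integral_diff[symmetric] sqi_mult_integrable s)
    also have "\<dots> = (\<integral>x. ((fs n x - f x) * (gs n x - g x) + (fs n x - f x) * g x) + f x * (gs n x - g x) \<partial>M)"
      by (simp add: algebra_simps)
    also have "\<dots> = ((\<integral>x. (fs n x - f x) * (gs n x - g x) \<partial>M) + (\<integral>x. (fs n x - f x) * g x \<partial>M)) + (\<integral>x. f x * (gs n x - g x) \<partial>M)"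
      using sqi_mult_integrable[OF d] sqi_mult_integrable[OF d(1) s(4)] sqi_mult_integrable[OF s(2) d(2)] by simp
    also have "\<bar>\<dots>\<bar> \<le> e n"
      using CS_integral_sqrt[OF d] CS_integral_sqrt[OF d(1) s(4)] CS_integral_sqrt[OF s(2) d(2)]
      unfolding e_def a_def b_def by linarith
    finally show ?thesis .
  qed
  then have "(\<lambda>n. (\<integral>x. fs n x * gs n x \<partial>M) - (\<integral>x. f x * g x \<partial>M)) \<longlonglongrightarrow> 0"
    by (intro Lim_null_comparison[OF _ e0]) (auto simp: eventually_sequentially)
  then show ?thesis by (simp add: LIM_zero_iff)
qed

lemma L2c_norm:
  "L2c M fs f \<Longrightarrow> (\<lambda>n. \<integral>x. (fs n x)\<^sup>2 \<partial>M) \<longlonglongrightarrow> (\<integral>x. (f x)\<^sup>2 \<partial>M)"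
  using L2c_inner[of M fs f fs f] by (simp add: power2_eq_square)

lemma L2c_integral:
  assumes "finite_measure M" "L2c M fs f"
  shows "(\<lambda>n. \<integral>x. fs n x \<partial>M) \<longlonglongrightarrow> (\<integral>x. f x \<partial>M)"
proof -
  interpret finite_measure M by fact
  have "L2c M (\<lambda>_ _. 1) (\<lambda>_. 1)" by (rule L2c_const) (simp add: sqi_def)
  from L2c_inner[OF assms(2) this] show ?thesis by simp
qed

lemma L2c_cong:
  assumes "L2c M fs f" "\<And>n x. x \<in> space M \<Longrightarrow> fs n x = gs n x" "\<And>x. x \<in> space M \<Longrightarrow> f x = g x"
  shows "L2c M gs g"
proof -
  have "(\<integral>x. (fs n x - f x)\<^sup>2 \<partial>M) = (\<integral>x. (gs n x - g x)\<^sup>2 \<partial>M)" for n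
    by (rule Bochner_Integration.integral_cong) (use assms in auto)
  moreover have "sqi M (gs n)" for n using L2cD(1)[OF assms(1), of n] sqi_cong[of M "fs n" "gs n"] assms(2) by blast
  moreover have "sqi M g" using L2cD(2)[OF assms(1)] sqi_cong[of M f g] assms(3) by blast
  ultimately show ?thesis using assms(1) by (simp add: L2c_def)
qed

lemma L2c_dominated:
  assumes "\<And>n. fs n \<in> borel_measurable M" "f \<in> borel_measurable M" "sqi M w"
    "\<And>x. x \<in> space M \<Longrightarrow> (\<lambda>n. fs n x) \<longlonglongrightarrow> f x"
    "\<And>n x. x \<in> space M \<Longrightarrow> \<bar>fs n x\<bar> \<le> w x"
  shows "L2c M fs f"
proof -
  have fw: "\<bar>f x\<bar> \<le> w x" if "x \<in> space M" for x
    by (rule LIMSEQ_le_const2[OF tendsto_rabs[OF assms(4)[OF that]]]) (use assms(5)[OF that] in auto)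
  have s: "sqi M (fs n)" for n
    by (rule sqi_bound[OF assms(3) assms(1), of _ 1]) (use assms(5) in \<open>fastforce intro: order_trans\<close>)
  have sf: "sqi M f"
    by (rule sqi_bound[OF assms(3) assms(2), of 1]) (use fw in \<open>fastforce intro: order_trans\<close>)
  have "(\<lambda>n. \<integral>x. (fs n x - f x)\<^sup>2 \<partial>M) \<longlonglongrightarrow> (\<integral>x. 0 \<partial>M)"
  proof (rule integral_dominated_convergence[where w = "\<lambda>x. 4 * (w x)\<^sup>2"])
    show "integrable M (\<lambda>x. 4 * (w x)\<^sup>2)" using assms(3) by (simp add: sqi_def)
    show "AE x in M. (\<lambda>n. (fs n x - f x)\<^sup>2) \<longlonglongrightarrow> 0"
    proof (rule AE_I2)
      fix x assume "x \<in> space M"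
      then have "(\<lambda>n. (fs n x - f x)\<^sup>2) \<longlonglongrightarrow> (f x - f x)\<^sup>2" by (intro tendsto_intros assms)
      then show "(\<lambda>n. (fs n x - f x)\<^sup>2) \<longlonglongrightarrow> 0" by simp
    qed
    show "AE x in M. norm ((fs n x - f x)\<^sup>2) \<le> 4 * (w x)\<^sup>2" for n
    proof (rule AE_I2)
      fix x assume "x \<in> space M"
      then have "\<bar>fs n x - f x\<bar> \<le> 2 * w x" using fw[of x] assms(5)[of x n] by linarith
      then have "(fs n x - f x)\<^sup>2 \<le> (2 * w x)\<^sup>2" by (metis abs_ge_zero power2_abs power_mono)
      then show "norm ((fs n x - f x)\<^sup>2) \<le> 4 * (w x)\<^sup>2" by (simp add: power_mult_distrib)
    qed
  qed (use assms in auto)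
  then show ?thesis using s sf by (simp add: L2c_def)
qed

text \<open>Serves the diagonal arguments in \<open>tf_lim_closed\<close> and
  \<open>h1lim_closed\<close>: an error of 1/(n+1) in the n-th member does not change the
  limit.\<close>

lemma L2c_approx:
  assumes f: "L2c M fs f" and g: "\<And>n. sqi M (gs n)" "\<And>n. (\<integral>x. (gs n x - fs n x)\<^sup>2 \<partial>M) \<le> 1 / real (Suc n)"
  shows "L2c M gs f"
proof (rule L2cI_le[OF g(1) L2cD(2)[OF f]])
  show "(\<integral>x. (gs n x - f x)\<^sup>2 \<partial>M) \<le> 2 * (1 / real (Suc n)) + 2 * (\<integral>x. (fs n x - f x)\<^sup>2 \<partial>M)" for n
    using integral_sq_sum_le[OF sqi_diff[OF g(1)[of n] L2cD(1)[OF f, of n]] sqi_diff[OF L2cD(1)[OF f, of n] L2cD(2)[OF f]]] g(2)[of n]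
    by simp
  show "(\<lambda>n. 2 * (1 / real (Suc n)) + 2 * (\<integral>x. (fs n x - f x)\<^sup>2 \<partial>M)) \<longlonglongrightarrow> 0"
    using tendsto_add[OF tendsto_mult[OF tendsto_const[of 2] LIMSEQ_inverse_real_of_nat]
        tendsto_mult[OF tendsto_const[of 2] L2cD(3)[OF f]]] by (simp add: inverse_eq_divide)
qed

text \<open>Membership of a pointwise limit in L2 comes together with the bound. This is how square
  integrability is gained rather than assumed: for limits of Cauchy sequences, for
  \<open>gn x * f x\<close> and for the coordinates.\<close>

lemma Fatou_sq:
  assumes "\<And>n. sqi M (fs n)" "f \<in> borel_measurable M"
    "AE x in M. (\<lambda>n. fs n x) \<longlonglongrightarrow> f x" "\<And>n. n \<ge> N \<Longrightarrow> (\<integral>x. (fs n x)\<^sup>2 \<partial>M) \<le> C"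
  shows "sqi M f" "(\<integral>x. (f x)\<^sup>2 \<partial>M) \<le> C"
proof -
  have C0: "0 \<le> C" using assms(4)[of N] integral_sq_nonneg[of M "fs N"] by linarith
  have "(\<integral>\<^sup>+x. ennreal ((f x)\<^sup>2) \<partial>M) = (\<integral>\<^sup>+x. liminf (\<lambda>n. ennreal ((fs n x)\<^sup>2)) \<partial>M)"
  proof (rule nn_integral_cong_AE)
    show "AE x in M. ennreal ((f x)\<^sup>2) = liminf (\<lambda>n. ennreal ((fs n x)\<^sup>2))"
      using assms(3)
    proof eventually_elim
      case (elim x)
      then have "(\<lambda>n. ennreal ((fs n x)\<^sup>2)) \<longlonglongrightarrow> ennreal ((f x)\<^sup>2)"
        by (intro tendsto_ennrealI tendsto_intros)
      then show ?case by (rule lim_imp_Liminf[OF sequentially_bot, symmetric])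
    qed
  qed
  also have "\<dots> \<le> liminf (\<lambda>n. \<integral>\<^sup>+x. ennreal ((fs n x)\<^sup>2) \<partial>M)"
    by (rule nn_integral_liminf) (use assms(1) in \<open>auto simp: sqi_def\<close>)
  also have "\<dots> \<le> ennreal C"
  proof (rule Liminf_le)
    have "(\<integral>\<^sup>+x. ennreal ((fs n x)\<^sup>2) \<partial>M) \<le> ennreal C" if "n \<ge> N" for n
      using assms(4)[OF that] sqiD(2)[OF assms(1)[of n]] by (subst nn_integral_eq_integral) (auto simp: ennreal_leI)
    then show "\<forall>\<^sub>F n in sequentially. (\<integral>\<^sup>+x. ennreal ((fs n x)\<^sup>2) \<partial>M) \<le> ennreal C"
      by (auto simp: eventually_sequentially)
  qed auto
  finally have le: "(\<integral>\<^sup>+x. ennreal ((f x)\<^sup>2) \<partial>M) \<le> ennreal C" .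
  have int: "integrable M (\<lambda>x. (f x)\<^sup>2)"
    by (rule integrableI_bounded) (use assms(2) le in \<open>auto simp: less_top[symmetric] top_unique\<close>)
  then show "sqi M f" using assms(2) by (simp add: sqi_def)
  have "ennreal (\<integral>x. (f x)\<^sup>2 \<partial>M) = (\<integral>\<^sup>+x. ennreal ((f x)\<^sup>2) \<partial>M)"
    by (rule nn_integral_eq_integral[symmetric, OF int]) simp
  then show "(\<integral>x. (f x)\<^sup>2 \<partial>M) \<le> C" using le C0 by (metis ennreal_le_iff)
qed

text \<open>For a finite measure an L2 Cauchy sequence is Cauchy in L1, hence has a subsequence
  converging almost everywhere. Fatou's lemma applied to \<open>fs m - fs (r i)\<close> for growing
  i then makes the almost everywhere limit the L2 limit of the whole sequence.\<close>

lemma L2_complete: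
  assumes fin: "finite_measure M" and s: "\<And>n. sqi M (fs n)"
    and C: "\<And>e. e > 0 \<Longrightarrow> \<exists>N. \<forall>m\<ge>N. \<forall>n\<ge>N. (\<integral>x. (fs m x - fs n x)\<^sup>2 \<partial>M) < e"
  shows "\<exists>f. L2c M fs f"
proof -
  interpret finite_measure M by fact
  have one: "sqi M (\<lambda>_. 1)" by (simp add: sqi_def)
  have L1: "(\<integral>x. norm (fs m x - fs n x) \<partial>M) \<le> sqrt (\<integral>x. (fs m x - fs n x)\<^sup>2 \<partial>M) * sqrt (measure M (space M))" for m n
  proof -
    have "sqi M (\<lambda>x. \<bar>fs m x - fs n x\<bar>)"
      using sqi_diff[OF s[of m] s[of n]] by (auto simp: sqi_def)
    from CS_integral_sqrt[OF this one] show ?thesis by simp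
  qed
  obtain r where r: "strict_mono r" "AE x in M. Cauchy (\<lambda>i. fs (r i) x)"
  proof (rule cauchy_L1_AE_cauchy_subseq[of M fs])
    show "integrable M (fs n)" for n by (rule sqi_integrable[OF fin s])
    fix e :: real assume e: "0 < e"
    \<comment> \<open>The added 1 keeps K positive when the measure is zero.\<close>
    define K where "K = sqrt (measure M (space M)) + 1"
    have K: "K > 0" by (simp add: K_def add_nonneg_pos)
    obtain N where N: "\<And>m n. m \<ge> N \<Longrightarrow> n \<ge> N \<Longrightarrow> (\<integral>x. (fs m x - fs n x)\<^sup>2 \<partial>M) < (e / K)\<^sup>2"
      using C[of "(e / K)\<^sup>2"] e K by auto
    have "(\<integral>x. norm (fs m x - fs n x) \<partial>M) < e" if "m \<ge> N" "n \<ge> N" for m n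
    proof -
      have "sqrt (\<integral>x. (fs m x - fs n x)\<^sup>2 \<partial>M) < e / K"
        using N[OF that] e K by (metis divide_pos_pos less_eq_real_def real_sqrt_less_iff real_sqrt_pow2_iff real_sqrt_power)
      then have "sqrt (\<integral>x. (fs m x - fs n x)\<^sup>2 \<partial>M) * K < e"
        using K by (simp add: pos_less_divide_eq)
      moreover have "sqrt (\<integral>x. (fs m x - fs n x)\<^sup>2 \<partial>M) * sqrt (measure M (space M)) \<le> sqrt (\<integral>x. (fs m x - fs n x)\<^sup>2 \<partial>M) * K"
        by (intro mult_left_mono) (auto simp: K_def)
      ultimately show ?thesis using L1[of m n] by linarith
    qed
    then show "\<exists>N. \<forall>i\<ge>N. \<forall>j\<ge>N. (\<integral>x. norm (fs i x - fs j x) \<partial>M) < e" by blast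
  qed auto
  define f where "f x = lim (\<lambda>i. fs (r i) x)" for x
  have fm [measurable]: "f \<in> borel_measurable M" unfolding f_def
    by (rule borel_measurable_lim_metric) (use s in \<open>auto simp: sqi_def\<close>)
  have conv: "AE x in M. (\<lambda>i. fs (r i) x) \<longlonglongrightarrow> f x"
    using r(2) by eventually_elim (auto simp: f_def convergent_LIMSEQ_iff[symmetric] Cauchy_convergent_iff)
  have key: "sqi M (\<lambda>x. fs m x - f x) \<and> (\<integral>x. (fs m x - f x)\<^sup>2 \<partial>M) \<le> e"
    if "m \<ge> N" and lt: "\<And>m n. m \<ge> N \<Longrightarrow> n \<ge> N \<Longrightarrow> (\<integral>x. (fs m x - fs n x)\<^sup>2 \<partial>M) < e" for m N e
  proof -
    have a: "AE x in M. (\<lambda>i. fs m x - fs (r i) x) \<longlonglongrightarrow> fs m x - f x"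
      using conv by eventually_elim (intro tendsto_intros)
    have b: "(\<integral>x. (fs m x - fs (r i) x)\<^sup>2 \<partial>M) \<le> e" if "i \<ge> N" for i
    proof -
      have "r i \<ge> N" using that seq_suble[OF r(1), of i] by linarith
      from lt[OF \<open>m \<ge> N\<close> this] show ?thesis by simp
    qed
    have c: "sqi M (\<lambda>x. fs m x - fs (r i) x)" for i by (intro sqi_diff s)
    have d: "(\<lambda>x. fs m x - f x) \<in> borel_measurable M" using s[of m] by (auto simp: sqi_def)
    show ?thesis using Fatou_sq[OF c d a b] by blast
  qed
  have sf: "sqi M f"
  proof -
    obtain N where N: "\<And>m n. m \<ge> N \<Longrightarrow> n \<ge> N \<Longrightarrow> (\<integral>x. (fs m x - fs n x)\<^sup>2 \<partial>M) < 1" using C[of 1] by auto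
    have "sqi M (\<lambda>x. fs N x - f x)" using key[OF order_refl N] by blast
    from sqi_diff[OF s[of N] this] show ?thesis by simp
  qed
  have "(\<lambda>n. \<integral>x. (fs n x - f x)\<^sup>2 \<partial>M) \<longlonglongrightarrow> 0"
  proof (rule LIMSEQ_I)
    fix e :: real assume "0 < e"
    then obtain N where N: "\<And>m n. m \<ge> N \<Longrightarrow> n \<ge> N \<Longrightarrow> (\<integral>x. (fs m x - fs n x)\<^sup>2 \<partial>M) < e / 2" using C[of "e/2"] by auto
    have "norm ((\<integral>x. (fs n x - f x)\<^sup>2 \<partial>M) - 0) < e" if "n \<ge> N" for n
      using key[OF that N] \<open>0 < e\<close> by simp
    then show "\<exists>no. \<forall>n\<ge>no. norm ((\<integral>x. (fs n x - f x)\<^sup>2 \<partial>M) - 0) < e" by blast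
  qed
  then have "L2c M fs f" unfolding L2c_def using s sf by blast
  then show ?thesis by blast
qed

text \<open>The first variation at a minimum: \<open>a\<close> is the linear coefficient,
  \<open>q\<close> the quadratic one, of whatever sign. With q enlarged to the positive number
  \<open>\<bar>q\<bar> + 1\<close>, the value at the vertex would be negative for nonzero
  \<open>a\<close>.\<close>

lemma quadratic_vertex_zero:
  fixes a q :: real
  assumes "\<And>t. 0 \<le> 2 * t * a + t\<^sup>2 * q" shows "a = 0"
proof (rule ccontr)
  assume a: "a \<noteq> 0"
  define p where "p = \<bar>q\<bar> + 1"
  have p: "p > 0" "q \<le> p" by (auto simp: p_def)
  have "0 \<le> 2 * (- a / p) * a + (- a / p)\<^sup>2 * q" by (rule assms)
  also have "\<dots> \<le> 2 * (- a / p) * a + (- a / p)\<^sup>2 * p" using p by (intro add_left_mono mult_left_mono) auto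
  also have "\<dots> = - (a\<^sup>2 / p)" using p by (simp add: field_simps power2_eq_square)
  also have "\<dots> < 0" using a p by simp
  finally show False by simp
qed

text \<open>V is a linear space that need not be closed, so the distance to f may not be attained in
  V. What converges is the residual, and it is orthogonal to V. \<open>Lap_dense\<close> takes for V
  the range of the weighted Laplacian.\<close>

lemma L2_projection:
  assumes fin: "finite_measure M" and f: "sqi M f"
    and V: "V \<noteq> {}" "\<And>v. v \<in> V \<Longrightarrow> sqi M v"
      "\<And>u v a b. u \<in> V \<Longrightarrow> v \<in> V \<Longrightarrow> (\<lambda>x. a * u x + b * v x) \<in> V"
  shows "\<exists>r vs. L2c M (\<lambda>n x. f x - vs n x) r \<and> (\<forall>n. vs n \<in> V) \<and> (\<forall>v\<in>V. (\<integral>x. r x * v x \<partial>M) = 0)"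
proof -
  define J where "J v = (\<integral>x. (f x - v x)\<^sup>2 \<partial>M)" for v
  define m where "m = Inf (J ` V)"
  have bdd: "bdd_below (J ` V)" by (rule bdd_belowI[of _ 0]) (auto simp: J_def)
  have mle: "m \<le> J v" if "v \<in> V" for v unfolding m_def by (rule cINF_lower[OF bdd that])
  have "\<exists>v\<in>V. J v < m + 1 / real (Suc n)" for n
  proof -
    have "m < m + 1 / real (Suc n)" by simp
    then show ?thesis using cInf_lessD[of "J ` V" "m + 1 / real (Suc n)"] V(1) unfolding m_def[symmetric] by auto
  qed
  then obtain vs where vs: "\<And>n. vs n \<in> V" "\<And>n. J (vs n) < m + 1 / real (Suc n)" by metis
  have s: "sqi M (\<lambda>x. f x - v x)" if "v \<in> V" for v by (intro sqi_diff f V(2) that)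
  have par: "(\<integral>x. ((f x - vs i x) - (f x - vs j x))\<^sup>2 \<partial>M) \<le> 2 / real (Suc i) + 2 / real (Suc j)" for i j
  proof -
    \<comment> \<open>The midpoint of two near-minimisers lies in V, so its squared distance to f is
      at least m; by the parallelogram identity the two are then close to each other.\<close>
    define w where "w = (\<lambda>x. (1/2) * vs i x + (1/2) * vs j x)"
    have w: "w \<in> V" unfolding w_def by (rule V(3)[OF vs(1) vs(1)])
    have e: "((f x - vs i x) - (f x - vs j x))\<^sup>2 = 2 * (f x - vs i x)\<^sup>2 + 2 * (f x - vs j x)\<^sup>2 - 4 * (f x - w x)\<^sup>2" for x
      by (simp add: w_def power2_eq_square field_simps)
    have "(\<integral>x. ((f x - vs i x) - (f x - vs j x))\<^sup>2 \<partial>M) = 2 * J (vs i) + 2 * J (vs j) - 4 * J w"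
      unfolding e J_def using s[OF vs(1)[of i]] s[OF vs(1)[of j]] s[OF w] by (simp add: sqi_def)
    also have "\<dots> \<le> 2 / real (Suc i) + 2 / real (Suc j)"
    proof -
      have "2 * J (vs i) \<le> 2 * (m + 1 / real (Suc i))" "2 * J (vs j) \<le> 2 * (m + 1 / real (Suc j))"
        using vs(2)[of i] vs(2)[of j] by auto
      then show ?thesis using mle[OF w] by (simp add: algebra_simps)
    qed
    finally show ?thesis .
  qed
  have "\<exists>r. L2c M (\<lambda>n x. f x - vs n x) r"
  proof (rule L2_complete[OF fin s[OF vs(1)]])
    fix e :: real assume "0 < e"
    then obtain N where "inverse (real (Suc N)) < e / 4"
      using reals_Archimedean[of "e / 4"] by auto
    then have N: "4 / real (Suc N) < e" by (simp add: field_simps)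
    have "(\<integral>x. ((f x - vs i x) - (f x - vs j x))\<^sup>2 \<partial>M) < e" if "i \<ge> N" "j \<ge> N" for i j
    proof -
      have "2 / real (Suc i) \<le> 2 / real (Suc N)" "2 / real (Suc j) \<le> 2 / real (Suc N)"
        using that by (auto intro!: divide_left_mono)
      then show ?thesis using par[of i j] N by simp
    qed
    then show "\<exists>N. \<forall>i\<ge>N. \<forall>j\<ge>N. (\<integral>x. ((f x - vs i x) - (f x - vs j x))\<^sup>2 \<partial>M) < e" by blast
  qed
  then obtain r where r: "L2c M (\<lambda>n x. f x - vs n x) r" by blast
  have Jlim: "(\<lambda>n. J (vs n)) \<longlonglongrightarrow> m"
  proof (rule tendsto_sandwich[of "\<lambda>_. m" _ _ "\<lambda>n. m + 1 / real (Suc n)"])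
    show "(\<lambda>n. m + 1 / real (Suc n)) \<longlonglongrightarrow> m"
      using tendsto_add[OF tendsto_const[of m] LIMSEQ_inverse_real_of_nat] by (simp add: inverse_eq_divide)
  qed (use mle[OF vs(1)] vs(2) in \<open>auto simp: less_imp_le\<close>)
  have rm: "(\<integral>x. (r x)\<^sup>2 \<partial>M) = m"
    using LIMSEQ_unique[OF L2c_norm[OF r]] Jlim unfolding J_def by blast
  have "(\<integral>x. r x * v x \<partial>M) = 0" if v: "v \<in> V" for v
  proof -
    define b c where "b = (\<integral>x. r x * v x \<partial>M)" and "c = (\<integral>x. (v x)\<^sup>2 \<partial>M)"
    have q: "0 \<le> - 2 * t * b + t\<^sup>2 * c" for t
    proof -
      have l: "L2c M (\<lambda>n x. (f x - vs n x) - t * v x) (\<lambda>x. r x - t * v x)"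
        by (intro L2c_diff r L2c_cmult L2c_const V(2) v)
      have "m \<le> (\<integral>x. ((f x - vs n x) - t * v x)\<^sup>2 \<partial>M)" for n
        using mle[OF V(3)[OF vs(1)[of n] v, of 1 t]] by (simp add: J_def algebra_simps)
      then have "m \<le> (\<integral>x. (r x - t * v x)\<^sup>2 \<partial>M)"
        by (intro LIMSEQ_le_const[OF L2c_norm[OF l]]) auto
      also have "\<dots> = (\<integral>x. (r x)\<^sup>2 - 2 * t * (r x * v x) + t\<^sup>2 * (v x)\<^sup>2 \<partial>M)"
        by (simp add: power2_diff power_mult_distrib algebra_simps)
      also have "\<dots> = m - 2 * t * b + t\<^sup>2 * c"
        using L2cD(2)[OF r] V(2)[OF v] sqi_mult_integrable[OF L2cD(2)[OF r] V(2)[OF v]]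
        by (simp add: sqi_def rm b_def c_def)
      finally show ?thesis by simp
    qed
    have "- b = 0" by (rule quadratic_vertex_zero[of _ c]) (use q in \<open>simp add: mult.assoc\<close>)
    then show ?thesis by (simp add: b_def)
  qed
  then show ?thesis using r vs(1) by blast
qed

subsection \<open>Boxes and compact supports\<close>

interpretation lebp: product_sigma_finite "\<lambda>_::nat. lborel :: real measure"
  by standard

lemma space_leb [simp]: "space (leb d) = Rn d"
  by (simp add: leb_def Rn_def space_PiM)

lemma sigma_finite_leb: "sigma_finite_measure (leb d)"
  unfolding leb_def by (rule lebp.sigma_finite) simp

lemma coord_meas [measurable]: "i < d \<Longrightarrow> (\<lambda>x. x i) \<in> borel_measurable (leb d)"
  unfolding leb_def by measurable

lemma upd_Rn: "x \<in> Rn d \<Longrightarrow> j < d \<Longrightarrow> x(j := t) \<in> Rn d"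
  by (auto simp: Rn_def PiE_iff extensional_def)

definition bx :: "nat \<Rightarrow> real \<Rightarrow> point set" where
  "bx d r = {x \<in> Rn d. \<forall>i<d. \<bar>x i\<bar> \<le> r}"

lemma bx_PiE: "bx d r = PiE {..<d} (\<lambda>_. {-r..r})"
proof -
  have "\<bar>a\<bar> \<le> r \<longleftrightarrow> a \<in> {-r..r}" for a :: real by auto
  then show ?thesis
    by (intro set_eqI) (simp add: bx_def Rn_def PiE_iff conj_commute Ball_def)
qed

lemma bx_sets [measurable]: "bx d r \<in> sets (leb d)"
  unfolding bx_PiE leb_def by (rule sets_PiM_I_finite) auto

lemma bx_Rn: "x \<in> bx d r \<Longrightarrow> x \<in> Rn d"
  by (simp add: bx_def)

lemma bx_mono: "r \<le> s \<Longrightarrow> x \<in> bx d r \<Longrightarrow> x \<in> bx d s"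
  by (auto simp: bx_def)

lemma bx_exhaust:
  assumes "x \<in> Rn d" obtains N where "\<And>n. n \<ge> N \<Longrightarrow> x \<in> bx d (real n)"
proof -
  obtain N where N: "(\<Sum>i<d. \<bar>x i\<bar>) \<le> real N" using real_arch_simple by blast
  have "x \<in> bx d (real n)" if "n \<ge> N" for n
  proof -
    have "\<bar>x i\<bar> \<le> real n" if "i < d" for i
    proof -
      have "\<bar>x i\<bar> \<le> (\<Sum>i<d. \<bar>x i\<bar>)" using that by (intro member_le_sum) auto
      then show ?thesis using N \<open>n \<ge> N\<close> by linarith
    qed
    then show ?thesis using assms by (simp add: bx_def)
  qed
  then show thesis by (rule that)
qed

lemma emeasure_bx: "emeasure (leb d) (bx d r) < \<infinity>"
proof -
  have "emeasure (leb d) (bx d r) = (\<Prod>i<d. emeasure lborel {-r..r})"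
    unfolding bx_PiE leb_def by (rule lebp.emeasure_PiM) auto
  also have "\<dots> < \<infinity>"
    by (cases "-r \<le> r") (auto simp: power_less_top_ennreal)
  finally show ?thesis .
qed

text \<open>A point is \<open>undefined\<close> outside \<open>{..<d}\<close>, so a box is a product
  over all naturals of intervals and singletons, and Tychonoff's theorem applies in the full
  function space.\<close>

lemma compact_bx: "compact (bx d r)"
proof -
  have e: "bx d r = PiE UNIV (\<lambda>i. if i < d then {-r..r} else {undefined})"
  proof (rule set_eqI)
    fix x
    have "x \<in> bx d r \<longleftrightarrow> (\<forall>i. (i < d \<longrightarrow> x i \<in> {-r..r}) \<and> (\<not> i < d \<longrightarrow> x i = undefined))"
      unfolding bx_PiE PiE_iff extensional_def by blast
    also have "\<dots> \<longleftrightarrow> (\<forall>i. x i \<in> (if i < d then {-r..r} else {undefined}))"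
      by (intro all_cong1) simp
    finally show "x \<in> bx d r \<longleftrightarrow> x \<in> PiE UNIV (\<lambda>i. if i < d then {-r..r} else {undefined})"
      by (simp only: PiE_UNIV_domain Pi_iff UNIV_I simp_thms ball_UNIV)
  qed
  have "compactin (product_topology (\<lambda>i. euclidean) UNIV) (PiE UNIV (\<lambda>i. if i < d then {-r..r} else {undefined::real}))"
    unfolding compactin_PiE by (intro disjI2 ballI) simp
  then show ?thesis unfolding e euclidean_product_topology by simp
qed

text \<open>On the space of \<open>leb d\<close> the coordinates from index d on are the constant
  \<open>undefined\<close>, hence measurable as well. This connects the product sigma-algebra with
  the Borel sets of the function space.\<close>

lemma id_meas_leb: "(\<lambda>x. x) \<in> measurable (leb d) (borel :: (nat \<Rightarrow> real) measure)"
proof -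
  have "(\<lambda>x. x) \<in> measurable (leb d) (PiM UNIV (\<lambda>_::nat. borel :: real measure))"
  proof (rule measurable_PiM_single')
    fix i :: nat
    show "(\<lambda>x. x i) \<in> borel_measurable (leb d)"
    proof (cases "i < d")
      case False
      have "(\<lambda>x. x i) \<in> borel_measurable (leb d) \<longleftrightarrow> (\<lambda>x::nat\<Rightarrow>real. undefined::real) \<in> borel_measurable (leb d)"
        by (rule measurable_cong) (use False in \<open>auto simp: Rn_def PiE_iff extensional_def\<close>)
      then show ?thesis by simp
    qed simp
  qed auto
  then show ?thesis
    using measurable_cong_sets[OF refl sets_PiM_equal_borel, of "leb d"] by (metis (mono_tags))
qed

text \<open>Continuity is given on \<open>Rn d\<close> only. Composition with the continuous
  retraction \<open>restrict x {..<d}\<close> extends f continuously to the whole function space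
  without changing it on \<open>Rn d\<close>.\<close>

lemma cont_meas:
  assumes "continuous_on (Rn d) f" shows "f \<in> borel_measurable (leb d)"
proof -
  have r: "continuous_on UNIV (\<lambda>x::nat\<Rightarrow>real. restrict x {..<d})"
  proof (rule continuous_on_coordinatewise_then_product)
    fix i
    show "continuous_on UNIV (\<lambda>x::nat\<Rightarrow>real. restrict x {..<d} i)"
      by (cases "i < d") auto
  qed
  have "continuous_on UNIV (\<lambda>x. f (restrict x {..<d}))"
    by (rule continuous_on_compose2[OF assms r], rule image_subsetI) (simp add: Rn_def restrict_PiE_iff)
  then have "(\<lambda>x. f (restrict x {..<d})) \<in> borel_measurable borel"
    by (rule borel_measurable_continuous_onI)
  from measurable_compose[OF id_meas_leb this]
  have "(\<lambda>x. f (restrict x {..<d})) \<in> borel_measurable (leb d)" by simp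
  also have "?this \<longleftrightarrow> f \<in> borel_measurable (leb d)"
  proof (rule measurable_cong)
    fix x assume "x \<in> space (leb d)"
    then have "restrict x {..<d} = x" by (auto simp: Rn_def PiE_iff intro: extensional_restrict)
    then show "f (restrict x {..<d}) = f x" by simp
  qed
  finally show ?thesis .
qed

lemma bdd_on_bx:
  assumes "continuous_on (Rn d) f" shows "\<exists>C\<ge>0. \<forall>x\<in>bx d r. \<bar>f x\<bar> \<le> (C::real)"
proof -
  have "compact (f ` bx d r)"
    by (rule compact_continuous_image[OF continuous_on_subset[OF assms] compact_bx]) (auto simp: bx_def)
  then obtain C where "\<forall>y\<in>f ` bx d r. norm y \<le> C" using compact_imp_bounded bounded_iff by metis
  then have "\<forall>x\<in>bx d r. \<bar>f x\<bar> \<le> max C 0" by (auto simp: max.coboundedI1)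
  then show ?thesis by (metis max.cobounded2)
qed

text \<open>Compact support, expressed by boxes because only the values on \<open>Rn d\<close>
  count.\<close>

definition csup :: "nat \<Rightarrow> (point \<Rightarrow> real) \<Rightarrow> bool" where
  "csup d f \<longleftrightarrow> (\<exists>r. \<forall>x\<in>Rn d. x \<notin> bx d r \<longrightarrow> f x = 0)"

lemma csup_mult1: "csup d f \<Longrightarrow> csup d (\<lambda>x. f x * g x)"
  unfolding csup_def by (metis mult_zero_left mult_zero_right)

lemma csup_mult2: "csup d g \<Longrightarrow> csup d (\<lambda>x. f x * g x)"
  unfolding csup_def by (metis mult_zero_left mult_zero_right)

lemma csup_add:
  assumes "csup d f" "csup d g" shows "csup d (\<lambda>x. f x + g x)"
proof -
  obtain r s where "\<forall>x\<in>Rn d. x \<notin> bx d r \<longrightarrow> f x = 0" "\<forall>x\<in>Rn d. x \<notin> bx d s \<longrightarrow> g x = 0"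
    using assms by (auto simp: csup_def)
  then have "\<forall>x\<in>Rn d. x \<notin> bx d (max r s) \<longrightarrow> f x + g x = 0"
    using bx_mono[of r "max r s"] bx_mono[of s "max r s"] by fastforce
  then show ?thesis unfolding csup_def by blast
qed

lemma csup_zero: "csup d (\<lambda>x. 0)"
  by (simp add: csup_def)

lemma csup_sum: "(\<And>i. i \<in> I \<Longrightarrow> csup d (f i)) \<Longrightarrow> csup d (\<lambda>x. \<Sum>i\<in>I. f i x)"
  by (induction I rule: infinite_finite_induct) (auto intro: csup_add csup_zero)

lemma test_fun_iff: "test_fun d f \<longleftrightarrow> (\<forall>k. Ck d k f) \<and> csup d f"
proof -
  have "x \<notin> bx d r \<longleftrightarrow> (\<exists>i<d. \<bar>x i\<bar> > r)" if "x \<in> Rn d" for x r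
    using that by (auto simp: bx_def not_le)
  then show ?thesis unfolding test_fun_def csup_def by (simp cong: ball_cong)
qed

lemma cc_bounded:
  assumes "continuous_on (Rn d) f" "csup d f"
  shows "\<exists>C\<ge>0. \<forall>x\<in>Rn d. \<bar>f x\<bar> \<le> C"
proof -
  obtain r where r: "\<forall>x\<in>Rn d. x \<notin> bx d r \<longrightarrow> f x = 0" using assms by (auto simp: csup_def)
  obtain C where "C \<ge> 0" "\<forall>x\<in>bx d r. \<bar>f x\<bar> \<le> C" using bdd_on_bx[OF assms(1)] by blast
  then show ?thesis using r by (metis abs_zero)
qed

lemma integrable_bdd_bx:
  fixes f :: "point \<Rightarrow> real"
  assumes "f \<in> borel_measurable (leb d)" "\<And>x. x \<in> Rn d \<Longrightarrow> x \<notin> bx d r \<Longrightarrow> f x = 0"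
    "\<And>x. x \<in> bx d r \<Longrightarrow> \<bar>f x\<bar> \<le> C"
  shows "integrable (leb d) f"
proof (rule Bochner_Integration.integrable_bound)
  show "integrable (leb d) (\<lambda>x. C * indicator (bx d r) x)"
  proof -
    have "bx d r \<inter> Rn d = bx d r" by (auto simp: bx_def)
    then show ?thesis
      using emeasure_bx[of d r] by (intro integrable_mult_right) (auto simp: integrable_indicator_iff)
  qed
  show "AE x in leb d. norm (f x) \<le> norm (C * indicator (bx d r) x)"
  proof (rule AE_I2)
    fix x assume "x \<in> space (leb d)"
    then show "norm (f x) \<le> norm (C * indicator (bx d r) x)"
      using assms(2)[of x] assms(3)[of x] by (cases "x \<in> bx d r") (simp_all add: order_trans[OF _ abs_ge_self])
  qed
qed fact

lemma cc_integrable: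
  assumes "continuous_on (Rn d) f" "csup d f" shows "integrable (leb d) f"
proof -
  obtain r where r: "\<forall>x\<in>Rn d. x \<notin> bx d r \<longrightarrow> f x = 0" using assms by (auto simp: csup_def)
  obtain C where "\<forall>x\<in>bx d r. \<bar>f x\<bar> \<le> C" using bdd_on_bx[OF assms(1), of r] by blast
  then show ?thesis using r assms(1) by (intro integrable_bdd_bx[of f d r C] cont_meas) auto
qed

lemma tendsto_fun:
  fixes f :: "'b \<Rightarrow> 'a \<Rightarrow> 'c::topological_space"
  assumes "\<And>i. ((\<lambda>n. f n i) \<longlongrightarrow> l i) F" shows "(f \<longlongrightarrow> l) F"
proof -
  have "limitin (product_topology (\<lambda>i. euclidean) UNIV) f l F"
    unfolding limitin_componentwise using assms by simp
  then show ?thesis by (simp add: euclidean_product_topology)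
qed

subsection \<open>Functions of class \<open>C\<^sup>k\<close>\<close>

lemma pdI: "((\<lambda>t. f (x(j := t))) has_real_derivative a) (at (x j)) \<Longrightarrow> pd j f x = a"
  unfolding pd_def by (rule DERIV_imp_deriv)

lemma Ck_cont: "Ck d k f \<Longrightarrow> continuous_on (Rn d) f"
  by (cases k) auto

lemma pd_has_derivative:
  assumes "Ck d (Suc k) f" "x(j := s) \<in> Rn d" "j < d"
  shows "((\<lambda>t. f (x(j := t))) has_real_derivative pd j f (x(j := s))) (at s)"
proof -
  have "\<forall>y\<in>Rn d. (\<lambda>t. f (y(j := t))) differentiable (at (y j))"
    using assms(1,3) by simp
  from bspec[OF this assms(2)] have "(\<lambda>t. f (x(j := t))) differentiable (at s)"
    by (simp only: fun_upd_same fun_upd_upd)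
  then show ?thesis unfolding pd_def by (simp add: DERIV_deriv_iff_real_differentiable)
qed

lemma pd_has_derivative_at:
  assumes "Ck d (Suc k) f" "x \<in> Rn d" "j < d"
  shows "((\<lambda>t. f (x(j := t))) has_real_derivative pd j f x) (at (x j))"
  using pd_has_derivative[of d k f x j "x j"] assms by simp

lemma Ck_cong:
  assumes "Ck d k f" "\<And>x. x \<in> Rn d \<Longrightarrow> f x = g x" shows "Ck d k g"
  using assms
proof (induction k arbitrary: f g)
  case 0
  then show ?case by (simp cong: continuous_on_cong)
next
  case (Suc k)
  have fe: "(\<lambda>t. f (x(j := t))) = (\<lambda>t. g (x(j := t)))" if "x \<in> Rn d" "j < d" for x j
    using Suc.prems(2) upd_Rn[OF that] by auto
  have "continuous_on (Rn d) g" using Suc.prems Ck_cont continuous_on_cong by blast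
  moreover have "(\<lambda>t. g (x(j := t))) differentiable (at (x j))" if "x \<in> Rn d" "j < d" for x j
    unfolding fe[OF that, symmetric] using Suc.prems(1) that by simp
  moreover have "Ck d k (pd j g)" if "j < d" for j
  proof (rule Suc.IH)
    show "Ck d k (pd j f)" using Suc.prems(1) that by simp
    show "pd j f x = pd j g x" if "x \<in> Rn d" for x
      unfolding pd_def using fe[OF that \<open>j < d\<close>] by simp
  qed
  ultimately show ?case by simp
qed

lemma Ck_SucI:
  assumes "continuous_on (Rn d) f"
    "\<And>j x. j < d \<Longrightarrow> x \<in> Rn d \<Longrightarrow> ((\<lambda>t. f (x(j := t))) has_real_derivative g j x) (at (x j))"
    "\<And>j. j < d \<Longrightarrow> Ck d k (g j)"
  shows "Ck d (Suc k) f"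
proof -
  have "Ck d k (pd j f)" if "j < d" for j
    by (rule Ck_cong[OF assms(3)[OF that]]) (simp add: pdI[OF assms(2)[OF that]])
  then show ?thesis using assms(1,2) by (auto simp: real_differentiable_def)
qed

lemma Ck_Suc_imp: "Ck d (Suc k) f \<Longrightarrow> Ck d k f"
proof (induction k arbitrary: f)
  case (Suc k)
  then show ?case by (metis Ck.simps(2))
qed simp

lemma Ck_le: "Ck d m f \<Longrightarrow> k \<le> m \<Longrightarrow> Ck d k f"
  by (induction m) (auto simp del: Ck.simps simp: le_Suc_eq intro: Ck_Suc_imp)

declare Ck.simps(2) [simp del]

lemma Ck_pd': "Ck d (Suc k) f \<Longrightarrow> j < d \<Longrightarrow> Ck d k (pd j f)"
  by (simp add: Ck.simps(2))

lemma Ck_const: "Ck d k (\<lambda>x. c)"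
proof (induction k arbitrary: c)
  case (Suc k)
  show ?case by (rule Ck_SucI[where g = "\<lambda>_ _. 0"]) (auto intro: Suc)
qed simp

lemma cont_coord [continuous_intros]: "continuous_on S (\<lambda>x. x i :: real)"
  by (rule continuous_on_subset[OF continuous_on_product_coordinates]) simp

lemma Ck_coord: "Ck d k (\<lambda>x. x i)"
proof (cases k)
  case (Suc m)
  show ?thesis unfolding Suc
  proof (rule Ck_SucI[where g = "\<lambda>j _. if i = j then 1 else 0"])
    show "((\<lambda>t. (x(j := t)) i) has_real_derivative (if i = j then 1 else 0)) (at (x j))" for j x
      by (cases "i = j") (auto intro!: derivative_eq_intros)
  qed (auto intro: Ck_const continuous_intros)
qed (auto intro: continuous_intros)

lemma Ck_add:
  assumes "Ck d k f" "Ck d k g" shows "Ck d k (\<lambda>x. f x + g x)"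
  using assms
proof (induction k arbitrary: f g)
  case (Suc k)
  show ?case
  proof (rule Ck_SucI[where g = "\<lambda>j x. pd j f x + pd j g x"])
    show "continuous_on (Rn d) (\<lambda>x. f x + g x)" by (intro continuous_intros Ck_cont[OF Suc.prems(1)] Ck_cont[OF Suc.prems(2)])
    show "((\<lambda>t. f (x(j := t)) + g (x(j := t))) has_real_derivative pd j f x + pd j g x) (at (x j))"
      if "j < d" "x \<in> Rn d" for j x
      by (intro DERIV_add pd_has_derivative_at[OF Suc.prems(1)] pd_has_derivative_at[OF Suc.prems(2)] that)
  qed (intro Suc.IH Ck_pd' Suc.prems)
qed (auto intro: continuous_intros)

lemma Ck_mult:
  assumes "Ck d k f" "Ck d k g" shows "Ck d k (\<lambda>x. f x * g x)"
  using assms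
proof (induction k arbitrary: f g)
  case (Suc k)
  show ?case
  proof (rule Ck_SucI[where g = "\<lambda>j x. pd j f x * g x + pd j g x * f x"])
    show "continuous_on (Rn d) (\<lambda>x. f x * g x)" by (intro continuous_intros Ck_cont[OF Suc.prems(1)] Ck_cont[OF Suc.prems(2)])
    show "((\<lambda>t. f (x(j := t)) * g (x(j := t))) has_real_derivative pd j f x * g x + pd j g x * f x) (at (x j))"
      if "j < d" "x \<in> Rn d" for j x
      using DERIV_mult[OF pd_has_derivative_at[OF Suc.prems(1) that(2,1)] pd_has_derivative_at[OF Suc.prems(2) that(2,1)]]
      by (simp only: fun_upd_triv)
    show "Ck d k (\<lambda>x. pd j f x * g x + pd j g x * f x)" if "j < d" for j
      by (intro Ck_add Suc.IH Ck_pd'[OF _ that] Suc.prems Ck_Suc_imp)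
  qed
qed (auto intro: continuous_intros)

lemma Ck_cmult: "Ck d k f \<Longrightarrow> Ck d k (\<lambda>x. c * f x)"
  by (rule Ck_mult[OF Ck_const])

lemma Ck_uminus: "Ck d k f \<Longrightarrow> Ck d k (\<lambda>x. - f x)"
  using Ck_cmult[of d k f "-1"] by simp

lemma Ck_diff: "Ck d k f \<Longrightarrow> Ck d k g \<Longrightarrow> Ck d k (\<lambda>x. f x - g x)"
  using Ck_add[of d k f "\<lambda>x. - g x"] Ck_uminus[of d k g] by simp

lemma Ck_sum: "(\<And>i. i \<in> I \<Longrightarrow> Ck d k (f i)) \<Longrightarrow> Ck d k (\<lambda>x. \<Sum>i\<in>I. f i x)"
  by (induction I rule: infinite_finite_induct) (auto intro: Ck_const Ck_add)

lemma Ck_exp: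
  assumes "Ck d k f" shows "Ck d k (\<lambda>x. exp (f x))"
  using assms
proof (induction k arbitrary: f)
  case (Suc k)
  show ?case
  proof (rule Ck_SucI[where g = "\<lambda>j x. exp (f x) * pd j f x"])
    show "continuous_on (Rn d) (\<lambda>x. exp (f x))" by (intro continuous_intros Ck_cont[OF Suc.prems(1)])
    show "((\<lambda>t. exp (f (x(j := t)))) has_real_derivative exp (f x) * pd j f x) (at (x j))"
      if "j < d" "x \<in> Rn d" for j x
      using DERIV_fun_exp[OF pd_has_derivative_at[OF Suc.prems(1) that(2,1)]] by (simp only: fun_upd_triv)
    show "Ck d k (\<lambda>x. exp (f x) * pd j f x)" if "j < d" for j
      by (intro Ck_mult Suc.IH Ck_pd'[OF _ that] Suc.prems Ck_Suc_imp)
  qed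
qed (auto intro: continuous_intros)

lemma pd_cong:
  assumes "\<And>x. x \<in> Rn d \<Longrightarrow> f x = g x" "x \<in> Rn d" "j < d" shows "pd j f x = pd j g x"
proof -
  have "(\<lambda>t. f (x(j := t))) = (\<lambda>t. g (x(j := t)))" using assms upd_Rn[OF assms(2,3)] by auto
  then show ?thesis by (simp add: pd_def)
qed

context
  fixes d k j x and f g :: "point \<Rightarrow> real"
  assumes f: "Ck d (Suc k) f" and x: "x \<in> Rn d" and j: "j < d"
begin

lemma pd_add: "Ck d (Suc m) g \<Longrightarrow> pd j (\<lambda>x. f x + g x) x = pd j f x + pd j g x"
  by (rule pdI) (intro DERIV_add pd_has_derivative_at[OF f x j] pd_has_derivative_at[OF _ x j])

lemma pd_diff: "Ck d (Suc m) g \<Longrightarrow> pd j (\<lambda>x. f x - g x) x = pd j f x - pd j g x"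
  by (rule pdI) (intro DERIV_diff pd_has_derivative_at[OF f x j] pd_has_derivative_at[OF _ x j])

lemma pd_mult: "Ck d (Suc m) g \<Longrightarrow> pd j (\<lambda>x. f x * g x) x = pd j f x * g x + f x * pd j g x"
  using DERIV_mult[OF pd_has_derivative_at[OF f x j] pd_has_derivative_at[OF _ x j, of m g]]
  by (intro pdI) (simp only: fun_upd_triv mult.commute)

lemma pd_cmult: "pd j (\<lambda>x. c * f x) x = c * pd j f x"
  by (rule pdI) (intro DERIV_cmult pd_has_derivative_at[OF f x j])

lemma pd_uminus: "pd j (\<lambda>x. - f x) x = - pd j f x"
  by (rule pdI) (intro DERIV_minus pd_has_derivative_at[OF f x j])

lemma pd_exp: "pd j (\<lambda>x. exp (f x)) x = exp (f x) * pd j f x"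
  using DERIV_fun_exp[OF pd_has_derivative_at[OF f x j]] by (intro pdI) (simp only: fun_upd_triv)

end

lemma pd_const [simp]: "pd j (\<lambda>x. c) x = 0"
  by (rule pdI) auto

lemma pd_coord: "pd j (\<lambda>x. x i) x = (if i = j then 1 else 0)"
  by (rule pdI, cases "i = j") (auto intro!: derivative_eq_intros)

section \<open>Compactly supported functions: derivatives and integration by parts\<close>

lemma pd_eq_0_outside:
  assumes z: "\<And>x. x \<in> Rn d \<Longrightarrow> x \<notin> bx d r \<Longrightarrow> f x = 0" and x: "x \<in> Rn d" "x \<notin> bx d r" and j: "j < d"
  shows "pd j f x = 0"
proof (rule pdI)
  obtain i where i: "i < d" "\<bar>x i\<bar> > r" using x by (auto simp: bx_def not_le)
  have "open ((\<lambda>t. \<bar>(x(j := t)) i\<bar>) -` {r<..})"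
    by (cases "i = j") (auto intro!: continuous_open_vimage continuous_intros)
  moreover have "x j \<in> (\<lambda>t. \<bar>(x(j := t)) i\<bar>) -` {r<..}" using i by (cases "i = j") simp_all
  moreover have "f (x(j := t)) = 0" if "t \<in> (\<lambda>t. \<bar>(x(j := t)) i\<bar>) -` {r<..}" for t
    using that i upd_Rn[OF x(1) j] by (intro z) (auto simp: bx_def not_le intro!: exI[of _ i])
  ultimately show "((\<lambda>t. f (x(j := t))) has_real_derivative 0) (at (x j))"
    by (intro has_field_derivative_transform_within_open[of "\<lambda>_. 0" 0 _ _ "\<lambda>t. f (x(j := t))"]) auto
qed

lemma csup_pd:
  assumes "csup d f" "j < d" shows "csup d (pd j f)"
proof -
  obtain r where "\<And>x. x \<in> Rn d \<Longrightarrow> x \<notin> bx d r \<Longrightarrow> f x = 0" using assms by (auto simp: csup_def)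
  from pd_eq_0_outside[of d r f, OF this _ _ assms(2)] show ?thesis by (auto simp: csup_def)
qed

text \<open>Fubini's theorem with the j-th variable innermost reduces this to the fundamental
  theorem of calculus on lines.\<close>

lemma integral_pd_zero:
  assumes f: "Ck d (Suc k) f" "csup d f" and j: "j < d"
  shows "(\<integral>x. pd j f x \<partial>leb d) = 0"
proof -
  define I where "I = {..<d} - {j}"
  have ins: "insert j I = {..<d}" using j by (auto simp: I_def)
  obtain r where r: "\<And>x. x \<in> Rn d \<Longrightarrow> x \<notin> bx d r \<Longrightarrow> f x = 0" using f by (auto simp: csup_def)
  obtain r' where r': "\<And>x. x \<in> Rn d \<Longrightarrow> x \<notin> bx d r' \<Longrightarrow> pd j f x = 0" using csup_pd[OF f(2) j] by (auto simp: csup_def)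
  \<comment> \<open>Strictly larger than both radii: the derivative vanishes off
    \<open>{-s..s}\<close>, and f itself at the two endpoints.\<close>
  define s where "s = max \<bar>r\<bar> \<bar>r'\<bar> + 1"
  have cont: "continuous_on (Rn d) (pd j f)" by (rule Ck_cont[OF Ck_pd'[OF f(1) j]])
  have int: "integrable (leb d) (pd j f)" by (rule cc_integrable[OF cont csup_pd[OF f(2) j]])
  have "(\<integral>x. pd j f x \<partial>leb d) = (\<integral>x. (\<integral>y. pd j f (x(j := y)) \<partial>lborel) \<partial>PiM I (\<lambda>_. lborel))"
    unfolding leb_def ins[symmetric]
  proof (rule lebp.product_integral_insert)
    show "finite I" "j \<notin> I" by (auto simp: I_def)
    show "integrable (PiM (insert j I) (\<lambda>_. lborel)) (pd j f)" using int by (simp add: leb_def ins)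
  qed
  also have "\<dots> = (\<integral>x. 0 \<partial>PiM I (\<lambda>_::nat. lborel :: real measure))"
  proof (rule Bochner_Integration.integral_cong[OF refl])
    fix x assume x: "x \<in> space (PiM I (\<lambda>_::nat. lborel :: real measure))"
    have R: "x(j := t) \<in> Rn d" for t
      using x j by (auto simp: Rn_def space_PiM PiE_iff extensional_def I_def)
    have nb: "x(j := t) \<notin> bx d \<rho>" if "\<bar>t\<bar> > \<rho>" for t \<rho>
      using that j by (auto simp: bx_def not_le intro!: exI[of _ j])
    have c: "continuous_on UNIV (\<lambda>t. pd j f (x(j := t)))"
    proof (rule continuous_on_compose2[OF cont])
      show "continuous_on UNIV (\<lambda>t. x(j := t))"
      proof (rule continuous_on_coordinatewise_then_product)
        show "continuous_on UNIV (\<lambda>t. (x(j := t)) i)" for i by (cases "i = j") auto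
      qed
    qed (use R in auto)
    have "(\<integral>y. pd j f (x(j := y)) \<partial>lborel) = (\<integral>y. pd j f (x(j := y)) * indicator {-s..s} y \<partial>lborel)"
    proof (rule Bochner_Integration.integral_cong[OF refl])
      fix y :: real
      show "pd j f (x(j := y)) = pd j f (x(j := y)) * indicator {-s..s} y"
      proof (cases "y \<in> {-s..s}")
        case False
        then have "\<bar>y\<bar> > r'" by (auto simp: s_def)
        then show ?thesis using r'[OF R nb] False by simp
      qed simp
    qed
    also have "\<dots> = f (x(j := s)) - f (x(j := -s))"
    proof (rule integral_FTC_Icc_real)
      show "- s \<le> s" by (simp add: s_def)
      show "((\<lambda>t. f (x(j := t))) has_real_derivative pd j f (x(j := t))) (at t)" for t
        by (rule pd_has_derivative[OF f(1) R j])
      show "isCont (\<lambda>t. pd j f (x(j := t))) t" for t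
        using c by (simp add: continuous_on_eq_continuous_at)
    qed
    also have "\<dots> = 0"
    proof -
      have "\<bar>s\<bar> > r" "\<bar>-s\<bar> > r" by (auto simp: s_def)
      then show ?thesis using r[OF R nb] by simp
    qed
    finally show "(\<integral>y. pd j f (x(j := y)) \<partial>lborel) = 0" .
  qed
  finally show ?thesis by simp
qed

lemma ibp_leb:
  assumes f: "Ck d (Suc k) f" and g: "Ck d (Suc m) g" "csup d g" and j: "j < d"
  shows "(\<integral>x. pd j f x * g x \<partial>leb d) = - (\<integral>x. f x * pd j g x \<partial>leb d)"
proof -
  have f1: "Ck d (Suc 0) f" and g1: "Ck d (Suc 0) g" by (auto intro: Ck_le f g)
  have "0 = (\<integral>x. pd j (\<lambda>x. f x * g x) x \<partial>leb d)"
    by (rule integral_pd_zero[symmetric, of d 0]) (auto intro: Ck_mult f1 g1 csup_mult2 g j)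
  also have "\<dots> = (\<integral>x. pd j f x * g x + f x * pd j g x \<partial>leb d)"
    by (rule Bochner_Integration.integral_cong) (auto simp: pd_mult[OF f1 _ j g1])
  also have "\<dots> = (\<integral>x. pd j f x * g x \<partial>leb d) + (\<integral>x. f x * pd j g x \<partial>leb d)"
  proof (rule Bochner_Integration.integral_add)
    show "integrable (leb d) (\<lambda>x. pd j f x * g x)"
      by (intro cc_integrable continuous_intros csup_mult2 g Ck_cont[OF g1] Ck_cont[OF Ck_pd'[OF f j]])
    show "integrable (leb d) (\<lambda>x. f x * pd j g x)"
      by (intro cc_integrable continuous_intros csup_mult2 csup_pd j g Ck_cont[OF f] Ck_cont[OF Ck_pd'[OF g(1) j]])
  qed
  finally show ?thesis by linarith
qed

text \<open>The mixed second difference is symmetric in i and j. Two uses of the mean value theorem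
  turn it into a mixed derivative at a nearby point, in the order chosen; \<open>Schwarz\<close>
  compares both orders and lets h tend to 0.\<close>

lemma Schwarz_step:
  assumes f: "Ck d (Suc (Suc k)) f" and x: "x \<in> Rn d" and ij: "i < d" "j < d" "i \<noteq> j" and h: "h > 0"
  shows "\<exists>s\<in>{0<..<h}. \<exists>t\<in>{0<..<h}. f (x(i := x i + h, j := x j + h)) - f (x(j := x j + h)) - (f (x(i := x i + h)) - f x)
     = h * h * pd j (pd i f) (x(i := x i + s, j := x j + t))"
proof -
  define g where "g s = f (x(i := s, j := x j + h)) - f (x(i := s))" for s
  have R: "x(i := s, j := t) \<in> Rn d" "x(i := s) \<in> Rn d" "x(j := t) \<in> Rn d" for s t
    using x ij by (auto intro: upd_Rn)
  have "\<exists>z>x i. z < x i + h \<and> g (x i + h) - g (x i) = (x i + h - x i) * (pd i f (x(i := z, j := x j + h)) - pd i f (x(i := z)))"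
  proof (rule MVT2)
    fix s
    have "((\<lambda>s. f ((x(j := x j + h))(i := s))) has_real_derivative pd i f ((x(j := x j + h))(i := s))) (at s)"
      by (rule pd_has_derivative[OF f]) (use R ij in \<open>auto intro: upd_Rn\<close>)
    moreover have "((\<lambda>s. f (x(i := s))) has_real_derivative pd i f (x(i := s))) (at s)"
      by (rule pd_has_derivative[OF f]) (use R ij in auto)
    ultimately show "(g has_real_derivative (pd i f (x(i := s, j := x j + h)) - pd i f (x(i := s)))) (at s)"
      unfolding g_def using ij by (simp add: fun_upd_twist DERIV_diff)
  qed (use h in auto)
  then obtain z where z: "x i < z" "z < x i + h" "g (x i + h) - g (x i) = h * (pd i f (x(i := z, j := x j + h)) - pd i f (x(i := z)))"
    by auto
  have "\<exists>w>x j. w < x j + h \<and> pd i f (x(i := z, j := x j + h)) - pd i f (x(i := z, j := x j)) = (x j + h - x j) * pd j (pd i f) (x(i := z, j := w))"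
  proof (rule MVT2)
    fix s
    show "((\<lambda>t. pd i f (x(i := z, j := t))) has_real_derivative pd j (pd i f) (x(i := z, j := s))) (at s)"
      by (rule pd_has_derivative[OF Ck_pd'[OF f]]) (use R ij in auto)
  qed (use h in auto)
  then obtain w where w: "x j < w" "w < x j + h" "pd i f (x(i := z, j := x j + h)) - pd i f (x(i := z, j := x j)) = h * pd j (pd i f) (x(i := z, j := w))"
    by auto
  have e: "x(i := z, j := x j) = x(i := z)" using ij by auto
  have "g (x i + h) - g (x i) = h * (h * pd j (pd i f) (x(i := z, j := w)))"
    using z(3) w(3) unfolding e by simp
  then show ?thesis unfolding g_def using z w ij
    by (intro bexI[of _ "z - x i"] bexI[of _ "w - x j"]) (auto simp: algebra_simps)
qed

lemma Schwarz:
  assumes f: "Ck d (Suc (Suc k)) f" and x: "x \<in> Rn d" and ij: "i < d" "j < d"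
  shows "pd i (pd j f) x = pd j (pd i f) x"
proof (cases "i = j")
  case False
  define h where "h n = 1 / real (Suc n)" for n
  have h: "h n > 0" for n by (simp add: h_def)
  have h0: "h \<longlonglongrightarrow> 0" unfolding h_def using LIMSEQ_inverse_real_of_nat by (simp add: inverse_eq_divide)
  have lim: "(\<lambda>n. pd b (pd a f) (x(a := x a + s n, b := x b + t n))) \<longlonglongrightarrow> pd b (pd a f) x"
    if ab: "a < d" "b < d" "a \<noteq> b" and st: "\<And>n. s n \<in> {0<..<h n}" "\<And>n. t n \<in> {0<..<h n}" for a b s t
  proof -
    have c: "continuous_on (Rn d) (pd b (pd a f))"
      by (rule Ck_cont[OF Ck_pd'[OF Ck_pd'[OF f]]]) (use ab in auto)
    have s0: "s \<longlonglongrightarrow> 0" by (rule tendsto_sandwich[OF _ _ tendsto_const h0]) (use st in \<open>auto simp: less_imp_le\<close>)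
    have t0: "t \<longlonglongrightarrow> 0" by (rule tendsto_sandwich[OF _ _ tendsto_const h0]) (use st in \<open>auto simp: less_imp_le\<close>)
    have "(\<lambda>n. x(a := x a + s n, b := x b + t n)) \<longlonglongrightarrow> x"
    proof (rule tendsto_fun)
      fix i
      have "(\<lambda>n. x a + s n) \<longlonglongrightarrow> x a" "(\<lambda>n. x b + t n) \<longlonglongrightarrow> x b"
        using tendsto_add[OF tendsto_const s0] tendsto_add[OF tendsto_const t0] by auto
      then show "(\<lambda>n. (x(a := x a + s n, b := x b + t n)) i) \<longlonglongrightarrow> x i"
        by (cases "i = b"; cases "i = a") auto
    qed
    then show ?thesis
      by (intro continuous_on_tendsto_compose[OF c _ x]) (use x ab in \<open>auto intro!: always_eventually upd_Rn\<close>)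
  qed
  have "\<exists>s t. s \<in> {0<..<h n} \<and> t \<in> {0<..<h n} \<and> f (x(i := x i + h n, j := x j + h n)) - f (x(j := x j + h n)) - (f (x(i := x i + h n)) - f x)
     = h n * h n * pd j (pd i f) (x(i := x i + s, j := x j + t))" for n
    using Schwarz_step[OF f x ij False h[of n]] by blast
  then obtain s t where st: "\<And>n. s n \<in> {0<..<h n}" "\<And>n. t n \<in> {0<..<h n}"
    "\<And>n. f (x(i := x i + h n, j := x j + h n)) - f (x(j := x j + h n)) - (f (x(i := x i + h n)) - f x)
     = h n * h n * pd j (pd i f) (x(i := x i + s n, j := x j + t n))" by metis
  have "\<exists>s t. s \<in> {0<..<h n} \<and> t \<in> {0<..<h n} \<and> f (x(j := x j + h n, i := x i + h n)) - f (x(i := x i + h n)) - (f (x(j := x j + h n)) - f x)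
     = h n * h n * pd i (pd j f) (x(j := x j + s, i := x i + t))" for n
    using Schwarz_step[OF f x ij(2,1) False[symmetric] h[of n]] by blast
  then obtain s' t' where st': "\<And>n. s' n \<in> {0<..<h n}" "\<And>n. t' n \<in> {0<..<h n}"
    "\<And>n. f (x(j := x j + h n, i := x i + h n)) - f (x(i := x i + h n)) - (f (x(j := x j + h n)) - f x)
     = h n * h n * pd i (pd j f) (x(j := x j + s' n, i := x i + t' n))" by metis
  have "h n * h n * pd j (pd i f) (x(i := x i + s n, j := x j + t n)) = h n * h n * pd i (pd j f) (x(j := x j + s' n, i := x i + t' n))" for n
  proof -
    have "f (x(i := x i + h n, j := x j + h n)) = f (x(j := x j + h n, i := x i + h n))"
      by (simp only: fun_upd_twist[OF False])
    then show ?thesis using st(3)[of n] st'(3)[of n] by linarith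
  qed
  then have e: "pd j (pd i f) (x(i := x i + s n, j := x j + t n)) = pd i (pd j f) (x(j := x j + s' n, i := x i + t' n))" for n
    using h[of n] mult_cancel_left[of "h n * h n"] by (metis less_irrefl mult_pos_pos)
  have a: "(\<lambda>n. pd j (pd i f) (x(i := x i + s n, j := x j + t n))) \<longlonglongrightarrow> pd j (pd i f) x"
    by (rule lim[OF ij False st(1,2)])
  have b: "(\<lambda>n. pd j (pd i f) (x(i := x i + s n, j := x j + t n))) \<longlonglongrightarrow> pd i (pd j f) x"
    unfolding e by (rule lim[OF ij(2,1) False[symmetric] st'(1,2)])
  show ?thesis by (rule LIMSEQ_unique[OF b a])
qed simp

subsection \<open>A smooth bump function\<close>

text \<open>The bump function \<open>exp (- 1 / (1 + t)) * exp (- 1 / (1 - t))\<close> on \<open>{-1<..<1}\<close> and its derivatives are sums of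
  products \<open>pexp p (1 + t) * pexp q (1 - t)\<close>; such a sum is represented by the list of the pairs \<open>(p, q)\<close>.\<close>

definition pexp :: "real poly \<Rightarrow> real \<Rightarrow> real" where
  "pexp p t = (if t > 0 then poly p (1 / t) * exp (- (1 / t)) else 0)"

text \<open>The derivative of \<open>poly p (1 / t) * exp (- (1 / t))\<close> is
  \<open>(1 / t)^2 * poly (p - pderiv p) (1 / t) * exp (- (1 / t))\<close>, so the class of these
  functions is closed under differentiation.\<close>

definition pexp_deriv :: "real poly \<Rightarrow> real poly" where
  "pexp_deriv p = [:0, 0, 1:] * (p - pderiv p)"

lemma poly_times_exp_minus_tendsto_0:
  "((\<lambda>y. poly p y * exp (- y)) \<longlongrightarrow> (0::real)) at_top"
proof -
  have "((\<lambda>y. \<Sum>i\<le>degree p. coeff p i * (y ^ i / exp y)) \<longlongrightarrow> (\<Sum>i\<le>degree p. coeff p i * 0)) at_top"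
    by (intro tendsto_intros tendsto_power_div_exp_0)
  then show ?thesis
    by (simp add: poly_altdef sum_distrib_right exp_minus divide_inverse mult.assoc)
qed

text \<open>Only t = 0 is more than a computation: the right difference quotient is a polynomial in
  1/t times exp (-1/t), which tends to 0, and the left one is 0.\<close>

lemma pexp_has_derivative: "(pexp p has_real_derivative pexp (pexp_deriv p) t) (at t)"
proof -
  consider "t > 0" | "t < 0" | "t = 0" by linarith
  then show ?thesis
  proof cases
    case 1
    have "((\<lambda>t. poly p (1 / t) * exp (- (1 / t))) has_real_derivative
        poly (pderiv p) (1 / t) * (- 1 / t\<^sup>2) * exp (- (1 / t)) + exp (- (1 / t)) * (1 / t\<^sup>2) * poly p (1 / t)) (at t)"
    proof -
      have i: "((\<lambda>t. 1 / t) has_real_derivative (- 1 / t\<^sup>2)) (at t)"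
        using 1 by (auto intro!: derivative_eq_intros simp: power2_eq_square)
      have a: "((\<lambda>t. poly p (1 / t)) has_real_derivative poly (pderiv p) (1 / t) * (- 1 / t\<^sup>2)) (at t)"
        by (rule DERIV_chain2[OF poly_DERIV i])
      have b: "((\<lambda>t. exp (- (1 / t))) has_real_derivative exp (- (1 / t)) * (1 / t\<^sup>2)) (at t)"
        using DERIV_fun_exp[OF DERIV_minus[OF i]] by simp
      show ?thesis using DERIV_mult[OF a b] by simp
    qed
    also have "poly (pderiv p) (1 / t) * (- 1 / t\<^sup>2) * exp (- (1 / t)) + exp (- (1 / t)) * (1 / t\<^sup>2) * poly p (1 / t) = pexp (pexp_deriv p) t"
      using 1 by (simp add: pexp_def pexp_deriv_def algebra_simps power2_eq_square)
    finally have "((\<lambda>t. poly p (1 / t) * exp (- (1 / t))) has_real_derivative pexp (pexp_deriv p) t) (at t)" .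
    then show ?thesis
      by (rule has_field_derivative_transform_within_open[of _ _ _ "{0<..}"]) (use 1 in \<open>auto simp: pexp_def\<close>)
  next
    case 2
    have "((\<lambda>t. 0) has_real_derivative pexp (pexp_deriv p) t) (at t)"
      using 2 by (simp add: pexp_def)
    then show ?thesis
      by (rule has_field_derivative_transform_within_open[of _ _ _ "{..<0}"]) (use 2 in \<open>auto simp: pexp_def\<close>)
  next
    case 3
    have l: "((\<lambda>y. pexp p y / y) \<longlongrightarrow> 0) (at_left 0)"
    proof (rule Lim_transform_eventually[OF tendsto_const])
      show "\<forall>\<^sub>F x in at_left 0. 0 = pexp p x / x"
        by (auto simp: eventually_at_filter pexp_def)
    qed
    have r: "((\<lambda>y. pexp p y / y) \<longlongrightarrow> 0) (at_right 0)"
    proof (rule Lim_transform_eventually)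
      show "((\<lambda>y. poly ([:0, 1:] * p) (inverse y) * exp (- inverse y)) \<longlongrightarrow> 0) (at_right 0)"
        by (rule filterlim_compose[OF poly_times_exp_minus_tendsto_0 filterlim_inverse_at_top_right])
      show "\<forall>\<^sub>F x in at_right 0. poly ([:0, 1:] * p) (inverse x) * exp (- inverse x) = pexp p x / x"
        by (auto simp: eventually_at_filter pexp_def field_simps)
    qed
    have "((\<lambda>y. pexp p y / y) \<longlongrightarrow> 0) (at 0)" by (rule filterlim_split_at[OF l r])
    then show ?thesis using 3 by (simp add: has_field_derivative_iff pexp_def)
  qed
qed

text \<open>The product rule on each pair; the minus sign is the inner derivative of
  \<open>1 - t\<close>.\<close>

fun pair_deriv :: "(real poly \<times> real poly) list \<Rightarrow> (real poly \<times> real poly) list" where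
  "pair_deriv [] = []"
| "pair_deriv ((p, q) # L) = (pexp_deriv p, q) # (p, - pexp_deriv q) # pair_deriv L"

definition pair_fun :: "(real poly \<times> real poly) list \<Rightarrow> real \<Rightarrow> real" where
  "pair_fun L t = (\<Sum>(p, q)\<leftarrow>L. pexp p (1 + t) * pexp q (1 - t))"

lemma pair_fun_has_derivative: "(pair_fun L has_real_derivative pair_fun (pair_deriv L) t) (at t)"
proof (induction L rule: pair_deriv.induct)
  case 1
  show ?case by (simp add: pair_fun_def)
next
  case (2 p q L)
  have a: "((\<lambda>t. pexp p (1 + t)) has_real_derivative pexp (pexp_deriv p) (1 + t)) (at t)"
  proof -
    have "((\<lambda>t. 1 + t) has_real_derivative 1) (at t)" by (auto intro!: derivative_eq_intros)
    from DERIV_chain2[OF pexp_has_derivative this] show ?thesis by simp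
  qed
  have b: "((\<lambda>t. pexp q (1 - t)) has_real_derivative - pexp (pexp_deriv q) (1 - t)) (at t)"
  proof -
    have "((\<lambda>t. 1 - t) has_real_derivative -1) (at t)" by (auto intro!: derivative_eq_intros)
    from DERIV_chain2[OF pexp_has_derivative this] show ?thesis by simp
  qed
  have c: "pexp (- r) s = - pexp r s" for r s by (simp add: pexp_def)
  have "((\<lambda>t. pexp p (1 + t) * pexp q (1 - t) + pair_fun L t) has_real_derivative
     (pexp (pexp_deriv p) (1 + t) * pexp q (1 - t) + - pexp (pexp_deriv q) (1 - t) * pexp p (1 + t)) + pair_fun (pair_deriv L) t) (at t)"
    by (intro DERIV_add DERIV_mult a b 2)
  then show ?case by (simp add: pair_fun_def c algebra_simps)
qed

definition bump_mass :: real where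
  "bump_mass = (\<integral>t. pair_fun [(1, 1)] t \<partial>lborel)"

definition bump :: "nat \<Rightarrow> real \<Rightarrow> real" where
  "bump n t = pair_fun ((pair_deriv ^^ n) [(1, 1)]) t / bump_mass"

lemma bump_has_derivative: "(bump n has_real_derivative bump (Suc n) t) (at t)"
  unfolding bump_def[abs_def] by (intro DERIV_cdivide) (simp add: pair_fun_has_derivative)

lemma bump_cont: "continuous_on S (bump n)"
  by (rule DERIV_continuous_on[of _ _ "bump (Suc n)"]) (rule DERIV_subset[OF bump_has_derivative], simp)

lemma bump_measurable [measurable]: "bump n \<in> borel_measurable borel"
  by (rule borel_measurable_continuous_onI[OF bump_cont])

lemma pair_fun_support: "\<bar>t\<bar> \<ge> 1 \<Longrightarrow> pair_fun L t = 0"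
  by (induction L) (auto simp: pair_fun_def pexp_def)

lemma bump_support: "\<bar>t\<bar> \<ge> 1 \<Longrightarrow> bump n t = 0"
  by (simp add: bump_def pair_fun_support)

lemma pair_fun_11_nonneg: "0 \<le> pair_fun [(1, 1)] t"
  by (simp add: pair_fun_def pexp_def)

lemma pair_fun_cont: "continuous_on S (pair_fun L)"
  by (rule DERIV_continuous_on[of _ _ "pair_fun (pair_deriv L)"]) (rule DERIV_subset[OF pair_fun_has_derivative], simp)

lemma continuous_unit_support_integrable:
  fixes f :: "real \<Rightarrow> real"
  assumes "continuous_on UNIV f" "\<And>t. \<bar>t\<bar> \<ge> 1 \<Longrightarrow> f t = 0" shows "integrable lborel f"
proof -
  have "set_integrable lborel {-1..1} f"
    by (rule borel_integrable_atLeastAtMost') (rule continuous_on_subset[OF assms(1)], simp)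
  moreover have "(\<lambda>x. indicator {-1..1} x *\<^sub>R f x) = f"
  proof
    fix x show "indicator {-1..1} x *\<^sub>R f x = f x"
      using assms(2)[of x] by (cases "x \<in> {-1..1}") auto
  qed
  ultimately show ?thesis by (simp add: set_integrable_def)
qed

lemma bump_mass_pos: "bump_mass > 0"
proof -
  \<comment> \<open>On \<open>{-1/2..1/2}\<close>, an interval of length 1, both exponents are at
    least -2, so the bump is at least exp (-4) there.\<close>
  have "exp (-4 :: real) = (\<integral>t. exp (-4) * indicator {-1/2..1/2} t \<partial>(lborel :: real measure))" by simp
  also have "\<dots> \<le> bump_mass" unfolding bump_mass_def
  proof (rule integral_mono)
    show "integrable lborel (pair_fun [(1, 1)])"
      by (rule continuous_unit_support_integrable[OF pair_fun_cont pair_fun_support])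
    fix t :: real
    show "exp (-4) * indicator {-1/2..1/2} t \<le> pair_fun [(1, 1)] t"
    proof (cases "t \<in> {-1/2..1/2}")
      case True
      then have "1 / (1 + t) \<le> 2" "1 / (1 - t) \<le> 2" by (auto simp: field_simps)
      then have "exp (- 2) * exp (- 2) \<le> exp (- (1 / (1 + t))) * exp (- (1 / (1 - t)))"
        by (intro mult_mono) auto
      then show ?thesis using True by (simp add: pair_fun_def pexp_def exp_add[symmetric])
    qed (simp add: pair_fun_11_nonneg)
  qed (auto intro!: integrable_mult_right simp: integrable_indicator_iff)
  finally show ?thesis using exp_gt_zero[of "-4::real"] by linarith
qed

lemma bump_0_nonneg: "0 \<le> bump 0 t"
  using bump_mass_pos pair_fun_11_nonneg[of t] by (simp add: bump_def)

lemma bump_integrable: "integrable lborel (bump n)"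
  by (rule continuous_unit_support_integrable[OF bump_cont bump_support])

lemma bump_0_integral: "(\<integral>t. bump 0 t \<partial>lborel) = 1"
  using bump_mass_pos by (simp add: bump_def bump_mass_def[symmetric])

lemma bump_bounded: "\<exists>C\<ge>0. \<forall>t. \<bar>bump n t\<bar> \<le> C"
proof -
  have "compact (bump n ` {-1..1})" by (rule compact_continuous_image[OF bump_cont]) simp
  then obtain C where C: "\<forall>y\<in>bump n ` {-1..1}. norm y \<le> C" using compact_imp_bounded bounded_iff by metis
  have "\<bar>bump n t\<bar> \<le> max C 0" for t
    using C bump_support[of t n] by (cases "t \<in> {-1..1}") (auto simp: max.coboundedI1)
  then show ?thesis by (metis max.cobounded2)
qed

subsection \<open>Mollification\<close>

text \<open>The multi-index \<open>m\<close> records how often the kernel has been differentiated in each variable.\<close>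

definition kern1 :: "real \<Rightarrow> nat \<Rightarrow> real \<Rightarrow> real" where
  "kern1 \<epsilon> n t = (1 / \<epsilon>) ^ Suc n * bump n (t / \<epsilon>)"

definition kern :: "nat \<Rightarrow> real \<Rightarrow> (nat \<Rightarrow> nat) \<Rightarrow> point \<Rightarrow> point \<Rightarrow> real" where
  "kern d \<epsilon> m x y = (\<Prod>i<d. kern1 \<epsilon> (m i) (x i - y i))"

text \<open>All derivatives fall on the kernel: for integrable f this is the derivative of order m
  of the mollification of f at scale \<epsilon>.\<close>

definition moll :: "nat \<Rightarrow> real \<Rightarrow> (nat \<Rightarrow> nat) \<Rightarrow> (point \<Rightarrow> real) \<Rightarrow> point \<Rightarrow> real" where
  "moll d \<epsilon> m f x = (\<integral>y. f y * kern d \<epsilon> m x y \<partial>leb d)"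

abbreviation inc :: "nat \<Rightarrow> (nat \<Rightarrow> nat) \<Rightarrow> nat \<Rightarrow> nat" where
  "inc j m \<equiv> m(j := Suc (m j))"

lemma kern1_has_derivative: "(kern1 \<epsilon> n has_real_derivative kern1 \<epsilon> (Suc n) t) (at t)"
proof -
  have "((\<lambda>t. t / \<epsilon>) has_real_derivative 1 / \<epsilon>) (at t)" by (rule DERIV_cdivide) simp
  from DERIV_cmult[OF DERIV_chain2[OF bump_has_derivative this], of "(1 / \<epsilon>) ^ Suc n" n]
  show ?thesis by (simp add: kern1_def[abs_def] mult_ac)
qed

lemma kern1_cont: "continuous_on S (kern1 \<epsilon> n)"
  by (rule DERIV_continuous_on[of _ _ "kern1 \<epsilon> (Suc n)"]) (rule DERIV_subset[OF kern1_has_derivative], simp)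

lemma kern1_support: "\<epsilon> > 0 \<Longrightarrow> \<bar>t\<bar> \<ge> \<epsilon> \<Longrightarrow> kern1 \<epsilon> n t = 0"
  by (simp add: kern1_def bump_support)

lemma kern1_nonneg: "\<epsilon> > 0 \<Longrightarrow> 0 \<le> kern1 \<epsilon> 0 t"
  by (simp add: kern1_def bump_0_nonneg)

lemma kern1_bounded: "\<exists>C\<ge>0. \<forall>t. \<bar>kern1 \<epsilon> n t\<bar> \<le> C"
proof -
  obtain C where C: "C \<ge> 0" "\<forall>t. \<bar>bump n t\<bar> \<le> C" using bump_bounded by blast
  have "\<bar>kern1 \<epsilon> n t\<bar> \<le> \<bar>1 / \<epsilon>\<bar> ^ Suc n * C" for t
    unfolding kern1_def abs_mult power_abs using C by (intro mult_left_mono) auto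
  then show ?thesis using C by (intro exI[of _ "\<bar>1 / \<epsilon>\<bar> ^ Suc n * C"]) auto
qed

lemma kern1_shift_integral:
  assumes "\<epsilon> > 0"
  shows "integrable lborel (\<lambda>s. kern1 \<epsilon> 0 (t - s))" "(\<integral>s. kern1 \<epsilon> 0 (t - s) \<partial>lborel) = 1"
    "integrable lborel (\<lambda>s. kern1 \<epsilon> 0 (s - t))" "(\<integral>s. kern1 \<epsilon> 0 (s - t) \<partial>lborel) = 1"
proof -
  have b: "integrable lborel (\<lambda>s. bump 0 (t / \<epsilon> + (-1 / \<epsilon>) * s))" "integrable lborel (\<lambda>s. bump 0 (- t / \<epsilon> + (1 / \<epsilon>) * s))"
    using lborel_integrable_real_affine[OF bump_integrable[of 0], of "-1/\<epsilon>" "t/\<epsilon>"]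
      lborel_integrable_real_affine[OF bump_integrable[of 0], of "1/\<epsilon>" "-t/\<epsilon>"] assms by auto
  have i: "(\<integral>s. bump 0 (t / \<epsilon> + (-1 / \<epsilon>) * s) \<partial>lborel) = \<epsilon>" "(\<integral>s. bump 0 (- t / \<epsilon> + (1 / \<epsilon>) * s) \<partial>lborel) = \<epsilon>"
    using lborel_integral_real_affine[of "-1/\<epsilon>" "bump 0" "t/\<epsilon>"]
      lborel_integral_real_affine[of "1/\<epsilon>" "bump 0" "-t/\<epsilon>"] assms by (auto simp: bump_0_integral field_simps)
  have e: "kern1 \<epsilon> 0 (t - s) = (1/\<epsilon>) * bump 0 (t / \<epsilon> + (-1 / \<epsilon>) * s)"
    "kern1 \<epsilon> 0 (s - t) = (1/\<epsilon>) * bump 0 (- t / \<epsilon> + (1 / \<epsilon>) * s)" for s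
    using assms by (auto simp: kern1_def diff_divide_distrib)
  show "integrable lborel (\<lambda>s. kern1 \<epsilon> 0 (t - s))" unfolding e by (rule integrable_mult_right[OF b(1)])
  show "integrable lborel (\<lambda>s. kern1 \<epsilon> 0 (s - t))" unfolding e by (rule integrable_mult_right[OF b(2)])
  show "(\<integral>s. kern1 \<epsilon> 0 (t - s) \<partial>lborel) = 1"
    unfolding e integral_mult_right_zero i using assms by simp
  show "(\<integral>s. kern1 \<epsilon> 0 (s - t) \<partial>lborel) = 1"
    unfolding e integral_mult_right_zero i using assms by simp
qed

lemma kern_split:
  assumes "j < d"
  shows "kern d \<epsilon> m x y = kern1 \<epsilon> (m j) (x j - y j) * (\<Prod>i\<in>{..<d} - {j}. kern1 \<epsilon> (m i) (x i - y i))"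
  unfolding kern_def using assms by (subst prod.remove[of _ j]) auto

lemma kern_has_derivative_left:
  assumes "j < d"
  shows "((\<lambda>t. kern d \<epsilon> m (x(j := t)) y) has_real_derivative kern d \<epsilon> (inc j m) (x(j := s)) y) (at s)"
proof -
  define P where "P = (\<Prod>i\<in>{..<d} - {j}. kern1 \<epsilon> (m i) (x i - y i))"
  have a: "kern d \<epsilon> m (x(j := t)) y = kern1 \<epsilon> (m j) (t - y j) * P" for t
    unfolding kern_split[OF assms] P_def by (intro arg_cong2[where f = "(*)"] prod.cong) auto
  have b: "kern d \<epsilon> (inc j m) (x(j := s)) y = kern1 \<epsilon> (Suc (m j)) (s - y j) * P"
    unfolding kern_split[OF assms] P_def by (intro arg_cong2[where f = "(*)"] prod.cong) auto
  have "((\<lambda>t. kern1 \<epsilon> (m j) (t - y j)) has_real_derivative kern1 \<epsilon> (Suc (m j)) (s - y j)) (at s)"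
  proof -
    have "((\<lambda>t. t - y j) has_real_derivative 1) (at s)" by (auto intro!: derivative_eq_intros)
    from DERIV_chain2[OF kern1_has_derivative this] show ?thesis by simp
  qed
  from DERIV_cmult_right[OF this, of P] show ?thesis unfolding a b .
qed

lemma kern_has_derivative_right:
  assumes "j < d"
  shows "((\<lambda>t. kern d \<epsilon> m x (y(j := t))) has_real_derivative - kern d \<epsilon> (inc j m) x (y(j := s))) (at s)"
proof -
  define P where "P = (\<Prod>i\<in>{..<d} - {j}. kern1 \<epsilon> (m i) (x i - y i))"
  have a: "kern d \<epsilon> m x (y(j := t)) = kern1 \<epsilon> (m j) (x j - t) * P" for t
    unfolding kern_split[OF assms] P_def by (intro arg_cong2[where f = "(*)"] prod.cong) auto
  have b: "kern d \<epsilon> (inc j m) x (y(j := s)) = kern1 \<epsilon> (Suc (m j)) (x j - s) * P"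
    unfolding kern_split[OF assms] P_def by (intro arg_cong2[where f = "(*)"] prod.cong) auto
  have "((\<lambda>t. kern1 \<epsilon> (m j) (x j - t)) has_real_derivative - kern1 \<epsilon> (Suc (m j)) (x j - s)) (at s)"
  proof -
    have "((\<lambda>t. x j - t) has_real_derivative -1) (at s)" by (auto intro!: derivative_eq_intros)
    from DERIV_chain2[OF kern1_has_derivative this] show ?thesis by simp
  qed
  from DERIV_cmult_right[OF this, of P] show ?thesis unfolding a b by simp
qed

lemma kern_support:
  assumes "\<epsilon> > 0" "i < d" "\<bar>x i - y i\<bar> \<ge> \<epsilon>" shows "kern d \<epsilon> m x y = 0"
  unfolding kern_split[OF assms(2)] by (simp add: kern1_support assms)

lemma kern_bounded: "\<exists>C\<ge>0. \<forall>x y. \<bar>kern d \<epsilon> m x y\<bar> \<le> C"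
proof -
  obtain c where c: "\<And>n. c n \<ge> 0" "\<And>n t. \<bar>kern1 \<epsilon> n t\<bar> \<le> c n" using kern1_bounded by metis
  have "\<bar>kern d \<epsilon> m x y\<bar> \<le> (\<Prod>i<d. c (m i))" for x y
    unfolding kern_def abs_prod by (intro prod_mono) (auto simp: c)
  then show ?thesis using c by (intro exI[of _ "\<Prod>i<d. c (m i)"]) (auto intro: prod_nonneg)
qed

lemma kern_nonneg: "\<epsilon> > 0 \<Longrightarrow> 0 \<le> kern d \<epsilon> (\<lambda>_. 0) x y"
  unfolding kern_def by (intro prod_nonneg) (auto intro: kern1_nonneg)

lemma kern_cont_left: "continuous_on S (\<lambda>x. kern d \<epsilon> m x y)"
  unfolding kern_def
  by (intro continuous_on_prod continuous_on_compose2[OF kern1_cont[of UNIV]] continuous_intros) auto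

lemma kern_cont_right: "continuous_on S (\<lambda>y. kern d \<epsilon> m x y)"
  unfolding kern_def
  by (intro continuous_on_prod continuous_on_compose2[OF kern1_cont[of UNIV]] continuous_intros) auto

lemma kern_measurable_right [measurable]: "(\<lambda>y. kern d \<epsilon> m x y) \<in> borel_measurable (leb d)"
  by (rule cont_meas[OF kern_cont_right])

lemma kern1_measurable [measurable]: "kern1 \<epsilon> n \<in> borel_measurable borel"
  by (rule borel_measurable_continuous_onI[OF kern1_cont])

lemma kern_measurable_pair [measurable]:
  "(\<lambda>(x, y). kern d \<epsilon> m x y) \<in> borel_measurable (leb d \<Otimes>\<^sub>M leb d)"
  unfolding kern_def leb_def split_beta by measurable

lemma kern_Ck_right: "Ck d k (\<lambda>y. kern d \<epsilon> m x y)"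
proof (induction k arbitrary: m)
  case (Suc k)
  show ?case
  proof (rule Ck_SucI[where g = "\<lambda>j y. - kern d \<epsilon> (inc j m) x y"])
    show "((\<lambda>t. kern d \<epsilon> m x (y(j := t))) has_real_derivative - kern d \<epsilon> (inc j m) x y) (at (y j))"
      if "j < d" for j y
      using kern_has_derivative_right[OF that, of \<epsilon> m x y "y j"] by (simp only: fun_upd_triv)
  qed (auto intro: kern_cont_right Ck_uminus Suc)
qed (simp add: kern_cont_right)

lemma pd_kern_right: "j < d \<Longrightarrow> pd j (\<lambda>y. kern d \<epsilon> m x y) y = - kern d \<epsilon> (inc j m) x y"
  using kern_has_derivative_right[of j d \<epsilon> m x y "y j"] by (intro pdI) (simp only: fun_upd_triv)

lemma kern_test_fun:
  assumes "\<epsilon> > 0" "x \<in> Rn d" shows "test_fun d (\<lambda>y. kern d \<epsilon> m x y)"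
proof -
  obtain N where N: "\<And>n. n \<ge> N \<Longrightarrow> x \<in> bx d (real n)" using bx_exhaust[OF assms(2)] by metis
  have "kern d \<epsilon> m x y = 0" if y: "y \<in> Rn d" "y \<notin> bx d (real N + \<epsilon>)" for y
  proof -
    obtain i where i: "i < d" "\<bar>y i\<bar> > real N + \<epsilon>" using y by (auto simp: bx_def not_le)
    have "\<bar>x i\<bar> \<le> real N" using N[of N] i by (auto simp: bx_def)
    then show ?thesis using i assms by (intro kern_support[of \<epsilon> i]) auto
  qed
  then show ?thesis by (auto simp: test_fun_iff kern_Ck_right csup_def)
qed

text \<open>Mass one in y makes the mollification an average; mass one in x is what makes it a
  contraction of L2.\<close>

lemma kern_integral:
  assumes "\<epsilon> > 0"
  shows "(\<integral>y. kern d \<epsilon> (\<lambda>_. 0) x y \<partial>leb d) = 1" "(\<integral>x. kern d \<epsilon> (\<lambda>_. 0) x y \<partial>leb d) = 1"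
    "integrable (leb d) (\<lambda>y. kern d \<epsilon> (\<lambda>_. 0) x y)" "integrable (leb d) (\<lambda>x. kern d \<epsilon> (\<lambda>_. 0) x y)"
proof -
  show "(\<integral>y. kern d \<epsilon> (\<lambda>_. 0) x y \<partial>leb d) = 1"
    unfolding kern_def leb_def
    using lebp.product_integral_prod[of "{..<d}" "\<lambda>i s. kern1 \<epsilon> 0 (x i - s)"] kern1_shift_integral[OF assms] by simp
  show "(\<integral>x. kern d \<epsilon> (\<lambda>_. 0) x y \<partial>leb d) = 1"
    unfolding kern_def leb_def
    using lebp.product_integral_prod[of "{..<d}" "\<lambda>i s. kern1 \<epsilon> 0 (s - y i)"] kern1_shift_integral[OF assms] by simp
  show "integrable (leb d) (\<lambda>y. kern d \<epsilon> (\<lambda>_. 0) x y)"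
    unfolding kern_def leb_def
    using lebp.product_integrable_prod[of "{..<d}" "\<lambda>i s. kern1 \<epsilon> 0 (x i - s)"] kern1_shift_integral[OF assms] by simp
  show "integrable (leb d) (\<lambda>x. kern d \<epsilon> (\<lambda>_. 0) x y)"
    unfolding kern_def leb_def
    using lebp.product_integrable_prod[of "{..<d}" "\<lambda>i s. kern1 \<epsilon> 0 (s - y i)"] kern1_shift_integral[OF assms] by simp
qed

text \<open>By the mean value theorem difference quotients are values of the derivative, hence
  dominated by w. A bound for all t at once is available for the kernels, whose derivatives are
  bounded everywhere.\<close>

lemma has_derivative_integral_dominated:
  fixes g :: "real \<Rightarrow> 'a \<Rightarrow> real"
  assumes int: "\<And>t. integrable M (g t)"
    and der: "\<And>t y. y \<in> space M \<Longrightarrow> ((\<lambda>t. g t y) has_real_derivative g' t y) (at t)"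
    and bd: "\<And>t y. y \<in> space M \<Longrightarrow> \<bar>g' t y\<bar> \<le> w y" and w: "integrable M w"
    and m: "g' s \<in> borel_measurable M"
  shows "((\<lambda>t. \<integral>y. g t y \<partial>M) has_real_derivative (\<integral>y. g' s y \<partial>M)) (at s)"
  unfolding has_field_derivative_iff tendsto_at_iff_sequentially comp_def
proof (intro allI impI)
  fix T :: "nat \<Rightarrow> real" assume T: "\<forall>i. T i \<in> UNIV - {s}" "T \<longlonglongrightarrow> s"
  have e: "((\<integral>y. g (T i) y \<partial>M) - (\<integral>y. g s y \<partial>M)) / (T i - s) = (\<integral>y. (g (T i) y - g s y) / (T i - s) \<partial>M)" for i
    using int by simp
  show "(\<lambda>i. ((\<integral>y. g (T i) y \<partial>M) - (\<integral>y. g s y \<partial>M)) / (T i - s)) \<longlonglongrightarrow> (\<integral>y. g' s y \<partial>M)"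
    unfolding e
  proof (rule integral_dominated_convergence[where w = w])
    show "AE y in M. (\<lambda>i. (g (T i) y - g s y) / (T i - s)) \<longlonglongrightarrow> g' s y"
    proof (rule AE_I2)
      fix y assume "y \<in> space M"
      from der[OF this, of s] show "(\<lambda>i. (g (T i) y - g s y) / (T i - s)) \<longlonglongrightarrow> g' s y"
        unfolding has_field_derivative_iff tendsto_at_iff_sequentially comp_def using T by blast
    qed
    show "AE y in M. norm ((g (T i) y - g s y) / (T i - s)) \<le> w y" for i
    proof (rule AE_I2)
      fix y assume y: "y \<in> space M"
      have mvt: "\<exists>z. g b y - g a y = (b - a) * g' z y" if "a < b" for a b
        using MVT2[OF that, of "\<lambda>t. g t y" "\<lambda>t. g' t y"] der[OF y] by blast
      have "\<exists>z. g (T i) y - g s y = (T i - s) * g' z y"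
      proof (cases "s < T i")
        case True then show ?thesis by (rule mvt)
      next
        case False
        then have "T i < s" using T(1) by (metis DiffE UNIV_I insertI1 linorder_neqE_linordered_idom)
        from mvt[OF this] obtain z where "g s y - g (T i) y = (s - T i) * g' z y" by blast
        then have "g (T i) y - g s y = (T i - s) * g' z y" by (simp add: algebra_simps)
        then show ?thesis by blast
      qed
      then obtain z where "g (T i) y - g s y = (T i - s) * g' z y" by blast
      moreover have "T i - s \<noteq> 0" using T(1) by simp
      ultimately show "norm ((g (T i) y - g s y) / (T i - s)) \<le> w y" using bd[OF y, of z] by simp
    qed
    show "(\<lambda>y. (g (T i) y - g s y) / (T i - s)) \<in> borel_measurable M" for i
      using borel_measurable_integrable[OF int] by measurable
  qed (use m w in auto)
qed

lemma abs_mult_le: "\<bar>k\<bar> \<le> C \<Longrightarrow> \<bar>a * k\<bar> \<le> C * \<bar>a\<bar>" for a k C :: real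
  using mult_right_mono[of "\<bar>k\<bar>" C "\<bar>a\<bar>"] by (simp add: abs_mult mult.commute)

context
  fixes d and f :: "point \<Rightarrow> real" and \<epsilon> :: real
  assumes f: "integrable (leb d) f"
begin

lemma moll_integrable: "integrable (leb d) (\<lambda>y. f y * kern d \<epsilon> m x y)"
proof -
  obtain C where C: "C \<ge> 0" "\<And>x y. \<bar>kern d \<epsilon> m x y\<bar> \<le> C" using kern_bounded by blast
  show ?thesis
  proof (rule Bochner_Integration.integrable_bound)
    show "integrable (leb d) (\<lambda>y. C * f y)" using f by simp
    show "AE y in leb d. norm (f y * kern d \<epsilon> m x y) \<le> norm (C * f y)"
      using abs_mult_le[OF C(2)] C(1) by (intro AE_I2) (simp add: abs_mult)
  qed (use borel_measurable_integrable[OF f] in measurable)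
qed

lemma moll_cont: "continuous_on (Rn d) (moll d \<epsilon> m f)"
  unfolding continuous_on_sequentially comp_def
proof (intro allI ballI impI, elim conjE)
  fix X a assume a: "a \<in> Rn d" "\<forall>n. X n \<in> Rn d" "X \<longlonglongrightarrow> a"
  obtain C where C: "C \<ge> 0" "\<And>x y. \<bar>kern d \<epsilon> m x y\<bar> \<le> C" using kern_bounded by blast
  show "(\<lambda>n. moll d \<epsilon> m f (X n)) \<longlonglongrightarrow> moll d \<epsilon> m f a"
    unfolding moll_def
  proof (rule integral_dominated_convergence[where w = "\<lambda>y. C * \<bar>f y\<bar>"])
    show "AE y in leb d. (\<lambda>i. f y * kern d \<epsilon> m (X i) y) \<longlonglongrightarrow> f y * kern d \<epsilon> m a y"
      by (intro AE_I2 tendsto_mult tendsto_const continuous_on_tendsto_compose[OF kern_cont_left[of UNIV] a(3)]) auto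
    show "AE y in leb d. norm (f y * kern d \<epsilon> m (X i) y) \<le> C * \<bar>f y\<bar>" for i
      using C(2) by (intro AE_I2) (simp add: abs_mult_le order_trans[OF abs_mult_le abs_ge_self])
    show "integrable (leb d) (\<lambda>y. C * \<bar>f y\<bar>)" using f by simp
  qed (use borel_measurable_integrable[OF f] in measurable)
qed

lemma moll_has_derivative:
  assumes "j < d"
  shows "((\<lambda>t. moll d \<epsilon> m f (x(j := t))) has_real_derivative moll d \<epsilon> (inc j m) f x) (at (x j))"
proof -
  obtain C where C: "C \<ge> 0" "\<And>x y. \<bar>kern d \<epsilon> (inc j m) x y\<bar> \<le> C" using kern_bounded by blast
  have "((\<lambda>t. \<integral>y. f y * kern d \<epsilon> m (x(j := t)) y \<partial>leb d) has_real_derivative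
      (\<integral>y. f y * kern d \<epsilon> (inc j m) (x(j := x j)) y \<partial>leb d)) (at (x j))"
  proof (rule has_derivative_integral_dominated[where w = "\<lambda>y. C * \<bar>f y\<bar>"])
    show "((\<lambda>t. f y * kern d \<epsilon> m (x(j := t)) y) has_real_derivative f y * kern d \<epsilon> (inc j m) (x(j := t)) y) (at t)" for t y
      by (intro DERIV_cmult kern_has_derivative_left assms)
    show "\<bar>f y * kern d \<epsilon> (inc j m) (x(j := t)) y\<bar> \<le> C * \<bar>f y\<bar>" for t y
      by (rule abs_mult_le[OF C(2)])
    show "integrable (leb d) (\<lambda>y. C * \<bar>f y\<bar>)" using f by simp
  qed (use moll_integrable in \<open>auto simp: borel_measurable_integrable\<close>)
  then show ?thesis unfolding moll_def by (simp only: fun_upd_triv)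
qed

lemma moll_Ck: "Ck d k (moll d \<epsilon> m f)"
proof (induction k arbitrary: m)
  case (Suc k)
  show ?case
    by (rule Ck_SucI[where g = "\<lambda>j. moll d \<epsilon> (inc j m) f"]) (rule moll_cont moll_has_derivative Suc | assumption)+
qed (simp add: moll_cont)

lemma pd_moll: "j < d \<Longrightarrow> pd j (moll d \<epsilon> m f) x = moll d \<epsilon> (inc j m) f x"
  by (rule pdI) (rule moll_has_derivative)

end

section \<open>Supports, truncation and weak derivatives of mollifications\<close>

lemma moll_support:
  assumes "\<epsilon> > 0" "\<And>x. x \<in> Rn d \<Longrightarrow> x \<notin> bx d r \<Longrightarrow> f x = 0" "x \<in> Rn d" "x \<notin> bx d (r + \<epsilon>)"
  shows "moll d \<epsilon> m f x = 0"
proof -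
  have "moll d \<epsilon> m f x = (\<integral>y. 0 \<partial>leb d)" unfolding moll_def
  proof (rule Bochner_Integration.integral_cong[OF refl])
    fix y assume "y \<in> space (leb d)"
    then have y: "y \<in> Rn d" by simp
    show "f y * kern d \<epsilon> m x y = 0"
    proof (cases "y \<in> bx d r")
      case True
      obtain i where i: "i < d" "\<bar>x i\<bar> > r + \<epsilon>" using assms by (auto simp: bx_def not_le)
      have "\<bar>y i\<bar> \<le> r" using True i by (auto simp: bx_def)
      then have "kern d \<epsilon> m x y = 0" using i assms by (intro kern_support[of \<epsilon> i]) auto
      then show ?thesis by simp
    qed (use assms y in auto)
  qed
  then show ?thesis by simp
qed

lemma moll_test_fun:
  assumes "\<epsilon> > 0" "integrable (leb d) f" "\<And>x. x \<in> Rn d \<Longrightarrow> x \<notin> bx d r \<Longrightarrow> f x = 0"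
  shows "test_fun d (moll d \<epsilon> m f)"
  unfolding test_fun_iff csup_def
  using moll_Ck[OF assms(2)] moll_support[where f = f and r = r, OF assms(1) assms(3)] by blast

text \<open>Only values of f within \<epsilon> of x enter, so on the smaller box the truncation is
  invisible. In this way functions that are merely locally integrable can be mollified.\<close>

lemma moll_trunc:
  assumes "\<epsilon> > 0" "x \<in> bx d R" "R + \<epsilon> \<le> S"
  shows "moll d \<epsilon> m (\<lambda>y. f y * indicator (bx d S) y) x = (\<integral>y. f y * kern d \<epsilon> m x y \<partial>leb d)"
  unfolding moll_def
proof (rule Bochner_Integration.integral_cong[OF refl])
  fix y assume "y \<in> space (leb d)"
  then have y: "y \<in> Rn d" by simp
  show "f y * indicator (bx d S) y * kern d \<epsilon> m x y = f y * kern d \<epsilon> m x y"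
  proof (cases "y \<in> bx d S")
    case False
    then obtain i where i: "i < d" "\<bar>y i\<bar> > S" using y by (auto simp: bx_def not_le)
    have "\<bar>x i\<bar> \<le> R" using assms i by (auto simp: bx_def)
    then have "kern d \<epsilon> m x y = 0" using i assms by (intro kern_support[of \<epsilon> i]) auto
    then show ?thesis by simp
  qed simp
qed

text \<open>The kernel is a test function of its second variable, and its derivative there is minus
  the one in the first variable. This sign cancels that of the weak derivative, so mollification
  commutes with weak differentiation away from the edge of the truncation.\<close>

lemma moll_weak_pd:
  assumes w: "weak_pd d j f g" and j: "j < d" and e: "\<epsilon> > 0" "x \<in> bx d R" "R + \<epsilon> \<le> S"
  shows "moll d \<epsilon> (inc j m) (\<lambda>y. f y * indicator (bx d S) y) x = moll d \<epsilon> m (\<lambda>y. g y * indicator (bx d S) y) x"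
proof -
  have t: "test_fun d (\<lambda>y. kern d \<epsilon> m x y)" using kern_test_fun[OF e(1) bx_Rn[OF e(2)]] .
  have "(\<integral>y. f y * pd j (\<lambda>y. kern d \<epsilon> m x y) y \<partial>leb d) = - (\<integral>y. g y * kern d \<epsilon> m x y \<partial>leb d)"
    using w t unfolding weak_pd_def by blast
  then show ?thesis unfolding moll_trunc[OF e] pd_kern_right[OF j] by simp
qed

lemma indicator_bx_integrable: "integrable (leb d) (indicator (bx d r) :: point \<Rightarrow> real)"
  by (rule integrable_bdd_bx[of _ _ r 1]) (auto simp: indicator_def)

lemma indicator_bx_sqi: "sqi (leb d) (indicator (bx d r) :: point \<Rightarrow> real)"
proof -
  have "(indicator (bx d r) y :: real)\<^sup>2 = indicator (bx d r) y" for y by (simp add: indicator_def)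
  then show ?thesis by (simp add: sqi_def indicator_bx_integrable)
qed

lemma sq_int_trunc:
  assumes "sqi (leb d) (\<lambda>y. f y * indicator (bx d S) y)"
  shows "integrable (leb d) (\<lambda>y. f y * indicator (bx d S) y)"
proof -
  have "(\<lambda>y. f y * indicator (bx d S) y * indicator (bx d S) y) = (\<lambda>y. f y * indicator (bx d S) y :: real)"
    by (auto simp: indicator_def)
  then show ?thesis using sqi_mult_integrable[OF assms indicator_bx_sqi[of d S]] by simp
qed

text \<open>Jensen's inequality for the probability density
  \<open>kern d \<epsilon> (\<lambda>_. 0) x\<close>, in the form of Cauchy-Schwarz with the kernel
  split into two square roots, followed by Tonelli's theorem.\<close>

lemma moll_L2_bound:
  assumes e: "\<epsilon> > 0" and f: "sqi (leb d) f" and fi: "integrable (leb d) f"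
  shows "sqi (leb d) (moll d \<epsilon> (\<lambda>_. 0) f)"
    "(\<integral>x. (moll d \<epsilon> (\<lambda>_. 0) f x)\<^sup>2 \<partial>leb d) \<le> (\<integral>x. (f x)\<^sup>2 \<partial>leb d)"
proof -
  interpret sf: sigma_finite_measure "leb d" by (rule sigma_finite_leb)
  interpret pair_sigma_finite "leb d" "leb d" by unfold_locales
  let ?K = "kern d \<epsilon> (\<lambda>_. 0)"
  have fm [measurable]: "f \<in> borel_measurable (leb d)" using f by (rule sqiD)
  have mm [measurable]: "moll d \<epsilon> (\<lambda>_. 0) f \<in> borel_measurable (leb d)" by (rule cont_meas[OF moll_cont[OF fi]])
  obtain C where C: "C \<ge> 0" "\<And>x y. \<bar>?K x y\<bar> \<le> C" using kern_bounded by blast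
  have i2: "integrable (leb d) (\<lambda>y. (f y)\<^sup>2 * ?K x y)" for x
    using moll_integrable[of d "\<lambda>y. (f y)\<^sup>2" \<epsilon> "\<lambda>_. 0" x] f by (simp add: sqi_def)
  have pt: "(moll d \<epsilon> (\<lambda>_. 0) f x)\<^sup>2 \<le> (\<integral>y. (f y)\<^sup>2 * ?K x y \<partial>leb d)" for x
  proof -
    have a: "sqi (leb d) (\<lambda>y. f y * sqrt (?K x y))"
      using i2[of x] by (simp add: sqi_def power_mult_distrib kern_nonneg[OF e])
    have b: "sqi (leb d) (\<lambda>y. sqrt (?K x y))"
      using kern_integral(3)[OF e] by (simp add: sqi_def kern_nonneg[OF e])
    have "(\<integral>y. f y * sqrt (?K x y) * sqrt (?K x y) \<partial>leb d)\<^sup>2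
      \<le> (\<integral>y. (f y * sqrt (?K x y))\<^sup>2 \<partial>leb d) * (\<integral>y. (sqrt (?K x y))\<^sup>2 \<partial>leb d)"
      by (rule CS_integral[OF a b])
    then show ?thesis
      by (simp add: moll_def power_mult_distrib kern_nonneg[OF e] mult.assoc kern_integral[OF e])
  qed
  have "(\<integral>\<^sup>+x. ennreal ((moll d \<epsilon> (\<lambda>_. 0) f x)\<^sup>2) \<partial>leb d) \<le> (\<integral>\<^sup>+x. \<integral>\<^sup>+y. ennreal ((f y)\<^sup>2 * ?K x y) \<partial>leb d \<partial>leb d)"
  proof (rule nn_integral_mono)
    fix x
    have "ennreal ((moll d \<epsilon> (\<lambda>_. 0) f x)\<^sup>2) \<le> ennreal (\<integral>y. (f y)\<^sup>2 * ?K x y \<partial>leb d)"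
      by (rule ennreal_leI[OF pt])
    also have "\<dots> = (\<integral>\<^sup>+y. ennreal ((f y)\<^sup>2 * ?K x y) \<partial>leb d)"
      by (rule nn_integral_eq_integral[symmetric, OF i2]) (simp add: kern_nonneg[OF e])
    finally show "ennreal ((moll d \<epsilon> (\<lambda>_. 0) f x)\<^sup>2) \<le> (\<integral>\<^sup>+y. ennreal ((f y)\<^sup>2 * ?K x y) \<partial>leb d)" .
  qed
  also have "\<dots> = (\<integral>\<^sup>+y. \<integral>\<^sup>+x. ennreal ((f y)\<^sup>2 * ?K x y) \<partial>leb d \<partial>leb d)"
    by (rule Fubini'[symmetric]) measurable
  also have "\<dots> = (\<integral>\<^sup>+y. ennreal ((f y)\<^sup>2) \<partial>leb d)"
  proof (rule nn_integral_cong)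
    fix y
    have "(\<integral>\<^sup>+x. ennreal ((f y)\<^sup>2 * ?K x y) \<partial>leb d) = ennreal (\<integral>x. (f y)\<^sup>2 * ?K x y \<partial>leb d)"
      by (rule nn_integral_eq_integral) (auto simp: kern_nonneg[OF e] kern_integral[OF e])
    then show "(\<integral>\<^sup>+x. ennreal ((f y)\<^sup>2 * ?K x y) \<partial>leb d) = ennreal ((f y)\<^sup>2)"
      by (simp add: kern_integral[OF e])
  qed
  also have "\<dots> = ennreal (\<integral>y. (f y)\<^sup>2 \<partial>leb d)"
    by (rule nn_integral_eq_integral[OF sqiD(2)[OF f]]) simp
  finally have le: "(\<integral>\<^sup>+x. ennreal ((moll d \<epsilon> (\<lambda>_. 0) f x)\<^sup>2) \<partial>leb d) \<le> ennreal (\<integral>y. (f y)\<^sup>2 \<partial>leb d)" .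
  have int: "integrable (leb d) (\<lambda>x. (moll d \<epsilon> (\<lambda>_. 0) f x)\<^sup>2)"
    by (rule integrableI_bounded) (use le in \<open>auto simp: less_top[symmetric] top_unique\<close>)
  then show "sqi (leb d) (moll d \<epsilon> (\<lambda>_. 0) f)" by (simp add: sqi_def)
  have "ennreal (\<integral>x. (moll d \<epsilon> (\<lambda>_. 0) f x)\<^sup>2 \<partial>leb d) \<le> ennreal (\<integral>y. (f y)\<^sup>2 \<partial>leb d)"
    using le by (subst nn_integral_eq_integral[symmetric, OF int]) auto
  then show "(\<integral>x. (moll d \<epsilon> (\<lambda>_. 0) f x)\<^sup>2 \<partial>leb d) \<le> (\<integral>x. (f x)\<^sup>2 \<partial>leb d)"
    by (simp add: ennreal_le_iff)
qed

subsection \<open>Density of test functions\<close>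

lemma test_funD: "test_fun d \<psi> \<Longrightarrow> Ck d k \<psi>" "test_fun d \<psi> \<Longrightarrow> csup d \<psi>"
  by (auto simp: test_fun_iff)

lemma test_fun_cont: "test_fun d f \<Longrightarrow> continuous_on (Rn d) f"
  by (auto simp: test_fun_iff intro: Ck_cont[of d 0])

lemma test_fun_mult: "test_fun d f \<Longrightarrow> test_fun d g \<Longrightarrow> test_fun d (\<lambda>x. f x * g x)"
  by (auto simp: test_fun_iff intro: Ck_mult csup_mult1)

lemma test_fun_add: "test_fun d f \<Longrightarrow> test_fun d g \<Longrightarrow> test_fun d (\<lambda>x. f x + g x)"
  by (auto simp: test_fun_iff intro: Ck_add csup_add)

lemma test_fun_cmult: "test_fun d f \<Longrightarrow> test_fun d (\<lambda>x. c * f x)"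
  by (auto simp: test_fun_iff intro: Ck_cmult csup_mult2)

lemma test_fun_zero: "test_fun d (\<lambda>x. 0)"
  by (auto simp: test_fun_iff intro: Ck_const csup_zero)

lemma test_fun_bounded: "test_fun d f \<Longrightarrow> \<exists>C\<ge>0. \<forall>x\<in>Rn d. \<bar>f x\<bar> \<le> C"
  by (rule cc_bounded[OF test_fun_cont]) (auto simp: test_fun_iff)

lemma test_fun_pd: "test_fun d f \<Longrightarrow> j < d \<Longrightarrow> test_fun d (pd j f)"
  unfolding test_fun_iff using Ck_pd' csup_pd by blast

lemma Rn_sets [measurable, simp]: "Rn d \<in> sets (leb d)"
  using sets.top[of "leb d"] by simp

text \<open>Density of the test functions is proved for any finite measure because it is needed for
  three: the weighted measure, Lebesgue measure on a box (\<open>moll_L2c\<close>), and the measure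
  with density \<open>\<bar>g\<bar>\<close> on a box (\<open>fundamental_lemma\<close>).\<close>

locale fin_meas = finite_measure \<nu> for \<nu> :: "point measure" and d :: nat +
  assumes sets_nu: "sets \<nu> = sets (leb d)"
begin

lemma space_nu: "space \<nu> = Rn d"
  using sets_eq_imp_space_eq[OF sets_nu] by simp

lemma meas_nu: "f \<in> borel_measurable \<nu> \<longleftrightarrow> f \<in> borel_measurable (leb d)"
  by (simp add: measurable_cong_sets[OF sets_nu refl])

lemma test_fun_sqi: "test_fun d f \<Longrightarrow> sqi \<nu> f"
proof -
  assume t: "test_fun d f"
  obtain C where C: "\<forall>x\<in>Rn d. \<bar>f x\<bar> \<le> C" using test_fun_bounded[OF t] by blast
  show ?thesis
    by (rule sqi_bounded[OF finite_measure_axioms, of f C])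
      (use C cont_meas[OF test_fun_cont[OF t]] in \<open>auto simp: meas_nu space_nu\<close>)
qed

definition tf_lim :: "(point \<Rightarrow> real) \<Rightarrow> bool" where
  "tf_lim f \<longleftrightarrow> (\<exists>\<eta>. (\<forall>n. test_fun d (\<eta> n)) \<and> L2c \<nu> \<eta> f)"

lemma tf_limI: "(\<And>n. test_fun d (\<eta> n)) \<Longrightarrow> L2c \<nu> \<eta> f \<Longrightarrow> tf_lim f"
  unfolding tf_lim_def by (rule exI[of _ \<eta>]) simp

lemma tf_limE:
  assumes "tf_lim f" obtains \<eta> where "\<forall>n. test_fun d (\<eta> n)" "L2c \<nu> \<eta> f"
  using assms unfolding tf_lim_def by (elim exE conjE)

lemma tf_lim_add:
  assumes "tf_lim f" "tf_lim g" shows "tf_lim (\<lambda>x. f x + g x)"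
proof -
  obtain \<eta> where f: "\<forall>n. test_fun d (\<eta> n)" "L2c \<nu> \<eta> f" using assms(1) by (rule tf_limE)
  obtain \<zeta> where g: "\<forall>n. test_fun d (\<zeta> n)" "L2c \<nu> \<zeta> g" using assms(2) by (rule tf_limE)
  show ?thesis by (rule tf_limI[OF test_fun_add[OF spec[OF f(1)] spec[OF g(1)]] L2c_add[OF f(2) g(2)]])
qed

lemma tf_lim_cmult:
  assumes "tf_lim f" shows "tf_lim (\<lambda>x. c * f x)"
proof -
  obtain \<eta> where f: "\<forall>n. test_fun d (\<eta> n)" "L2c \<nu> \<eta> f" using assms by (rule tf_limE)
  show ?thesis by (rule tf_limI[OF test_fun_cmult[OF spec[OF f(1)]] L2c_cmult[OF f(2)]])
qed

lemma tf_lim_diff: "tf_lim f \<Longrightarrow> tf_lim g \<Longrightarrow> tf_lim (\<lambda>x. f x - g x)"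
  using tf_lim_add[of f "\<lambda>x. -1 * g x"] tf_lim_cmult[of g "-1"] by simp

lemma tf_lim_zero: "tf_lim (\<lambda>x. 0)"
  by (rule tf_limI[OF test_fun_zero L2c_const[OF sqi_zero]])

lemma tf_lim_sum: "(\<And>i. i \<in> I \<Longrightarrow> tf_lim (f i)) \<Longrightarrow> tf_lim (\<lambda>x. \<Sum>i\<in>I. f i x)"
  by (induction I rule: infinite_finite_induct) (auto intro: tf_lim_zero tf_lim_add)

lemma tf_lim_cong:
  assumes "tf_lim f" "\<And>x. x \<in> Rn d \<Longrightarrow> f x = g x" shows "tf_lim g"
proof -
  obtain \<eta> where f: "\<forall>n. test_fun d (\<eta> n)" "L2c \<nu> \<eta> f" using assms(1) by (rule tf_limE)
  have "L2c \<nu> \<eta> g" by (rule L2c_cong[OF f(2)]) (simp_all add: assms(2) space_nu)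
  then show ?thesis by (rule tf_limI[OF spec[OF f(1)]])
qed

lemma tf_lim_closed:
  assumes "\<And>n. tf_lim (fs n)" "L2c \<nu> fs f" shows "tf_lim f"
proof -
  have "\<exists>\<eta>. test_fun d \<eta> \<and> (\<integral>x. (\<eta> x - fs n x)\<^sup>2 \<partial>\<nu>) < 1 / real (Suc n)" for n
  proof -
    obtain \<eta> where e: "\<forall>k. test_fun d (\<eta> k)" "L2c \<nu> \<eta> (fs n)" using assms(1)[of n] by (rule tf_limE)
    have "\<forall>\<^sub>F k in sequentially. (\<integral>x. (\<eta> k x - fs n x)\<^sup>2 \<partial>\<nu>) < 1 / real (Suc n)"
      using order_tendstoD(2)[OF L2cD(3)[OF e(2)], of "1 / real (Suc n)"] by simp
    then obtain k where "(\<integral>x. (\<eta> k x - fs n x)\<^sup>2 \<partial>\<nu>) < 1 / real (Suc n)"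
      using eventually_happens[of _ sequentially] by auto
    then show ?thesis using e(1) by blast
  qed
  then obtain \<eta> where e: "\<And>n. test_fun d (\<eta> n)" "\<And>n. (\<integral>x. (\<eta> n x - fs n x)\<^sup>2 \<partial>\<nu>) < 1 / real (Suc n)" by metis
  have "L2c \<nu> \<eta> f"
    by (rule L2c_approx[OF assms(2) test_fun_sqi[OF e(1)] less_imp_le[OF e(2)]])
  then show ?thesis by (rule tf_limI[OF e(1)])
qed

lemma tf_lim_box: "tf_lim (indicator (PiE {..<d} (\<lambda>i. {a i<..<b i})))"
proof -
  define e where "e n = 1 / real (Suc n)" for n
  have e: "e n > 0" for n by (simp add: e_def)
  have e0: "e \<longlonglongrightarrow> 0" unfolding e_def using LIMSEQ_inverse_real_of_nat by (simp add: inverse_eq_divide)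
  \<comment> \<open>The margin 2e exceeds the mollification radius e, so the mollified indicator
    still vanishes outside the open box; at a point more than 3e away from all faces the kernel sees
    only Q, and the value is 1.\<close>
  define Q where "Q n = PiE {..<d} (\<lambda>i. {a i + 2 * e n..b i - 2 * e n})" for n
  define B where "B = PiE {..<d} (\<lambda>i. {a i<..<b i})"
  define f where "f n = (indicator (Q n) :: point \<Rightarrow> real)" for n
  define \<eta> where "\<eta> n = moll d (e n) (\<lambda>_. 0) (f n)" for n
  have Qm [measurable]: "Q n \<in> sets (leb d)" for n
    unfolding Q_def leb_def by (rule sets_PiM_I_finite) auto
  define r where "r = (\<Sum>i<d. \<bar>a i\<bar> + \<bar>b i\<bar>)"
  have Qr: "Q n \<subseteq> bx d r" for n
  proof
    fix x assume x: "x \<in> Q n"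
    have "\<bar>x i\<bar> \<le> r" if "i < d" for i :: nat
    proof -
      have "a i + 2 * e n \<le> x i" "x i \<le> b i - 2 * e n" using x that by (auto simp: Q_def PiE_iff)
      then have "\<bar>x i\<bar> \<le> \<bar>a i\<bar> + \<bar>b i\<bar>" using e[of n] by linarith
      also have "\<dots> \<le> r" unfolding r_def using that by (intro member_le_sum) auto
      finally show ?thesis .
    qed
    then show "x \<in> bx d r" using x by (auto simp: bx_def Rn_def Q_def PiE_iff)
  qed
  have fi: "integrable (leb d) (f n)" for n
    unfolding f_def by (rule integrable_bdd_bx[where r = r and C = 1]) (use Qr in \<open>auto simp: indicator_def\<close>)
  have t: "test_fun d (\<eta> n)" for n
    unfolding \<eta>_def by (rule moll_test_fun[OF e fi, of r]) (use Qr in \<open>auto simp: f_def indicator_def\<close>)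
  have "L2c \<nu> \<eta> (indicator B)"
  proof (rule L2c_dominated[where w = "\<lambda>_. 1"])
    show "\<eta> n \<in> borel_measurable \<nu>" for n using test_fun_sqi[OF t] by (rule sqiD)
    have "B \<in> sets (leb d)" unfolding B_def leb_def by (rule sets_PiM_I_finite) auto
    then show "indicator B \<in> borel_measurable \<nu>" by (simp add: meas_nu)
    show "sqi \<nu> (\<lambda>_. 1)" by (simp add: sqi_def)
    fix x assume "x \<in> space \<nu>"
    then have x: "x \<in> Rn d" by (simp add: space_nu)
    show "\<bar>\<eta> n x\<bar> \<le> 1" for n
    proof -
      have "0 \<le> \<eta> n x" unfolding \<eta>_def moll_def
        by (rule integral_nonneg_AE) (simp add: f_def kern_nonneg[OF e])
      moreover have "\<eta> n x \<le> (\<integral>y. kern d (e n) (\<lambda>_. 0) x y \<partial>leb d)" unfolding \<eta>_def moll_def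
        by (rule integral_mono[OF moll_integrable[OF fi] kern_integral(3)[OF e]])
          (auto simp: f_def indicator_def kern_nonneg[OF e])
      ultimately show ?thesis by (simp add: kern_integral[OF e])
    qed
    show "(\<lambda>n. \<eta> n x) \<longlonglongrightarrow> indicator B x"
    proof (cases "x \<in> B")
      case True
      have "\<forall>\<^sub>F n in sequentially. \<forall>i\<in>{..<d}. a i + 3 * e n < x i \<and> x i < b i - 3 * e n"
      proof (rule eventually_ball_finite, simp, rule ballI)
        fix i assume i: "i \<in> {..<d}"
        have l: "(\<lambda>n. a i + 3 * e n) \<longlonglongrightarrow> a i + 3 * 0" "(\<lambda>n. b i - 3 * e n) \<longlonglongrightarrow> b i - 3 * 0" by (intro tendsto_intros e0)+
        have "a i < x i" "x i < b i" using True i by (auto simp: B_def PiE_iff)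
        then show "\<forall>\<^sub>F n in sequentially. a i + 3 * e n < x i \<and> x i < b i - 3 * e n"
          using order_tendstoD(2)[OF l(1)] order_tendstoD(1)[OF l(2)] by (auto intro: eventually_conj)
      qed
      then have "\<forall>\<^sub>F n in sequentially. \<eta> n x = 1"
      proof eventually_elim
        case (elim n)
        have "\<eta> n x = (\<integral>y. kern d (e n) (\<lambda>_. 0) x y \<partial>leb d)" unfolding \<eta>_def moll_def
        proof (rule Bochner_Integration.integral_cong[OF refl])
          fix y assume "y \<in> space (leb d)"
          then have y: "y \<in> Rn d" by simp
          show "f n y * kern d (e n) (\<lambda>_. 0) x y = kern d (e n) (\<lambda>_. 0) x y"
          proof (cases "\<forall>i<d. \<bar>x i - y i\<bar> < e n")
            case True
            have "a i + 2 * e n \<le> y i \<and> y i \<le> b i - 2 * e n" if "i < d" for i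
            proof -
              have "\<bar>x i - y i\<bar> < e n" "a i + 3 * e n < x i" "x i < b i - 3 * e n" using True elim that by auto
              then show ?thesis by linarith
            qed
            then have "y \<in> Q n" using y by (auto simp: Q_def Rn_def PiE_iff)
            then show ?thesis by (simp add: f_def)
          next
            case False
            then obtain i where "i < d" "\<bar>x i - y i\<bar> \<ge> e n" by (auto simp: not_less)
            then show ?thesis using kern_support[OF e, where i = i and d = d and x = x and y = y] by simp
          qed
        qed
        then show ?case by (simp add: kern_integral[OF e])
      qed
      then show ?thesis using True by (simp add: tendsto_eventually)
    next
      case False
      have "\<eta> n x = 0" for n
      proof -
        have "\<eta> n x = (\<integral>y. 0 \<partial>leb d)" unfolding \<eta>_def moll_def
        proof (rule Bochner_Integration.integral_cong[OF refl])
          fix y assume "y \<in> space (leb d)"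
          show "f n y * kern d (e n) (\<lambda>_. 0) x y = 0"
          proof (cases "y \<in> Q n")
            case True
            obtain i where i: "i < d" "\<not> (a i < x i \<and> x i < b i)" using False x by (auto simp: B_def Rn_def PiE_iff)
            have "a i + 2 * e n \<le> y i" "y i \<le> b i - 2 * e n" using True i by (auto simp: Q_def PiE_iff)
            then have "\<bar>x i - y i\<bar> \<ge> e n" using i(2) e[of n] by (auto simp: abs_real_def)
            then show ?thesis using kern_support[OF e i(1), where x = x and y = y] by simp
          qed (simp add: f_def)
        qed
        then show ?thesis by simp
      qed
      then show ?thesis using False by simp
    qed
  qed
  then show ?thesis unfolding B_def by (rule tf_limI[OF t])
qed

lemma tf_lim_one: "tf_lim (\<lambda>x. 1)"
proof (rule tf_lim_closed[OF tf_lim_box])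
  let ?B = "\<lambda>n. PiE {..<d} (\<lambda>i. {- real n<..<real n})"
  show "L2c \<nu> (\<lambda>n. indicator (?B n)) (\<lambda>x. 1)"
  proof (rule L2c_dominated[where w = "\<lambda>_. 1"])
    have "?B n \<in> sets (leb d)" for n unfolding leb_def by (rule sets_PiM_I_finite) auto
    then show "indicator (?B n) \<in> borel_measurable \<nu>" for n by (simp add: meas_nu)
    show "sqi \<nu> (\<lambda>_. 1)" by (simp add: sqi_def)
    fix x assume "x \<in> space \<nu>"
    then have x: "x \<in> Rn d" by (simp add: space_nu)
    obtain N where N: "\<And>n. n \<ge> N \<Longrightarrow> x \<in> bx d (real n)" using bx_exhaust[OF x] by metis
    have "indicator (?B n) x = (1::real)" if "n \<ge> Suc N" for n
    proof -
      have "- real n < x i \<and> x i < real n" if "i < d" for i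
      proof -
        have "\<bar>x i\<bar> \<le> real N" using N[of N] that by (auto simp: bx_def)
        then show ?thesis using \<open>n \<ge> Suc N\<close> by linarith
      qed
      then have "x \<in> ?B n" using x by (auto simp: Rn_def PiE_iff)
      then show ?thesis by simp
    qed
    then show "(\<lambda>n. indicator (?B n) x) \<longlonglongrightarrow> (1::real)"
      by (intro tendsto_eventually) (auto simp: eventually_sequentially)
  qed (auto simp: indicator_def)
qed

text \<open>Indicators of open boxes can be approximated by explicit mollifications, and boxes are
  stable under intersection; together this allows the pi-lambda argument of
  \<open>tf_lim_indicator\<close>.\<close>

lemma sets_leb_boxes:
  "sets (leb d) = sigma_sets (Rn d) {PiE {..<d} F |F. \<forall>i\<in>{..<d}. F i \<in> range (\<lambda>(a, b). {a<..<b::real})}"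
proof -
  let ?E = "\<lambda>_::nat. range (\<lambda>(a, b). {a<..<b::real})"
  have "sets (PiM {..<d} (\<lambda>i. sigma UNIV (?E i))) = sets (sigma (PiE {..<d} (\<lambda>_. UNIV))
      {{f \<in> PiE {..<d} (\<lambda>_. UNIV). \<forall>i\<in>j. f i \<in> A i} |A j. j \<in> {{..<d}} \<and> A \<in> Pi j ?E})"
  proof (rule sets_PiM_sigma)
    fix i
    have "(\<Union>n::nat. {- real n<..<real n}) = UNIV"
    proof -
      have "\<exists>n. - real n < x \<and> x < real n" for x
      proof -
        obtain n where "\<bar>x\<bar> < real n" using reals_Archimedean2 by blast
        then show ?thesis by (intro exI[of _ n]) auto
      qed
      then show ?thesis by auto
    qed
    then show "\<exists>S\<subseteq>?E i. countable S \<and> UNIV = \<Union> S"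
      by (intro exI[of _ "range (\<lambda>n::nat. {- real n<..<real n})"]) auto
  qed auto
  moreover have "sigma UNIV (?E i) = borel" for i
    using borel_eq_box[where 'a = real] by (simp only: box_real)
  moreover have "{{f \<in> PiE {..<d} (\<lambda>_. UNIV). \<forall>i\<in>j. f i \<in> A i} |A j. j \<in> {{..<d}} \<and> A \<in> Pi j ?E}
     = {PiE {..<d} F |F. \<forall>i\<in>{..<d}. F i \<in> range (\<lambda>(a, b). {a<..<b::real})}" (is "?L = ?R")
  proof -
    have "{f \<in> PiE {..<d} (\<lambda>_. UNIV). \<forall>i\<in>{..<d}. f i \<in> A i} = PiE {..<d} A" for A :: "nat \<Rightarrow> real set"
      by (simp add: set_eq_iff PiE_iff conj_commute)
    then show ?thesis by (simp add: Pi_iff)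
  qed
  moreover have "sets (leb d) = sets (PiM {..<d} (\<lambda>_::nat. borel :: real measure))"
    unfolding leb_def by (rule sets_PiM_cong) auto
  ultimately have "sets (leb d) = sets (sigma (Rn d) {PiE {..<d} F |F. \<forall>i\<in>{..<d}. F i \<in> range (\<lambda>(a, b). {a<..<b::real})})"
    by (simp add: Rn_def)
  also have "\<dots> = sigma_sets (Rn d) {PiE {..<d} F |F. \<forall>i\<in>{..<d}. F i \<in> range (\<lambda>(a, b). {a<..<b::real})}"
    by (rule sets_measure_of) (auto simp: Rn_def PiE_iff)
  finally show ?thesis .
qed

lemma tf_lim_indicator:
  assumes "A \<in> sets (leb d)" shows "tf_lim (indicator A)"
proof -
  let ?G = "{PiE {..<d} F |F. \<forall>i\<in>{..<d}. F i \<in> range (\<lambda>(a, b). {a<..<b::real})}"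
  have G: "\<exists>a b. A = PiE {..<d} (\<lambda>i. {a i<..<b i})" if AG: "A \<in> ?G" for A
  proof -
    obtain F where F: "A = PiE {..<d} F" "\<forall>i\<in>{..<d}. F i \<in> range (\<lambda>(a, b). {a<..<b::real})"
      using AG unfolding mem_Collect_eq by (elim exE conjE)
    have "\<exists>p. i < d \<longrightarrow> F i = {fst p<..<snd p}" for i
    proof (cases "i < d")
      case True
      then have "F i \<in> range (\<lambda>(a, b). {a<..<b::real})" using F(2) by simp
      then show ?thesis by (auto simp: image_iff)
    qed simp
    then obtain p where p: "\<And>i. i < d \<Longrightarrow> F i = {fst (p i)<..<snd (p i)}" by metis
    have "A = PiE {..<d} (\<lambda>i. {fst (p i)<..<snd (p i)})" unfolding F(1) by (intro PiE_cong) (simp add: p)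
    then show ?thesis by (intro exI[of _ "\<lambda>i. fst (p i)"] exI[of _ "\<lambda>i. snd (p i)"])
  qed
  have "Int_stable ?G"
  proof (rule Int_stableI)
    fix A B assume AB: "A \<in> ?G" "B \<in> ?G"
    obtain a b where A: "A = PiE {..<d} (\<lambda>i. {a i<..<b i})" using G[OF AB(1)] by (elim exE)
    obtain a' b' where B: "B = PiE {..<d} (\<lambda>i. {a' i<..<b' i})" using G[OF AB(2)] by (elim exE)
    have "A \<inter> B = PiE {..<d} (\<lambda>i. {max (a i) (a' i)<..<min (b i) (b' i)})"
      unfolding A B PiE_Int by (intro PiE_cong) auto
    moreover have "{max (a i) (a' i)<..<min (b i) (b' i)} \<in> range (\<lambda>(a, b). {a<..<b::real})" for i
      by (rule range_eqI[of _ _ "(max (a i) (a' i), min (b i) (b' i))"]) simp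
    ultimately show "A \<inter> B \<in> ?G"
      unfolding mem_Collect_eq by (intro exI[of _ "\<lambda>i. {max (a i) (a' i)<..<min (b i) (b' i)}"] conjI ballI)
  qed
  moreover have "?G \<subseteq> Pow (Rn d)" by (auto simp: Rn_def PiE_iff)
  ultimately show ?thesis using assms unfolding sets_leb_boxes
  proof (induction rule: sigma_sets_induct_disjoint)
    case (basic A)
    obtain a b where A: "A = PiE {..<d} (\<lambda>i. {a i<..<b i})" using G[OF basic] by (elim exE)
    show ?case unfolding A by (rule tf_lim_box)
  next
    case empty
    then show ?case using tf_lim_zero by simp
  next
    case (compl A)
    have "tf_lim (\<lambda>x. 1 - indicator A x)" by (rule tf_lim_diff[OF tf_lim_one compl(2)])
    then show ?case by (rule tf_lim_cong) (auto simp: indicator_def)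
  next
    case (union A)
    have A: "A i \<in> sets (leb d)" for i using union(2) unfolding sets_leb_boxes by auto
    show ?case
    proof (rule tf_lim_closed)
      show "L2c \<nu> (\<lambda>n. indicator (\<Union>i<n. A i)) (indicator (\<Union>i. A i))"
      proof (rule L2c_dominated[where w = "\<lambda>_. 1"])
        show "indicator (\<Union>i<n. A i) \<in> borel_measurable \<nu>" for n
          using A by (auto simp: meas_nu intro!: borel_measurable_indicator sets.finite_UN)
        show "indicator (\<Union>i. A i) \<in> borel_measurable \<nu>"
          using A by (auto simp: meas_nu intro!: borel_measurable_indicator sets.countable_UN)
        show "sqi \<nu> (\<lambda>_. 1)" by (simp add: sqi_def)
        show "(\<lambda>n. indicator (\<Union>i<n. A i) x) \<longlonglongrightarrow> (indicator (\<Union>i. A i) x :: real)" for x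
          by (rule LIMSEQ_indicator_UN)
      qed (auto simp: indicator_def)
      show "tf_lim (indicator (\<Union>i<n. A i))" for n
      proof -
        have "tf_lim (\<lambda>x. \<Sum>i<n. indicator (A i) x)" by (intro tf_lim_sum union(3))
        then show ?thesis
        proof (rule tf_lim_cong)
          show "(\<Sum>i<n. indicator (A i) x) = (indicator (\<Union>i<n. A i) x :: real)" for x
            by (rule indicator_UN_disjoint[symmetric]) (use union(1) in \<open>auto intro: disjoint_family_on_mono\<close>)
        qed
      qed
    qed
  qed
qed

text \<open>Square integrability stands as an implication inside the induction: the summands and the
  monotone approximations of a nonnegative square-integrable function inherit it by
  domination.\<close>

lemma tf_lim_nonneg:
  assumes "f \<in> borel_measurable \<nu>" "\<And>x. 0 \<le> f x" shows "sqi \<nu> f \<longrightarrow> tf_lim f"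
  using assms
proof (induction rule: borel_measurable_induct_real)
  case (set A)
  then show ?case using tf_lim_indicator sets_nu by blast
next
  case (mult u c)
  show ?case
  proof (cases "c = 0")
    case False
    show ?thesis
    proof
      assume "sqi \<nu> (\<lambda>x. c * u x)"
      from sqi_cmult[OF this, of "1 / c"] have "sqi \<nu> u" using False by simp
      then show "tf_lim (\<lambda>x. c * u x)" using mult by (intro tf_lim_cmult) auto
    qed
  qed (simp add: tf_lim_zero)
next
  case (add u v)
  show ?case
  proof
    assume s: "sqi \<nu> (\<lambda>x. v x + u x)"
    have "sqi \<nu> u" by (rule sqi_bound[OF s, of _ 1]) (use add in auto)
    moreover have "sqi \<nu> v" by (rule sqi_bound[OF s, of _ 1]) (use add in auto)
    ultimately show "tf_lim (\<lambda>x. v x + u x)" using add by (intro tf_lim_add) auto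
  qed
next
  case (seq U)
  show ?case
  proof
    assume s: "sqi \<nu> f"
    have le: "U i x \<le> f x" if "x \<in> space \<nu>" for i x
      by (rule incseq_le[OF _ seq.hyps(4)[OF that]]) (use seq.hyps(3) in \<open>auto simp: incseq_def le_fun_def\<close>)
    have sU: "sqi \<nu> (U i)" for i
    proof (rule sqi_bound[OF s seq.hyps(1)])
      show "\<bar>U i x\<bar> \<le> 1 * \<bar>f x\<bar>" if "x \<in> space \<nu>" for x
        using le[OF that, of i] seq.hyps(2)[of i x] by simp
    qed
    have l: "L2c \<nu> U f"
      by (rule L2c_dominated[OF seq.hyps(1) assms(1) s seq.hyps(4)]) (use le seq.hyps(2) in auto)
    have "tf_lim (U i)" for i using seq.IH[of i] sU[of i] by simp
    then show "tf_lim f" by (rule tf_lim_closed[OF _ l])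
  qed
qed

theorem test_fun_dense:
  assumes f: "sqi \<nu> f" shows "\<exists>\<eta>. (\<forall>n. test_fun d (\<eta> n)) \<and> L2c \<nu> \<eta> f"
proof -
  have [measurable]: "f \<in> borel_measurable \<nu>" using f by (rule sqiD)
  have "sqi \<nu> (\<lambda>x. max (f x) 0)" by (rule sqi_bound[OF f, of _ 1]) auto
  then have a: "tf_lim (\<lambda>x. max (f x) 0)" using tf_lim_nonneg[of "\<lambda>x. max (f x) 0"] by auto
  have "sqi \<nu> (\<lambda>x. max (- f x) 0)" by (rule sqi_bound[OF f, of _ 1]) auto
  then have b: "tf_lim (\<lambda>x. max (- f x) 0)" using tf_lim_nonneg[of "\<lambda>x. max (- f x) 0"] by auto
  have "tf_lim f" by (rule tf_lim_cong[OF tf_lim_diff[OF a b]]) auto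
  then show ?thesis unfolding tf_lim_def .
qed

end

subsection \<open>Cut-off functions\<close>

text \<open>Half a unit for the enlarged box and half a unit for the mollification radius: the
  result is 1 on \<open>bx d r\<close> and 0 outside \<open>bx d (r + 1)\<close>.\<close>

definition cut :: "nat \<Rightarrow> real \<Rightarrow> point \<Rightarrow> real" where
  "cut d r = moll d (1/2) (\<lambda>_. 0) (indicator (bx d (r + 1/2)))"

lemma cut_test_fun: "test_fun d (cut d r)"
  unfolding cut_def by (rule moll_test_fun[OF _ indicator_bx_integrable, of _ _ "r + 1/2"]) (auto simp: indicator_def)

lemma cut_range: "0 \<le> cut d r x" "cut d r x \<le> 1"
proof -
  have h: "(1/2::real) > 0" by simp
  show "0 \<le> cut d r x" unfolding cut_def moll_def
    by (rule integral_nonneg_AE) (simp add: kern_nonneg[OF h])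
  have "cut d r x \<le> (\<integral>y. kern d (1/2) (\<lambda>_. 0) x y \<partial>leb d)" unfolding cut_def moll_def
    by (rule integral_mono[OF moll_integrable[OF indicator_bx_integrable] kern_integral(3)[OF h]])
      (auto simp: indicator_def kern_nonneg[OF h])
  then show "cut d r x \<le> 1" by (simp only: kern_integral[OF h])
qed

lemma cut_eq_1: "x \<in> bx d r \<Longrightarrow> cut d r x = 1"
  using moll_trunc[of "1/2" x d r "r + 1/2" "\<lambda>_. 0" "\<lambda>_. 1"] kern_integral(1)[of "1/2" d x]
  by (simp add: cut_def)

lemma cut_eq_0: "x \<in> Rn d \<Longrightarrow> x \<notin> bx d (r + 1) \<Longrightarrow> cut d r x = 0"
  unfolding cut_def by (rule moll_support[of _ _ "r + 1/2"]) (auto simp: indicator_def add.assoc)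

text \<open>Independence of r is the point, since the cut-offs are sent to infinity. The derivative
  is at most the L1 norm of the differentiated kernel, a product of one-dimensional integrals in
  which neither r nor x occurs.\<close>

lemma cut_pd_bounded: "\<exists>C\<ge>0. \<forall>r x. \<forall>j<d. \<bar>pd j (cut d r) x\<bar> \<le> C"
proof -
  define L where "L j = (\<Prod>i<d. \<integral>s. \<bar>kern1 (1/2) (inc j (\<lambda>_. 0) i) s\<bar> \<partial>lborel)" for j
  have L0: "0 \<le> L j" for j unfolding L_def by (intro prod_nonneg ballI integral_nonneg_AE) auto
  have i1: "integrable lborel (\<lambda>s. \<bar>kern1 (1/2) n s\<bar>)" for n
  proof (rule continuous_unit_support_integrable)
    show "continuous_on UNIV (\<lambda>s. \<bar>kern1 (1/2) n s\<bar>)" by (intro continuous_intros kern1_cont)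
    show "\<bar>kern1 (1/2) n t\<bar> = 0" if "\<bar>t\<bar> \<ge> 1" for t
      using kern1_support[of "1/2" t n] that by simp
  qed
  have i2: "integrable lborel (\<lambda>s. \<bar>kern1 (1/2) n (t - s)\<bar>)" "(\<integral>s. \<bar>kern1 (1/2) n (t - s)\<bar> \<partial>lborel) = (\<integral>s. \<bar>kern1 (1/2) n s\<bar> \<partial>lborel)" for n t
    using lborel_integrable_real_affine[OF i1[of n], of "-1" t] lborel_integral_real_affine[of "-1" "\<lambda>s. \<bar>kern1 (1/2) n s\<bar>" t] by auto
  have b: "\<bar>pd j (cut d r) x\<bar> \<le> L j" if "j < d" for j r x
  proof -
    define m where "m = inc j (\<lambda>_. 0)"
    have ki: "integrable (leb d) (\<lambda>y. \<bar>kern d (1/2) m x y\<bar>)" "(\<integral>y. \<bar>kern d (1/2) m x y\<bar> \<partial>leb d) = L j"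
      unfolding kern_def leb_def abs_prod L_def m_def[symmetric]
      using lebp.product_integrable_prod[of "{..<d}" "\<lambda>i s. \<bar>kern1 (1/2) (m i) (x i - s)\<bar>"]
        lebp.product_integral_prod[of "{..<d}" "\<lambda>i s. \<bar>kern1 (1/2) (m i) (x i - s)\<bar>"] i2 by auto
    have "\<bar>pd j (cut d r) x\<bar> = \<bar>\<integral>y. indicator (bx d (r + 1/2)) y * kern d (1/2) m x y \<partial>leb d\<bar>"
      unfolding cut_def pd_moll[OF indicator_bx_integrable that] moll_def m_def by simp
    also have "\<dots> \<le> (\<integral>y. \<bar>indicator (bx d (r + 1/2)) y * kern d (1/2) m x y\<bar> \<partial>leb d)"
      by (rule integral_abs_bound)
    also have "\<dots> \<le> (\<integral>y. \<bar>kern d (1/2) m x y\<bar> \<partial>leb d)"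
      by (rule integral_mono[OF integrable_abs[OF moll_integrable[OF indicator_bx_integrable]] ki(1)]) (auto simp: indicator_def)
    finally show ?thesis by (simp add: ki)
  qed
  have "\<bar>pd j (cut d r) x\<bar> \<le> (\<Sum>j<d. L j)" if "j < d" for j r x
    using b[OF that, of r x] member_le_sum[of j "{..<d}" L] L0 that by auto
  then show ?thesis using L0 by (intro exI[of _ "\<Sum>j<d. L j"]) (auto intro: sum_nonneg)
qed

lemma cut_pd_eq_0:
  assumes "x \<in> bx d r" "j < d" shows "pd j (cut d (r + 1)) x = 0"
proof (rule pdI)
  have "((\<lambda>t. 1) has_real_derivative 0) (at (x j))" by simp
  then show "((\<lambda>t. cut d (r + 1) (x(j := t))) has_real_derivative 0) (at (x j))"
  proof (rule has_field_derivative_transform_within_open[of _ _ _ "{-r-1<..<r+1}"])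
    show "x j \<in> {- r - 1<..<r + 1}" using assms by (auto simp: bx_def abs_le_iff)
    fix t assume t: "t \<in> {- r - 1<..<r + 1}"
    have "\<bar>(x(j := t)) i\<bar> \<le> r + 1" if "i < d" for i
      using t assms that by (cases "i = j") (auto simp: bx_def abs_le_iff intro: add_increasing2)
    then have "x(j := t) \<in> bx d (r + 1)" using upd_Rn[OF bx_Rn[OF assms(1)] assms(2)] by (auto simp: bx_def)
    then show "1 = cut d (r + 1) (x(j := t))" by (simp add: cut_eq_1)
  qed auto
qed

text \<open>The shift by one makes the cut-off equal to 1 around \<open>bx d (real N)\<close>, so
  that its derivatives vanish on that box (\<open>cut_pd_eq_0\<close>).\<close>

definition cuts :: "nat \<Rightarrow> nat \<Rightarrow> point \<Rightarrow> real" where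
  "cuts d N = cut d (real N + 1)"

lemma cuts_test_fun: "test_fun d (cuts d N)"
  by (simp add: cuts_def cut_test_fun)

lemma cuts_meas: "cuts d N \<in> borel_measurable (leb d)"
  by (rule cont_meas[OF test_fun_cont[OF cuts_test_fun]])

lemma pd_cuts_meas: "j < d \<Longrightarrow> pd j (cuts d N) \<in> borel_measurable (leb d)"
  by (rule cont_meas[OF test_fun_cont[OF test_fun_pd[OF cuts_test_fun]]])

lemma cuts_le_1: "\<bar>cuts d N x\<bar> \<le> 1"
  using cut_range[of d "real N + 1" x] by (simp add: cuts_def)

lemma cuts_eq_0: "x \<in> Rn d \<Longrightarrow> x \<notin> bx d (real N + 2) \<Longrightarrow> cuts d N x = 0"
  using cut_eq_0[of x d "real N + 1"] by (simp add: cuts_def add.assoc)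

lemma pd_cuts_bounded: "\<exists>C\<ge>0. \<forall>N x. \<forall>j<d. \<bar>pd j (cuts d N) x\<bar> \<le> C"
  using cut_pd_bounded[of d] by (auto simp: cuts_def)

lemma cuts_eventually:
  assumes "x \<in> Rn d"
  shows "\<forall>\<^sub>F N in sequentially. cuts d N x = 1" "j < d \<Longrightarrow> \<forall>\<^sub>F N in sequentially. pd j (cuts d N) x = 0"
proof -
  obtain N0 where N0: "\<And>n. n \<ge> N0 \<Longrightarrow> x \<in> bx d (real n)" using bx_exhaust[OF assms] by metis
  have "cuts d N x = 1 \<and> (\<forall>j<d. pd j (cuts d N) x = 0)" if "N \<ge> N0" for N
    using cut_eq_1[OF bx_mono[OF _ N0[OF that]], of "real N + 1"] cut_pd_eq_0[OF N0[OF that]] by (simp add: cuts_def)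
  then show "\<forall>\<^sub>F N in sequentially. cuts d N x = 1" "j < d \<Longrightarrow> \<forall>\<^sub>F N in sequentially. pd j (cuts d N) x = 0"
    unfolding eventually_sequentially by blast+
qed

lemma L2c_cuts:
  assumes M: "sets M = sets (leb d)" and f: "sqi M f"
  shows "L2c M (\<lambda>N x. cuts d N x * f x) f"
proof (rule L2c_dominated[where w = "\<lambda>x. \<bar>f x\<bar>"])
  have [measurable_cong]: "sets M = sets (leb d)" by (rule M)
  show "(\<lambda>x. cuts d N x * f x) \<in> borel_measurable M" for N
    using cuts_meas[of d N] sqiD(1)[OF f] by measurable
  show "(\<lambda>N. cuts d N x * f x) \<longlonglongrightarrow> f x" if "x \<in> space M" for x
    by (rule tendsto_eventually, rule eventually_mono[OF cuts_eventually(1)]) (use that sets_eq_imp_space_eq[OF M] in auto)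
  show "\<bar>cuts d N x * f x\<bar> \<le> \<bar>f x\<bar>" for N x
    using mult_right_mono[OF cuts_le_1[of d N x], of "\<bar>f x\<bar>"] by (simp add: abs_mult)
qed (use f in \<open>auto simp: sqi_def\<close>)

text \<open>The derivatives of the cut-offs are uniformly bounded and eventually 0 at each point.
  This removes the error terms of every localisation below.\<close>

lemma L2c_pd_cuts:
  assumes M: "sets M = sets (leb d)" and f: "sqi M f" and j: "j < d"
  shows "L2c M (\<lambda>N x. pd j (cuts d N) x * f x) (\<lambda>x. 0)"
proof -
  obtain C where C: "\<And>N x. \<bar>pd j (cuts d N) x\<bar> \<le> C" using pd_cuts_bounded[of d] j by blast
  show ?thesis
  proof (rule L2c_dominated[where w = "\<lambda>x. C * \<bar>f x\<bar>"])
    have [measurable_cong]: "sets M = sets (leb d)" by (rule M)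
    show "(\<lambda>x. pd j (cuts d N) x * f x) \<in> borel_measurable M" for N
      using pd_cuts_meas[OF j, of N] sqiD(1)[OF f] by measurable
    show "sqi M (\<lambda>x. C * \<bar>f x\<bar>)" by (intro sqi_cmult) (use f in \<open>auto simp: sqi_def\<close>)
    show "(\<lambda>N. pd j (cuts d N) x * f x) \<longlonglongrightarrow> 0" if "x \<in> space M" for x
      by (rule tendsto_eventually, rule eventually_mono[OF cuts_eventually(2)[OF _ j]]) (use that sets_eq_imp_space_eq[OF M] in auto)
    show "\<bar>pd j (cuts d N) x * f x\<bar> \<le> C * \<bar>f x\<bar>" for N x
      using mult_right_mono[OF C[of N x], of "\<bar>f x\<bar>"] by (simp add: abs_mult)
  qed simp
qed

subsection \<open>Convergence of mollifications\<close>

lemma continuous_at_box: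
  assumes "continuous_on (Rn d) f" "x \<in> Rn d" "e > (0::real)"
  shows "\<exists>N. \<forall>n\<ge>N. \<forall>y\<in>Rn d. (\<forall>i<d. \<bar>x i - y i\<bar> < 1 / real (Suc n)) \<longrightarrow> \<bar>f y - f x\<bar> < e"
proof (rule ccontr)
  assume "\<not> ?thesis"
  then have "\<forall>N. \<exists>n\<ge>N. \<exists>y\<in>Rn d. (\<forall>i<d. \<bar>x i - y i\<bar> < 1 / real (Suc n)) \<and> \<bar>f y - f x\<bar> \<ge> e"
    by (simp add: not_less)
  then obtain n y where ny: "\<And>N. n N \<ge> N" "\<And>N. y N \<in> Rn d" "\<And>N i. i < d \<Longrightarrow> \<bar>x i - y N i\<bar> < 1 / real (Suc (n N))" "\<And>N. \<bar>f (y N) - f x\<bar> \<ge> e"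
    by metis
  have "y \<longlonglongrightarrow> x"
  proof (rule tendsto_fun)
    fix i
    show "(\<lambda>N. y N i) \<longlonglongrightarrow> x i"
    proof (cases "i < d")
      case True
      have "\<bar>y N i - x i\<bar> \<le> inverse (real (Suc N))" for N
      proof -
        have "\<bar>y N i - x i\<bar> \<le> 1 / real (Suc (n N))" using ny(3)[OF True, of N] by (simp add: abs_minus_commute)
        also have "\<dots> \<le> 1 / real (Suc N)" using ny(1)[of N] by (intro divide_left_mono) auto
        finally show ?thesis by (simp add: inverse_eq_divide)
      qed
      then have "(\<lambda>N. y N i - x i) \<longlonglongrightarrow> 0"
        by (intro Lim_null_comparison[OF _ LIMSEQ_inverse_real_of_nat]) auto
      then show ?thesis by (simp add: LIM_zero_iff)
    next
      case False
      then have "y N i = x i" for N using ny(2)[of N] assms(2) by (auto simp: Rn_def PiE_iff extensional_def)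
      then show ?thesis by simp
    qed
  qed
  then have "(\<lambda>N. f (y N)) \<longlonglongrightarrow> f x"
    by (rule continuous_on_tendsto_compose[OF assms(1) _ assms(2)]) (use ny(2) in auto)
  then have "(\<lambda>N. \<bar>f (y N) - f x\<bar>) \<longlonglongrightarrow> \<bar>f x - f x\<bar>" by (intro tendsto_intros)
  then have "e \<le> \<bar>f x - f x\<bar>" by (rule LIMSEQ_le_const) (use ny(4) in auto)
  then show False using assms(3) by simp
qed

abbreviation mo :: "nat \<Rightarrow> (point \<Rightarrow> real) \<Rightarrow> nat \<Rightarrow> point \<Rightarrow> real" where
  "mo d f n \<equiv> moll d (1 / real (Suc n)) (\<lambda>_. 0) f"

lemma moll_pointwise:
  assumes c: "continuous_on (Rn d) f" and i: "integrable (leb d) f" and x: "x \<in> Rn d"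
  shows "(\<lambda>n. mo d f n x) \<longlonglongrightarrow> f x"
proof (rule LIMSEQ_I)
  fix e :: real assume e: "e > 0"
  obtain N where N: "\<And>n y. n \<ge> N \<Longrightarrow> y \<in> Rn d \<Longrightarrow> (\<forall>i<d. \<bar>x i - y i\<bar> < 1 / real (Suc n)) \<Longrightarrow> \<bar>f y - f x\<bar> < e / 2"
    using continuous_at_box[OF c x, of "e/2"] e by auto
  have "norm (mo d f n x - f x) < e" if n: "n \<ge> N" for n
  proof -
    define h where "h = 1 / real (Suc n)"
    have h: "h > 0" by (simp add: h_def)
    let ?K = "kern d h (\<lambda>_. 0) x"
    note ki = kern_integral(3)[OF h, of d x]
    have fi: "integrable (leb d) (\<lambda>y. f y * ?K y - f x * ?K y)"
      by (intro Bochner_Integration.integrable_diff moll_integrable[OF i] integrable_mult_right ki)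
    have "mo d f n x - f x = (\<integral>y. f y * ?K y \<partial>leb d) - (\<integral>y. f x * ?K y \<partial>leb d)"
      unfolding moll_def h_def[symmetric] by (simp add: kern_integral[OF h])
    also have "\<dots> = (\<integral>y. f y * ?K y - f x * ?K y \<partial>leb d)"
      by (rule Bochner_Integration.integral_diff[symmetric]) (intro moll_integrable[OF i] integrable_mult_right ki)+
    also have "norm \<dots> \<le> (\<integral>y. norm (f y * ?K y - f x * ?K y) \<partial>leb d)"
      by (rule integral_norm_bound)
    also have "\<dots> \<le> (\<integral>y. (e / 2) * ?K y \<partial>leb d)"
    proof (rule integral_mono)
      fix y assume "y \<in> space (leb d)"
      then have y: "y \<in> Rn d" by simp
      show "norm (f y * ?K y - f x * ?K y) \<le> e / 2 * ?K y"
      proof (cases "\<forall>i<d. \<bar>x i - y i\<bar> < h")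
        case True
        then have "\<bar>f y - f x\<bar> < e / 2" using N[OF n y] by (simp add: h_def)
        then have "\<bar>f y - f x\<bar> * ?K y \<le> e / 2 * ?K y" by (intro mult_right_mono) (auto simp: kern_nonneg[OF h])
        then show ?thesis by (simp add: left_diff_distrib[symmetric] abs_mult kern_nonneg[OF h])
      next
        case False
        then obtain i where "i < d" "\<bar>x i - y i\<bar> \<ge> h" by (auto simp: not_less)
        then have "?K y = 0" by (rule kern_support[OF h])
        then show ?thesis by simp
      qed
    qed (use fi ki in auto)
    also have "\<dots> = e / 2" by (simp add: kern_integral[OF h])
    finally show ?thesis using e by simp
  qed
  then show "\<exists>no. \<forall>n\<ge>no. norm (mo d f n x - f x) < e" by blast
qed

lemma moll_L2c_cc:
  assumes c: "continuous_on (Rn d) f" and s: "csup d f"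
  shows "L2c (leb d) (mo d f) f"
proof -
  note i = cc_integrable[OF c s]
  obtain C where C: "C \<ge> 0" "\<And>x. x \<in> Rn d \<Longrightarrow> \<bar>f x\<bar> \<le> C" using cc_bounded[OF c s] by blast
  obtain r where r: "\<And>x. x \<in> Rn d \<Longrightarrow> x \<notin> bx d r \<Longrightarrow> f x = 0" using s by (auto simp: csup_def)
  show ?thesis
  proof (rule L2c_dominated[where w = "\<lambda>x. C * indicator (bx d (r + 1)) x"])
    show "mo d f n \<in> borel_measurable (leb d)" for n by (rule cont_meas[OF moll_cont[OF i]])
    show "f \<in> borel_measurable (leb d)" by (rule cont_meas[OF c])
    show "sqi (leb d) (\<lambda>x. C * indicator (bx d (r + 1)) x)" by (rule sqi_cmult[OF indicator_bx_sqi])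
    fix x assume "x \<in> space (leb d)"
    then have x: "x \<in> Rn d" by simp
    show "(\<lambda>n. mo d f n x) \<longlonglongrightarrow> f x" by (rule moll_pointwise[OF c i x])
    show "\<bar>mo d f n x\<bar> \<le> C * indicator (bx d (r + 1)) x" for n
    proof (cases "x \<in> bx d (r + 1)")
      case True
      define h where "h = 1 / real (Suc n)"
      have h: "h > 0" by (simp add: h_def)
      have "\<bar>mo d f n x\<bar> \<le> (\<integral>y. \<bar>f y * kern d h (\<lambda>_. 0) x y\<bar> \<partial>leb d)"
        unfolding moll_def h_def by (rule integral_abs_bound)
      also have "\<dots> \<le> (\<integral>y. C * kern d h (\<lambda>_. 0) x y \<partial>leb d)"
      proof (rule integral_mono)
        show "integrable (leb d) (\<lambda>y. \<bar>f y * kern d h (\<lambda>_. 0) x y\<bar>)" by (intro integrable_abs moll_integrable[OF i])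
        show "integrable (leb d) (\<lambda>y. C * kern d h (\<lambda>_. 0) x y)" by (intro integrable_mult_right kern_integral[OF h])
        show "\<bar>f y * kern d h (\<lambda>_. 0) x y\<bar> \<le> C * kern d h (\<lambda>_. 0) x y" if "y \<in> space (leb d)" for y
          using C(2)[of y] that by (simp add: abs_mult kern_nonneg[OF h] mult_right_mono)
      qed
      also have "\<dots> = C" by (simp add: kern_integral[OF h])
      finally show ?thesis using True by simp
    next
      case False
      have "x \<notin> bx d (r + 1 / real (Suc n))"
        using False bx_mono[of "r + 1 / real (Suc n)" "r + 1" x d] by auto
      then have "mo d f n x = 0" using x by (intro moll_support[of _ d r f]) (auto simp: r)
      then show ?thesis by (simp add: C)
    qed
  qed
qed

text \<open>For continuous f with compact support the convergence is pointwise and dominated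
  (\<open>moll_L2c_cc\<close>). In general f is approximated by a test function, and
  \<open>moll_L2_bound\<close> controls the mollified difference.\<close>

theorem moll_L2c:
  assumes f: "sqi (leb d) f" and r: "\<And>x. x \<in> Rn d \<Longrightarrow> x \<notin> bx d r \<Longrightarrow> f x = 0"
  shows "L2c (leb d) (mo d f) f"
proof -
  have fe: "f x * indicator (bx d r) x = f x" if "x \<in> space (leb d)" for x using r[of x] that by (auto simp: indicator_def)
  have ti: "integrable (leb d) f"
  proof -
    have "sqi (leb d) (\<lambda>x. f x * indicator (bx d r) x)" using f sqi_cong[of "leb d" "\<lambda>x. f x * indicator (bx d r) x" f] fe by simp
    from sq_int_trunc[OF this] show ?thesis by (subst (asm) Bochner_Integration.integrable_cong[OF refl fe])
  qed
  define \<nu> where "\<nu> = density (leb d) (\<lambda>x. ennreal (indicator (bx d (r + 1)) x))"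
  have nd: "integrable \<nu> g \<longleftrightarrow> integrable (leb d) (\<lambda>x. indicator (bx d (r + 1)) x * g x)"
    "(\<integral>x. g x \<partial>\<nu>) = (\<integral>x. indicator (bx d (r + 1)) x * g x \<partial>leb d)" if "g \<in> borel_measurable (leb d)" for g :: "point \<Rightarrow> real"
    unfolding \<nu>_def using integrable_density[OF that, of "indicator (bx d (r + 1))"] integral_density[OF that, of "indicator (bx d (r + 1))"] by auto
  interpret fin_meas \<nu> d
  proof (intro fin_meas.intro fin_meas_axioms.intro finite_measureI)
    show "sets \<nu> = sets (leb d)" by (simp add: \<nu>_def)
    have "emeasure \<nu> (space \<nu>) = (\<integral>\<^sup>+x. ennreal (indicator (bx d (r + 1)) x) \<partial>leb d)"
      unfolding \<nu>_def by (subst emeasure_density) (auto intro!: nn_integral_cong simp: indicator_def)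
    also have "\<dots> = emeasure (leb d) (bx d (r + 1))" by (simp add: ennreal_indicator)
    finally show "emeasure \<nu> (space \<nu>) \<noteq> \<infinity>" using emeasure_bx[of d "r + 1"] by simp
  qed
  have fm [measurable]: "f \<in> borel_measurable (leb d)" using f by (rule sqiD)
  have "sqi \<nu> f"
  proof -
    have "integrable (leb d) (\<lambda>x. indicator (bx d (r + 1)) x * (f x)\<^sup>2)"
      by (rule Bochner_Integration.integrable_bound[OF sqiD(2)[OF f]]) (auto simp: indicator_def)
    then show ?thesis by (simp add: sqi_def nd meas_nu)
  qed
  then obtain \<eta> where \<eta>: "\<And>n. test_fun d (\<eta> n)" "L2c \<nu> \<eta> f" using test_fun_dense by blast
  have close: "\<exists>\<zeta>. test_fun d \<zeta> \<and> (\<integral>x. (f x - \<zeta> x)\<^sup>2 \<partial>leb d) < \<delta>" if dp: "\<delta> > 0" for \<delta>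
  proof -
    obtain k where k: "(\<integral>x. (\<eta> k x - f x)\<^sup>2 \<partial>\<nu>) < \<delta>"
      using eventually_happens[OF order_tendstoD(2)[OF L2cD(3)[OF \<eta>(2)] dp]] by auto
    \<comment> \<open>\<eta> is known to be close to f only on \<open>bx d (r + 1)\<close>. The
      cut-off removes the rest and does not enlarge the error, because f is 0 off
      \<open>bx d r\<close>.\<close>
    define \<zeta> where "\<zeta> x = cut d r x * \<eta> k x" for x
    have t: "test_fun d \<zeta>" unfolding \<zeta>_def by (rule test_fun_mult[OF cut_test_fun \<eta>(1)])
    have [measurable]: "\<eta> k \<in> borel_measurable (leb d)" by (rule cont_meas[OF test_fun_cont[OF \<eta>(1)]])
    have [measurable]: "\<zeta> \<in> borel_measurable (leb d)" by (rule cont_meas[OF test_fun_cont[OF t]])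
    have i1: "integrable (leb d) (\<lambda>x. indicator (bx d (r + 1)) x * (\<eta> k x - f x)\<^sup>2)"
      using sqiD(2)[OF sqi_diff[OF L2cD(1)[OF \<eta>(2), of k] L2cD(2)[OF \<eta>(2)]]] by (simp add: nd)
    have le: "(f x - \<zeta> x)\<^sup>2 \<le> indicator (bx d (r + 1)) x * (\<eta> k x - f x)\<^sup>2" if "x \<in> space (leb d)" for x
    proof -
      have x: "x \<in> Rn d" using that by simp
      consider "x \<in> bx d r" | "x \<notin> bx d r" "x \<in> bx d (r + 1)" | "x \<notin> bx d r" "x \<notin> bx d (r + 1)" by blast
      then show ?thesis
      proof cases
        case 1
        then have "x \<in> bx d (r + 1)" using bx_mono[of r "r + 1"] by simp
        then show ?thesis using 1 by (simp add: \<zeta>_def cut_eq_1 power2_commute)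
      next
        case 2
        have "\<bar>cut d r x * \<eta> k x\<bar> \<le> \<bar>\<eta> k x\<bar>"
          using cut_range[of d r x] by (simp add: abs_mult mult_left_le_one_le)
        then have "(cut d r x * \<eta> k x)\<^sup>2 \<le> (\<eta> k x)\<^sup>2" by (simp add: abs_le_square_iff)
        then show ?thesis using 2 r[OF x] by (simp add: \<zeta>_def)
      next
        case 3
        then show ?thesis using r[OF x] x by (simp add: \<zeta>_def cut_eq_0)
      qed
    qed
    have i2: "integrable (leb d) (\<lambda>x. (f x - \<zeta> x)\<^sup>2)"
      by (rule Bochner_Integration.integrable_bound[OF i1]) (use le in \<open>auto intro!: AE_I2\<close>)
    have "(\<integral>x. (f x - \<zeta> x)\<^sup>2 \<partial>leb d) \<le> (\<integral>x. indicator (bx d (r + 1)) x * (\<eta> k x - f x)\<^sup>2 \<partial>leb d)"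
      by (rule integral_mono[OF i2 i1 le])
    also have "\<dots> = (\<integral>x. (\<eta> k x - f x)\<^sup>2 \<partial>\<nu>)" by (simp add: nd)
    finally show ?thesis using k t by auto
  qed
  have e: "1 / real (Suc n) > 0" for n by simp
  have lim: "(\<lambda>n. \<integral>x. (mo d f n x - f x)\<^sup>2 \<partial>leb d) \<longlonglongrightarrow> 0"
  proof (rule LIMSEQ_I)
    fix \<delta> :: real assume d0: "\<delta> > 0"
    \<comment> \<open>The final estimate has 8 times this error plus 2 times the error of mollifying
      \<zeta>: \<open>8 * \<delta> / 16 + 2 * \<delta> / 4 = \<delta>\<close>.\<close>
    obtain \<zeta> where z: "test_fun d \<zeta>" "(\<integral>x. (f x - \<zeta> x)\<^sup>2 \<partial>leb d) < \<delta> / 16" using close[of "\<delta> / 16"] d0 by auto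
    have zc: "L2c (leb d) (mo d \<zeta>) \<zeta>" using z(1) by (intro moll_L2c_cc test_fun_cont) (auto simp: test_fun_iff)
    have zi: "integrable (leb d) \<zeta>" using z(1) by (intro cc_integrable test_fun_cont) (auto simp: test_fun_iff)
    obtain N where N: "\<And>n. n \<ge> N \<Longrightarrow> (\<integral>x. (mo d \<zeta> n x - \<zeta> x)\<^sup>2 \<partial>leb d) < \<delta> / 4"
      using order_tendstoD(2)[OF L2cD(3)[OF zc], of "\<delta> / 4"] d0 by (auto simp: eventually_sequentially)
    have "norm ((\<integral>x. (mo d f n x - f x)\<^sup>2 \<partial>leb d) - 0) < \<delta>" if "n \<ge> N" for n
    proof -
      define g where "g x = f x - \<zeta> x" for x
      have gs: "sqi (leb d) g" unfolding g_def by (rule sqi_diff[OF f L2cD(2)[OF zc]])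
      have gi: "integrable (leb d) g" unfolding g_def using ti zi by simp
      have gl: "mo d g n x = mo d f n x - mo d \<zeta> n x" for x
        unfolding moll_def g_def left_diff_distrib
        by (rule Bochner_Integration.integral_diff[OF moll_integrable[OF ti] moll_integrable[OF zi]])
      note mg = moll_L2_bound[OF e[of n] gs gi]
      have s1: "sqi (leb d) (\<lambda>x. mo d g n x + - g x)" by (intro sqi_add mg sqi_uminus gs)
      have s2: "sqi (leb d) (\<lambda>x. mo d \<zeta> n x - \<zeta> x)" by (intro sqi_diff L2cD[OF zc])
      have "(\<integral>x. (mo d f n x - f x)\<^sup>2 \<partial>leb d) = (\<integral>x. ((mo d g n x + - g x) + (mo d \<zeta> n x - \<zeta> x))\<^sup>2 \<partial>leb d)"
        unfolding gl g_def by (intro Bochner_Integration.integral_cong[OF refl] arg_cong[where f = power2]) (simp add: algebra_simps)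
      also have "\<dots> \<le> 2 * (\<integral>x. (mo d g n x + - g x)\<^sup>2 \<partial>leb d) + 2 * (\<integral>x. (mo d \<zeta> n x - \<zeta> x)\<^sup>2 \<partial>leb d)"
        by (rule integral_sq_sum_le[OF s1 s2])
      also have "(\<integral>x. (mo d g n x + - g x)\<^sup>2 \<partial>leb d) \<le> 2 * (\<integral>x. (mo d g n x)\<^sup>2 \<partial>leb d) + 2 * (\<integral>x. (- g x)\<^sup>2 \<partial>leb d)"
        by (rule integral_sq_sum_le[OF mg(1) sqi_uminus[OF gs]])
      finally have "(\<integral>x. (mo d f n x - f x)\<^sup>2 \<partial>leb d) \<le> 8 * (\<integral>x. (g x)\<^sup>2 \<partial>leb d) + 2 * (\<integral>x. (mo d \<zeta> n x - \<zeta> x)\<^sup>2 \<partial>leb d)"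
        using mg(2) by simp
      also have "\<dots> < \<delta>" using z(2) N[OF that] unfolding g_def by linarith
      finally show ?thesis by simp
    qed
    then show "\<exists>no. \<forall>n\<ge>no. norm ((\<integral>x. (mo d f n x - f x)\<^sup>2 \<partial>leb d) - 0) < \<delta>" by blast
  qed
  show ?thesis unfolding L2c_def using f lim moll_L2_bound(1)[OF e f ti] by blast
qed

text \<open>Mollification does not see null sets, yet converges at every point of continuity. This
  turns vanishing in norm into vanishing at every point, as the definition of \<open>Rot_phi\<close>
  demands.\<close>

lemma continuous_AE_zero:
  fixes g :: "point \<Rightarrow> real"
  assumes c: "continuous_on (Rn d) g" and z: "AE x in leb d. g x = 0" and x: "x \<in> Rn d"
  shows "g x = 0"
proof -
  obtain N where N: "\<And>n. n \<ge> N \<Longrightarrow> x \<in> bx d (real n)" using bx_exhaust[OF x] by metis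
  define h where "h y = cut d (real N) y * g y" for y
  have hc: "continuous_on (Rn d) h" unfolding h_def by (intro continuous_intros test_fun_cont[OF cut_test_fun] c)
  have "csup d h" unfolding h_def using cut_test_fun[of d "real N"] by (intro csup_mult1) (auto simp: test_fun_iff)
  then have hi: "integrable (leb d) h" by (rule cc_integrable[OF hc])
  have "mo d h n x = 0" for n
    unfolding moll_def by (rule integral_eq_zero_AE) (use z in eventually_elim, auto simp: h_def)
  then have "(\<lambda>n. 0) \<longlonglongrightarrow> h x" using moll_pointwise[OF hc hi x] by simp
  then have "h x = 0" by (simp add: LIMSEQ_const_iff)
  then show ?thesis using cut_eq_1[OF N[OF order_refl]] by (simp add: h_def)
qed

text \<open>In L2 of the measure with density \<open>\<bar>g\<bar>\<close> on a box, the sign of g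
  is a limit of test functions; testing with these recovers the integral of
  \<open>\<bar>g\<bar>\<close>.\<close>

theorem fundamental_lemma:
  assumes g: "loc_int d g" and z: "\<And>\<psi>. test_fun d \<psi> \<Longrightarrow> (\<integral>x. g x * \<psi> x \<partial>leb d) = 0"
  shows "AE x in leb d. g x = 0"
proof -
  have gi: "integrable (leb d) (\<lambda>x. indicator (bx d r) x * g x)" for r
    using g by (simp add: loc_int_def set_integrable_def bx_def)
  have main: "AE x in leb d. x \<in> bx d (real R) \<longrightarrow> g x = 0" for R :: nat
  proof -
    define w where "w x = \<bar>indicator (bx d (real R + 1)) x * g x\<bar>" for x
    define \<sigma> where "\<sigma> x = sgn (indicator (bx d (real R + 1)) x * g x)" for x
    have wi: "integrable (leb d) w" unfolding w_def by (intro integrable_abs gi)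
    have [measurable]: "w \<in> borel_measurable (leb d)" by (rule borel_measurable_integrable[OF wi])
    have [measurable]: "\<sigma> \<in> borel_measurable (leb d)"
      unfolding \<sigma>_def using borel_measurable_integrable[OF gi[of "real R + 1"]] by measurable
    have ws: "w x * \<sigma> x = indicator (bx d (real R + 1)) x * g x" for x by (simp add: w_def \<sigma>_def abs_mult_sgn mult.commute sgn_mult_abs)
    define \<nu> where "\<nu> = density (leb d) (\<lambda>x. ennreal (w x))"
    have nd: "(\<integral>x. h x \<partial>\<nu>) = (\<integral>x. w x * h x \<partial>leb d)" if "h \<in> borel_measurable (leb d)" for h :: "point \<Rightarrow> real"
      unfolding \<nu>_def using integral_density[OF that, of w] by (auto simp: w_def)
    interpret fin_meas \<nu> d
    proof (intro fin_meas.intro fin_meas_axioms.intro finite_measureI)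
      show "sets \<nu> = sets (leb d)" by (simp add: \<nu>_def)
      have "emeasure \<nu> (space \<nu>) = (\<integral>\<^sup>+x. ennreal (w x) \<partial>leb d)"
        unfolding \<nu>_def by (subst emeasure_density) (auto intro!: nn_integral_cong simp: indicator_def)
      also have "\<dots> = ennreal (\<integral>x. w x \<partial>leb d)" by (rule nn_integral_eq_integral[OF wi]) (simp add: w_def)
      finally show "emeasure \<nu> (space \<nu>) \<noteq> \<infinity>" by simp
    qed
    define s where "s x = \<sigma> x * indicator (bx d (real R)) x" for x
    have sm [measurable]: "s \<in> borel_measurable (leb d)" unfolding s_def by measurable
    have ss: "sqi \<nu> s" by (rule sqi_bounded[OF finite_measure_axioms, of _ 1]) (auto simp: meas_nu s_def \<sigma>_def sgn_real_def indicator_def)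
    obtain \<eta> where \<eta>: "\<And>n. test_fun d (\<eta> n)" "L2c \<nu> \<eta> s" using test_fun_dense[OF ss] by blast
    \<comment> \<open>The sign turns the weight \<open>w\<close> back into g, and the cut-off
      confines the integral to the box on which w was kept; what results is the integral of g
      against a test function.\<close>
    define c where "c x = \<sigma> x * cut d (real R) x" for x
    have cm [measurable]: "cut d (real R) \<in> borel_measurable (leb d)" by (rule cont_meas[OF test_fun_cont[OF cut_test_fun]])
    have l: "L2c \<nu> (\<lambda>n x. c x * \<eta> n x) (\<lambda>x. c x * s x)"
    proof (rule L2c_mult_bdd[OF \<eta>(2)])
      show "c \<in> borel_measurable \<nu>" unfolding meas_nu c_def by measurable
      show "\<bar>c x\<bar> \<le> 1" for x
        using cut_range[of d "real R" x] by (auto simp: c_def \<sigma>_def sgn_real_def)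
    qed
    have "(\<integral>x. c x * \<eta> n x \<partial>\<nu>) = 0" for n
    proof -
      have [measurable]: "\<eta> n \<in> borel_measurable (leb d)" by (rule cont_meas[OF test_fun_cont[OF \<eta>(1)]])
      have "(\<integral>x. c x * \<eta> n x \<partial>\<nu>) = (\<integral>x. w x * (c x * \<eta> n x) \<partial>leb d)" by (rule nd) (auto simp: c_def)
      also have "\<dots> = (\<integral>x. g x * (cut d (real R) x * \<eta> n x) \<partial>leb d)"
      proof (rule Bochner_Integration.integral_cong[OF refl])
        fix x assume "x \<in> space (leb d)"
        then show "w x * (c x * \<eta> n x) = g x * (cut d (real R) x * \<eta> n x)"
          using ws[of x] cut_eq_0[of x d "real R"] by (cases "x \<in> bx d (real R + 1)") (auto simp: c_def mult.assoc[symmetric])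
      qed
      also have "\<dots> = 0" by (rule z[OF test_fun_mult[OF cut_test_fun \<eta>(1)]])
      finally show ?thesis .
    qed
    then have "(\<integral>x. c x * s x \<partial>\<nu>) = 0"
      using LIMSEQ_unique[OF L2c_integral[OF finite_measure_axioms l]] by (simp add: LIMSEQ_const_iff)
    moreover have "(\<integral>x. c x * s x \<partial>\<nu>) = (\<integral>x. w x * (c x * s x) \<partial>leb d)" by (rule nd) (auto simp: c_def)
    moreover have "\<dots> = (\<integral>x. \<bar>indicator (bx d (real R)) x * g x\<bar> \<partial>leb d)"
    proof (rule Bochner_Integration.integral_cong[OF refl])
      fix x assume "x \<in> space (leb d)"
      show "w x * (c x * s x) = \<bar>indicator (bx d (real R)) x * g x\<bar>"
      proof (cases "x \<in> bx d (real R)")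
        case True
        then have "x \<in> bx d (real R + 1)" using bx_mono[of "real R" "real R + 1"] by simp
        then show ?thesis using True by (simp add: w_def c_def s_def \<sigma>_def cut_eq_1 sgn_real_def)
      qed (simp add: s_def)
    qed
    ultimately have "(\<integral>x. \<bar>indicator (bx d (real R)) x * g x\<bar> \<partial>leb d) = 0" by simp
    then have "AE x in leb d. \<bar>indicator (bx d (real R)) x * g x\<bar> = 0"
      using integral_nonneg_eq_0_iff_AE[OF integrable_abs[OF gi[of "real R"]]] by simp
    then show ?thesis
    proof eventually_elim
      case (elim x)
      then show ?case by (cases "x \<in> bx d (real R)") auto
    qed
  qed
  have "AE x in leb d. \<forall>R::nat. x \<in> bx d (real R) \<longrightarrow> g x = 0" by (intro AE_all_countable[THEN iffD2] allI main)
  moreover have "AE x in leb d. x \<in> Rn d" by (rule AE_I2) simp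
  ultimately show ?thesis
  proof eventually_elim
    case (elim x)
    obtain N where "\<And>n. n \<ge> N \<Longrightarrow> x \<in> bx d (real n)" using bx_exhaust[OF elim(2)] by metis
    then have "x \<in> bx d (real N)" by simp
    then show ?case using spec[OF elim(1), of N] by simp
  qed
qed

subsection \<open>The weighted space\<close>

locale pot =
  fixes d :: nat and \<phi> :: "point \<Rightarrow> real" and CP Cphi Cphi' :: real
  assumes mass: "has_bochner_integral (leb d) (\<lambda>x. exp (- \<phi> x)) 1"
    and centred: "\<And>i. i < d \<Longrightarrow> has_bochner_integral (leb d) (\<lambda>x. x i * exp (- \<phi> x)) 0"
    and C2: "Ck d 2 \<phi>"
    and CP0: "0 \<le> CP"
    and poin: "poincare d \<phi> CP"
    and Cphi8: "8 < Cphi"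
    and Cphi': "Cphi < Cphi'"
    and hess1: "\<And>x. x \<in> Rn d \<Longrightarrow> 4 * sqrt (real d) * sqrt (msq d (hess \<phi> x)) \<le> vsq d (grad \<phi> x) + Cphi - 1"
    and hess2: "\<And>x. x \<in> Rn d \<Longrightarrow> 4 * sqrt (msq d (hess \<phi> x)) \<le> (vsq d (grad \<phi> x) + Cphi') / sqrt Cphi"
begin

abbreviation M :: "point measure" where "M \<equiv> mu d \<phi>"

definition rho :: "point \<Rightarrow> real" where "rho x = exp (- \<phi> x)"

lemma phiC2: "Ck d (Suc (Suc 0)) \<phi>"
  using C2 by (simp add: numeral_2_eq_2)

lemma phijC1: "j < d \<Longrightarrow> Ck d (Suc 0) (pd j \<phi>)"
  by (rule Ck_pd'[OF phiC2])

lemma rhoC2: "Ck d (Suc (Suc 0)) rho"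
  unfolding rho_def[abs_def] by (rule Ck_exp[OF Ck_uminus[OF phiC2]])

lemma rho_pos: "rho x > 0"
  by (simp add: rho_def)

lemma pd_rho: "x \<in> Rn d \<Longrightarrow> j < d \<Longrightarrow> pd j rho x = - rho x * pd j \<phi> x"
  unfolding rho_def[abs_def] by (simp add: pd_exp[OF Ck_uminus[OF phiC2]] pd_uminus[OF phiC2])

lemma rho_cont: "continuous_on (Rn d) rho"
  by (rule Ck_cont[OF rhoC2])

lemma rho_meas [measurable]: "rho \<in> borel_measurable (leb d)"
  by (rule cont_meas[OF rho_cont])

lemma mu_rho: "M = density (leb d) (\<lambda>x. ennreal (rho x))"
  by (simp add: mu_def rho_def)

lemma sets_M [measurable_cong]: "sets M = sets (leb d)"
  by (simp add: mu_rho)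

lemma meas_M: "f \<in> borel_measurable M \<longleftrightarrow> f \<in> borel_measurable (leb d)"
  by (simp add: measurable_cong_sets[OF sets_M refl])

lemma space_M [simp]: "space M = Rn d"
  using sets_eq_imp_space_eq[OF sets_M] by simp

lemma rho_integrable: "integrable (leb d) rho" and rho_integral: "(\<integral>x. rho x \<partial>leb d) = 1"
  using mass by (auto simp: rho_def[abs_def] has_bochner_integral_iff)

lemma emeasure_M: "emeasure M (Rn d) = 1"
proof -
  have "emeasure M (Rn d) = (\<integral>\<^sup>+x. ennreal (rho x) \<partial>leb d)"
    unfolding mu_rho by (subst emeasure_density) (auto intro!: nn_integral_cong simp: indicator_def)
  also have "\<dots> = ennreal (\<integral>x. rho x \<partial>leb d)"
    by (rule nn_integral_eq_integral[OF rho_integrable]) (simp add: rho_pos less_imp_le)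
  finally show ?thesis by (simp add: rho_integral)
qed

sublocale fin_meas M d
  by (intro fin_meas.intro fin_meas_axioms.intro finite_measureI sets_M) (simp add: emeasure_M)

lemmas fm = finite_measure_axioms

lemma measure_M: "measure M (Rn d) = 1"
  using emeasure_M by (simp add: measure_def)

lemma integrable_M: "f \<in> borel_measurable (leb d) \<Longrightarrow> integrable M f \<longleftrightarrow> integrable (leb d) (\<lambda>x. rho x * f x)" for f :: "point \<Rightarrow> real"
  unfolding mu_rho by (subst integrable_density) (auto simp: rho_pos less_imp_le)

lemma integral_M: "f \<in> borel_measurable (leb d) \<Longrightarrow> (\<integral>x. f x \<partial>M) = (\<integral>x. rho x * f x \<partial>leb d)" for f :: "point \<Rightarrow> real"
  unfolding mu_rho by (subst integral_density) (auto simp: rho_pos less_imp_le)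

lemma cc_integrable_M: "continuous_on (Rn d) f \<Longrightarrow> csup d f \<Longrightarrow> integrable M f"
  by (subst integrable_M) (auto intro!: cont_meas cc_integrable continuous_intros rho_cont csup_mult2)

lemma cc_sqi:
  assumes "continuous_on (Rn d) f" "csup d f" shows "sqi M f"
proof -
  obtain C where C: "\<forall>x\<in>Rn d. \<bar>f x\<bar> \<le> C" using cc_bounded[OF assms] by blast
  show ?thesis
    by (rule sqi_bounded[OF fm, of f C]) (use C cont_meas[OF assms(1)] in \<open>auto simp: meas_M\<close>)
qed

section \<open>Passing between Lebesgue measure and the weighted measure\<close>

lemma sqi_M: "f \<in> borel_measurable (leb d) \<Longrightarrow> sqi M f \<longleftrightarrow> sqi (leb d) (\<lambda>x. sqrt (rho x) * f x)"
  unfolding sqi_def meas_M by (simp add: integrable_M power_mult_distrib rho_pos less_imp_le)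

text \<open>Mollifications converge for Lebesgue measure, whereas the estimates are weighted. After
  multiplication by a bounded function supported in a box, where \<open>rho\<close> is bounded,
  convergence carries over. \<open>sqi_trunc\<close> goes the other way, \<open>1 / rho\<close>
  being bounded on boxes too.\<close>

lemma sqi_leb_M:
  assumes f: "sqi (leb d) f" and c: "c \<in> borel_measurable (leb d)"
    and z: "\<And>x. x \<in> Rn d \<Longrightarrow> x \<notin> bx d R \<Longrightarrow> c x = 0" and b: "\<And>x. x \<in> bx d R \<Longrightarrow> \<bar>c x\<bar> \<le> C"
  shows "sqi M (\<lambda>x. c x * f x)"
    and "(\<And>n. sqi (leb d) (fs n)) \<Longrightarrow> L2c (leb d) fs f \<Longrightarrow> L2c M (\<lambda>n x. c x * fs n x) (\<lambda>x. c x * f x)"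
proof -
  obtain B where B: "B \<ge> 0" "\<forall>x\<in>bx d R. \<bar>sqrt (rho x)\<bar> \<le> B"
    using bdd_on_bx[OF continuous_on_real_sqrt[OF rho_cont], of R] by blast
  define w where "w x = sqrt (rho x) * c x" for x
  have wm: "w \<in> borel_measurable (leb d)" using c unfolding w_def by measurable
  have wb: "\<bar>w x\<bar> \<le> B * \<bar>C\<bar>" if "x \<in> space (leb d)" for x
  proof (cases "x \<in> bx d R")
    case True
    have "\<bar>sqrt (rho x)\<bar> * \<bar>c x\<bar> \<le> B * \<bar>C\<bar>"
      using B True b[OF True] by (intro mult_mono) auto
    then show ?thesis by (simp add: w_def abs_mult)
  qed (use z that B in \<open>auto simp: w_def\<close>)
  have e: "(\<lambda>x. sqrt (rho x) * (c x * h x)) = (\<lambda>x. w x * h x)" for h by (simp add: w_def mult.assoc)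
  have one: "sqi M (\<lambda>x. c x * h x)" if "sqi (leb d) h" for h
    using sqi_mult_bdd[OF that wm wb] sqiD(1)[OF that] c by (subst sqi_M) (auto simp: e)
  then show "sqi M (\<lambda>x. c x * f x)" using f by blast
  assume fs: "\<And>n. sqi (leb d) (fs n)" and l: "L2c (leb d) fs f"
  have l2: "L2c (leb d) (\<lambda>n x. w x * fs n x) (\<lambda>x. w x * f x)" by (rule L2c_mult_bdd[OF l wm wb])
  have "(\<integral>x. (c x * fs n x - c x * f x)\<^sup>2 \<partial>M) = (\<integral>x. (w x * fs n x - w x * f x)\<^sup>2 \<partial>leb d)" for n
  proof -
    have "(\<lambda>x. (c x * fs n x - c x * f x)\<^sup>2) \<in> borel_measurable (leb d)"
      using c sqiD(1)[OF f] sqiD(1)[OF fs[of n]] by measurable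
    then have "(\<integral>x. (c x * fs n x - c x * f x)\<^sup>2 \<partial>M) = (\<integral>x. rho x * (c x * fs n x - c x * f x)\<^sup>2 \<partial>leb d)"
      by (rule integral_M)
    also have "\<dots> = (\<integral>x. (w x * fs n x - w x * f x)\<^sup>2 \<partial>leb d)"
      by (simp add: w_def right_diff_distrib[symmetric] mult.assoc power_mult_distrib rho_pos less_imp_le)
    finally show ?thesis .
  qed
  then show "L2c M (\<lambda>n x. c x * fs n x) (\<lambda>x. c x * f x)"
    using one[OF fs] one[OF f] L2cD(3)[OF l2] unfolding L2c_def by simp
qed

lemma sqi_trunc:
  assumes f: "sqi M f" and c: "c \<in> borel_measurable (leb d)"
    "\<And>x. x \<in> bx d S \<Longrightarrow> \<bar>c x\<bar> \<le> C"
  shows "sqi (leb d) (\<lambda>x. c x * f x * indicator (bx d S) x)"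
proof -
  have m: "f \<in> borel_measurable (leb d)" using sqiD(1)[OF f] by (simp add: meas_M)
  have cn: "continuous_on (Rn d) (\<lambda>x. 1 / sqrt (rho x))"
    by (intro continuous_intros rho_cont) (use rho_pos in \<open>auto simp: less_le\<close>)
  obtain B where B: "B \<ge> 0" "\<forall>x\<in>bx d S. \<bar>1 / sqrt (rho x)\<bar> \<le> B" using bdd_on_bx[OF cn, of S] by blast
  define w where "w x = 1 / sqrt (rho x) * c x * indicator (bx d S) x" for x
  have "sqi (leb d) (\<lambda>x. w x * (sqrt (rho x) * f x))"
  proof (rule sqi_mult_bdd)
    show "sqi (leb d) (\<lambda>x. sqrt (rho x) * f x)" using f sqi_M[OF m] by simp
    show "w \<in> borel_measurable (leb d)" unfolding w_def using c(1) by measurable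
    show "\<bar>w x\<bar> \<le> B * \<bar>C\<bar>" for x
    proof (cases "x \<in> bx d S")
      case True
      have "\<bar>1 / sqrt (rho x)\<bar> * \<bar>c x\<bar> \<le> B * \<bar>C\<bar>" using B True c(2)[OF True] by (intro mult_mono) auto
      then show ?thesis using True by (simp add: w_def abs_mult)
    qed (use B in \<open>auto simp: w_def\<close>)
  qed
  moreover have "w x * (sqrt (rho x) * f x) = c x * f x * indicator (bx d S) x" for x
    using rho_pos[of x] by (simp add: w_def)
  ultimately show ?thesis by simp
qed

lemma sqi_trunc1: "sqi M f \<Longrightarrow> sqi (leb d) (\<lambda>x. f x * indicator (bx d S) x)"
  using sqi_trunc[of f "\<lambda>_. 1" S 1] by simp

text \<open>Since \<open>pd j rho = - rho * pd j \<phi>\<close>, the weighted adjoint of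
  \<open>pd j\<close> is multiplication by \<open>pd j \<phi>\<close> minus \<open>pd j\<close>. The
  same operator returns under the name \<open>adj\<close>.\<close>

lemma ibp_M:
  assumes f: "Ck d (Suc k) f" and g: "Ck d (Suc m) g" "csup d g" and j: "j < d"
  shows "(\<integral>x. pd j f x * g x \<partial>M) = (\<integral>x. f x * (pd j \<phi> x * g x - pd j g x) \<partial>M)"
proof -
  have f1: "Ck d (Suc 0) f" and g1: "Ck d (Suc 0) g" by (auto intro: Ck_le f g)
  have r1: "Ck d (Suc 0) rho" by (rule Ck_le[OF rhoC2]) simp
  note ct = Ck_cont[OF Ck_pd'[OF f1 j]] Ck_cont[OF g1] Ck_cont[OF f1] Ck_cont[OF Ck_pd'[OF g1 j]] Ck_cont[OF phijC1[OF j]]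
  have "(\<integral>x. pd j f x * g x \<partial>M) = (\<integral>x. rho x * (pd j f x * g x) \<partial>leb d)"
    by (rule integral_M) (intro cont_meas continuous_intros ct)
  also have "\<dots> = (\<integral>x. pd j f x * (rho x * g x) \<partial>leb d)" by (simp add: mult_ac)
  also have "\<dots> = - (\<integral>x. f x * pd j (\<lambda>x. rho x * g x) x \<partial>leb d)"
    by (rule ibp_leb[OF f1 _ _ j, of 0]) (auto intro: Ck_mult r1 g1 csup_mult2 g)
  also have "\<dots> = (\<integral>x. - (f x * pd j (\<lambda>x. rho x * g x) x) \<partial>leb d)" by simp
  also have "\<dots> = (\<integral>x. rho x * (f x * (pd j \<phi> x * g x - pd j g x)) \<partial>leb d)"
  proof (rule Bochner_Integration.integral_cong[OF refl])
    fix x assume "x \<in> space (leb d)"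
    then have "pd j (\<lambda>x. rho x * g x) x = rho x * (pd j g x - pd j \<phi> x * g x)"
      by (simp add: pd_mult[OF r1 _ j g1] pd_rho j right_diff_distrib)
    then show "- (f x * pd j (\<lambda>x. rho x * g x) x) = rho x * (f x * (pd j \<phi> x * g x - pd j g x))"
      by (simp only:) (simp add: algebra_simps)
  qed
  also have "\<dots> = (\<integral>x. f x * (pd j \<phi> x * g x - pd j g x) \<partial>M)"
    by (rule integral_M[symmetric]) (intro cont_meas continuous_intros ct)
  finally show ?thesis .
qed

lemma integral_phij:
  assumes "Ck d (Suc k) g" "csup d g" "j < d"
  shows "(\<integral>x. pd j \<phi> x * g x \<partial>M) = (\<integral>x. pd j g x \<partial>M)"
proof -
  have g1: "Ck d (Suc 0) g" by (rule Ck_le[OF assms(1)]) simp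
  have "0 = (\<integral>x. 1 * (pd j \<phi> x * g x - pd j g x) \<partial>M)"
    using ibp_M[OF Ck_const[of d "Suc 0" 1] assms] by simp
  also have "\<dots> = (\<integral>x. pd j \<phi> x * g x \<partial>M) - (\<integral>x. pd j g x \<partial>M)"
    unfolding mult_1
    by (intro Bochner_Integration.integral_diff cc_integrable_M continuous_intros csup_mult2 csup_pd assms
        Ck_cont[OF phijC1] Ck_cont[OF g1] Ck_cont[OF Ck_pd'[OF g1]])
  finally show ?thesis by simp
qed

section \<open>Weighted inequalities for the gradient and the Hessian of \<phi>\<close>

definition gn :: "point \<Rightarrow> real" where "gn x = sqrt (vsq d (grad \<phi> x))"

definition hn :: "point \<Rightarrow> real" where "hn x = sqrt (msq d (hess \<phi> x))"

lemma gn_sq: "(gn x)\<^sup>2 = (\<Sum>i<d. (pd i \<phi> x)\<^sup>2)"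
  by (simp add: gn_def vsq_def grad_def sum_nonneg)

lemma hn_sq: "(hn x)\<^sup>2 = (\<Sum>i<d. \<Sum>j<d. (pd i (pd j \<phi>) x)\<^sup>2)"
  by (simp add: hn_def msq_def hess_def sum_nonneg)

lemma gn_nonneg: "0 \<le> gn x" and hn_nonneg: "0 \<le> hn x"
  by (auto simp: gn_def hn_def vsq_def msq_def intro!: sum_nonneg)

lemma gn_cont: "continuous_on (Rn d) gn"
  unfolding gn_def vsq_def grad_def by (intro continuous_intros Ck_cont[OF phijC1]) auto

lemma hn_cont: "continuous_on (Rn d) hn"
  unfolding hn_def msq_def hess_def by (intro continuous_intros Ck_cont[OF Ck_pd'[OF phijC1]]) auto

lemma hess1': "x \<in> Rn d \<Longrightarrow> 4 * sqrt (real d) * hn x \<le> (gn x)\<^sup>2 + Cphi - 1"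
  using hess1[of x] by (simp add: hn_def gn_def vsq_def sum_nonneg)

lemma hess2': "x \<in> Rn d \<Longrightarrow> 4 * hn x \<le> ((gn x)\<^sup>2 + Cphi') / sqrt Cphi"
  using hess2[of x] by (simp add: hn_def gn_def vsq_def sum_nonneg)

text \<open>Cauchy-Schwarz on the diagonal of the Hessian costs sqrt d; this is why the first
  hypothesis on the Hessian carries that factor.\<close>

lemma laplace_le: "(\<Sum>i<d. pd i (pd i \<phi>) x) \<le> sqrt (real d) * hn x"
proof -
  have "(\<Sum>i<d. pd i (pd i \<phi>) x)\<^sup>2 \<le> real (card {..<d}) * (\<Sum>i<d. (pd i (pd i \<phi>) x)\<^sup>2)"
    using sum_squared_le_sum_of_squares[of "\<lambda>i. pd i (pd i \<phi>) x" "{..<d}"] by (simp add: mult.commute)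
  also have "\<dots> \<le> real d * (hn x)\<^sup>2"
  proof -
    have "(\<Sum>i<d. (pd i (pd i \<phi>) x)\<^sup>2) \<le> (\<Sum>i<d. \<Sum>j<d. (pd i (pd j \<phi>) x)\<^sup>2)"
      by (intro sum_mono member_le_sum) auto
    then show ?thesis by (simp add: hn_sq mult_left_mono)
  qed
  finally have "sqrt ((\<Sum>i<d. pd i (pd i \<phi>) x)\<^sup>2) \<le> sqrt (real d * (hn x)\<^sup>2)" by (rule real_sqrt_le_mono)
  then show ?thesis using hn_nonneg[of x] by (simp add: real_sqrt_mult)
qed

lemma csup_comp0: "csup d f \<Longrightarrow> (\<And>x. f x = 0 \<Longrightarrow> h x = 0) \<Longrightarrow> csup d h"
  unfolding csup_def by blast

text \<open>Integration by parts trades one factor \<open>grad \<phi>\<close> for a derivative: the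
  left side is the integral of \<open>\<Delta>\<phi> g^2 + 2 g grad \<phi> \<cdot> grad g\<close>.
  By the first hypothesis the Laplacian returns a quarter of the left side, and Young's inequality
  returns half of it; dividing by the remaining quarter gives the factors 8 and
  \<open>Cphi - 1\<close>.\<close>

lemma grad_weight_C1c:
  assumes g: "Ck d (Suc 0) g" "csup d g"
  shows "(\<integral>x. (gn x * g x)\<^sup>2 \<partial>M) \<le> 8 * (\<Sum>j<d. \<integral>x. (pd j g x)\<^sup>2 \<partial>M) + (Cphi - 1) * (\<integral>x. (g x)\<^sup>2 \<partial>M)"
proof -
  note gc = Ck_cont[OF g(1)] and gj = Ck_cont[OF Ck_pd'[OF g(1)]] and pc = Ck_cont[OF phijC1] and ppc = Ck_cont[OF Ck_pd'[OF phijC1]]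
  have cs: "csup d (\<lambda>x. (g x)\<^sup>2)" "csup d (\<lambda>x. g x * h x)" "csup d (\<lambda>x. h x * (g x)\<^sup>2)" "csup d (\<lambda>x. (h x * g x)\<^sup>2)" for h
    by (rule csup_comp0[OF g(2)]; simp)+
  have cj: "csup d (\<lambda>x. (pd j g x)\<^sup>2)" if "j < d" for j
    by (rule csup_comp0[OF csup_pd[OF g(2) that]]) simp
  have i1: "(\<integral>x. (pd i \<phi> x * g x)\<^sup>2 \<partial>M) = (\<integral>x. pd i (pd i \<phi>) x * (g x)\<^sup>2 + 2 * (pd i \<phi> x * g x * pd i g x) \<partial>M)" if i: "i < d" for i
  proof -
    define h where "h x = pd i \<phi> x * (g x * g x)" for x
    have gg: "Ck d (Suc 0) (\<lambda>x. g x * g x)" by (intro Ck_mult g)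
    have h1: "Ck d (Suc 0) h" unfolding h_def by (intro Ck_mult g phijC1[OF i])
    have h2: "csup d h" unfolding h_def by (intro csup_mult2 g)
    have "(\<integral>x. (pd i \<phi> x * g x)\<^sup>2 \<partial>M) = (\<integral>x. pd i \<phi> x * h x \<partial>M)" by (simp add: h_def power2_eq_square mult_ac)
    also have "\<dots> = (\<integral>x. pd i h x \<partial>M)" by (rule integral_phij[OF h1 h2 i])
    also have "\<dots> = (\<integral>x. pd i (pd i \<phi>) x * (g x)\<^sup>2 + 2 * (pd i \<phi> x * g x * pd i g x) \<partial>M)"
    proof (rule Bochner_Integration.integral_cong[OF refl])
      fix x assume "x \<in> space M"
      then have "pd i h x = pd i (pd i \<phi>) x * (g x * g x) + pd i \<phi> x * (pd i g x * g x + g x * pd i g x)"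
        by (simp add: h_def[abs_def] pd_mult[OF phijC1[OF i] _ i gg] pd_mult[OF g(1) _ i g(1)])
      then show "pd i h x = pd i (pd i \<phi>) x * (g x)\<^sup>2 + 2 * (pd i \<phi> x * g x * pd i g x)"
        by (simp only:) (simp add: power2_eq_square algebra_simps)
    qed
    finally show ?thesis .
  qed
  have ia: "integrable M (\<lambda>x. (pd i \<phi> x * g x)\<^sup>2)" if "i < d" for i
    by (intro cc_integrable_M continuous_intros gc pc that cs)
  have ib: "integrable M (\<lambda>x. pd i (pd i \<phi>) x * (g x)\<^sup>2 + 2 * (pd i \<phi> x * g x * pd i g x))" if "i < d" for i
    by (intro cc_integrable_M continuous_intros gc pc ppc gj that csup_add csup_mult2[of _ "\<lambda>x. pd i \<phi> x * g x * pd i g x"] csup_mult2 cs csup_pd g)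
  have ic: "integrable M (\<lambda>x. (pd j g x)\<^sup>2)" if "j < d" for j
    by (intro cc_integrable_M continuous_intros gj that cj)
  have id: "integrable M (\<lambda>x. (gn x * g x)\<^sup>2)" by (intro cc_integrable_M continuous_intros gc gn_cont cs)
  have ie: "integrable M (\<lambda>x. (g x)\<^sup>2)" by (intro cc_integrable_M continuous_intros gc cs)
  define I where "I = (\<integral>x. (gn x * g x)\<^sup>2 \<partial>M)"
  have e: "(gn x * g x)\<^sup>2 = (\<Sum>i<d. (pd i \<phi> x * g x)\<^sup>2)" for x
    by (simp add: power_mult_distrib gn_sq sum_distrib_right)
  have "I = (\<Sum>i<d. \<integral>x. (pd i \<phi> x * g x)\<^sup>2 \<partial>M)"
    unfolding I_def e by (rule Bochner_Integration.integral_sum) (use ia in auto)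
  also have "\<dots> = (\<Sum>i<d. \<integral>x. pd i (pd i \<phi>) x * (g x)\<^sup>2 + 2 * (pd i \<phi> x * g x * pd i g x) \<partial>M)"
    by (intro sum.cong i1) auto
  also have "\<dots> = (\<integral>x. (\<Sum>i<d. pd i (pd i \<phi>) x * (g x)\<^sup>2 + 2 * (pd i \<phi> x * g x * pd i g x)) \<partial>M)"
    by (rule Bochner_Integration.integral_sum[symmetric]) (use ib in auto)
  also have "\<dots> \<le> (\<integral>x. 3/4 * (gn x * g x)\<^sup>2 + (Cphi - 1) / 4 * (g x)\<^sup>2 + 2 * (\<Sum>j<d. (pd j g x)\<^sup>2) \<partial>M)"
  proof (rule integral_mono)
    fix x assume "x \<in> space M"
    then have x: "x \<in> Rn d" by simp
    have a: "(\<Sum>i<d. pd i (pd i \<phi>) x * (g x)\<^sup>2) \<le> ((gn x)\<^sup>2 + Cphi - 1) / 4 * (g x)\<^sup>2"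
      unfolding sum_distrib_right[symmetric] using laplace_le[of x] hess1'[OF x] by (intro mult_right_mono) auto
    have b: "(\<Sum>i<d. 2 * (pd i \<phi> x * g x * pd i g x)) \<le> (\<Sum>i<d. 1/2 * (pd i \<phi> x * g x)\<^sup>2 + 2 * (pd i g x)\<^sup>2)"
    proof (rule sum_mono)
      fix i
      have "0 \<le> (pd i \<phi> x * g x - 2 * pd i g x)\<^sup>2" by simp
      then show "2 * (pd i \<phi> x * g x * pd i g x) \<le> 1/2 * (pd i \<phi> x * g x)\<^sup>2 + 2 * (pd i g x)\<^sup>2"
        by (simp add: power2_diff power_mult_distrib algebra_simps)
    qed
    have "(\<Sum>i<d. pd i (pd i \<phi>) x * (g x)\<^sup>2 + 2 * (pd i \<phi> x * g x * pd i g x))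
      = (\<Sum>i<d. pd i (pd i \<phi>) x * (g x)\<^sup>2) + (\<Sum>i<d. 2 * (pd i \<phi> x * g x * pd i g x))" by (rule sum.distrib)
    also have "\<dots> \<le> ((gn x)\<^sup>2 + Cphi - 1) / 4 * (g x)\<^sup>2 + (1/2 * (gn x * g x)\<^sup>2 + 2 * (\<Sum>j<d. (pd j g x)\<^sup>2))"
      using a b unfolding e sum.distrib sum_distrib_left by linarith
    also have "\<dots> = 3/4 * (gn x * g x)\<^sup>2 + (Cphi - 1) / 4 * (g x)\<^sup>2 + 2 * (\<Sum>j<d. (pd j g x)\<^sup>2)"
      by (simp add: power_mult_distrib algebra_simps add_divide_distrib diff_divide_distrib)
    finally show "(\<Sum>i<d. pd i (pd i \<phi>) x * (g x)\<^sup>2 + 2 * (pd i \<phi> x * g x * pd i g x))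
      \<le> 3/4 * (gn x * g x)\<^sup>2 + (Cphi - 1) / 4 * (g x)\<^sup>2 + 2 * (\<Sum>j<d. (pd j g x)\<^sup>2)" .
  next
    show "integrable M (\<lambda>x. \<Sum>i<d. pd i (pd i \<phi>) x * (g x)\<^sup>2 + 2 * (pd i \<phi> x * g x * pd i g x))"
      by (rule Bochner_Integration.integrable_sum) (use ib in auto)
    show "integrable M (\<lambda>x. 3/4 * (gn x * g x)\<^sup>2 + (Cphi - 1) / 4 * (g x)\<^sup>2 + 2 * (\<Sum>j<d. (pd j g x)\<^sup>2))"
      by (intro Bochner_Integration.integrable_add integrable_mult_right Bochner_Integration.integrable_sum) (use id ie ic in auto)
  qed
  also have "\<dots> = 3/4 * I + (Cphi - 1) / 4 * (\<integral>x. (g x)\<^sup>2 \<partial>M) + 2 * (\<Sum>j<d. \<integral>x. (pd j g x)\<^sup>2 \<partial>M)"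
  proof -
    have s: "integrable M (\<lambda>x. \<Sum>j<d. (pd j g x)\<^sup>2)" by (rule Bochner_Integration.integrable_sum) (use ic in auto)
    have "(\<integral>x. (\<Sum>j<d. (pd j g x)\<^sup>2) \<partial>M) = (\<Sum>j<d. \<integral>x. (pd j g x)\<^sup>2 \<partial>M)"
      by (rule Bochner_Integration.integral_sum) (use ic in auto)
    then show ?thesis using id ie s by (simp add: I_def)
  qed
  finally show ?thesis unfolding I_def by (simp add: field_simps)
qed

text \<open>The coefficients that result when \<open>grad_weight_C1c\<close> is inserted into the
  second hypothesis on the Hessian: \<open>th = 8 / (4 * sqrt Cphi)\<close> belongs to the
  derivatives, \<open>qq\<close> to the function itself.\<close>

definition qq :: real where "qq = (Cphi - 1 + Cphi') / (4 * sqrt Cphi)"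
definition th :: real where "th = 2 / sqrt Cphi"

lemma th_bounds: "0 < th" "th < 3/4" and qq_pos: "0 < qq"
proof -
  show "0 < th" using Cphi8 by (simp add: th_def)
  \<comment> \<open>\<open>th < 3/4\<close> amounts to \<open>sqrt Cphi > 8/3\<close>, and 64/9 < 8.
    That \<open>th\<close> is below 1 permits the absorption in
    \<open>second_derivative_bound\<close>.\<close>
  have "8/3 < sqrt Cphi" by (rule real_less_rsqrt) (use Cphi8 in \<open>simp add: power2_eq_square\<close>)
  then show "th < 3/4" using Cphi8 by (simp add: th_def pos_divide_less_eq)
  show "0 < qq" using Cphi8 Cphi' by (simp add: qq_def)
qed

lemma hess_weight_C1c:
  assumes g: "Ck d (Suc 0) g" "csup d g"
  shows "(\<integral>x. hn x * (g x)\<^sup>2 \<partial>M) \<le> th * (\<Sum>j<d. \<integral>x. (pd j g x)\<^sup>2 \<partial>M) + qq * (\<integral>x. (g x)\<^sup>2 \<partial>M)"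
proof -
  note gc = Ck_cont[OF g(1)]
  have cs: "csup d (\<lambda>x. (g x)\<^sup>2)" "csup d (\<lambda>x. h x * (g x)\<^sup>2)" "csup d (\<lambda>x. (h x * g x)\<^sup>2)" for h
    by (rule csup_comp0[OF g(2)]; simp)+
  have id: "integrable M (\<lambda>x. (gn x * g x)\<^sup>2)" by (intro cc_integrable_M continuous_intros gc gn_cont cs)
  have ie: "integrable M (\<lambda>x. (g x)\<^sup>2)" by (intro cc_integrable_M continuous_intros gc cs)
  have s0: "sqrt Cphi > 0" using Cphi8 by simp
  have "(\<integral>x. hn x * (g x)\<^sup>2 \<partial>M) \<le> (\<integral>x. 1 / (4 * sqrt Cphi) * (gn x * g x)\<^sup>2 + Cphi' / (4 * sqrt Cphi) * (g x)\<^sup>2 \<partial>M)"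
  proof (rule integral_mono)
    show "integrable M (\<lambda>x. hn x * (g x)\<^sup>2)" by (intro cc_integrable_M continuous_intros gc hn_cont cs)
    show "integrable M (\<lambda>x. 1 / (4 * sqrt Cphi) * (gn x * g x)\<^sup>2 + Cphi' / (4 * sqrt Cphi) * (g x)\<^sup>2)" using id ie by simp
    fix x assume "x \<in> space M"
    then have "hn x \<le> ((gn x)\<^sup>2 + Cphi') / (4 * sqrt Cphi)" using hess2'[of x] s0 by (simp add: field_simps)
    then have "hn x * (g x)\<^sup>2 \<le> ((gn x)\<^sup>2 + Cphi') / (4 * sqrt Cphi) * (g x)\<^sup>2" by (rule mult_right_mono) simp
    then show "hn x * (g x)\<^sup>2 \<le> 1 / (4 * sqrt Cphi) * (gn x * g x)\<^sup>2 + Cphi' / (4 * sqrt Cphi) * (g x)\<^sup>2"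
      by (simp add: power_mult_distrib algebra_simps add_divide_distrib)
  qed
  also have "\<dots> = 1 / (4 * sqrt Cphi) * (\<integral>x. (gn x * g x)\<^sup>2 \<partial>M) + Cphi' / (4 * sqrt Cphi) * (\<integral>x. (g x)\<^sup>2 \<partial>M)"
    using id ie by simp
  also have "\<dots> \<le> 1 / (4 * sqrt Cphi) * (8 * (\<Sum>j<d. \<integral>x. (pd j g x)\<^sup>2 \<partial>M) + (Cphi - 1) * (\<integral>x. (g x)\<^sup>2 \<partial>M)) + Cphi' / (4 * sqrt Cphi) * (\<integral>x. (g x)\<^sup>2 \<partial>M)"
    using grad_weight_C1c[OF g] s0 by (intro add_right_mono mult_left_mono) auto
  also have "\<dots> = th * (\<Sum>j<d. \<integral>x. (pd j g x)\<^sup>2 \<partial>M) + qq * (\<integral>x. (g x)\<^sup>2 \<partial>M)"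
    using s0 by (simp add: th_def qq_def field_simps)
  finally show ?thesis .
qed

subsection \<open>Weak derivatives in the weighted space\<close>

text \<open>The weighted Sobolev space as the closure of the test functions, with g as gradient of
  f: inequalities for test functions extend by passing to the limit. \<open>weak_h1lim\<close> and
  \<open>h1lim_weak_pd\<close> connect it with weak derivatives.\<close>

definition h1lim :: "(point \<Rightarrow> real) \<Rightarrow> (nat \<Rightarrow> point \<Rightarrow> real) \<Rightarrow> bool" where
  "h1lim f g \<longleftrightarrow> (\<exists>\<eta>. (\<forall>n. test_fun d (\<eta> n)) \<and> L2c M \<eta> f \<and> (\<forall>j<d. L2c M (\<lambda>n. pd j (\<eta> n)) (g j)))"

lemma h1limI:
  "(\<And>n. test_fun d (\<eta> n)) \<Longrightarrow> L2c M \<eta> f \<Longrightarrow> (\<And>j. j < d \<Longrightarrow> L2c M (\<lambda>n. pd j (\<eta> n)) (g j)) \<Longrightarrow> h1lim f g"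
  unfolding h1lim_def by (rule exI[of _ \<eta>]) simp

lemma h1limE:
  assumes "h1lim f g"
  obtains \<eta> where "\<forall>n. test_fun d (\<eta> n)" "L2c M \<eta> f" "\<forall>j<d. L2c M (\<lambda>n. pd j (\<eta> n)) (g j)"
  using assms unfolding h1lim_def by (elim exE conjE)

lemma h1lim_sqi:
  assumes "h1lim f g" shows "sqi M f" "j < d \<Longrightarrow> sqi M (g j)"
  using assms by (auto elim!: h1limE dest: L2cD(2))

text \<open>A diagonal sequence; as there are finitely many derivatives, one index serves the
  function and all of them.\<close>

lemma h1lim_closed:
  assumes h: "\<And>N. h1lim (F N) (G N)" and f: "L2c M F f" and g: "\<And>j. j < d \<Longrightarrow> L2c M (\<lambda>N. G N j) (g j)"
  shows "h1lim f g"
proof -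
  define P where "P N \<eta> \<longleftrightarrow> test_fun d \<eta> \<and> (\<integral>x. (\<eta> x - F N x)\<^sup>2 \<partial>M) \<le> 1 / real (Suc N)
    \<and> (\<forall>j<d. (\<integral>x. (pd j \<eta> x - G N j x)\<^sup>2 \<partial>M) \<le> 1 / real (Suc N))" for N \<eta>
  have ex: "\<exists>\<eta>. P N \<eta>" for N
  proof -
    obtain \<eta> where e: "\<forall>n. test_fun d (\<eta> n)" "L2c M \<eta> (F N)" "\<forall>j<d. L2c M (\<lambda>n. pd j (\<eta> n)) (G N j)"
      using h[of N] by (rule h1limE)
    have p: "0 < 1 / real (Suc N)" by simp
    have "\<forall>\<^sub>F n in sequentially. (\<integral>x. (\<eta> n x - F N x)\<^sup>2 \<partial>M) < 1 / real (Suc N)"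
      by (rule order_tendstoD(2)[OF L2cD(3)[OF e(2)] p])
    moreover have "\<forall>\<^sub>F n in sequentially. \<forall>j\<in>{..<d}. (\<integral>x. (pd j (\<eta> n) x - G N j x)\<^sup>2 \<partial>M) < 1 / real (Suc N)"
    proof (rule eventually_ball_finite, simp, rule ballI)
      fix j assume "j \<in> {..<d}"
      then have "L2c M (\<lambda>n. pd j (\<eta> n)) (G N j)" using e(3) by simp
      from order_tendstoD(2)[OF L2cD(3)[OF this] p]
      show "\<forall>\<^sub>F n in sequentially. (\<integral>x. (pd j (\<eta> n) x - G N j x)\<^sup>2 \<partial>M) < 1 / real (Suc N)" .
    qed
    ultimately have "\<forall>\<^sub>F n in sequentially. (\<integral>x. (\<eta> n x - F N x)\<^sup>2 \<partial>M) < 1 / real (Suc N) \<and> (\<forall>j\<in>{..<d}. (\<integral>x. (pd j (\<eta> n) x - G N j x)\<^sup>2 \<partial>M) < 1 / real (Suc N))"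
      by (rule eventually_conj)
    from eventually_happens[OF this] obtain n where "(\<integral>x. (\<eta> n x - F N x)\<^sup>2 \<partial>M) < 1 / real (Suc N)" "\<forall>j\<in>{..<d}. (\<integral>x. (pd j (\<eta> n) x - G N j x)\<^sup>2 \<partial>M) < 1 / real (Suc N)" by auto
    then show ?thesis using e(1) unfolding P_def by (intro exI[of _ "\<eta> n"]) (auto intro: less_imp_le)
  qed
  have "\<exists>\<eta>. \<forall>N. P N (\<eta> N)" by (rule choice) (intro allI ex)
  then obtain \<eta> where \<eta>: "\<forall>N. P N (\<eta> N)" by (elim exE)
  have e: "test_fun d (\<eta> N)" "(\<integral>x. (\<eta> N x - F N x)\<^sup>2 \<partial>M) \<le> 1 / real (Suc N)"
    "j < d \<Longrightarrow> (\<integral>x. (pd j (\<eta> N) x - G N j x)\<^sup>2 \<partial>M) \<le> 1 / real (Suc N)" for N j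
    using spec[OF \<eta>, of N] unfolding P_def by simp_all
  show ?thesis
  proof (rule h1limI[OF e(1)])
    show "L2c M \<eta> f" by (rule L2c_approx[OF f test_fun_sqi[OF e(1)] e(2)])
    show "L2c M (\<lambda>n. pd j (\<eta> n)) (g j)" if "j < d" for j
      by (rule L2c_approx[OF g[OF that] test_fun_sqi[OF test_fun_pd[OF e(1) that]] e(3)[OF that]])
  qed
qed

text \<open>The Meyers-Serrin argument, cutting off and then mollifying. On a box the weight is
  bounded above and below, so the unweighted convergence of mollifications suffices; globally only
  the cut-off has to be removed, and its derivatives disappear in the limit.\<close>

theorem weak_h1lim:
  assumes f: "sqi M f" and g: "\<And>j. j < d \<Longrightarrow> sqi M (g j)" and w: "\<And>j. j < d \<Longrightarrow> weak_pd d j f (g j)"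
  shows "h1lim f g"
proof (rule h1lim_closed)
  define \<kappa> where "\<kappa> = cuts d"
  \<comment> \<open>\<open>cuts d N\<close> vanishes off \<open>bx d (N + 2)\<close> and the
    mollification radii are at most 1, so truncation at N + 3 does not affect the products.\<close>
  define S where "S N = real N + 3" for N :: nat
  note \<kappa>t = cuts_test_fun[of d, folded \<kappa>_def] and \<kappa>m = cuts_meas[of d, folded \<kappa>_def] and \<kappa>jm = pd_cuts_meas[of _ d, folded \<kappa>_def]
    and \<kappa>b = cuts_le_1[of d, folded \<kappa>_def] and \<kappa>0 = cuts_eq_0[of _ d, folded \<kappa>_def]
  obtain C where C: "\<forall>N x. \<forall>j<d. \<bar>pd j (\<kappa> N) x\<bar> \<le> C" using pd_cuts_bounded[of d] unfolding \<kappa>_def by blast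
  have \<kappa>jb: "\<bar>pd j (\<kappa> N) x\<bar> \<le> C" if "j < d" for j N x using C that by simp
  have \<kappa>j0: "pd j (\<kappa> N) x = 0" if x: "x \<in> Rn d" "x \<notin> bx d (real N + 2)" and j: "j < d" for N x j
    by (rule pd_eq_0_outside[OF \<kappa>0 x j])
  show "h1lim (\<lambda>x. \<kappa> N x * f x) (\<lambda>j x. pd j (\<kappa> N) x * f x + \<kappa> N x * g j x)" for N
  proof -
    define f' where "f' x = f x * indicator (bx d (S N)) x" for x
    define g' where "g' j x = g j x * indicator (bx d (S N)) x" for j x
    have f's: "sqi (leb d) f'" unfolding f'_def by (rule sqi_trunc1[OF f])
    have g's: "sqi (leb d) (g' j)" if "j < d" for j unfolding g'_def by (rule sqi_trunc1[OF g[OF that]])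
    have f'i: "integrable (leb d) f'" unfolding f'_def by (rule sq_int_trunc[OF sqi_trunc1[OF f]])
    have f'l: "L2c (leb d) (mo d f') f'" by (rule moll_L2c[OF f's, of "S N"]) (simp add: f'_def)
    have g'l: "L2c (leb d) (mo d (g' j)) (g' j)" if "j < d" for j by (rule moll_L2c[OF g's[OF that], of "S N"]) (simp add: g'_def)
    have e: "1 / real (Suc n) > 0" "1 / real (Suc n) \<le> 1" for n by auto
    define \<eta> where "\<eta> n x = \<kappa> N x * mo d f' n x" for n x
    have mt: "test_fun d (mo d f' n)" for n by (rule moll_test_fun[OF e(1) f'i, of "S N"]) (simp add: f'_def)
    have t: "test_fun d (\<eta> n)" for n unfolding \<eta>_def by (rule test_fun_mult[OF \<kappa>t mt])
    have bS: "x \<in> bx d (S N)" if "x \<in> bx d (real N + 2)" for x using bx_mono[of "real N + 2" "S N" x d] that by (simp add: S_def)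
    have pde: "pd j (\<eta> n) x = pd j (\<kappa> N) x * mo d f' n x + \<kappa> N x * mo d (g' j) n x" if x: "x \<in> Rn d" and j: "j < d" for n j x
    proof -
      have "Ck d (Suc 0) (\<kappa> N)" "Ck d (Suc 0) (mo d f' n)" using \<kappa>t[of N] mt[of n] unfolding test_fun_iff by blast+
      then have 1: "pd j (\<eta> n) x = pd j (\<kappa> N) x * mo d f' n x + \<kappa> N x * pd j (mo d f' n) x"
        unfolding \<eta>_def by (rule pd_mult[OF _ x j])
      show ?thesis
      proof (cases "x \<in> bx d (real N + 2)")
        case True
        have "pd j (mo d f' n) x = mo d (g' j) n x"
          unfolding pd_moll[OF f'i j] unfolding f'_def g'_def
          by (rule moll_weak_pd[OF w[OF j] j e(1) True]) (use e(2)[of n] in \<open>simp add: S_def\<close>)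
        then show ?thesis using 1 by simp
      next
        case False
        then show ?thesis using 1 \<kappa>0[OF x] by simp
      qed
    qed
    show ?thesis
    proof (rule h1limI[OF t])
      have "L2c M (\<lambda>n x. \<kappa> N x * mo d f' n x) (\<lambda>x. \<kappa> N x * f' x)"
        by (rule sqi_leb_M(2)[OF f's \<kappa>m \<kappa>0 \<kappa>b L2cD(1)[OF f'l] f'l])
      then show "L2c M \<eta> (\<lambda>x. \<kappa> N x * f x)"
      proof (rule L2c_cong)
        show "\<kappa> N x * f' x = \<kappa> N x * f x" if "x \<in> space M" for x
          using \<kappa>0[of x N] that bS[of x] by (cases "x \<in> bx d (real N + 2)") (auto simp: f'_def)
      qed (simp add: \<eta>_def)
      fix j assume j: "j < d"
      have "L2c M (\<lambda>n x. pd j (\<kappa> N) x * mo d f' n x + \<kappa> N x * mo d (g' j) n x) (\<lambda>x. pd j (\<kappa> N) x * f' x + \<kappa> N x * g' j x)"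
        by (intro L2c_add sqi_leb_M(2)[OF f's \<kappa>jm[OF j] \<kappa>j0 \<kappa>jb[OF j] L2cD(1)[OF f'l] f'l]
            sqi_leb_M(2)[OF g's[OF j] \<kappa>m \<kappa>0 \<kappa>b L2cD(1)[OF g'l[OF j]] g'l[OF j]]) (use j in auto)
      then show "L2c M (\<lambda>n. pd j (\<eta> n)) (\<lambda>x. pd j (\<kappa> N) x * f x + \<kappa> N x * g j x)"
      proof (rule L2c_cong)
        show "pd j (\<kappa> N) x * mo d f' n x + \<kappa> N x * mo d (g' j) n x = pd j (\<eta> n) x" if "x \<in> space M" for n x
          using pde[OF _ j, of x n] that by simp
        show "pd j (\<kappa> N) x * f' x + \<kappa> N x * g' j x = pd j (\<kappa> N) x * f x + \<kappa> N x * g j x" if "x \<in> space M" for x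
          using \<kappa>0[of x N] \<kappa>j0[of x N j] j that bS[of x] by (cases "x \<in> bx d (real N + 2)") (auto simp: f'_def g'_def)
      qed
    qed
  qed
  show "L2c M (\<lambda>N x. \<kappa> N x * f x) f" unfolding \<kappa>_def by (rule L2c_cuts[OF sets_M f])
  show "L2c M (\<lambda>N x. pd j (\<kappa> N) x * f x + \<kappa> N x * g j x) (g j)" if j: "j < d" for j
    using L2c_add[OF L2c_pd_cuts[OF sets_M f j] L2c_cuts[OF sets_M g[OF j]]] by (simp add: \<kappa>_def)
qed

section \<open>Inequalities for Sobolev functions\<close>

lemma variance_eq:
  assumes "sqi M h"
  shows "(\<integral>x. (h x - (\<integral>x. h x \<partial>M))\<^sup>2 \<partial>M) = (\<integral>x. (h x)\<^sup>2 \<partial>M) - (\<integral>x. h x \<partial>M)\<^sup>2"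
proof -
  define m where "m = (\<integral>x. h x \<partial>M)"
  have "(\<integral>x. (h x - m)\<^sup>2 \<partial>M) = (\<integral>x. (h x)\<^sup>2 - 2 * m * h x + m\<^sup>2 \<partial>M)" by (simp add: power2_diff algebra_simps)
  also have "\<dots> = (\<integral>x. (h x)\<^sup>2 \<partial>M) - 2 * m * m + m\<^sup>2"
    using sqiD(2)[OF assms] sqi_integrable[OF fm assms] by (simp add: m_def measure_M)
  finally show ?thesis by (simp add: m_def power2_eq_square)
qed

text \<open>Written as second moment minus squared mean, both continuous in L2, the variance passes
  to the limit.\<close>

lemma h1lim_poincare:
  assumes "h1lim f g"
  shows "(\<integral>x. (f x - (\<integral>x. f x \<partial>M))\<^sup>2 \<partial>M) \<le> CP * (\<Sum>j<d. \<integral>x. (g j x)\<^sup>2 \<partial>M)"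
proof -
  obtain \<eta> where e: "\<forall>n. test_fun d (\<eta> n)" "L2c M \<eta> f" "\<forall>j<d. L2c M (\<lambda>n. pd j (\<eta> n)) (g j)" using assms by (rule h1limE)
  have le: "(\<integral>x. (\<eta> n x)\<^sup>2 \<partial>M) - (\<integral>x. \<eta> n x \<partial>M)\<^sup>2 \<le> CP * (\<Sum>j<d. \<integral>x. (pd j (\<eta> n) x)\<^sup>2 \<partial>M)" for n
  proof -
    have t: "test_fun d (\<eta> n)" using e(1) by simp
    have "vnorm2 d \<phi> (grad (\<eta> n)) = (\<Sum>j<d. \<integral>x. (pd j (\<eta> n) x)\<^sup>2 \<partial>M)"
      unfolding vnorm2_def vsq_def grad_def
      by (rule Bochner_Integration.integral_sum) (use test_fun_sqi[OF test_fun_pd[OF t]] in \<open>auto simp: sqi_def\<close>)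
    moreover have "norm2 d \<phi> (\<lambda>x. \<eta> n x - mean d \<phi> (\<eta> n)) \<le> CP * vnorm2 d \<phi> (grad (\<eta> n))"
      using poin t unfolding poincare_def by blast
    ultimately show ?thesis using variance_eq[OF test_fun_sqi[OF t]] by (simp add: norm2_def mean_def)
  qed
  have "(\<integral>x. (f x)\<^sup>2 \<partial>M) - (\<integral>x. f x \<partial>M)\<^sup>2 \<le> CP * (\<Sum>j<d. \<integral>x. (g j x)\<^sup>2 \<partial>M)"
  proof (rule LIMSEQ_le)
    show "(\<lambda>n. (\<integral>x. (\<eta> n x)\<^sup>2 \<partial>M) - (\<integral>x. \<eta> n x \<partial>M)\<^sup>2) \<longlonglongrightarrow> (\<integral>x. (f x)\<^sup>2 \<partial>M) - (\<integral>x. f x \<partial>M)\<^sup>2"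
      by (intro tendsto_intros L2c_norm L2c_integral[OF fm] e)
    show "(\<lambda>n. CP * (\<Sum>j<d. \<integral>x. (pd j (\<eta> n) x)\<^sup>2 \<partial>M)) \<longlonglongrightarrow> CP * (\<Sum>j<d. \<integral>x. (g j x)\<^sup>2 \<partial>M)"
      by (intro tendsto_intros L2c_norm) (use e(3) in auto)
  qed (use le in auto)
  then show ?thesis using variance_eq[OF h1lim_sqi(1)[OF assms]] by simp
qed

text \<open>\<open>gn\<close> may be unbounded, so \<open>gn x * f x\<close> is not directly a limit
  in L2. With the weight truncated to a box the inequality passes to the limit in the test
  functions; Fatou's lemma then removes the truncation and yields square integrability.\<close>

lemma h1lim_grad_weight:
  assumes "h1lim f g"
  shows "sqi M (\<lambda>x. gn x * f x)"
    "(\<integral>x. (gn x * f x)\<^sup>2 \<partial>M) \<le> 8 * (\<Sum>j<d. \<integral>x. (g j x)\<^sup>2 \<partial>M) + (Cphi - 1) * (\<integral>x. (f x)\<^sup>2 \<partial>M)" (is "_ \<le> ?R")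
proof -
  obtain \<eta> where e: "\<forall>n. test_fun d (\<eta> n)" "L2c M \<eta> f" "\<forall>j<d. L2c M (\<lambda>n. pd j (\<eta> n)) (g j)" using assms by (rule h1limE)
  have f: "sqi M f" by (rule h1lim_sqi(1)[OF assms])
  have gm: "gn \<in> borel_measurable (leb d)" by (rule cont_meas[OF gn_cont])
  define w where "w R x = gn x * indicator (bx d (real R)) x" for R :: nat and x
  have wm: "w R \<in> borel_measurable M" for R unfolding w_def meas_M using gm by measurable
  have wb: "\<exists>B. \<forall>x. \<bar>w R x\<bar> \<le> B" for R
  proof -
    obtain B where "B \<ge> 0" "\<forall>x\<in>bx d (real R). \<bar>gn x\<bar> \<le> B" using bdd_on_bx[OF gn_cont] by blast
    then have "\<bar>w R x\<bar> \<le> B" for x by (cases "x \<in> bx d (real R)") (auto simp: w_def)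
    then show ?thesis by blast
  qed
  have ws: "sqi M (\<lambda>x. w R x * f x)" for R
  proof -
    obtain B where "\<forall>x. \<bar>w R x\<bar> \<le> B" using wb by blast
    then show ?thesis by (intro sqi_mult_bdd[OF f wm, of R B]) auto
  qed
  have wle: "(\<integral>x. (w R x * f x)\<^sup>2 \<partial>M) \<le> ?R" for R
  proof (rule LIMSEQ_le)
    obtain B where B: "\<forall>x. \<bar>w R x\<bar> \<le> B" using wb by blast
    show "(\<lambda>n. \<integral>x. (w R x * \<eta> n x)\<^sup>2 \<partial>M) \<longlonglongrightarrow> (\<integral>x. (w R x * f x)\<^sup>2 \<partial>M)"
      by (intro L2c_norm L2c_mult_bdd[OF e(2) wm, of R B]) (use B in auto)
    show "(\<lambda>n. 8 * (\<Sum>j<d. \<integral>x. (pd j (\<eta> n) x)\<^sup>2 \<partial>M) + (Cphi - 1) * (\<integral>x. (\<eta> n x)\<^sup>2 \<partial>M)) \<longlonglongrightarrow> ?R"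
      by (intro tendsto_intros L2c_norm e) (use e(3) in auto)
    have "(\<integral>x. (w R x * \<eta> n x)\<^sup>2 \<partial>M) \<le> 8 * (\<Sum>j<d. \<integral>x. (pd j (\<eta> n) x)\<^sup>2 \<partial>M) + (Cphi - 1) * (\<integral>x. (\<eta> n x)\<^sup>2 \<partial>M)" for n
    proof -
      have t: "test_fun d (\<eta> n)" using e(1) by simp
      have t1: "Ck d (Suc 0) (\<eta> n)" and t2: "csup d (\<eta> n)" using t unfolding test_fun_iff by blast+
      have "(\<integral>x. (w R x * \<eta> n x)\<^sup>2 \<partial>M) \<le> (\<integral>x. (gn x * \<eta> n x)\<^sup>2 \<partial>M)"
      proof (rule integral_mono)
        have "sqi M (\<lambda>x. w R x * \<eta> n x)" by (rule sqi_mult_bdd[OF test_fun_sqi[OF t] wm, of R B]) (use B in auto)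
        then show "integrable M (\<lambda>x. (w R x * \<eta> n x)\<^sup>2)" by (rule sqiD)
        have "sqi M (\<lambda>x. gn x * \<eta> n x)" by (intro cc_sqi continuous_intros gn_cont Ck_cont[OF t1] csup_mult2 t2)
        then show "integrable M (\<lambda>x. (gn x * \<eta> n x)\<^sup>2)" by (rule sqiD)
        show "(w R x * \<eta> n x)\<^sup>2 \<le> (gn x * \<eta> n x)\<^sup>2" for x by (cases "x \<in> bx d (real R)") (auto simp: w_def)
      qed
      also have "\<dots> \<le> 8 * (\<Sum>j<d. \<integral>x. (pd j (\<eta> n) x)\<^sup>2 \<partial>M) + (Cphi - 1) * (\<integral>x. (\<eta> n x)\<^sup>2 \<partial>M)"
        by (rule grad_weight_C1c[OF t1 t2])
      finally show ?thesis .
    qed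
    then show "\<exists>N. \<forall>n\<ge>N. (\<integral>x. (w R x * \<eta> n x)\<^sup>2 \<partial>M) \<le> 8 * (\<Sum>j<d. \<integral>x. (pd j (\<eta> n) x)\<^sup>2 \<partial>M) + (Cphi - 1) * (\<integral>x. (\<eta> n x)\<^sup>2 \<partial>M)" by blast
  qed
  have lim: "AE x in M. (\<lambda>R. w R x * f x) \<longlonglongrightarrow> gn x * f x"
  proof (rule AE_I2)
    fix x assume "x \<in> space M"
    then have "x \<in> Rn d" by simp
    then obtain N where N: "\<And>n. n \<ge> N \<Longrightarrow> x \<in> bx d (real n)" using bx_exhaust by metis
    then have "w R x * f x = gn x * f x" if "R \<ge> N" for R using that by (simp add: w_def)
    then show "(\<lambda>R. w R x * f x) \<longlonglongrightarrow> gn x * f x" by (intro tendsto_eventually) (auto simp: eventually_sequentially)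
  qed
  have m: "(\<lambda>x. gn x * f x) \<in> borel_measurable M" using gm sqiD(1)[OF f] by (simp add: meas_M)
  show "sqi M (\<lambda>x. gn x * f x)" "(\<integral>x. (gn x * f x)\<^sup>2 \<partial>M) \<le> ?R"
    using Fatou_sq[OF ws m lim, of 0 ?R] wle by auto
qed

lemma h1lim_add:
  assumes "h1lim f g" "h1lim f' g'" shows "h1lim (\<lambda>x. f x + f' x) (\<lambda>j x. g j x + g' j x)"
proof -
  obtain \<eta> where e: "\<forall>n. test_fun d (\<eta> n)" "L2c M \<eta> f" "\<forall>j<d. L2c M (\<lambda>n. pd j (\<eta> n)) (g j)" using assms(1) by (rule h1limE)
  obtain \<zeta> where z: "\<forall>n. test_fun d (\<zeta> n)" "L2c M \<zeta> f'" "\<forall>j<d. L2c M (\<lambda>n. pd j (\<zeta> n)) (g' j)" using assms(2) by (rule h1limE)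
  show ?thesis
  proof (rule h1limI)
    show "test_fun d (\<lambda>x. \<eta> n x + \<zeta> n x)" for n by (intro test_fun_add) (use e z in auto)
    show "L2c M (\<lambda>n x. \<eta> n x + \<zeta> n x) (\<lambda>x. f x + f' x)" by (intro L2c_add e z)
    fix j assume j: "j < d"
    have "L2c M (\<lambda>n x. pd j (\<eta> n) x + pd j (\<zeta> n) x) (\<lambda>x. g j x + g' j x)" by (intro L2c_add) (use e z j in auto)
    then show "L2c M (\<lambda>n. pd j (\<lambda>x. \<eta> n x + \<zeta> n x)) (\<lambda>x. g j x + g' j x)"
    proof (rule L2c_cong)
      fix n x assume x: "x \<in> space M"
      have "Ck d (Suc 0) (\<eta> n)" "Ck d (Suc 0) (\<zeta> n)" using e(1) z(1) unfolding test_fun_iff by blast+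
      then show "pd j (\<eta> n) x + pd j (\<zeta> n) x = pd j (\<lambda>x. \<eta> n x + \<zeta> n x) x" using pd_add[of d 0 "\<eta> n" x j 0 "\<zeta> n"] x j by simp
    qed simp
  qed
qed

lemma C1_weak_pd:
  assumes f: "Ck d (Suc k) f" and j: "j < d" shows "weak_pd d j f (pd j f)"
proof -
  have li: "loc_int d h" if hc: "continuous_on (Rn d) h" for h
  proof -
    have "set_integrable (leb d) (bx d r) h" for r
    proof -
      obtain C where C: "\<forall>x\<in>bx d r. \<bar>h x\<bar> \<le> C" using bdd_on_bx[OF hc] by blast
      have [measurable]: "h \<in> borel_measurable (leb d)" by (rule cont_meas[OF hc])
      show ?thesis unfolding set_integrable_def
        by (rule integrable_bdd_bx[of _ d r C]) (use C in auto)
    qed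
    then show ?thesis by (simp add: loc_int_def bx_def)
  qed
  have "(\<integral>x. f x * pd j \<psi> x \<partial>leb d) = - (\<integral>x. pd j f x * \<psi> x \<partial>leb d)" if "test_fun d \<psi>" for \<psi>
    using ibp_leb[OF f _ _ j, of 0 \<psi>] that unfolding test_fun_iff by simp
  then show ?thesis using li[OF Ck_cont[OF f]] li[OF Ck_cont[OF Ck_pd'[OF f j]]] by (simp add: weak_pd_def)
qed

lemma C1_h1lim:
  assumes "Ck d (Suc k) f" "sqi M f" "\<And>j. j < d \<Longrightarrow> sqi M (pd j f)"
  shows "h1lim f (\<lambda>j. pd j f)"
proof (rule weak_h1lim[where g = "\<lambda>j. pd j f"])
  show "sqi M f" by fact
  show "sqi M (pd j f)" if "j < d" for j by (rule assms(3)[OF that])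
  show "weak_pd d j f (pd j f)" if "j < d" for j by (rule C1_weak_pd[OF assms(1) that])
qed

text \<open>The density is positive, so the null sets are the same and uniqueness statements for
  Lebesgue measure transfer.\<close>

lemma AE_M_iff: "(AE x in M. P x) \<longleftrightarrow> (AE x in leb d. P x)"
proof -
  have "(\<lambda>x. ennreal (rho x)) \<in> borel_measurable (leb d)" by measurable
  from AE_density[OF this, of P] show ?thesis unfolding mu_rho by (simp add: rho_pos)
qed

subsection \<open>The range of the weighted Laplacian\<close>

definition Lap :: "(point \<Rightarrow> real) \<Rightarrow> point \<Rightarrow> real" where
  "Lap \<psi> x = (\<Sum>j<d. pd j \<phi> x * pd j \<psi> x - pd j (pd j \<psi>) x)"

lemma Lap_cont:
  assumes p: "Ck d (Suc (Suc 0)) \<psi>" shows "continuous_on (Rn d) (Lap \<psi>)"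
  unfolding Lap_def
  by (intro continuous_intros Ck_cont[OF phijC1] Ck_cont[OF Ck_pd'[OF p]] Ck_cont[OF Ck_pd'[OF Ck_pd'[OF p]]]) auto

lemma Lap_csup:
  assumes p: "csup d \<psi>" shows "csup d (Lap \<psi>)"
  unfolding Lap_def
proof (rule csup_sum)
  fix j assume "j \<in> {..<d}"
  then have j: "j < d" by simp
  have "csup d (\<lambda>x. - pd j (pd j \<psi>) x)" by (rule csup_comp0[OF csup_pd[OF csup_pd[OF p j] j]]) simp
  from csup_add[OF csup_mult2[OF csup_pd[OF p j], of "pd j \<phi>"] this]
  show "csup d (\<lambda>x. pd j \<phi> x * pd j \<psi> x - pd j (pd j \<psi>) x)" by simp
qed

lemma Lap_sqi: "test_fun d \<psi> \<Longrightarrow> sqi M (Lap \<psi>)"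
  by (intro cc_sqi Lap_cont Lap_csup test_funD)

lemma Lap_mean:
  assumes t: "test_fun d \<psi>" shows "(\<integral>x. Lap \<psi> x \<partial>M) = 0"
proof -
  have s: "sqi M (\<lambda>x. pd j \<phi> x * pd j \<psi> x)" "sqi M (pd j (pd j \<psi>))" if "j < d" for j
  proof -
    show "sqi M (\<lambda>x. pd j \<phi> x * pd j \<psi> x)"
      using that by (intro cc_sqi continuous_intros csup_mult2 csup_pd test_funD(2)[OF t] Ck_cont[OF phijC1] Ck_cont[OF Ck_pd'[OF test_funD(1)[OF t, of "Suc 0"]]])
    show "sqi M (pd j (pd j \<psi>))" by (intro test_fun_sqi test_fun_pd t that)
  qed
  have "(\<integral>x. Lap \<psi> x \<partial>M) = (\<Sum>j<d. \<integral>x. pd j \<phi> x * pd j \<psi> x - pd j (pd j \<psi>) x \<partial>M)"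
    unfolding Lap_def by (rule Bochner_Integration.integral_sum) (use s sqi_integrable[OF fm] in auto)
  also have "\<dots> = (\<Sum>j<d. 0)"
  proof (rule sum.cong[OF refl])
    fix j assume "j \<in> {..<d}"
    then have j: "j < d" by simp
    have "(\<integral>x. pd j \<phi> x * pd j \<psi> x \<partial>M) = (\<integral>x. pd j (pd j \<psi>) x \<partial>M)"
      by (rule integral_phij[OF test_funD(1)[OF test_fun_pd[OF t j], of "Suc 0"] test_funD(2)[OF test_fun_pd[OF t j]] j])
    then show "(\<integral>x. pd j \<phi> x * pd j \<psi> x - pd j (pd j \<psi>) x \<partial>M) = 0"
      using sqi_integrable[OF fm s(1)[OF j]] sqi_integrable[OF fm s(2)[OF j]] by simp
  qed
  finally show ?thesis by simp
qed

text \<open>Caccioppoli estimate for the mollification \<open>H\<close> of \<open>r * rho\<close>: the equation for \<open>H / rho\<close> holds up to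
  the commutator \<open>E\<close> of multiplication by \<open>grad \<phi>\<close> with mollification, which enters without derivatives.\<close>

lemma caccioppoli:
  assumes H: "Ck d (Suc (Suc 0)) H" and K: "\<And>j. j < d \<Longrightarrow> Ck d (Suc 0) (K j)"
    and eq: "\<And>x. x \<in> bx d R \<Longrightarrow> (\<Sum>j<d. pd j (K j) x + pd j (pd j H) x) = 0"
    and \<kappa>: "test_fun d \<kappa>" "\<And>x. x \<in> Rn d \<Longrightarrow> x \<notin> bx d R \<Longrightarrow> \<kappa> x = 0"
  defines "v \<equiv> \<lambda>x. \<kappa> x * (H x * exp (\<phi> x))"
  shows "Ck d (Suc 0) v" "csup d v"
    "(\<Sum>j<d. \<integral>x. (pd j v x)\<^sup>2 \<partial>M) \<le> 2 * (\<Sum>j<d. \<integral>x. (\<kappa> x * exp (\<phi> x) * (pd j \<phi> x * H x - K j x))\<^sup>2 \<partial>M)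
      + 3 * (\<Sum>j<d. \<integral>x. (pd j \<kappa> x * exp (\<phi> x) * H x)\<^sup>2 \<partial>M)"
proof -
  define rt where "rt x = H x * exp (\<phi> x)" for x
  have p1: "Ck d (Suc 0) \<phi>" by (rule Ck_le[OF phiC2]) simp
  have H1: "Ck d (Suc 0) H" by (rule Ck_le[OF H]) simp
  have ex1: "Ck d (Suc 0) (\<lambda>x. exp (\<phi> x))" by (rule Ck_exp[OF p1])
  have rt1: "Ck d (Suc 0) rt" unfolding rt_def by (intro Ck_mult H1 ex1)
  have k1: "Ck d (Suc 0) \<kappa>" by (rule test_funD(1)[OF \<kappa>(1)])
  have ks: "csup d \<kappa>" by (rule test_funD(2)[OF \<kappa>(1)])
  show v1: "Ck d (Suc 0) v" unfolding v_def rt_def[symmetric] by (intro Ck_mult k1 rt1)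
  show v2: "csup d v" unfolding v_def by (intro csup_mult1 ks)
  \<comment> \<open>The usual test function for such an estimate, the squared cut-off times
    \<open>H / rho\<close>.\<close>
  define \<zeta> where "\<zeta> x = \<kappa> x * v x" for x
  have z1: "Ck d (Suc 0) \<zeta>" unfolding \<zeta>_def by (intro Ck_mult k1 v1)
  have z2: "csup d \<zeta>" unfolding \<zeta>_def by (intro csup_mult1 ks)
  define e where "e j x = \<kappa> x * exp (\<phi> x) * (pd j \<phi> x * H x - K j x)" for j x
  define b where "b j x = pd j \<kappa> x * exp (\<phi> x) * H x" for j x
  have ct: "continuous_on (Rn d) H" "continuous_on (Rn d) \<phi>" "continuous_on (Rn d) \<kappa>" "continuous_on (Rn d) v" "continuous_on (Rn d) \<zeta>"
    by (intro Ck_cont[OF H] Ck_cont[OF p1] Ck_cont[OF k1] Ck_cont[OF v1] Ck_cont[OF z1])+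
  have ctj: "continuous_on (Rn d) (K j)" "continuous_on (Rn d) (pd j \<phi>)" "continuous_on (Rn d) (pd j \<kappa>)" "continuous_on (Rn d) (pd j v)"
    "continuous_on (Rn d) (pd j \<zeta>)" "continuous_on (Rn d) (pd j H)" "continuous_on (Rn d) (pd j (pd j H))" "continuous_on (Rn d) (pd j (K j))" if "j < d" for j
    by (intro Ck_cont[OF K] Ck_cont[OF phijC1] Ck_cont[OF Ck_pd'[OF k1]] Ck_cont[OF Ck_pd'[OF v1]] Ck_cont[OF Ck_pd'[OF z1]]
        Ck_cont[OF Ck_pd'[OF H1]] Ck_cont[OF Ck_pd'[OF Ck_pd'[OF H]]] Ck_cont[OF Ck_pd'[OF K]] that)+
  have es: "sqi M (e j)" if "j < d" for j
    unfolding e_def using that by (intro cc_sqi continuous_intros ct ctj csup_mult1 ks)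
  have bs: "sqi M (b j)" if "j < d" for j
    unfolding b_def using that by (intro cc_sqi continuous_intros ct ctj csup_mult1 csup_pd ks)
  have vs: "sqi M (pd j v)" if "j < d" for j
    using that by (intro cc_sqi ctj csup_pd v2)
  define Q where "Q j x = (K j x + pd j H x) * pd j \<zeta> x" for j x
  have Qi: "integrable (leb d) (Q j)" if "j < d" for j
    unfolding Q_def using that by (intro cc_integrable continuous_intros ct ctj csup_mult2 csup_pd z2)
  have Q0: "(\<Sum>j<d. \<integral>x. Q j x \<partial>leb d) = 0"
  proof -
    have a: "(\<integral>x. Q j x \<partial>leb d) = - (\<integral>x. (pd j (K j) x + pd j (pd j H) x) * \<zeta> x \<partial>leb d)" if j: "j < d" for j
    proof -
      define f where "f x = K j x + pd j H x" for x
      have f1: "Ck d (Suc 0) f" unfolding f_def by (intro Ck_add K Ck_pd'[OF H] j)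
      have "(\<integral>x. pd j f x * \<zeta> x \<partial>leb d) = - (\<integral>x. f x * pd j \<zeta> x \<partial>leb d)" by (rule ibp_leb[OF f1 z1 z2 j])
      moreover have "(\<integral>x. pd j f x * \<zeta> x \<partial>leb d) = (\<integral>x. (pd j (K j) x + pd j (pd j H) x) * \<zeta> x \<partial>leb d)"
        by (rule Bochner_Integration.integral_cong[OF refl]) (simp add: f_def[abs_def] pd_add[OF K[OF j] _ j Ck_pd'[OF H j]])
      ultimately show ?thesis by (simp add: Q_def f_def)
    qed
    have i: "integrable (leb d) (\<lambda>x. (pd j (K j) x + pd j (pd j H) x) * \<zeta> x)" if "j < d" for j
      using that by (intro cc_integrable continuous_intros ct ctj csup_mult2 z2)
    have "(\<Sum>j<d. \<integral>x. Q j x \<partial>leb d) = - (\<Sum>j<d. \<integral>x. (pd j (K j) x + pd j (pd j H) x) * \<zeta> x \<partial>leb d)"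
      using a by (simp add: sum_negf)
    also have "\<dots> = - (\<integral>x. (\<Sum>j<d. (pd j (K j) x + pd j (pd j H) x) * \<zeta> x) \<partial>leb d)"
      by (subst Bochner_Integration.integral_sum) (use i in auto)
    also have "\<dots> = - (\<integral>x. 0 \<partial>leb d)"
    proof (intro arg_cong[where f = uminus] Bochner_Integration.integral_cong[OF refl])
      fix x assume "x \<in> space (leb d)"
      then have x: "x \<in> Rn d" by simp
      have "(\<Sum>j<d. (pd j (K j) x + pd j (pd j H) x) * \<zeta> x) = (\<Sum>j<d. pd j (K j) x + pd j (pd j H) x) * \<zeta> x"
        by (rule sum_distrib_right[symmetric])
      also have "\<dots> = 0" using eq[of x] \<kappa>(2)[OF x] by (cases "x \<in> bx d R") (simp_all add: \<zeta>_def)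
      finally show "(\<Sum>j<d. (pd j (K j) x + pd j (pd j H) x) * \<zeta> x) = 0" .
    qed
    finally show ?thesis by simp
  qed
  have QM: "(\<integral>x. exp (\<phi> x) * Q j x \<partial>M) = (\<integral>x. Q j x \<partial>leb d)" "integrable M (\<lambda>x. exp (\<phi> x) * Q j x)" if j: "j < d" for j
  proof -
    have m: "(\<lambda>x. exp (\<phi> x) * Q j x) \<in> borel_measurable (leb d)"
      unfolding Q_def using j by (intro cont_meas continuous_intros ct ctj)
    have e1: "rho x * (exp (\<phi> x) * Q j x) = Q j x" for x by (simp add: rho_def exp_minus field_simps)
    show "(\<integral>x. exp (\<phi> x) * Q j x \<partial>M) = (\<integral>x. Q j x \<partial>leb d)" "integrable M (\<lambda>x. exp (\<phi> x) * Q j x)"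
      using integral_M[OF m, unfolded e1] integrable_M[OF m, unfolded e1] Qi[OF j] by simp_all
  qed
  have pt: "(pd j v x)\<^sup>2 \<le> 2 * (exp (\<phi> x) * Q j x) + 2 * (e j x)\<^sup>2 + 3 * (b j x)\<^sup>2" if x: "x \<in> Rn d" and j: "j < d" for j x
  proof -
    define E where "E = exp (\<phi> x)"
    define a where "a = \<kappa> x * pd j rt x"
    have rtx: "pd j rt x = pd j H x * E + H x * (E * pd j \<phi> x)"
      unfolding rt_def E_def by (simp add: pd_mult[OF H1 x j ex1] pd_exp[OF p1 x j])
    have v_rt: "v = (\<lambda>x. \<kappa> x * rt x)" by (simp add: v_def rt_def)
    have vx: "pd j v x = a + b j x"
      unfolding v_rt pd_mult[OF k1 x j rt1] by (simp add: a_def b_def rt_def)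
    have zx: "pd j \<zeta> x = \<kappa> x * (a + 2 * b j x)"
      unfolding \<zeta>_def pd_mult[OF k1 x j v1] vx by (simp add: b_def v_def algebra_simps)
    have Qx: "E * Q j x = (a - e j x) * (a + 2 * b j x)"
      unfolding Q_def zx by (simp add: a_def rtx e_def E_def[symmetric] algebra_simps)
    \<comment> \<open>This sum of two squares is exactly the difference of the two sides;
      \<open>a\<close> is the part of \<open>pd j v\<close> in which the cut-off is not
      differentiated.\<close>
    have "0 \<le> (e j x - (a + b j x))\<^sup>2 + (e j x - b j x)\<^sup>2" by simp
    then show ?thesis unfolding vx E_def[symmetric] Qx by (simp add: power2_eq_square algebra_simps)
  qed
  have "(\<Sum>j<d. \<integral>x. (pd j v x)\<^sup>2 \<partial>M) \<le> (\<Sum>j<d. 2 * (\<integral>x. Q j x \<partial>leb d) + 2 * (\<integral>x. (e j x)\<^sup>2 \<partial>M) + 3 * (\<integral>x. (b j x)\<^sup>2 \<partial>M))"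
  proof (rule sum_mono)
    fix j assume "j \<in> {..<d}"
    then have j: "j < d" by simp
    note ii = QM(2)[OF j] sqiD(2)[OF es[OF j]] sqiD(2)[OF bs[OF j]]
    have "(\<integral>x. (pd j v x)\<^sup>2 \<partial>M) \<le> (\<integral>x. 2 * (exp (\<phi> x) * Q j x) + 2 * (e j x)\<^sup>2 + 3 * (b j x)\<^sup>2 \<partial>M)"
      by (rule integral_mono[OF sqiD(2)[OF vs[OF j]]]) (use ii pt[OF _ j] in auto)
    then show "(\<integral>x. (pd j v x)\<^sup>2 \<partial>M) \<le> 2 * (\<integral>x. Q j x \<partial>leb d) + 2 * (\<integral>x. (e j x)\<^sup>2 \<partial>M) + 3 * (\<integral>x. (b j x)\<^sup>2 \<partial>M)"
      using ii QM(1)[OF j] by simp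
  qed
  also have "\<dots> = 2 * (\<Sum>j<d. \<integral>x. Q j x \<partial>leb d) + 2 * (\<Sum>j<d. \<integral>x. (e j x)\<^sup>2 \<partial>M) + 3 * (\<Sum>j<d. \<integral>x. (b j x)\<^sup>2 \<partial>M)"
    by (simp add: sum.distrib sum_distrib_left)
  finally show "(\<Sum>j<d. \<integral>x. (pd j v x)\<^sup>2 \<partial>M) \<le> 2 * (\<Sum>j<d. \<integral>x. (\<kappa> x * exp (\<phi> x) * (pd j \<phi> x * H x - K j x))\<^sup>2 \<partial>M)
      + 3 * (\<Sum>j<d. \<integral>x. (pd j \<kappa> x * exp (\<phi> x) * H x)\<^sup>2 \<partial>M)"
    by (simp add: Q0 e_def b_def)
qed

lemma pd_pd_kern:
  assumes "j < d"
  shows "pd j (pd j (\<lambda>y. kern d \<epsilon> m x y)) y = kern d \<epsilon> (inc j (inc j m)) x y"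
proof -
  have a: "pd j (\<lambda>y. kern d \<epsilon> m x y) = (\<lambda>y. - kern d \<epsilon> (inc j m) x y)"
    by (rule ext) (rule pd_kern_right[OF assms])
  have "((\<lambda>t. - kern d \<epsilon> (inc j m) x (y(j := t))) has_real_derivative - (- kern d \<epsilon> (inc j (inc j m)) x (y(j := y j)))) (at (y j))"
    by (rule DERIV_minus[OF kern_has_derivative_right[OF assms]])
  then have "((\<lambda>t. - kern d \<epsilon> (inc j m) x (y(j := t))) has_real_derivative kern d \<epsilon> (inc j (inc j m)) x y) (at (y j))"
    by (simp only: fun_upd_triv minus_minus)
  then show ?thesis unfolding a by (rule pdI)
qed

text \<open>Testing the orthogonality with the mollifying kernel centred at x gives the divergence
  equation that \<open>caccioppoli\<close> requires, and the Poincare inequality then bounds the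
  variance of the localised function. In the limit the commutator drops out, as both of its parts
  tend to the same function; only the derivatives of the cut-off remain.\<close>

lemma weyl_local:
  assumes r: "sqi M r" and orth: "\<And>\<psi>. test_fun d \<psi> \<Longrightarrow> (\<integral>x. r x * Lap \<psi> x \<partial>M) = 0"
    and \<kappa>: "test_fun d \<kappa>" "\<And>x. x \<in> Rn d \<Longrightarrow> x \<notin> bx d R \<Longrightarrow> \<kappa> x = 0"
  shows "(\<integral>x. (\<kappa> x * r x)\<^sup>2 \<partial>M) - (\<integral>x. \<kappa> x * r x \<partial>M)\<^sup>2 \<le> 3 * CP * (\<Sum>j<d. \<integral>x. (pd j \<kappa> x * r x)\<^sup>2 \<partial>M)"
proof -
  \<comment> \<open>Room for the mollification radii, which are at most 1.\<close>
  define S where "S = R + 1"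
  define h where "h x = rho x * r x * indicator (bx d S) x" for x
  define k where "k j x = rho x * pd j \<phi> x * r x * indicator (bx d S) x" for j x
  have pjm [measurable]: "j < d \<Longrightarrow> pd j \<phi> \<in> borel_measurable (leb d)" for j by (rule cont_meas[OF Ck_cont[OF phijC1]])
  have hs: "sqi (leb d) h"
  proof -
    obtain C where "\<forall>x\<in>bx d S. \<bar>rho x\<bar> \<le> C" using bdd_on_bx[OF rho_cont] by blast
    then show ?thesis unfolding h_def by (intro sqi_trunc[OF r rho_meas, of S C]) auto
  qed
  have ks: "sqi (leb d) (k j)" if j: "j < d" for j
  proof -
    obtain C where "\<forall>x\<in>bx d S. \<bar>rho x * pd j \<phi> x\<bar> \<le> C"
      using bdd_on_bx[OF continuous_on_mult[OF rho_cont Ck_cont[OF phijC1[OF j]]]] by blast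
    then show ?thesis unfolding k_def using j by (intro sqi_trunc[OF r, of _ S C]) auto
  qed
  have hi: "integrable (leb d) h" using hs unfolding h_def by (rule sq_int_trunc)
  have ki: "integrable (leb d) (k j)" if "j < d" for j using ks[OF that] unfolding k_def by (rule sq_int_trunc)
  have eps: "1 / real (Suc n) > 0" "1 / real (Suc n) \<le> 1" for n by auto
  have RS: "R + 1 / real (Suc n) \<le> S" for n using eps(2)[of n] by (simp add: S_def)
  define H where "H n = mo d h n" for n
  define K where "K n j = mo d (k j) n" for n j
  have HC: "Ck d m (H n)" for n m unfolding H_def by (rule moll_Ck[OF hi])
  have KC: "Ck d m (K n j)" if "j < d" for n m j unfolding K_def by (rule moll_Ck[OF ki[OF that]])
  have eq: "(\<Sum>j<d. pd j (K n j) x + pd j (pd j (H n)) x) = 0" if x: "x \<in> bx d R" for n x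
  proof -
    define e where "e = 1 / real (Suc n)"
    have e: "e > 0" "R + e \<le> S" using eps(1) RS by (auto simp: e_def)
    let ?z = "\<lambda>_::nat. 0::nat"
    have t: "test_fun d (\<lambda>y. kern d e ?z x y)" by (rule kern_test_fun[OF e(1) bx_Rn[OF x]])
    have a: "pd j (K n j) x = (\<integral>y. (rho y * pd j \<phi> y * r y) * kern d e (inc j ?z) x y \<partial>leb d)" if j: "j < d" for j
      unfolding K_def pd_moll[OF ki[OF j] j] e_def[symmetric] unfolding k_def by (rule moll_trunc[OF e(1) x e(2)])
    have pH: "pd j (H n) = moll d e (inc j ?z) h" if j: "j < d" for j
      unfolding H_def e_def by (rule ext) (rule pd_moll[OF hi j])
    have b: "pd j (pd j (H n)) x = (\<integral>y. (rho y * r y) * kern d e (inc j (inc j ?z)) x y \<partial>leb d)" if j: "j < d" for j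
      unfolding pH[OF j] pd_moll[OF hi j] unfolding h_def by (rule moll_trunc[OF e(1) x e(2)])
    have kz: "kern d e m x y = 0" if yS: "y \<in> Rn d" "y \<notin> bx d S" for y m
    proof -
      obtain i where i: "i < d" "\<bar>y i\<bar> > S" using yS by (auto simp: bx_def not_le)
      have "\<bar>x i\<bar> \<le> R" using x i by (auto simp: bx_def)
      then show ?thesis using i e by (intro kern_support[of e i]) auto
    qed
    have ia: "integrable (leb d) (\<lambda>y. (rho y * pd j \<phi> y * r y) * kern d e (inc j ?z) x y)" if j: "j < d" for j
    proof -
      have "integrable (leb d) (\<lambda>y. k j y * kern d e (inc j ?z) x y)" by (rule moll_integrable[OF ki[OF j]])
      also have "?this \<longleftrightarrow> ?thesis"
        by (rule Bochner_Integration.integrable_cong[OF refl]) (use kz in \<open>auto simp: k_def indicator_def\<close>)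
      finally show ?thesis .
    qed
    have ib: "integrable (leb d) (\<lambda>y. (rho y * r y) * kern d e m x y)" for m
    proof -
      have "integrable (leb d) (\<lambda>y. h y * kern d e m x y)" by (rule moll_integrable[OF hi])
      also have "?this \<longleftrightarrow> ?thesis"
        by (rule Bochner_Integration.integrable_cong[OF refl]) (use kz in \<open>auto simp: h_def indicator_def\<close>)
      finally show ?thesis .
    qed
    have rm: "r \<in> borel_measurable (leb d)" using sqiD(1)[OF r] by (simp add: meas_M)
    \<comment> \<open>In y, one derivative of the kernel brings a minus sign and two bring none; the
      result is minus the claimed equation.\<close>
    have "0 = (\<integral>y. r y * Lap (\<lambda>y. kern d e ?z x y) y \<partial>M)" by (rule orth[OF t, symmetric])
    also have "\<dots> = (\<integral>y. rho y * (r y * Lap (\<lambda>y. kern d e ?z x y) y) \<partial>leb d)"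
      by (rule integral_M) (intro borel_measurable_times rm cont_meas[OF Lap_cont[OF test_funD(1)[OF t]]])
    also have "\<dots> = (\<integral>y. (\<Sum>j<d. - ((rho y * pd j \<phi> y * r y) * kern d e (inc j ?z) x y + (rho y * r y) * kern d e (inc j (inc j ?z)) x y)) \<partial>leb d)"
    proof (rule Bochner_Integration.integral_cong[OF refl])
      fix y
      have "rho y * (r y * Lap (\<lambda>y. kern d e ?z x y) y) = (\<Sum>j<d. rho y * r y * (pd j \<phi> y * pd j (\<lambda>y. kern d e ?z x y) y - pd j (pd j (\<lambda>y. kern d e ?z x y)) y))"
        by (simp add: Lap_def sum_distrib_left mult.assoc)
      also have "\<dots> = (\<Sum>j<d. - ((rho y * pd j \<phi> y * r y) * kern d e (inc j ?z) x y + (rho y * r y) * kern d e (inc j (inc j ?z)) x y))"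
        by (intro sum.cong refl) (simp add: pd_kern_right pd_pd_kern algebra_simps)
      finally show "rho y * (r y * Lap (\<lambda>y. kern d e ?z x y) y) = (\<Sum>j<d. - ((rho y * pd j \<phi> y * r y) * kern d e (inc j ?z) x y + (rho y * r y) * kern d e (inc j (inc j ?z)) x y))" .
    qed
    also have "\<dots> = (\<Sum>j<d. \<integral>y. - ((rho y * pd j \<phi> y * r y) * kern d e (inc j ?z) x y + (rho y * r y) * kern d e (inc j (inc j ?z)) x y) \<partial>leb d)"
      by (rule Bochner_Integration.integral_sum) (use ia ib in \<open>auto intro!: integrable_minus Bochner_Integration.integrable_add\<close>)
    also have "\<dots> = (\<Sum>j<d. - (pd j (K n j) x + pd j (pd j (H n)) x))"
    proof (rule sum.cong[OF refl])
      fix j assume "j \<in> {..<d}"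
      then have j: "j < d" by simp
      show "(\<integral>y. - ((rho y * pd j \<phi> y * r y) * kern d e (inc j ?z) x y + (rho y * r y) * kern d e (inc j (inc j ?z)) x y) \<partial>leb d) = - (pd j (K n j) x + pd j (pd j (H n)) x)"
        unfolding a[OF j] b[OF j] Bochner_Integration.integral_minus by (simp only: Bochner_Integration.integral_add[OF ia[OF j] ib])
    qed
    finally have "- (\<Sum>j<d. pd j (K n j) x + pd j (pd j (H n)) x) = 0" by (simp only: sum_negf)
    then show ?thesis by (simp only: neg_equal_0_iff_equal)
  qed
  define E where "E x = exp (\<phi> x)" for x
  have Ec: "continuous_on (Rn d) E" unfolding E_def by (intro continuous_intros Ck_cont[OF phiC2])
  have hl: "L2c (leb d) (\<lambda>n. H n) h" unfolding H_def by (rule moll_L2c[OF hs, of S]) (simp add: h_def)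
  have kl: "L2c (leb d) (\<lambda>n. K n j) (k j)" if "j < d" for j unfolding K_def by (rule moll_L2c[OF ks[OF that], of S]) (simp add: k_def)
  have kc: "continuous_on (Rn d) \<kappa>" by (rule test_fun_cont[OF \<kappa>(1)])
  have kjc: "continuous_on (Rn d) (pd j \<kappa>)" if "j < d" for j by (rule test_fun_cont[OF test_fun_pd[OF \<kappa>(1) that]])
  have tr: "L2c M (\<lambda>n x. c x * fs n x) (\<lambda>x. c x * f x)"
    if lf: "L2c (leb d) fs f" and cc: "continuous_on (Rn d) c" and cz: "\<And>x. x \<in> Rn d \<Longrightarrow> x \<notin> bx d R \<Longrightarrow> c x = 0" for fs f c
  proof -
    obtain C where C: "\<forall>x\<in>bx d R. \<bar>c x\<bar> \<le> C" using bdd_on_bx[OF cc] by blast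
    show ?thesis
      by (rule sqi_leb_M(2)[where R = R and C = C, OF L2cD(2)[OF lf] cont_meas[OF cc] cz _ L2cD(1)[OF lf] lf]) (use C in auto)
  qed
  have bRS: "x \<in> bx d S" if "x \<in> bx d R" for x using bx_mono[of R S x d] that by (simp add: S_def)
  have Er: "E x * rho x = 1" for x by (simp add: E_def rho_def exp_minus)
  define v where "v n x = \<kappa> x * (H n x * exp (\<phi> x))" for n x
  have cac1: "Ck d (Suc 0) (v n)" "csup d (v n)" for n
    unfolding v_def by (rule caccioppoli[OF HC KC eq \<kappa>]; assumption)+
  have cac3: "(\<Sum>j<d. \<integral>x. (pd j (v n) x)\<^sup>2 \<partial>M) \<le> 2 * (\<Sum>j<d. \<integral>x. (\<kappa> x * exp (\<phi> x) * (pd j \<phi> x * H n x - K n j x))\<^sup>2 \<partial>M)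
      + 3 * (\<Sum>j<d. \<integral>x. (pd j \<kappa> x * exp (\<phi> x) * H n x)\<^sup>2 \<partial>M)" for n
    unfolding v_def by (rule caccioppoli(3)[OF HC KC eq \<kappa>]; assumption)
  have lv: "L2c M v (\<lambda>x. \<kappa> x * r x)"
  proof (rule L2c_cong)
    show "L2c M (\<lambda>n x. (\<kappa> x * E x) * H n x) (\<lambda>x. (\<kappa> x * E x) * h x)"
      by (rule tr[OF hl]) (auto intro!: continuous_intros kc Ec simp: \<kappa>)
    show "\<kappa> x * E x * H n x = v n x" for n x by (simp add: v_def E_def)
    show "\<kappa> x * E x * h x = \<kappa> x * r x" if "x \<in> space M" for x
      using Er[of x] bRS[of x] \<kappa>(2)[of x] that by (cases "x \<in> bx d R") (auto simp: h_def mult.assoc[symmetric] mult.commute[of _ "rho x"])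
  qed
  have lb: "L2c M (\<lambda>n x. pd j \<kappa> x * exp (\<phi> x) * H n x) (\<lambda>x. pd j \<kappa> x * r x)" if j: "j < d" for j
  proof (rule L2c_cong)
    have z: "pd j \<kappa> x = 0" if "x \<in> Rn d" "x \<notin> bx d R" for x by (rule pd_eq_0_outside[OF \<kappa>(2) that j])
    show "L2c M (\<lambda>n x. (pd j \<kappa> x * E x) * H n x) (\<lambda>x. (pd j \<kappa> x * E x) * h x)"
      by (rule tr[OF hl]) (auto intro!: continuous_intros kjc[OF j] Ec simp: z)
    show "pd j \<kappa> x * E x * H n x = pd j \<kappa> x * exp (\<phi> x) * H n x" for n x by (simp add: E_def)
    show "pd j \<kappa> x * E x * h x = pd j \<kappa> x * r x" if "x \<in> space M" for x
      using Er[of x] bRS[of x] z[of x] that by (cases "x \<in> bx d R") (auto simp: h_def mult.assoc[symmetric] mult.commute[of _ "rho x"])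
  qed
  have le: "L2c M (\<lambda>n x. \<kappa> x * exp (\<phi> x) * (pd j \<phi> x * H n x - K n j x)) (\<lambda>x. 0)" if j: "j < d" for j
  proof (rule L2c_cong)
    show "L2c M (\<lambda>n x. (\<kappa> x * E x * pd j \<phi> x) * H n x - (\<kappa> x * E x) * K n j x) (\<lambda>x. (\<kappa> x * E x * pd j \<phi> x) * h x - (\<kappa> x * E x) * k j x)"
      by (intro L2c_diff tr[OF hl] tr[OF kl[OF j]]) (auto intro!: continuous_intros kc Ec Ck_cont[OF phijC1[OF j]] simp: \<kappa>)
    show "(\<kappa> x * E x * pd j \<phi> x) * H n x - (\<kappa> x * E x) * K n j x = \<kappa> x * exp (\<phi> x) * (pd j \<phi> x * H n x - K n j x)" for n x
      by (simp add: E_def algebra_simps)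
    show "(\<kappa> x * E x * pd j \<phi> x) * h x - (\<kappa> x * E x) * k j x = 0" for x
      by (simp add: h_def k_def)
  qed
  have pv: "(\<integral>x. (v n x)\<^sup>2 \<partial>M) - (\<integral>x. v n x \<partial>M)\<^sup>2 \<le> CP * (2 * (\<Sum>j<d. \<integral>x. (\<kappa> x * exp (\<phi> x) * (pd j \<phi> x * H n x - K n j x))\<^sup>2 \<partial>M)
      + 3 * (\<Sum>j<d. \<integral>x. (pd j \<kappa> x * exp (\<phi> x) * H n x)\<^sup>2 \<partial>M))" for n
  proof -
    have s: "sqi M (v n)" by (rule cc_sqi[OF Ck_cont[OF cac1(1)] cac1(2)])
    have hl: "h1lim (v n) (\<lambda>j. pd j (v n))"
      by (rule C1_h1lim[OF cac1(1) s]) (intro cc_sqi Ck_cont[OF Ck_pd'[OF cac1(1)]] csup_pd cac1(2))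
    have "(\<integral>x. (v n x)\<^sup>2 \<partial>M) - (\<integral>x. v n x \<partial>M)\<^sup>2 \<le> CP * (\<Sum>j<d. \<integral>x. (pd j (v n) x)\<^sup>2 \<partial>M)"
      using h1lim_poincare[OF hl] variance_eq[OF s] by simp
    also have "\<dots> \<le> CP * (2 * (\<Sum>j<d. \<integral>x. (\<kappa> x * exp (\<phi> x) * (pd j \<phi> x * H n x - K n j x))\<^sup>2 \<partial>M)
      + 3 * (\<Sum>j<d. \<integral>x. (pd j \<kappa> x * exp (\<phi> x) * H n x)\<^sup>2 \<partial>M))"
      by (rule mult_left_mono[OF cac3 CP0])
    finally show ?thesis .
  qed
  have "(\<integral>x. (\<kappa> x * r x)\<^sup>2 \<partial>M) - (\<integral>x. \<kappa> x * r x \<partial>M)\<^sup>2 \<le> CP * (2 * (\<Sum>j<d. \<integral>x. 0\<^sup>2 \<partial>M) + 3 * (\<Sum>j<d. \<integral>x. (pd j \<kappa> x * r x)\<^sup>2 \<partial>M))"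
  proof (rule LIMSEQ_le)
    show "(\<lambda>n. (\<integral>x. (v n x)\<^sup>2 \<partial>M) - (\<integral>x. v n x \<partial>M)\<^sup>2) \<longlonglongrightarrow> (\<integral>x. (\<kappa> x * r x)\<^sup>2 \<partial>M) - (\<integral>x. \<kappa> x * r x \<partial>M)\<^sup>2"
      by (intro tendsto_intros L2c_norm[OF lv] L2c_integral[OF fm lv])
    show "(\<lambda>n. CP * (2 * (\<Sum>j<d. \<integral>x. (\<kappa> x * exp (\<phi> x) * (pd j \<phi> x * H n x - K n j x))\<^sup>2 \<partial>M)
      + 3 * (\<Sum>j<d. \<integral>x. (pd j \<kappa> x * exp (\<phi> x) * H n x)\<^sup>2 \<partial>M))) \<longlonglongrightarrow> CP * (2 * (\<Sum>j<d. \<integral>x. 0\<^sup>2 \<partial>M) + 3 * (\<Sum>j<d. \<integral>x. (pd j \<kappa> x * r x)\<^sup>2 \<partial>M))"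
      by (intro tendsto_mult tendsto_add tendsto_const tendsto_sum L2c_norm) (use le lb in auto)
  qed (use pv in auto)
  then show ?thesis by simp
qed

text \<open>M is a probability measure, so the conclusion means that the variance of r is 0, that
  is, r is constant almost everywhere. The right side of \<open>weyl_local\<close> vanishes as the
  cut-offs go to infinity.\<close>

theorem weyl:
  assumes r: "sqi M r" and orth: "\<And>\<psi>. test_fun d \<psi> \<Longrightarrow> (\<integral>x. r x * Lap \<psi> x \<partial>M) = 0"
  shows "(\<integral>x. (r x)\<^sup>2 \<partial>M) \<le> (\<integral>x. r x \<partial>M)\<^sup>2"
proof -
  note l1 = L2c_cuts[OF sets_M r]
  have "(\<integral>x. (r x)\<^sup>2 \<partial>M) - (\<integral>x. r x \<partial>M)\<^sup>2 \<le> 3 * CP * (\<Sum>j<d. \<integral>x. 0\<^sup>2 \<partial>M)"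
  proof (rule LIMSEQ_le)
    show "(\<lambda>N. (\<integral>x. (cuts d N x * r x)\<^sup>2 \<partial>M) - (\<integral>x. cuts d N x * r x \<partial>M)\<^sup>2) \<longlonglongrightarrow> (\<integral>x. (r x)\<^sup>2 \<partial>M) - (\<integral>x. r x \<partial>M)\<^sup>2"
      by (intro tendsto_intros L2c_norm[OF l1] L2c_integral[OF fm l1])
    show "(\<lambda>N. 3 * CP * (\<Sum>j<d. \<integral>x. (pd j (cuts d N) x * r x)\<^sup>2 \<partial>M)) \<longlonglongrightarrow> 3 * CP * (\<Sum>j<d. \<integral>x. 0\<^sup>2 \<partial>M)"
      by (intro tendsto_mult tendsto_const tendsto_sum L2c_norm) (use L2c_pd_cuts[OF sets_M r] in auto)
    show "\<exists>N. \<forall>n\<ge>N. (\<integral>x. (cuts d n x * r x)\<^sup>2 \<partial>M) - (\<integral>x. cuts d n x * r x \<partial>M)\<^sup>2 \<le> 3 * CP * (\<Sum>j<d. \<integral>x. (pd j (cuts d n) x * r x)\<^sup>2 \<partial>M)"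
      by (intro exI[of _ 0] allI impI weyl_local[OF r orth cuts_test_fun cuts_eq_0])
  qed
  then show ?thesis by simp
qed

text \<open>The residual of f after projection onto the range is orthogonal to that range, hence
  constant by \<open>weyl\<close>. It has mean 0, because f and every \<open>Lap \<psi>\<close> do,
  and is therefore 0.\<close>

theorem Lap_dense:
  assumes f: "sqi M f" and m: "(\<integral>x. f x \<partial>M) = 0"
  shows "\<exists>\<psi>. (\<forall>n. test_fun d (\<psi> n)) \<and> L2c M (\<lambda>n. Lap (\<psi> n)) f"
proof -
  \<comment> \<open>Equality is asked on \<open>Rn d\<close> only, since it is there that
    \<open>Lap\<close> is shown to be linear.\<close>
  define V where "V = {v. \<exists>\<psi>. test_fun d \<psi> \<and> (\<forall>x\<in>Rn d. v x = Lap \<psi> x)}"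
  have VI: "Lap \<psi> \<in> V" if "test_fun d \<psi>" for \<psi> unfolding V_def using that by blast
  have Vs: "sqi M v" if v: "v \<in> V" for v
  proof -
    obtain \<psi> where p: "test_fun d \<psi>" "\<forall>x\<in>Rn d. v x = Lap \<psi> x" using v unfolding V_def by blast
    have "sqi M v = sqi M (Lap \<psi>)" by (rule sqi_cong) (use p in simp)
    then show ?thesis using Lap_sqi[OF p(1)] by simp
  qed
  have Vne: "V \<noteq> {}" using VI[OF test_fun_zero] by blast
  have Vl: "(\<lambda>x. a * u x + b * v x) \<in> V" if u: "u \<in> V" and v: "v \<in> V" for u v a b
  proof -
    obtain \<psi> where p: "test_fun d \<psi>" "\<forall>x\<in>Rn d. u x = Lap \<psi> x" using u unfolding V_def by blast
    obtain \<eta> where q: "test_fun d \<eta>" "\<forall>x\<in>Rn d. v x = Lap \<eta> x" using v unfolding V_def by blast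
    define \<zeta> where "\<zeta> x = a * \<psi> x + b * \<eta> x" for x
    have t: "test_fun d \<zeta>" unfolding \<zeta>_def by (intro test_fun_add test_fun_cmult p q)
    note Cp = test_funD(1)[OF p(1)] and Cq = test_funD(1)[OF q(1)]
    have p1: "pd j \<zeta> x = a * pd j \<psi> x + b * pd j \<eta> x" if "x \<in> Rn d" "j < d" for j x
      unfolding \<zeta>_def using pd_add[OF Ck_cmult[OF Cp[of "Suc 0"]] that Ck_cmult[OF Cq[of "Suc 0"]], of a b]
        pd_cmult[OF Cp[of "Suc 0"] that, of a] pd_cmult[OF Cq[of "Suc 0"] that, of b] by simp
    have p2: "pd j (pd j \<zeta>) x = a * pd j (pd j \<psi>) x + b * pd j (pd j \<eta>) x" if x: "x \<in> Rn d" and j: "j < d" for j x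
    proof -
      have C1: "Ck d (Suc 0) (pd j \<psi>)" "Ck d (Suc 0) (pd j \<eta>)" using Ck_pd'[OF Cp j] Ck_pd'[OF Cq j] by auto
      have "pd j (pd j \<zeta>) x = pd j (\<lambda>x. a * pd j \<psi> x + b * pd j \<eta> x) x" by (rule pd_cong[OF p1[OF _ j] x j])
      then show ?thesis using pd_add[OF Ck_cmult[OF C1(1)] x j Ck_cmult[OF C1(2)], of a b]
        pd_cmult[OF C1(1) x j, of a] pd_cmult[OF C1(2) x j, of b] by simp
    qed
    have "a * u x + b * v x = Lap \<zeta> x" if "x \<in> Rn d" for x
    proof -
      have "Lap \<zeta> x = (\<Sum>j<d. a * (pd j \<phi> x * pd j \<psi> x - pd j (pd j \<psi>) x) + b * (pd j \<phi> x * pd j \<eta> x - pd j (pd j \<eta>) x))"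
        unfolding Lap_def by (intro sum.cong refl) (simp add: p1[OF that] p2[OF that] algebra_simps)
      also have "\<dots> = a * Lap \<psi> x + b * Lap \<eta> x" by (simp add: Lap_def sum.distrib sum_distrib_left)
      finally show ?thesis using p q that by simp
    qed
    then show ?thesis unfolding V_def using t by blast
  qed
  have "\<exists>r vs. L2c M (\<lambda>n x. f x - vs n x) r \<and> (\<forall>n. vs n \<in> V) \<and> (\<forall>v\<in>V. (\<integral>x. r x * v x \<partial>M) = 0)"
    by (rule L2_projection[OF fm f Vne Vs Vl])
  then obtain r vs where rv: "L2c M (\<lambda>n x. f x - vs n x) r" "\<forall>n. vs n \<in> V" "\<forall>v\<in>V. (\<integral>x. r x * v x \<partial>M) = 0" by (elim exE conjE)
  have "\<forall>n. \<exists>\<psi>. test_fun d \<psi> \<and> (\<forall>x\<in>Rn d. vs n x = Lap \<psi> x)" using rv(2) unfolding V_def by blast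
  from choice[OF this] obtain \<psi> where \<psi>: "\<forall>n. test_fun d (\<psi> n) \<and> (\<forall>x\<in>Rn d. vs n x = Lap (\<psi> n) x)" by (elim exE)
  have t: "test_fun d (\<psi> n)" for n using \<psi> by simp
  have l: "L2c M (\<lambda>n x. f x - Lap (\<psi> n) x) r" by (rule L2c_cong[OF rv(1)]) (use \<psi> in auto)
  have "(\<integral>x. f x - Lap (\<psi> n) x \<partial>M) = 0" for n
    using sqi_integrable[OF fm f] sqi_integrable[OF fm Lap_sqi[OF t]] Lap_mean[OF t] m by simp
  then have r0: "(\<integral>x. r x \<partial>M) = 0" using LIMSEQ_unique[OF L2c_integral[OF fm l]] by (simp add: LIMSEQ_const_iff)
  have "(\<integral>x. (r x)\<^sup>2 \<partial>M) \<le> (\<integral>x. r x \<partial>M)\<^sup>2"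
    by (rule weyl[OF L2cD(2)[OF l]]) (use rv(3) VI in blast)
  then have "(\<integral>x. (r x)\<^sup>2 \<partial>M) = 0" using r0 integral_sq_nonneg[of M r] by simp
  then have "(\<lambda>n. \<integral>x. (f x - Lap (\<psi> n) x)\<^sup>2 \<partial>M) \<longlonglongrightarrow> 0" using L2c_norm[OF l] by simp
  then have "L2c M (\<lambda>n. Lap (\<psi> n)) f"
    unfolding L2c_def using f Lap_sqi[OF t] by (simp add: power2_commute)
  then show ?thesis using t by (intro exI[of _ \<psi>]) simp
qed

subsection \<open>The Bochner identity\<close>

definition adj :: "nat \<Rightarrow> (point \<Rightarrow> real) \<Rightarrow> point \<Rightarrow> real" where
  "adj j h x = pd j \<phi> x * h x - pd j h x"

lemma adj_Ck: "Ck d (Suc (Suc 0)) h \<Longrightarrow> j < d \<Longrightarrow> Ck d (Suc 0) (adj j h)"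
  unfolding adj_def[abs_def]
  by (intro Ck_diff Ck_mult phijC1) (auto intro: Ck_Suc_imp Ck_pd')

lemma adj_cont: "Ck d (Suc 0) h \<Longrightarrow> j < d \<Longrightarrow> continuous_on (Rn d) (adj j h)"
  unfolding adj_def[abs_def]
  by (intro continuous_intros Ck_cont[OF phijC1]) (auto intro: Ck_cont[of d "Suc 0"] Ck_cont[of d 0] Ck_pd')

lemma adj_csup:
  assumes "csup d h" "j < d" shows "csup d (adj j h)"
proof -
  have "csup d (\<lambda>x. - pd j h x)" by (rule csup_comp0[OF csup_pd[OF assms]]) simp
  from csup_add[OF csup_mult2[OF assms(1), of "pd j \<phi>"] this] show ?thesis by (simp add: adj_def[abs_def])
qed

lemma adj_ibp:
  assumes "Ck d (Suc 0) f" "Ck d (Suc 0) g" "csup d g" "j < d"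
  shows "(\<integral>x. f x * adj j g x \<partial>M) = (\<integral>x. pd j f x * g x \<partial>M)"
  using ibp_M[OF assms] by (simp add: adj_def)

text \<open>Differentiating the factor \<open>pd j \<phi>\<close> of \<open>adj\<close> is what
  brings the Hessian of \<phi> into the Bochner identity.\<close>

lemma adj_commute:
  assumes h: "Ck d (Suc (Suc 0)) h" and j: "j < d" and k: "k < d" and x: "x \<in> Rn d"
  shows "adj j (pd k h) x = pd k (adj j h) x - pd k (pd j \<phi>) x * h x"
proof -
  have h1: "Ck d (Suc 0) h" by (rule Ck_Suc_imp[OF h])
  have "pd k (adj j h) x = pd k (pd j \<phi>) x * h x + pd j \<phi> x * pd k h x - pd k (pd j h) x"
    unfolding adj_def[abs_def]
    by (simp add: pd_diff[OF Ck_mult[OF phijC1[OF j] h1] x k Ck_pd'[OF h j]] pd_mult[OF phijC1[OF j] x k h1])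
  then show ?thesis using Schwarz[OF h x j k] by (simp add: adj_def)
qed

text \<open>The operator norm of a matrix is at most its Euclidean norm: Cauchy-Schwarz once in each
  index.\<close>

lemma hess_form_bound: "\<bar>\<Sum>j<d. \<Sum>k<d. pd k (pd j \<phi>) x * a j * a k\<bar> \<le> hn x * (\<Sum>k<d. (a k)\<^sup>2)"
proof -
  define b where "b j = (\<Sum>k<d. pd k (pd j \<phi>) x * a k)" for j
  have b2: "(b j)\<^sup>2 \<le> (\<Sum>k<d. (pd k (pd j \<phi>) x)\<^sup>2) * (\<Sum>k<d. (a k)\<^sup>2)" for j
    unfolding b_def by (rule Cauchy_Schwarz_ineq_sum)
  have "(\<Sum>j<d. a j * b j)\<^sup>2 \<le> (\<Sum>j<d. (a j)\<^sup>2) * (\<Sum>j<d. (b j)\<^sup>2)" by (rule Cauchy_Schwarz_ineq_sum)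
  also have "\<dots> \<le> (\<Sum>j<d. (a j)\<^sup>2) * (\<Sum>j<d. (\<Sum>k<d. (pd k (pd j \<phi>) x)\<^sup>2) * (\<Sum>k<d. (a k)\<^sup>2))"
    by (intro mult_left_mono sum_mono b2 sum_nonneg) auto
  also have "(\<Sum>j<d. (\<Sum>k<d. (pd k (pd j \<phi>) x)\<^sup>2) * (\<Sum>k<d. (a k)\<^sup>2)) = (hn x)\<^sup>2 * (\<Sum>k<d. (a k)\<^sup>2)"
  proof -
    have "(\<Sum>j<d. \<Sum>k<d. (pd k (pd j \<phi>) x)\<^sup>2) = (hn x)\<^sup>2" unfolding hn_sq by (rule sum.swap)
    then show ?thesis by (simp add: sum_distrib_right[symmetric])
  qed
  also have "(\<Sum>j<d. (a j)\<^sup>2) * ((hn x)\<^sup>2 * (\<Sum>k<d. (a k)\<^sup>2)) = (hn x * (\<Sum>k<d. (a k)\<^sup>2))\<^sup>2"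
    by (simp add: power_mult_distrib power2_eq_square[of "\<Sum>k<d. (a k)\<^sup>2"])
  finally have "\<bar>\<Sum>j<d. a j * b j\<bar> \<le> \<bar>hn x * (\<Sum>k<d. (a k)\<^sup>2)\<bar>" by (simp only: abs_le_square_iff)
  moreover have "0 \<le> hn x * (\<Sum>k<d. (a k)\<^sup>2)" using hn_nonneg by (intro mult_nonneg_nonneg sum_nonneg) auto
  moreover have "(\<Sum>j<d. \<Sum>k<d. pd k (pd j \<phi>) x * a j * a k) = (\<Sum>j<d. a j * b j)"
    unfolding b_def by (simp add: sum_distrib_left mult_ac)
  ultimately show ?thesis by linarith
qed

text \<open>Move \<open>pd j\<close> to the other factor, commute \<open>adj j\<close> past
  \<open>pd k\<close>, and move \<open>pd k\<close> onto \<open>v k\<close>. The field is arbitrary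
  because the identity is also applied to fields that are not gradients.\<close>

lemma bochner_identity:
  assumes v: "\<And>k. k < d \<Longrightarrow> Ck d (Suc (Suc 0)) (v k)" "\<And>k. k < d \<Longrightarrow> csup d (v k)"
  shows "(\<Sum>j<d. \<Sum>k<d. \<integral>x. pd j (v k) x * pd k (v j) x \<partial>M)
    = (\<integral>x. (\<Sum>j<d. adj j (v j) x)\<^sup>2 \<partial>M) - (\<integral>x. (\<Sum>j<d. \<Sum>k<d. pd k (pd j \<phi>) x * v j x * v k x) \<partial>M)"
proof -
  have v1: "Ck d (Suc 0) (v k)" if "k < d" for k by (rule Ck_Suc_imp[OF v(1)[OF that]])
  have vc: "continuous_on (Rn d) (v k)" if "k < d" for k by (rule Ck_cont[OF v1[OF that]])
  have ac: "continuous_on (Rn d) (adj k (v k))" if "k < d" for k by (rule adj_cont[OF v1[OF that] that])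
  have hc: "continuous_on (Rn d) (pd k (pd j \<phi>))" if "j < d" "k < d" for j k by (rule Ck_cont[OF Ck_pd'[OF phijC1[OF that(1)] that(2)]])
  have i1: "integrable M (\<lambda>x. adj j (v j) x * adj k (v k) x)" if "j < d" "k < d" for j k
    using that by (intro cc_integrable_M continuous_intros ac csup_mult2 adj_csup v)
  have i2: "integrable M (\<lambda>x. pd k (pd j \<phi>) x * v j x * v k x)" if "j < d" "k < d" for j k
    using that by (intro cc_integrable_M continuous_intros vc hc csup_mult2 v)
  have one: "(\<integral>x. pd j (v k) x * pd k (v j) x \<partial>M) = (\<integral>x. adj j (v j) x * adj k (v k) x \<partial>M) - (\<integral>x. pd k (pd j \<phi>) x * v j x * v k x \<partial>M)"
    if j: "j < d" and k: "k < d" for j k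
  proof -
    have a1: "Ck d (Suc 0) (adj j (v j))" by (rule adj_Ck[OF v(1)[OF j] j])
    have i3: "integrable M (\<lambda>x. pd k (adj j (v j)) x * v k x)"
      using j k by (intro cc_integrable_M continuous_intros vc Ck_cont[OF Ck_pd'[OF a1]] csup_mult2 v)
    have "(\<integral>x. pd j (v k) x * pd k (v j) x \<partial>M) = (\<integral>x. v k x * adj j (pd k (v j)) x \<partial>M)"
      by (rule adj_ibp[symmetric]) (use j k in \<open>auto intro: v1 Ck_pd'[OF v(1)] csup_pd v\<close>)
    also have "\<dots> = (\<integral>x. pd k (adj j (v j)) x * v k x - pd k (pd j \<phi>) x * v j x * v k x \<partial>M)"
      by (rule Bochner_Integration.integral_cong[OF refl]) (simp add: adj_commute[OF v(1)[OF j] j k] algebra_simps)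
    also have "\<dots> = (\<integral>x. pd k (adj j (v j)) x * v k x \<partial>M) - (\<integral>x. pd k (pd j \<phi>) x * v j x * v k x \<partial>M)"
      by (rule Bochner_Integration.integral_diff[OF i3 i2[OF j k]])
    also have "(\<integral>x. pd k (adj j (v j)) x * v k x \<partial>M) = (\<integral>x. adj j (v j) x * adj k (v k) x \<partial>M)"
      by (rule adj_ibp[symmetric, OF a1 v1[OF k] v(2)[OF k] k])
    finally show ?thesis .
  qed
  have "(\<Sum>j<d. \<Sum>k<d. \<integral>x. pd j (v k) x * pd k (v j) x \<partial>M)
    = (\<Sum>j<d. \<Sum>k<d. (\<integral>x. adj j (v j) x * adj k (v k) x \<partial>M) - (\<integral>x. pd k (pd j \<phi>) x * v j x * v k x \<partial>M))"
    by (intro sum.cong refl one) auto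
  also have "\<dots> = (\<Sum>j<d. \<Sum>k<d. \<integral>x. adj j (v j) x * adj k (v k) x \<partial>M) - (\<Sum>j<d. \<Sum>k<d. \<integral>x. pd k (pd j \<phi>) x * v j x * v k x \<partial>M)"
    by (simp add: sum_subtractf)
  also have "(\<Sum>j<d. \<Sum>k<d. \<integral>x. adj j (v j) x * adj k (v k) x \<partial>M) = (\<integral>x. (\<Sum>j<d. \<Sum>k<d. adj j (v j) x * adj k (v k) x) \<partial>M)"
    by (subst Bochner_Integration.integral_sum, fastforce intro: Bochner_Integration.integrable_sum i1)
      (intro sum.cong refl, subst Bochner_Integration.integral_sum, auto intro: i1)
  also have "\<dots> = (\<integral>x. (\<Sum>j<d. adj j (v j) x)\<^sup>2 \<partial>M)"
    by (simp add: power2_eq_square sum_product)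
  also have "(\<Sum>j<d. \<Sum>k<d. \<integral>x. pd k (pd j \<phi>) x * v j x * v k x \<partial>M) = (\<integral>x. (\<Sum>j<d. \<Sum>k<d. pd k (pd j \<phi>) x * v j x * v k x) \<partial>M)"
    by (subst Bochner_Integration.integral_sum, fastforce intro: Bochner_Integration.integrable_sum i2)
      (intro sum.cong refl, subst Bochner_Integration.integral_sum, auto intro: i2)
  finally show ?thesis .
qed

lemma hess_form_integral:
  assumes v: "\<And>k. k < d \<Longrightarrow> Ck d (Suc (Suc 0)) (v k)" "\<And>k. k < d \<Longrightarrow> csup d (v k)"
  shows "\<bar>\<integral>x. (\<Sum>j<d. \<Sum>k<d. pd k (pd j \<phi>) x * v j x * v k x) \<partial>M\<bar> \<le> (\<Sum>k<d. \<integral>x. hn x * (v k x)\<^sup>2 \<partial>M)"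
proof -
  have vc: "continuous_on (Rn d) (v k)" if "k < d" for k by (rule Ck_cont[OF v(1)[OF that]])
  have hc: "continuous_on (Rn d) (pd k (pd j \<phi>))" if "j < d" "k < d" for j k by (rule Ck_cont[OF Ck_pd'[OF phijC1[OF that(1)] that(2)]])
  have i2: "integrable M (\<lambda>x. pd k (pd j \<phi>) x * v j x * v k x)" if "j < d" "k < d" for j k
    using that by (intro cc_integrable_M continuous_intros vc hc csup_mult2 v)
  have i4: "integrable M (\<lambda>x. hn x * (v k x)\<^sup>2)" if k: "k < d" for k
  proof (rule cc_integrable_M)
    show "continuous_on (Rn d) (\<lambda>x. hn x * (v k x)\<^sup>2)" by (intro continuous_intros vc[OF k] hn_cont)
    show "csup d (\<lambda>x. hn x * (v k x)\<^sup>2)" by (rule csup_comp0[OF v(2)[OF k]]) simp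
  qed
  have i5: "integrable M (\<lambda>x. \<Sum>j<d. \<Sum>k<d. pd k (pd j \<phi>) x * v j x * v k x)"
    by (intro Bochner_Integration.integrable_sum i2) auto
  have "\<bar>\<integral>x. (\<Sum>j<d. \<Sum>k<d. pd k (pd j \<phi>) x * v j x * v k x) \<partial>M\<bar> \<le> (\<integral>x. \<bar>\<Sum>j<d. \<Sum>k<d. pd k (pd j \<phi>) x * v j x * v k x\<bar> \<partial>M)"
    by (rule integral_abs_bound)
  also have "\<dots> \<le> (\<integral>x. (\<Sum>k<d. hn x * (v k x)\<^sup>2) \<partial>M)"
  proof (rule integral_mono[OF integrable_abs[OF i5]])
    show "integrable M (\<lambda>x. \<Sum>k<d. hn x * (v k x)\<^sup>2)"
      by (intro Bochner_Integration.integrable_sum i4) auto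
    show "\<bar>\<Sum>j<d. \<Sum>k<d. pd k (pd j \<phi>) x * v j x * v k x\<bar> \<le> (\<Sum>k<d. hn x * (v k x)\<^sup>2)" for x
      using hess_form_bound[of x "\<lambda>k. v k x"] by (simp add: sum_distrib_left)
  qed
  also have "\<dots> = (\<Sum>k<d. \<integral>x. hn x * (v k x)\<^sup>2 \<partial>M)"
    by (rule Bochner_Integration.integral_sum) (use i4 in auto)
  finally show ?thesis .
qed

text \<open>Each product \<open>pd j (v k) * pd k (v j)\<close> is at most the mean of the two
  squares, so in the Bochner identity the weighted divergence costs no more than the full derivative
  and the Hessian term.\<close>

lemma divergence_bound:
  assumes v: "\<And>k. k < d \<Longrightarrow> Ck d (Suc (Suc 0)) (v k)" "\<And>k. k < d \<Longrightarrow> csup d (v k)"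
  shows "(\<integral>x. (\<Sum>j<d. adj j (v j) x)\<^sup>2 \<partial>M) \<le> (\<Sum>k<d. (\<Sum>j<d. \<integral>x. (pd j (v k) x)\<^sup>2 \<partial>M) + (\<integral>x. hn x * (v k x)\<^sup>2 \<partial>M))"
proof -
  have s: "sqi M (pd j (v k))" if "j < d" "k < d" for j k
    using that by (intro cc_sqi Ck_cont[OF Ck_pd'[OF v(1)]] csup_pd v)
  have "(\<integral>x. pd j (v k) x * pd k (v j) x \<partial>M) \<le> 1/2 * (\<integral>x. (pd j (v k) x)\<^sup>2 \<partial>M) + 1/2 * (\<integral>x. (pd k (v j) x)\<^sup>2 \<partial>M)" if "j < d" "k < d" for j k
  proof -
    have "(\<integral>x. pd j (v k) x * pd k (v j) x \<partial>M) \<le> (\<integral>x. 1/2 * (pd j (v k) x)\<^sup>2 + 1/2 * (pd k (v j) x)\<^sup>2 \<partial>M)"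
    proof (rule integral_mono)
      show "integrable M (\<lambda>x. pd j (v k) x * pd k (v j) x)" by (rule sqi_mult_integrable[OF s[OF that] s[OF that(2,1)]])
      show "integrable M (\<lambda>x. 1/2 * (pd j (v k) x)\<^sup>2 + 1/2 * (pd k (v j) x)\<^sup>2)" using s[OF that] s[OF that(2,1)] by (simp add: sqi_def)
      show "pd j (v k) x * pd k (v j) x \<le> 1/2 * (pd j (v k) x)\<^sup>2 + 1/2 * (pd k (v j) x)\<^sup>2" for x
        using sum_squares_bound[of "pd j (v k) x" "pd k (v j) x"] by simp
    qed
    also have "\<dots> = 1/2 * (\<integral>x. (pd j (v k) x)\<^sup>2 \<partial>M) + 1/2 * (\<integral>x. (pd k (v j) x)\<^sup>2 \<partial>M)"
      using s[OF that] s[OF that(2,1)] by (simp add: sqi_def)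
    finally show ?thesis .
  qed
  then have "(\<Sum>j<d. \<Sum>k<d. \<integral>x. pd j (v k) x * pd k (v j) x \<partial>M)
    \<le> (\<Sum>j<d. \<Sum>k<d. 1/2 * (\<integral>x. (pd j (v k) x)\<^sup>2 \<partial>M) + 1/2 * (\<integral>x. (pd k (v j) x)\<^sup>2 \<partial>M))"
    by (intro sum_mono) auto
  also have "\<dots> = 1/2 * (\<Sum>j<d. \<Sum>k<d. \<integral>x. (pd j (v k) x)\<^sup>2 \<partial>M) + 1/2 * (\<Sum>j<d. \<Sum>k<d. \<integral>x. (pd k (v j) x)\<^sup>2 \<partial>M)"
    by (simp add: sum.distrib sum_distrib_left)
  also have "(\<Sum>j<d. \<Sum>k<d. \<integral>x. (pd j (v k) x)\<^sup>2 \<partial>M) = (\<Sum>k<d. \<Sum>j<d. \<integral>x. (pd j (v k) x)\<^sup>2 \<partial>M)" by (rule sum.swap)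
  finally show ?thesis using bochner_identity[of v, OF v] hess_form_integral[of v, OF v] by (simp add: sum.distrib)
qed

text \<open>Solving \<open>D2 \<le> L + T\<close> and \<open>T \<le> th * D2 + qq * CP * L\<close>,
  the two estimates in \<open>second_derivative_bound\<close>, for \<open>D2 + T\<close> yields the
  bound \<open>CB * L\<close>.\<close>

definition CB :: real where "CB = (1 + th) * (1 + qq * CP) / (1 - th) + qq * CP"

lemma CB_pos: "CB > 0"
proof -
  have "(1 + th) * (1 + qq * CP) / (1 - th) > 0"
    using th_bounds qq_pos CP0 by (intro divide_pos_pos mult_pos_pos add_pos_nonneg) auto
  then show ?thesis using qq_pos CP0 by (simp add: CB_def add_pos_nonneg)
qed

lemma Lap_adj: "Lap \<psi> x = (\<Sum>j<d. adj j (pd j \<psi>) x)"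
  by (simp add: Lap_def adj_def)

text \<open>\<open>Lap\<close> is the adjoint of the gradient applied to the gradient, so the left
  side G is the scalar product of \<open>\<psi> - m\<close> with \<open>Lap \<psi>\<close>; the mean
  m may be subtracted because \<open>Lap \<psi>\<close> has mean 0. Cauchy-Schwarz and Poincare give
  \<open>G^2 \<le> CP * G * L\<close>.\<close>

lemma gradient_bound:
  assumes t: "test_fun d \<psi>"
  shows "(\<Sum>k<d. \<integral>x. (pd k \<psi> x)\<^sup>2 \<partial>M) \<le> CP * (\<integral>x. (Lap \<psi> x)\<^sup>2 \<partial>M)"
proof -
  define G L m where "G = (\<Sum>k<d. \<integral>x. (pd k \<psi> x)\<^sup>2 \<partial>M)" and "L = (\<integral>x. (Lap \<psi> x)\<^sup>2 \<partial>M)" and "m = (\<integral>x. \<psi> x \<partial>M)"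
  have p1: "Ck d (Suc 0) \<psi>" by (rule test_funD(1)[OF t])
  have pk: "test_fun d (pd k \<psi>)" if "k < d" for k by (rule test_fun_pd[OF t that])
  have sL: "sqi M (Lap \<psi>)" by (rule Lap_sqi[OF t])
  have sp: "sqi M \<psi>" by (rule test_fun_sqi[OF t])
  have one: "sqi M (\<lambda>_. 1)" by (simp add: sqi_def)
  have spm: "sqi M (\<lambda>x. \<psi> x - m)" using sqi_diff[OF sp sqi_cmult[OF one, of m]] by simp
  have "G = (\<Sum>k<d. \<integral>x. \<psi> x * adj k (pd k \<psi>) x \<partial>M)"
    unfolding G_def power2_eq_square
    by (intro sum.cong refl adj_ibp[symmetric] p1 test_funD pk) auto
  also have "\<dots> = (\<integral>x. (\<Sum>k<d. \<psi> x * adj k (pd k \<psi>) x) \<partial>M)"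
    by (rule Bochner_Integration.integral_sum[symmetric])
      (intro sqi_mult_integrable sp cc_sqi adj_cont adj_csup test_funD pk, auto)
  also have "\<dots> = (\<integral>x. (\<psi> x - m) * Lap \<psi> x + m * Lap \<psi> x \<partial>M)"
    by (rule Bochner_Integration.integral_cong[OF refl]) (simp add: Lap_adj sum_distrib_left[symmetric] algebra_simps)
  also have "\<dots> = (\<integral>x. (\<psi> x - m) * Lap \<psi> x \<partial>M)"
    using sqi_mult_integrable[OF spm sL] sqi_integrable[OF fm sL] Lap_mean[OF t] by simp
  finally have "G\<^sup>2 \<le> (\<integral>x. (\<psi> x - m)\<^sup>2 \<partial>M) * L"
    using CS_integral[OF spm sL] by (simp add: L_def)
  also have "\<dots> \<le> CP * G * L"
  proof (rule mult_right_mono)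
    have "h1lim \<psi> (\<lambda>j. pd j \<psi>)" by (rule C1_h1lim[OF p1 sp]) (rule test_fun_sqi[OF pk])
    from h1lim_poincare[OF this] show "(\<integral>x. (\<psi> x - m)\<^sup>2 \<partial>M) \<le> CP * G" by (simp add: m_def G_def)
  qed (simp add: L_def)
  finally have q: "G * G \<le> G * (CP * L)" by (simp add: power2_eq_square mult_ac)
  have G0: "0 \<le> G" and L0: "0 \<le> L" by (auto simp: G_def L_def intro!: sum_nonneg)
  have "G \<le> CP * L"
  proof (cases "G = 0")
    case False
    then show ?thesis using q G0 by (simp add: mult_le_cancel_left)
  qed (use CP0 L0 in simp)
  then show ?thesis by (simp add: G_def L_def)
qed

text \<open>For a gradient the left side of the Bochner identity is the sum of the squares of all
  second derivatives, by their symmetry. The Hessian term on the right is absorbed by means of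
  \<open>hess_weight_C1c\<close>, whose lower-order part is controlled by
  \<open>gradient_bound\<close>.\<close>

lemma second_derivative_bound:
  assumes t: "test_fun d \<psi>"
  shows "(\<Sum>k<d. (\<Sum>j<d. \<integral>x. (pd j (pd k \<psi>) x)\<^sup>2 \<partial>M) + (\<integral>x. hn x * (pd k \<psi> x)\<^sup>2 \<partial>M)) \<le> CB * (\<integral>x. (Lap \<psi> x)\<^sup>2 \<partial>M)"
proof -
  define D2 T G L where "D2 = (\<Sum>k<d. \<Sum>j<d. \<integral>x. (pd j (pd k \<psi>) x)\<^sup>2 \<partial>M)" and "T = (\<Sum>k<d. \<integral>x. hn x * (pd k \<psi> x)\<^sup>2 \<partial>M)"
    and "G = (\<Sum>k<d. \<integral>x. (pd k \<psi> x)\<^sup>2 \<partial>M)" and "L = (\<integral>x. (Lap \<psi> x)\<^sup>2 \<partial>M)"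
  have v: "Ck d m (pd k \<psi>)" "csup d (pd k \<psi>)" if "k < d" for k m using test_funD[OF test_fun_pd[OF t that]] by auto
  have "(\<Sum>j<d. \<Sum>k<d. \<integral>x. pd j (pd k \<psi>) x * pd k (pd j \<psi>) x \<partial>M) = D2"
  proof -
    have "(\<integral>x. pd j (pd k \<psi>) x * pd k (pd j \<psi>) x \<partial>M) = (\<integral>x. (pd j (pd k \<psi>) x)\<^sup>2 \<partial>M)" if "j < d" "k < d" for j k
      by (rule Bochner_Integration.integral_cong[OF refl])
        (use Schwarz[OF test_funD(1)[OF t, of "Suc (Suc 0)"] _ that] in \<open>simp add: power2_eq_square\<close>)
    then have "(\<Sum>j<d. \<Sum>k<d. \<integral>x. pd j (pd k \<psi>) x * pd k (pd j \<psi>) x \<partial>M) = (\<Sum>j<d. \<Sum>k<d. \<integral>x. (pd j (pd k \<psi>) x)\<^sup>2 \<partial>M)" by simp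
    also have "\<dots> = D2" unfolding D2_def by (rule sum.swap)
    finally show ?thesis .
  qed
  moreover have "(\<Sum>j<d. \<Sum>k<d. \<integral>x. pd j (pd k \<psi>) x * pd k (pd j \<psi>) x \<partial>M)
       = L - (\<integral>x. (\<Sum>j<d. \<Sum>k<d. pd k (pd j \<phi>) x * pd j \<psi> x * pd k \<psi> x) \<partial>M)"
    unfolding L_def Lap_adj by (rule bochner_identity[of "\<lambda>k. pd k \<psi>"]) (use v in auto)
  moreover have "\<bar>\<integral>x. (\<Sum>j<d. \<Sum>k<d. pd k (pd j \<phi>) x * pd j \<psi> x * pd k \<psi> x) \<partial>M\<bar> \<le> T"
    unfolding T_def by (rule hess_form_integral[of "\<lambda>k. pd k \<psi>"]) (use v in auto)
  ultimately have "D2 \<le> L + T" by linarith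
  moreover have "T \<le> th * D2 + qq * G"
  proof -
    have "T \<le> (\<Sum>k<d. th * (\<Sum>j<d. \<integral>x. (pd j (pd k \<psi>) x)\<^sup>2 \<partial>M) + qq * (\<integral>x. (pd k \<psi> x)\<^sup>2 \<partial>M))"
      unfolding T_def by (intro sum_mono hess_weight_C1c v) auto
    then show ?thesis by (simp add: D2_def G_def sum.distrib sum_distrib_left)
  qed
  moreover have "qq * G \<le> qq * (CP * L)"
    using gradient_bound[OF t] qq_pos unfolding G_def L_def by (intro mult_left_mono) auto
  ultimately have 1: "D2 \<le> L + T" and 2: "T \<le> th * D2 + qq * (CP * L)" by linarith+
  have "(1 - th) * D2 \<le> (1 + qq * CP) * L" using 1 2 by (simp add: algebra_simps)
  then have 3: "D2 \<le> (1 + qq * CP) * L / (1 - th)" using th_bounds by (simp add: pos_le_divide_eq mult.commute)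
  have "D2 + T \<le> (1 + th) * D2 + qq * CP * L" using 2 by (simp add: algebra_simps)
  also have "\<dots> \<le> (1 + th) * ((1 + qq * CP) * L / (1 - th)) + qq * CP * L"
    using 3 th_bounds by (intro add_right_mono mult_left_mono) auto
  also have "\<dots> = CB * L" by (simp add: CB_def algebra_simps)
  finally show ?thesis by (simp add: D2_def T_def L_def sum.distrib)
qed

text \<open>For fixed k the field with components \<open>pd k (\<psi> j)\<close> is in general no
  gradient, so \<open>divergence_bound\<close> has to come first. After exchanging the sums,
  \<open>second_derivative_bound\<close> applies to each \<open>\<psi> j\<close> separately, and no
  factor depending on d arises.\<close>

lemma adj_array_bound:
  assumes t: "\<And>j. j < d \<Longrightarrow> test_fun d (\<psi> j)"
  shows "(\<Sum>k<d. \<integral>x. (\<Sum>j<d. adj j (pd k (\<psi> j)) x)\<^sup>2 \<partial>M) \<le> CB * (\<Sum>j<d. \<integral>x. (Lap (\<psi> j) x)\<^sup>2 \<partial>M)"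
proof -
  have "(\<Sum>k<d. \<integral>x. (\<Sum>j<d. adj j (pd k (\<psi> j)) x)\<^sup>2 \<partial>M)
    \<le> (\<Sum>k<d. \<Sum>j<d. (\<Sum>l<d. \<integral>x. (pd l (pd k (\<psi> j)) x)\<^sup>2 \<partial>M) + (\<integral>x. hn x * (pd k (\<psi> j) x)\<^sup>2 \<partial>M))"
    by (intro sum_mono divergence_bound[of "\<lambda>j. pd _ (\<psi> j)"] test_funD test_fun_pd t) auto
  also have "\<dots> = (\<Sum>j<d. \<Sum>k<d. (\<Sum>l<d. \<integral>x. (pd l (pd k (\<psi> j)) x)\<^sup>2 \<partial>M) + (\<integral>x. hn x * (pd k (\<psi> j) x)\<^sup>2 \<partial>M))"
    by (rule sum.swap)
  also have "\<dots> \<le> (\<Sum>j<d. CB * (\<integral>x. (Lap (\<psi> j) x)\<^sup>2 \<partial>M))"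
    by (intro sum_mono second_derivative_bound t) auto
  finally show ?thesis by (simp add: sum_distrib_left)
qed

subsection \<open>The Korn inequality\<close>

definition symm :: "(nat \<Rightarrow> nat \<Rightarrow> point \<Rightarrow> real) \<Rightarrow> nat \<Rightarrow> nat \<Rightarrow> point \<Rightarrow> real" where
  "symm G i j x = (G i j x + G j i x) / 2"

definition anti :: "(nat \<Rightarrow> nat \<Rightarrow> point \<Rightarrow> real) \<Rightarrow> nat \<Rightarrow> nat \<Rightarrow> point \<Rightarrow> real" where
  "anti G i j x = (G i j x - G j i x) / 2"

context
  fixes u :: "nat \<Rightarrow> point \<Rightarrow> real"
  assumes u: "\<And>i. i < d \<Longrightarrow> test_fun d (u i)"
begin

abbreviation "Gu \<equiv> \<lambda>i j. pd j (u i)"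

lemma Gu_test: "i < d \<Longrightarrow> j < d \<Longrightarrow> test_fun d (Gu i j)"
  by (rule test_fun_pd[OF u])

lemma symm_test: "i < d \<Longrightarrow> j < d \<Longrightarrow> test_fun d (symm Gu i j)"
  unfolding symm_def[abs_def] add_divide_distrib
  using test_fun_add[OF test_fun_cmult[OF Gu_test[of i j], of "1/2"] test_fun_cmult[OF Gu_test[of j i], of "1/2"]] by simp

lemma anti_test: "i < d \<Longrightarrow> j < d \<Longrightarrow> test_fun d (anti Gu i j)"
  unfolding anti_def[abs_def] diff_divide_distrib
  using test_fun_add[OF test_fun_cmult[OF Gu_test[of i j], of "1/2"] test_fun_cmult[OF Gu_test[of j i], of "-1/2"]] by simp

lemma pd_anti:
  assumes ijk: "i < d" "j < d" "k < d" and x: "x \<in> Rn d"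
  shows "pd k (anti Gu i j) x = pd j (symm Gu i k) x - pd i (symm Gu j k) x"
proof -
  have g: "Ck d (Suc 0) (Gu a b)" if "a < d" "b < d" for a b by (rule test_funD(1)[OF Gu_test[OF that]])
  have s: "pd c (symm Gu a b) x = (pd c (Gu a b) x + pd c (Gu b a) x) / 2" if "a < d" "b < d" "c < d" for a b c
  proof -
    have "pd c (\<lambda>x. (1/2) * (Gu a b x + Gu b a x)) x = (1/2) * (pd c (Gu a b) x + pd c (Gu b a) x)"
      using pd_cmult[OF Ck_add[OF g[OF that(1,2)] g[OF that(2,1)]] x that(3), of "1/2"] pd_add[OF g[OF that(1,2)] x that(3) g[OF that(2,1)]] by simp
    then show ?thesis by (simp add: symm_def[abs_def])
  qed
  have a: "pd c (anti Gu a b) x = (pd c (Gu a b) x - pd c (Gu b a) x) / 2" if "a < d" "b < d" "c < d" for a b c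
  proof -
    have "pd c (\<lambda>x. (1/2) * (Gu a b x - Gu b a x)) x = (1/2) * (pd c (Gu a b) x - pd c (Gu b a) x)"
      using pd_cmult[OF Ck_diff[OF g[OF that(1,2)] g[OF that(2,1)]] x that(3), of "1/2"] pd_diff[OF g[OF that(1,2)] x that(3) g[OF that(2,1)]] by simp
    then show ?thesis by (simp add: anti_def[abs_def])
  qed
  have sw: "pd a (pd b (u c)) x = pd b (pd a (u c)) x" if "a < d" "b < d" "c < d" for a b c
    by (rule Schwarz[OF test_funD(1)[OF u[OF that(3)], of "Suc (Suc 0)"] x that(1,2)])
  show ?thesis
    unfolding s[OF ijk(1,3,2)] s[OF ijk(2,3,1)] a[OF ijk]
    using sw[OF ijk(3,2,1)] sw[OF ijk(3,1,2)] sw[OF ijk(2,1,3)] by (simp add: field_simps)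
qed

lemma anti_Lap:
  assumes ij: "i < d" "j < d" and t: "test_fun d \<psi>"
  shows "(\<integral>x. anti Gu i j x * Lap \<psi> x \<partial>M)
    = (\<Sum>k<d. (\<integral>x. symm Gu i k x * adj j (pd k \<psi>) x \<partial>M) - (\<integral>x. symm Gu j k x * adj i (pd k \<psi>) x \<partial>M))"
proof -
  have p1: "Ck d (Suc 0) (pd k \<psi>)" "csup d (pd k \<psi>)" if "k < d" for k using test_funD[OF test_fun_pd[OF t that]] by auto
  have sa: "sqi M (adj l (pd k \<psi>))" if "l < d" "k < d" for l k
    by (intro cc_sqi adj_cont adj_csup p1 that)
  have ss: "sqi M (pd l (symm Gu a b))" if "l < d" "a < d" "b < d" for l a b
    by (intro test_fun_sqi test_fun_pd symm_test that)
  have sp: "sqi M (pd k \<psi>)" if "k < d" for k by (intro test_fun_sqi test_fun_pd t that)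
  have "(\<integral>x. anti Gu i j x * Lap \<psi> x \<partial>M) = (\<integral>x. (\<Sum>k<d. anti Gu i j x * adj k (pd k \<psi>) x) \<partial>M)"
    by (simp add: Lap_adj sum_distrib_left)
  also have "\<dots> = (\<Sum>k<d. \<integral>x. anti Gu i j x * adj k (pd k \<psi>) x \<partial>M)"
    by (rule Bochner_Integration.integral_sum) (intro sqi_mult_integrable test_fun_sqi anti_test ij sa; simp)
  also have "\<dots> = (\<Sum>k<d. (\<integral>x. symm Gu i k x * adj j (pd k \<psi>) x \<partial>M) - (\<integral>x. symm Gu j k x * adj i (pd k \<psi>) x \<partial>M))"
  proof (rule sum.cong[OF refl])
    fix k assume "k \<in> {..<d}"
    then have k: "k < d" by simp
    have "(\<integral>x. anti Gu i j x * adj k (pd k \<psi>) x \<partial>M) = (\<integral>x. pd k (anti Gu i j) x * pd k \<psi> x \<partial>M)"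
      by (rule adj_ibp[OF test_funD(1)[OF anti_test[OF ij]] p1[OF k] k])
    also have "\<dots> = (\<integral>x. pd j (symm Gu i k) x * pd k \<psi> x - pd i (symm Gu j k) x * pd k \<psi> x \<partial>M)"
      by (rule Bochner_Integration.integral_cong[OF refl]) (simp add: pd_anti[OF ij k] left_diff_distrib)
    also have "\<dots> = (\<integral>x. pd j (symm Gu i k) x * pd k \<psi> x \<partial>M) - (\<integral>x. pd i (symm Gu j k) x * pd k \<psi> x \<partial>M)"
      by (intro Bochner_Integration.integral_diff sqi_mult_integrable ss sp ij k)
    also have "(\<integral>x. pd j (symm Gu i k) x * pd k \<psi> x \<partial>M) = (\<integral>x. symm Gu i k x * adj j (pd k \<psi>) x \<partial>M)"
      by (rule adj_ibp[symmetric, OF test_funD(1)[OF symm_test[OF ij(1) k]] p1[OF k] ij(2)])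
    also have "(\<integral>x. pd i (symm Gu j k) x * pd k \<psi> x \<partial>M) = (\<integral>x. symm Gu j k x * adj i (pd k \<psi>) x \<partial>M)"
      by (rule adj_ibp[symmetric, OF test_funD(1)[OF symm_test[OF ij(2) k]] p1[OF k] ij(1)])
    finally show "(\<integral>x. anti Gu i j x * adj k (pd k \<psi>) x \<partial>M) = (\<integral>x. symm Gu i k x * adj j (pd k \<psi>) x \<partial>M) - (\<integral>x. symm Gu j k x * adj i (pd k \<psi>) x \<partial>M)" .
  qed
  finally show ?thesis .
qed

text \<open>The weight is tuned to \<open>anti_Lap_bound\<close>: there the terms with g sum to at
  most \<open>CB * L\<close>, which the factor \<open>1 / (4 * CB)\<close> turns into a quarter of
  L.\<close>

lemma weighted_young:
  assumes f: "sqi M f" and g: "sqi M g"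
  shows "(\<integral>x. f x * g x \<partial>M) \<le> CB * (\<integral>x. (f x)\<^sup>2 \<partial>M) + 1 / (4 * CB) * (\<integral>x. (g x)\<^sup>2 \<partial>M)"
    "- (\<integral>x. f x * g x \<partial>M) \<le> CB * (\<integral>x. (f x)\<^sup>2 \<partial>M) + 1 / (4 * CB) * (\<integral>x. (g x)\<^sup>2 \<partial>M)"
proof -
  have pt: "\<bar>a * b\<bar> \<le> CB * a\<^sup>2 + 1 / (4 * CB) * b\<^sup>2" for a b
  proof -
    have "0 \<le> (2 * CB * \<bar>a\<bar> - \<bar>b\<bar>)\<^sup>2" by simp
    also have "(2 * CB * \<bar>a\<bar> - \<bar>b\<bar>)\<^sup>2 = 4 * CB * (CB * a\<^sup>2) + b\<^sup>2 - 4 * CB * \<bar>a * b\<bar>"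
      by (simp add: power2_diff power_mult_distrib abs_mult power2_eq_square[of CB] mult_ac)
    finally have "4 * CB * \<bar>a * b\<bar> \<le> 4 * CB * (CB * a\<^sup>2) + b\<^sup>2" by simp
    then show ?thesis using CB_pos by (simp add: field_simps)
  qed
  have i: "integrable M (\<lambda>x. CB * (f x)\<^sup>2 + 1 / (4 * CB) * (g x)\<^sup>2)" using f g by (simp add: sqi_def)
  have "\<bar>\<integral>x. f x * g x \<partial>M\<bar> \<le> (\<integral>x. \<bar>f x * g x\<bar> \<partial>M)" by (rule integral_abs_bound)
  also have "\<dots> \<le> (\<integral>x. CB * (f x)\<^sup>2 + 1 / (4 * CB) * (g x)\<^sup>2 \<partial>M)"
    by (rule integral_mono[OF integrable_abs[OF sqi_mult_integrable[OF f g]] i]) (rule pt)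
  also have "\<dots> = CB * (\<integral>x. (f x)\<^sup>2 \<partial>M) + 1 / (4 * CB) * (\<integral>x. (g x)\<^sup>2 \<partial>M)" using f g by (simp add: sqi_def)
  finally show "(\<integral>x. f x * g x \<partial>M) \<le> CB * (\<integral>x. (f x)\<^sup>2 \<partial>M) + 1 / (4 * CB) * (\<integral>x. (g x)\<^sup>2 \<partial>M)"
    "- (\<integral>x. f x * g x \<partial>M) \<le> CB * (\<integral>x. (f x)\<^sup>2 \<partial>M) + 1 / (4 * CB) * (\<integral>x. (g x)\<^sup>2 \<partial>M)" by linarith+
qed

text \<open>The sum splits into one part where \<open>symm Gu i k\<close> meets a divergence over j
  and another where \<open>symm Gu j k\<close> meets a divergence over i. Each costs
  \<open>CB * S + L / 4\<close>, and the total \<open>L / 2\<close> is small enough to be absorbed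
  in \<open>korn_test\<close>.\<close>

lemma anti_Lap_bound:
  assumes t: "\<And>i j. i < d \<Longrightarrow> j < d \<Longrightarrow> test_fun d (\<psi> i j)"
  shows "(\<Sum>i<d. \<Sum>j<d. \<integral>x. anti Gu i j x * Lap (\<psi> i j) x \<partial>M)
    \<le> 2 * CB * (\<Sum>i<d. \<Sum>j<d. \<integral>x. (symm Gu i j x)\<^sup>2 \<partial>M) + 1/2 * (\<Sum>i<d. \<Sum>j<d. \<integral>x. (Lap (\<psi> i j) x)\<^sup>2 \<partial>M)"
proof -
  define S L where "S = (\<Sum>i<d. \<Sum>j<d. \<integral>x. (symm Gu i j x)\<^sup>2 \<partial>M)" and "L = (\<Sum>i<d. \<Sum>j<d. \<integral>x. (Lap (\<psi> i j) x)\<^sup>2 \<partial>M)"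
  have sa: "sqi M (adj l (pd k (\<psi> i j)))" if "l < d" "k < d" "i < d" "j < d" for l k i j
    by (intro cc_sqi adj_cont adj_csup test_funD test_fun_pd t that)
  have ssy: "sqi M (symm Gu a b)" if "a < d" "b < d" for a b
    by (intro test_fun_sqi symm_test that)
  define P where "P i k x = (\<Sum>j<d. adj j (pd k (\<psi> i j)) x)" for i k x
  define Q where "Q j k x = (\<Sum>i<d. adj i (pd k (\<psi> i j)) x)" for j k x
  have Ps: "sqi M (P i k)" "sqi M (Q i k)" if "i < d" "k < d" for i k
    unfolding P_def Q_def using that by (auto intro!: sqi_sum sa)
  have "(\<Sum>i<d. \<Sum>j<d. \<integral>x. anti Gu i j x * Lap (\<psi> i j) x \<partial>M)
    = (\<Sum>i<d. \<Sum>j<d. \<Sum>k<d. (\<integral>x. symm Gu i k x * adj j (pd k (\<psi> i j)) x \<partial>M) - (\<integral>x. symm Gu j k x * adj i (pd k (\<psi> i j)) x \<partial>M))"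
    by (intro sum.cong refl anti_Lap t) auto
  also have "\<dots> = (\<Sum>i<d. \<Sum>j<d. \<Sum>k<d. \<integral>x. symm Gu i k x * adj j (pd k (\<psi> i j)) x \<partial>M) - (\<Sum>i<d. \<Sum>j<d. \<Sum>k<d. \<integral>x. symm Gu j k x * adj i (pd k (\<psi> i j)) x \<partial>M)"
    by (simp add: sum_subtractf)
  also have "(\<Sum>i<d. \<Sum>j<d. \<Sum>k<d. \<integral>x. symm Gu i k x * adj j (pd k (\<psi> i j)) x \<partial>M) = (\<Sum>i<d. \<Sum>k<d. \<integral>x. symm Gu i k x * P i k x \<partial>M)"
  proof (rule sum.cong[OF refl])
    fix i assume "i \<in> {..<d}"
    then have i: "i < d" by simp
    have "(\<Sum>j<d. \<Sum>k<d. \<integral>x. symm Gu i k x * adj j (pd k (\<psi> i j)) x \<partial>M) = (\<Sum>k<d. \<Sum>j<d. \<integral>x. symm Gu i k x * adj j (pd k (\<psi> i j)) x \<partial>M)" by (rule sum.swap)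
    also have "\<dots> = (\<Sum>k<d. \<integral>x. symm Gu i k x * P i k x \<partial>M)"
      unfolding P_def sum_distrib_left
      by (intro sum.cong refl Bochner_Integration.integral_sum[symmetric] sqi_mult_integrable ssy sa) (use i in auto)
    finally show "(\<Sum>j<d. \<Sum>k<d. \<integral>x. symm Gu i k x * adj j (pd k (\<psi> i j)) x \<partial>M) = (\<Sum>k<d. \<integral>x. symm Gu i k x * P i k x \<partial>M)" .
  qed
  also have "(\<Sum>i<d. \<Sum>j<d. \<Sum>k<d. \<integral>x. symm Gu j k x * adj i (pd k (\<psi> i j)) x \<partial>M) = (\<Sum>j<d. \<Sum>k<d. \<integral>x. symm Gu j k x * Q j k x \<partial>M)"
  proof -
    have "(\<Sum>i<d. \<Sum>j<d. \<Sum>k<d. \<integral>x. symm Gu j k x * adj i (pd k (\<psi> i j)) x \<partial>M) = (\<Sum>j<d. \<Sum>i<d. \<Sum>k<d. \<integral>x. symm Gu j k x * adj i (pd k (\<psi> i j)) x \<partial>M)" by (rule sum.swap)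
    also have "\<dots> = (\<Sum>j<d. \<Sum>k<d. \<Sum>i<d. \<integral>x. symm Gu j k x * adj i (pd k (\<psi> i j)) x \<partial>M)" by (rule sum.cong[OF refl sum.swap])
    also have "\<dots> = (\<Sum>j<d. \<Sum>k<d. \<integral>x. symm Gu j k x * Q j k x \<partial>M)"
      unfolding Q_def sum_distrib_left
      by (intro sum.cong refl Bochner_Integration.integral_sum[symmetric] sqi_mult_integrable ssy sa) auto
    finally show ?thesis .
  qed
  also have "(\<Sum>i<d. \<Sum>k<d. \<integral>x. symm Gu i k x * P i k x \<partial>M) - (\<Sum>j<d. \<Sum>k<d. \<integral>x. symm Gu j k x * Q j k x \<partial>M)
    \<le> (\<Sum>i<d. \<Sum>k<d. CB * (\<integral>x. (symm Gu i k x)\<^sup>2 \<partial>M) + 1 / (4 * CB) * (\<integral>x. (P i k x)\<^sup>2 \<partial>M))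
     + (\<Sum>i<d. \<Sum>k<d. CB * (\<integral>x. (symm Gu i k x)\<^sup>2 \<partial>M) + 1 / (4 * CB) * (\<integral>x. (Q i k x)\<^sup>2 \<partial>M))"
    unfolding diff_conv_add_uminus sum_negf[symmetric]
    by (intro add_mono sum_mono weighted_young ssy Ps) auto
  also have "\<dots> = 2 * CB * S + 1 / (4 * CB) * (\<Sum>i<d. \<Sum>k<d. \<integral>x. (P i k x)\<^sup>2 \<partial>M) + 1 / (4 * CB) * (\<Sum>i<d. \<Sum>k<d. \<integral>x. (Q i k x)\<^sup>2 \<partial>M)"
    by (simp add: S_def sum.distrib sum_distrib_left[symmetric] sum_divide_distrib[symmetric])
  also have "\<dots> \<le> 2 * CB * S + 1 / (4 * CB) * (CB * L) + 1 / (4 * CB) * (CB * L)"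
  proof (intro add_mono mult_left_mono order_refl)
    have "(\<Sum>i<d. \<Sum>k<d. \<integral>x. (P i k x)\<^sup>2 \<partial>M) \<le> (\<Sum>i<d. CB * (\<Sum>j<d. \<integral>x. (Lap (\<psi> i j) x)\<^sup>2 \<partial>M))"
      unfolding P_def by (intro sum_mono adj_array_bound t) auto
    then show "(\<Sum>i<d. \<Sum>k<d. \<integral>x. (P i k x)\<^sup>2 \<partial>M) \<le> CB * L" by (simp add: L_def sum_distrib_left)
    have "(\<Sum>j<d. \<Sum>k<d. \<integral>x. (Q j k x)\<^sup>2 \<partial>M) \<le> (\<Sum>j<d. CB * (\<Sum>i<d. \<integral>x. (Lap (\<psi> i j) x)\<^sup>2 \<partial>M))"
      unfolding Q_def by (intro sum_mono adj_array_bound[of "\<lambda>i. \<psi> i _"] t) auto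
    also have "\<dots> = CB * (\<Sum>j<d. \<Sum>i<d. \<integral>x. (Lap (\<psi> i j) x)\<^sup>2 \<partial>M)" by (simp add: sum_distrib_left)
    also have "(\<Sum>j<d. \<Sum>i<d. \<integral>x. (Lap (\<psi> i j) x)\<^sup>2 \<partial>M) = L" unfolding L_def by (rule sum.swap)
    finally show "(\<Sum>j<d. \<Sum>k<d. \<integral>x. (Q j k x)\<^sup>2 \<partial>M) \<le> CB * L" .
  qed (use CB_pos in auto)
  also have "\<dots> = 2 * CB * S + 1/2 * L" using CB_pos by (simp add: field_simps)
  finally show ?thesis by (simp add: S_def L_def)
qed

text \<open>When the \<open>Lap (\<Psi> (i, j) n)\<close> tend to the fluctuations W, with X the sum
  of their squared norms, the left side of \<open>anti_Lap_bound\<close> tends to X and the right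
  side to \<open>2 * CB * S + X / 2\<close>. Absorbing X / 2 gives the factor 4.\<close>

lemma korn_test:
  "(\<Sum>i<d. \<Sum>j<d. (\<integral>x. (anti Gu i j x)\<^sup>2 \<partial>M) - (\<integral>x. anti Gu i j x \<partial>M)\<^sup>2)
    \<le> 4 * CB * (\<Sum>i<d. \<Sum>j<d. \<integral>x. (symm Gu i j x)\<^sup>2 \<partial>M)"
proof -
  define m where "m i j = (\<integral>x. anti Gu i j x \<partial>M)" for i j
  define W where "W i j x = anti Gu i j x - m i j" for i j x
  have as: "sqi M (anti Gu i j)" if "i < d" "j < d" for i j by (intro test_fun_sqi anti_test that)
  have one: "sqi M (\<lambda>_. 1)" by (simp add: sqi_def)
  have Ws: "sqi M (W i j)" if "i < d" "j < d" for i j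
    using sqi_diff[OF as[OF that] sqi_cmult[OF one, of "m i j"]] by (simp add: W_def[abs_def])
  have Wm: "(\<integral>x. W i j x \<partial>M) = 0" if "i < d" "j < d" for i j
    using sqi_integrable[OF fm as[OF that]] by (simp add: W_def m_def measure_M)
  have "\<exists>\<psi>. (\<forall>n. test_fun d (\<psi> n)) \<and> (i < d \<and> j < d \<longrightarrow> L2c M (\<lambda>n. Lap (\<psi> n)) (W i j))" for i j
  proof (cases "i < d \<and> j < d")
    case True
    then show ?thesis using Lap_dense[OF Ws Wm] by simp
  next
    case False
    then show ?thesis by (intro exI[of _ "\<lambda>_ _. 0"]) (use test_fun_zero in auto)
  qed
  then have "\<forall>p. \<exists>\<psi>. (\<forall>n. test_fun d (\<psi> n)) \<and> (fst p < d \<and> snd p < d \<longrightarrow> L2c M (\<lambda>n. Lap (\<psi> n)) (W (fst p) (snd p)))"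
    by (intro allI)
  from choice[OF this] obtain \<Psi> where \<Psi>: "\<forall>p. (\<forall>n. test_fun d (\<Psi> p n)) \<and> (fst p < d \<and> snd p < d \<longrightarrow> L2c M (\<lambda>n. Lap (\<Psi> p n)) (W (fst p) (snd p)))"
    by (elim exE)
  have t: "test_fun d (\<Psi> (i, j) n)" for i j n using \<Psi> by simp
  have l: "L2c M (\<lambda>n. Lap (\<Psi> (i, j) n)) (W i j)" if "i < d" "j < d" for i j using spec[OF \<Psi>, of "(i, j)"] that by simp
  define X where "X = (\<Sum>i<d. \<Sum>j<d. \<integral>x. (W i j x)\<^sup>2 \<partial>M)"
  define S where "S = (\<Sum>i<d. \<Sum>j<d. \<integral>x. (symm Gu i j x)\<^sup>2 \<partial>M)"
  have aW: "(\<integral>x. anti Gu i j x * W i j x \<partial>M) = (\<integral>x. (W i j x)\<^sup>2 \<partial>M)" if "i < d" "j < d" for i j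
  proof -
    have "(\<integral>x. anti Gu i j x * W i j x \<partial>M) = (\<integral>x. (W i j x)\<^sup>2 + m i j * W i j x \<partial>M)"
      by (simp add: W_def power2_eq_square algebra_simps)
    also have "\<dots> = (\<integral>x. (W i j x)\<^sup>2 \<partial>M)"
      using sqiD(2)[OF Ws[OF that]] sqi_integrable[OF fm Ws[OF that]] Wm[OF that] by simp
    finally show ?thesis .
  qed
  have "(\<Sum>i<d. \<Sum>j<d. \<integral>x. anti Gu i j x * W i j x \<partial>M) \<le> 2 * CB * S + 1/2 * X"
  proof (rule LIMSEQ_le)
    show "(\<lambda>n. \<Sum>i<d. \<Sum>j<d. \<integral>x. anti Gu i j x * Lap (\<Psi> (i, j) n) x \<partial>M) \<longlonglongrightarrow> (\<Sum>i<d. \<Sum>j<d. \<integral>x. anti Gu i j x * W i j x \<partial>M)"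
      by (intro tendsto_sum L2c_inner[OF L2c_const[OF as] l]) auto
    show "(\<lambda>n. 2 * CB * S + 1/2 * (\<Sum>i<d. \<Sum>j<d. \<integral>x. (Lap (\<Psi> (i, j) n) x)\<^sup>2 \<partial>M)) \<longlonglongrightarrow> 2 * CB * S + 1/2 * X"
      unfolding X_def by (intro tendsto_add tendsto_mult tendsto_const tendsto_sum L2c_norm l) auto
    show "\<exists>N. \<forall>n\<ge>N. (\<Sum>i<d. \<Sum>j<d. \<integral>x. anti Gu i j x * Lap (\<Psi> (i, j) n) x \<partial>M) \<le> 2 * CB * S + 1/2 * (\<Sum>i<d. \<Sum>j<d. \<integral>x. (Lap (\<Psi> (i, j) n) x)\<^sup>2 \<partial>M)"
      unfolding S_def by (intro exI[of _ 0] allI impI anti_Lap_bound[of "\<lambda>i j. \<Psi> (i, j) _"] t)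
  qed
  moreover have "(\<Sum>i<d. \<Sum>j<d. \<integral>x. anti Gu i j x * W i j x \<partial>M) = X"
    unfolding X_def by (intro sum.cong refl aW) auto
  ultimately have "X \<le> 4 * CB * S" by simp
  moreover have "X = (\<Sum>i<d. \<Sum>j<d. (\<integral>x. (anti Gu i j x)\<^sup>2 \<partial>M) - (\<integral>x. anti Gu i j x \<partial>M)\<^sup>2)"
    unfolding X_def W_def m_def by (intro sum.cong refl variance_eq as) auto
  ultimately show ?thesis by (simp add: S_def)
qed

end

theorem korn:
  assumes h: "\<And>i. i < d \<Longrightarrow> h1lim (u i) (G i)"
  shows "(\<Sum>i<d. \<Sum>j<d. \<integral>x. (anti G i j x - (\<integral>x. anti G i j x \<partial>M))\<^sup>2 \<partial>M)
    \<le> 4 * CB * (\<Sum>i<d. \<Sum>j<d. \<integral>x. (symm G i j x)\<^sup>2 \<partial>M)"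
proof -
  have "\<forall>i. \<exists>\<eta>. i < d \<longrightarrow> (\<forall>n. test_fun d (\<eta> n)) \<and> (\<forall>j<d. L2c M (\<lambda>n. pd j (\<eta> n)) (G i j))"
  proof
    fix i
    show "\<exists>\<eta>. i < d \<longrightarrow> (\<forall>n. test_fun d (\<eta> n)) \<and> (\<forall>j<d. L2c M (\<lambda>n. pd j (\<eta> n)) (G i j))"
    proof (cases "i < d")
      case True
      obtain \<eta> where e: "\<forall>n. test_fun d (\<eta> n)" "L2c M \<eta> (u i)" "\<forall>j<d. L2c M (\<lambda>n. pd j (\<eta> n)) (G i j)" using h[OF True] by (rule h1limE)
      then show ?thesis by (intro exI[of _ \<eta>]) simp
    qed simp
  qed
  from choice[OF this] obtain \<eta> where \<eta>: "\<forall>i. i < d \<longrightarrow> (\<forall>n. test_fun d (\<eta> i n)) \<and> (\<forall>j<d. L2c M (\<lambda>n. pd j (\<eta> i n)) (G i j))" by (elim exE)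
  have t: "test_fun d (\<eta> i n)" if "i < d" for i n using \<eta> that by simp
  have l: "L2c M (\<lambda>n. pd j (\<eta> i n)) (G i j)" if "i < d" "j < d" for i j using \<eta> that by simp
  have ls: "L2c M (\<lambda>n. symm (\<lambda>i j. pd j (\<eta> i n)) i j) (symm G i j)" if "i < d" "j < d" for i j
    using L2c_cmult[OF L2c_add[OF l[OF that] l[OF that(2,1)]], of "1/2"] by (simp add: symm_def[abs_def])
  have la: "L2c M (\<lambda>n. anti (\<lambda>i j. pd j (\<eta> i n)) i j) (anti G i j)" if "i < d" "j < d" for i j
    using L2c_cmult[OF L2c_diff[OF l[OF that] l[OF that(2,1)]], of "1/2"] by (simp add: anti_def[abs_def])
  have "(\<Sum>i<d. \<Sum>j<d. (\<integral>x. (anti G i j x)\<^sup>2 \<partial>M) - (\<integral>x. anti G i j x \<partial>M)\<^sup>2) \<le> 4 * CB * (\<Sum>i<d. \<Sum>j<d. \<integral>x. (symm G i j x)\<^sup>2 \<partial>M)"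
  proof (rule LIMSEQ_le)
    show "(\<lambda>n. \<Sum>i<d. \<Sum>j<d. (\<integral>x. (anti (\<lambda>i j. pd j (\<eta> i n)) i j x)\<^sup>2 \<partial>M) - (\<integral>x. anti (\<lambda>i j. pd j (\<eta> i n)) i j x \<partial>M)\<^sup>2)
      \<longlonglongrightarrow> (\<Sum>i<d. \<Sum>j<d. (\<integral>x. (anti G i j x)\<^sup>2 \<partial>M) - (\<integral>x. anti G i j x \<partial>M)\<^sup>2)"
      by (intro tendsto_sum tendsto_diff tendsto_power L2c_norm la L2c_integral[OF fm la]) auto
    show "(\<lambda>n. 4 * CB * (\<Sum>i<d. \<Sum>j<d. \<integral>x. (symm (\<lambda>i j. pd j (\<eta> i n)) i j x)\<^sup>2 \<partial>M)) \<longlonglongrightarrow> 4 * CB * (\<Sum>i<d. \<Sum>j<d. \<integral>x. (symm G i j x)\<^sup>2 \<partial>M)"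
      by (intro tendsto_mult tendsto_const tendsto_sum L2c_norm ls) auto
    show "\<exists>N. \<forall>n\<ge>N. (\<Sum>i<d. \<Sum>j<d. (\<integral>x. (anti (\<lambda>i j. pd j (\<eta> i n)) i j x)\<^sup>2 \<partial>M) - (\<integral>x. anti (\<lambda>i j. pd j (\<eta> i n)) i j x \<partial>M)\<^sup>2)
      \<le> 4 * CB * (\<Sum>i<d. \<Sum>j<d. \<integral>x. (symm (\<lambda>i j. pd j (\<eta> i n)) i j x)\<^sup>2 \<partial>M)"
      by (intro exI[of _ 0] allI impI korn_test[of "\<lambda>i. \<eta> i _"] t)
  qed
  also have "(\<Sum>i<d. \<Sum>j<d. (\<integral>x. (anti G i j x)\<^sup>2 \<partial>M) - (\<integral>x. anti G i j x \<partial>M)\<^sup>2) = (\<Sum>i<d. \<Sum>j<d. \<integral>x. (anti G i j x - (\<integral>x. anti G i j x \<partial>M))\<^sup>2 \<partial>M)"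
    by (intro sum.cong refl variance_eq[symmetric] L2cD(2)[OF la]) auto
  finally show ?thesis .
qed

end

subsection \<open>Finite-dimensional minimisation\<close>

lemma compact_PiE_UNIV:
  fixes S :: "'i \<Rightarrow> 'b::topological_space set"
  assumes "\<And>i. compact (S i)" shows "compact (PiE UNIV S)"
proof -
  have "compactin (product_topology (\<lambda>i. euclidean) UNIV) (PiE UNIV S)"
    unfolding compactin_PiE by (intro disjI2 ballI) (simp add: assms)
  then show ?thesis unfolding euclidean_product_topology by simp
qed

lemma compact_mats: "compact (PiE UNIV (\<lambda>i. PiE UNIV (\<lambda>j. if i < d \<and> j < d then {-r..r} else {0::real})))"
  for d :: nat
  by (intro compact_PiE_UNIV) simp

lemma cont_entry:
  fixes f :: "'a::topological_space \<Rightarrow> mat"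
  assumes "continuous_on S f" shows "continuous_on S (\<lambda>p. f p i j)"
  by (rule continuous_on_product_then_coordinatewise[OF continuous_on_product_then_coordinatewise[OF assms]])

lemma entry_cont: "continuous_on S (\<lambda>A :: mat. A i j)"
  by (rule cont_entry[OF continuous_on_id])

lemma msq_nonneg: "0 \<le> msq d A" and vsq_nonneg: "0 \<le> vsq d b"
  by (auto simp: msq_def vsq_def intro!: sum_nonneg)

lemma msq_entry: "i < d \<Longrightarrow> j < d \<Longrightarrow> (A i j)\<^sup>2 \<le> msq d A"
proof -
  assume ij: "i < d" "j < d"
  have "(A i j)\<^sup>2 \<le> (\<Sum>j<d. (A i j)\<^sup>2)" using ij by (intro member_le_sum) auto
  also have "\<dots> \<le> msq d A" unfolding msq_def
    using ij by (intro member_le_sum[of i "{..<d}" "\<lambda>i. \<Sum>j<d. (A i j)\<^sup>2"]) (auto intro: sum_nonneg)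
  finally show ?thesis .
qed

lemma vsq_entry: "i < d \<Longrightarrow> (b i)\<^sup>2 \<le> vsq d b"
  unfolding vsq_def by (intro member_le_sum) auto

lemma msq_cont:
  fixes f :: "'a::topological_space \<Rightarrow> mat"
  assumes "continuous_on S f" shows "continuous_on S (\<lambda>p. msq d (f p))"
  unfolding msq_def by (intro continuous_on_sum continuous_on_power cont_entry[OF assms])

lemma vsq_cont:
  fixes f :: "'a::topological_space \<Rightarrow> nat \<Rightarrow> real"
  assumes "continuous_on S f" shows "continuous_on S (\<lambda>p. vsq d (f p))"
  unfolding vsq_def by (intro continuous_on_sum continuous_on_power continuous_on_product_then_coordinatewise[OF assms])

definition msupp :: "nat \<Rightarrow> mat \<Rightarrow> bool" where
  "msupp d A \<longleftrightarrow> (\<forall>i j. d \<le> i \<or> d \<le> j \<longrightarrow> A i j = 0)"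

lemma msupp_bounded:
  assumes "msupp d A" "msq d A \<le> r" "0 \<le> r"
  shows "A \<in> PiE UNIV (\<lambda>i. PiE UNIV (\<lambda>j. if i < d \<and> j < d then {- sqrt r..sqrt r} else {0}))"
proof -
  have "A i j \<in> (if i < d \<and> j < d then {- sqrt r..sqrt r} else {0})" for i j
  proof (cases "i < d \<and> j < d")
    case True
    then have "(A i j)\<^sup>2 \<le> r" using msq_entry[of i d j A] assms(2) by simp
    then have "\<bar>A i j\<bar> \<le> sqrt r" by (metis real_sqrt_abs real_sqrt_le_iff)
    then show ?thesis using True by auto
  next
    case False
    then show ?thesis using assms(1) by (auto simp: msupp_def not_less)
  qed
  then show ?thesis by (simp add: PiE_iff)
qed

lemma msq_zero_iff: "msupp d A \<Longrightarrow> msq d A = 0 \<longleftrightarrow> A = (\<lambda>i j. 0)"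
proof
  assume s: "msupp d A" and m: "msq d A = 0"
  show "A = (\<lambda>i j. 0)"
  proof (intro ext)
    fix i j show "A i j = 0"
      using s msq_entry[of i d j A] m by (cases "i < d \<and> j < d") (auto simp: msupp_def not_less)
  qed
qed (simp add: msq_def)

lemma vsq_zero_iff: "b \<in> vecs d \<Longrightarrow> vsq d b = 0 \<longleftrightarrow> b = (\<lambda>i. 0)"
proof
  assume s: "b \<in> vecs d" and m: "vsq d b = 0"
  show "b = (\<lambda>i. 0)"
  proof
    fix i show "b i = 0" using s vsq_entry[of i d b] m by (cases "i < d") (auto simp: vecs_def not_less)
  qed
qed (simp add: vsq_def)

text \<open>The continuous Q attains a positive minimum on the unit sphere of V, compact because V
  is closed and its members are supported on finitely many entries. Homogeneity of degree two
  carries the bound over to all of V.\<close>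

lemma unit_lower_bound:
  fixes V :: "(mat \<times> (nat \<Rightarrow> real)) set" and Q :: "mat \<times> (nat \<Rightarrow> real) \<Rightarrow> real"
  assumes supp: "\<And>A b. (A, b) \<in> V \<Longrightarrow> msupp d A \<and> b \<in> vecs d" and cl: "closed V"
    and sc: "\<And>A b t. (A, b) \<in> V \<Longrightarrow> ((\<lambda>i j. t * A i j), (\<lambda>i. t * b i)) \<in> V"
    and Qc: "continuous_on UNIV Q" and Qh: "\<And>A b t. Q ((\<lambda>i j. t * A i j), (\<lambda>i. t * b i)) = t\<^sup>2 * Q (A, b)"
    and pos: "\<And>A b. (A, b) \<in> V \<Longrightarrow> msq d A + vsq d b \<noteq> 0 \<Longrightarrow> Q (A, b) > 0"
  shows "\<exists>c>0. \<forall>(A, b)\<in>V. c * (msq d A + vsq d b) \<le> Q (A, b)"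
proof -
  define K where "K = V \<inter> {p. msq d (fst p) + vsq d (snd p) = 1}"
  define B where "B = (PiE UNIV (\<lambda>i. PiE UNIV (\<lambda>j. if i < d \<and> j < d then {- sqrt 1..sqrt 1} else {0::real}))) \<times> (PiE UNIV (\<lambda>i. if i < d then {-1..1} else {0::real}))"
  have "compact B" unfolding B_def by (intro compact_Times compact_mats compact_PiE_UNIV) simp
  moreover have "closed K"
  proof -
    have "closed {p :: mat \<times> (nat \<Rightarrow> real). msq d (fst p) + vsq d (snd p) = 1}"
      by (intro closed_Collect_eq continuous_on_add continuous_on_const msq_cont[OF continuous_on_fst[OF continuous_on_id]]
          vsq_cont[OF continuous_on_snd[OF continuous_on_id]])
    then show ?thesis unfolding K_def by (rule closed_Int[OF cl])
  qed
  moreover have "K \<subseteq> B"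
  proof
    fix p assume p: "p \<in> K"
    obtain A b where Ab: "p = (A, b)" by (cases p)
    have V: "(A, b) \<in> V" and n: "msq d A + vsq d b = 1" using p by (auto simp: K_def Ab)
    have a: "msq d A \<le> 1" and b: "vsq d b \<le> 1" using n msq_nonneg[of d A] vsq_nonneg[of d b] by auto
    have "b i \<in> (if i < d then {-1..1} else {0})" for i
    proof (cases "i < d")
      case True
      then have "(b i)\<^sup>2 \<le> 1" using vsq_entry[of i d b] b by simp
      then show ?thesis using True by (simp add: abs_square_le_1 abs_le_iff minus_le_iff)
    next
      case False
      then show ?thesis using supp[OF V] by (simp add: vecs_def)
    qed
    then show "p \<in> B" using msupp_bounded[of d A 1] supp[OF V] a by (simp add: B_def Ab PiE_iff)
  qed
  ultimately have K: "compact K" by (metis compact_Int_closed inf.absorb_iff2 inf_commute)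
  have scale: "(\<lambda>i j. (1 / sqrt n) * A i j, \<lambda>i. (1 / sqrt n) * b i) \<in> K" if V: "(A, b) \<in> V" and n: "n = msq d A + vsq d b" "n \<noteq> 0" for A b n
  proof -
    have n0: "n > 0" using n msq_nonneg[of d A] vsq_nonneg[of d b] by linarith
    have "msq d (\<lambda>i j. (1 / sqrt n) * A i j) + vsq d (\<lambda>i. (1 / sqrt n) * b i) = (1 / sqrt n)\<^sup>2 * (msq d A + vsq d b)"
      by (simp only: msq_def vsq_def power_mult_distrib sum_distrib_left distrib_left)
    also have "\<dots> = 1" using n0 n(1) by (simp add: power_divide)
    finally show ?thesis using sc[OF V, of "1 / sqrt n"] by (simp add: K_def)
  qed
  have zero: "Q (A, b) = 0" if V: "(A, b) \<in> V" and n: "msq d A + vsq d b = 0" for A b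
  proof -
    have "msq d A = 0" "vsq d b = 0" using n msq_nonneg[of d A] vsq_nonneg[of d b] by auto
    then have "A = (\<lambda>i j. 0)" "b = (\<lambda>i. 0)" using supp[OF V] msq_zero_iff[of d A] vsq_zero_iff[of b d] by auto
    then show ?thesis using Qh[of 0 A b] by simp
  qed
  show ?thesis
  proof (cases "K = {}")
    case True
    \<comment> \<open>An empty sphere means that V contains at most zero, so any positive constant
      will do.\<close>
    have "1 * (msq d A + vsq d b) \<le> Q (A, b)" if V: "(A, b) \<in> V" for A b
    proof (cases "msq d A + vsq d b = 0")
      case True
      then show ?thesis using zero[OF V] by simp
    next
      case False
      then show ?thesis using scale[OF V refl False] \<open>K = {}\<close> by simp
    qed
    then show ?thesis by (intro exI[of _ 1]) auto
  next
    case False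
    obtain p where p: "p \<in> K" "\<And>y. y \<in> K \<Longrightarrow> Q p \<le> Q y"
      using continuous_attains_inf[OF K False continuous_on_subset[OF Qc]] by auto
    obtain A0 b0 where p0: "p = (A0, b0)" by (cases p)
    have c: "Q p > 0" using pos[of A0 b0] p(1) by (auto simp: K_def p0)
    have "Q p * (msq d A + vsq d b) \<le> Q (A, b)" if V: "(A, b) \<in> V" for A b
    proof (cases "msq d A + vsq d b = 0")
      case True
      then show ?thesis using zero[OF V] by simp
    next
      case False
      define n where "n = msq d A + vsq d b"
      have n0: "n > 0" using False msq_nonneg[of d A] vsq_nonneg[of d b] by (simp add: n_def)
      have "Q p \<le> Q (\<lambda>i j. (1 / sqrt n) * A i j, \<lambda>i. (1 / sqrt n) * b i)"
        by (rule p(2)[OF scale[OF V n_def]]) (use n0 in simp)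
      also have "\<dots> = (1 / sqrt n)\<^sup>2 * Q (A, b)" by (rule Qh)
      also have "\<dots> = Q (A, b) / n" using n0 by (simp add: power_divide)
      finally show ?thesis using n0 by (simp add: n_def pos_le_divide_eq)
    qed
    then show ?thesis using c by (intro exI[of _ "Q p"]) auto
  qed
qed

text \<open>Projection by minimisation: J is a squared distance, \<open>bd\<close> its coercivity
  and \<open>l A S\<close> its first variation, which vanishes at a minimiser. The projections of
  matrices (\<open>mdot_projection\<close>) and of fields in the weighted space
  (\<open>rot_projection\<close>) are instances.\<close>

lemma riesz_fd:
  fixes V :: "mat set" and J :: "mat \<Rightarrow> real"
  assumes supp: "\<And>A. A \<in> V \<Longrightarrow> msupp d A" and cl: "closed V" and z: "(\<lambda>i j. 0) \<in> V"
    and lc: "\<And>A S t. A \<in> V \<Longrightarrow> S \<in> V \<Longrightarrow> (\<lambda>i j. A i j + t * S i j) \<in> V"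
    and Jc: "continuous_on UNIV J"
    and Je: "\<And>A S t. A \<in> V \<Longrightarrow> S \<in> V \<Longrightarrow> J (\<lambda>i j. A i j + t * S i j) = J A + 2 * t * l A S + t\<^sup>2 * q S"
    and bd: "\<And>A. A \<in> V \<Longrightarrow> J A \<le> J (\<lambda>i j. 0) \<Longrightarrow> msq d A \<le> r"
  shows "\<exists>A\<in>V. \<forall>S\<in>V. l A S = 0"
proof -
  define R where "R = max r 0"
  define K where "K = V \<inter> {A. msq d A \<le> R}"
  have "compact (PiE UNIV (\<lambda>i. PiE UNIV (\<lambda>j. if i < d \<and> j < d then {- sqrt R..sqrt R} else {0::real})))"
    by (rule compact_mats)
  moreover have "closed K"
  proof -
    have "closed {A :: mat. msq d A \<le> R}" by (intro closed_Collect_le continuous_on_const msq_cont[OF continuous_on_id])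
    then show ?thesis unfolding K_def by (rule closed_Int[OF cl])
  qed
  moreover have "K \<subseteq> PiE UNIV (\<lambda>i. PiE UNIV (\<lambda>j. if i < d \<and> j < d then {- sqrt R..sqrt R} else {0::real}))"
  proof
    fix A assume "A \<in> K"
    then show "A \<in> PiE UNIV (\<lambda>i. PiE UNIV (\<lambda>j. if i < d \<and> j < d then {- sqrt R..sqrt R} else {0::real}))"
      using msupp_bounded[OF supp, of A R] by (simp add: K_def R_def)
  qed
  ultimately have K: "compact K" by (metis compact_Int_closed inf.absorb_iff2 inf_commute)
  have zK: "(\<lambda>i j. 0) \<in> K" using z by (simp add: K_def R_def msq_def)
  then obtain A where A: "A \<in> K" "\<And>S. S \<in> K \<Longrightarrow> J A \<le> J S"
    using continuous_attains_inf[OF K _ continuous_on_subset[OF Jc]] by auto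
  have AV: "A \<in> V" using A by (simp add: K_def)
  have min: "J A \<le> J S" if S: "S \<in> V" for S
  proof (cases "J S \<le> J (\<lambda>i j. 0)")
    case True
    then have "S \<in> K" using bd[OF S] S by (auto simp: K_def R_def)
    then show ?thesis by (rule A(2))
  next
    case False
    then show ?thesis using A(2)[OF zK] by simp
  qed
  have "l A S = 0" if S: "S \<in> V" for S
  proof (rule quadratic_vertex_zero)
    fix t
    show "0 \<le> 2 * t * l A S + t\<^sup>2 * q S" using min[OF lc[OF AV S, of t]] Je[OF AV S, of t] by simp
  qed
  then show ?thesis using AV by blast
qed

section \<open>Uniqueness of weak derivatives\<close>

lemma loc_int_test_integrable:
  assumes g: "loc_int d g" and t: "test_fun d \<psi>" shows "integrable (leb d) (\<lambda>x. g x * \<psi> x)"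
proof -
  obtain r where r: "\<And>x. x \<in> Rn d \<Longrightarrow> x \<notin> bx d r \<Longrightarrow> \<psi> x = 0" using t by (auto simp: test_fun_iff csup_def)
  obtain C where C: "C \<ge> 0" "\<And>x. x \<in> Rn d \<Longrightarrow> \<bar>\<psi> x\<bar> \<le> C" using test_fun_bounded[OF t] by blast
  have gi: "integrable (leb d) (\<lambda>x. indicator (bx d r) x * g x)"
    using g by (simp add: loc_int_def set_integrable_def bx_def)
  have m: "\<psi> \<in> borel_measurable (leb d)" by (rule cont_meas[OF test_fun_cont[OF t]])
  have "integrable (leb d) (\<lambda>x. (indicator (bx d r) x * g x) * \<psi> x)"
  proof (rule Bochner_Integration.integrable_bound)
    show "integrable (leb d) (\<lambda>x. C * (indicator (bx d r) x * g x))" using gi by simp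
    show "(\<lambda>x. indicator (bx d r) x * g x * \<psi> x) \<in> borel_measurable (leb d)"
      using borel_measurable_integrable[OF gi] m by measurable
    show "AE x in leb d. norm (indicator (bx d r) x * g x * \<psi> x) \<le> norm (C * (indicator (bx d r) x * g x))"
    proof (rule AE_I2)
      fix x assume "x \<in> space (leb d)"
      then have "\<bar>\<psi> x\<bar> \<le> C" using C(2)[of x] by simp
      from abs_mult_le[OF this, of "indicator (bx d r) x * g x"]
      show "norm (indicator (bx d r) x * g x * \<psi> x) \<le> norm (C * (indicator (bx d r) x * g x))"
        using C(1) by (simp add: abs_mult)
    qed
  qed
  also have "?this \<longleftrightarrow> ?thesis"
    by (rule Bochner_Integration.integrable_cong[OF refl]) (use r in \<open>auto simp: indicator_def\<close>)
  finally show ?thesis .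
qed

text \<open>\<open>D\<close> selects some weak Jacobian. As any two agree almost everywhere,
  \<open>D_diff_rot\<close> may compute with an explicit version.\<close>

theorem weak_pd_unique:
  assumes f: "weak_pd d j f g" and f': "weak_pd d j f g'"
  shows "AE x in leb d. g x = g' x"
proof -
  have l: "loc_int d g" "loc_int d g'" using f f' by (auto simp: weak_pd_def)
  have ld: "loc_int d (\<lambda>x. g x - g' x)"
    using l by (auto simp: loc_int_def intro!: set_integral_diff)
  have "AE x in leb d. g x - g' x = 0"
  proof (rule fundamental_lemma[OF ld])
    fix \<psi> assume t: "test_fun d \<psi>"
    have "(\<integral>x. (g x - g' x) * \<psi> x \<partial>leb d) = (\<integral>x. g x * \<psi> x \<partial>leb d) - (\<integral>x. g' x * \<psi> x \<partial>leb d)"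
      unfolding left_diff_distrib by (intro Bochner_Integration.integral_diff loc_int_test_integrable l t)
    also have "\<dots> = 0" using f f' t unfolding weak_pd_def by (metis add.inverse_inverse diff_self)
    finally show "(\<integral>x. (g x - g' x) * \<psi> x \<partial>leb d) = 0" .
  qed
  then show ?thesis by eventually_elim simp
qed

section \<open>Skew matrices and the symmetries of \<phi>\<close>

lemma skew_msupp: "A \<in> skew d \<Longrightarrow> msupp d A"
  unfolding skew_def msupp_def by blast

lemma skewD: "A \<in> skew d \<Longrightarrow> A i j = - A j i"
  unfolding skew_def by blast

lemma skew_diag: "A \<in> skew d \<Longrightarrow> A i i = 0"
  using skewD[of A d i i] by simp

lemma skewI: "(\<And>i j. A i j = - A j i) \<Longrightarrow> msupp d A \<Longrightarrow> A \<in> skew d"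
  unfolding skew_def msupp_def by blast

lemma skew_lc:
  assumes "A \<in> skew d" "S \<in> skew d" shows "(\<lambda>i j. A i j + t * S i j) \<in> skew d"
proof (rule skewI)
  show "A i j + t * S i j = - (A j i + t * S j i)" for i j
    using skewD[OF assms(1), of i j] skewD[OF assms(2), of i j] by simp
  show "msupp d (\<lambda>i j. A i j + t * S i j)"
    using skew_msupp[OF assms(1)] skew_msupp[OF assms(2)] by (simp add: msupp_def)
qed

lemma lin_lc: "lin d (\<lambda>i j. A i j + t * S i j) x i = lin d A x i + t * lin d S x i"
  by (simp add: lin_def sum.distrib sum_distrib_left algebra_simps)

lemma gdot_lin_lc: "gdot d \<phi> (lin d (\<lambda>i j. A i j + t * S i j)) x = gdot d \<phi> (lin d A) x + t * gdot d \<phi> (lin d S) x"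
  by (simp add: gdot_def lin_lc sum.distrib sum_distrib_left algebra_simps)

lemma M_phi_iff: "A \<in> M_phi d \<phi> \<longleftrightarrow> A \<in> skew d \<and> (\<forall>x\<in>Rn d. gdot d \<phi> (lin d A) x = 0)"
  by (auto simp: M_phi_def Rot_phi_def Rot_def)

lemma Rot_phi_eq: "Rot_phi d \<phi> = lin d ` M_phi d \<phi>"
  by (auto simp: M_phi_def Rot_phi_def Rot_def)

lemma skew_zero: "(\<lambda>i j. 0) \<in> skew d" by (simp add: skew_def)

lemma lin_zero [simp]: "lin d (\<lambda>i j. 0) = (\<lambda>x i. 0)" by (simp add: lin_def fun_eq_iff)

lemma M_phi_zero: "(\<lambda>i j. 0) \<in> M_phi d \<phi>" by (simp add: M_phi_iff skew_zero gdot_def)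

lemma M_phi_lc: "A \<in> M_phi d \<phi> \<Longrightarrow> S \<in> M_phi d \<phi> \<Longrightarrow> (\<lambda>i j. A i j + t * S i j) \<in> M_phi d \<phi>"
  by (simp add: M_phi_iff skew_lc gdot_lin_lc)

lemma closed_skew: "closed (skew d)"
proof -
  have "skew d = (\<Inter>i. \<Inter>j. {A. A i j = - A j i}) \<inter> (\<Inter>i. \<Inter>j. {A. d \<le> i \<or> d \<le> j \<longrightarrow> A i j = 0})"
    unfolding skew_def by blast
  also have "closed \<dots>"
    by (intro closed_Int closed_INT ballI closed_Collect_imp closed_Collect_eq continuous_on_minus continuous_on_const entry_cont open_Collect_const)
  finally show ?thesis .
qed

lemma closed_vecs: "closed (vecs d)"
proof -
  have "vecs d = (\<Inter>i\<in>{d..}. {b. b i = 0})" by (auto simp: vecs_def)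
  also have "closed \<dots>"
    by (intro closed_INT ballI closed_Collect_eq cont_coord continuous_on_const)
  finally show ?thesis .
qed

lemma lin_cont: "continuous_on S (\<lambda>A. lin d A x i)"
  unfolding lin_def by (intro continuous_intros entry_cont)

lemma closed_M_phi: "closed (M_phi d \<phi>)"
proof -
  have "M_phi d \<phi> = skew d \<inter> (\<Inter>x\<in>Rn d. {A. gdot d \<phi> (lin d A) x = 0})" by (auto simp: M_phi_iff)
  also have "closed \<dots>"
    unfolding gdot_def by (intro closed_Int closed_skew closed_INT ballI closed_Collect_eq continuous_intros lin_cont)
  finally show ?thesis .
qed

lemma mdot_self: "mdot d A A = msq d A"
  by (simp add: mdot_def msq_def power2_eq_square)

lemma mdot_diff_left: "mdot d (\<lambda>i j. A i j - S i j) T = mdot d A T - mdot d S T"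
  by (simp add: mdot_def sum_subtractf left_diff_distrib)

lemma mdot_projection:
  assumes V: "\<And>A. A \<in> V \<Longrightarrow> msupp d A" "closed V" "(\<lambda>i j. 0) \<in> V"
    "\<And>A S t. A \<in> V \<Longrightarrow> S \<in> V \<Longrightarrow> (\<lambda>i j. A i j + t * S i j) \<in> V"
  shows "\<exists>A\<in>V. \<forall>S\<in>V. mdot d (\<lambda>i j. m i j - A i j) S = 0"
proof -
  define J where "J A = msq d (\<lambda>i j. m i j - A i j)" for A
  have "\<exists>A\<in>V. \<forall>S\<in>V. - mdot d (\<lambda>i j. m i j - A i j) S = 0"
  proof (rule riesz_fd[OF V, where J = J and q = "msq d" and r = "4 * msq d m"])
    show "continuous_on UNIV J" unfolding J_def msq_def by (intro continuous_intros entry_cont)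
    show "J (\<lambda>i j. A i j + t * S i j) = J A + 2 * t * - mdot d (\<lambda>i j. m i j - A i j) S + t\<^sup>2 * msq d S" for A S t
      unfolding J_def msq_def mdot_def sum_distrib_left sum_negf[symmetric] sum.distrib[symmetric]
      by (intro sum.cong refl) (simp add: power2_eq_square algebra_simps)
    show "msq d A \<le> 4 * msq d m" if "J A \<le> J (\<lambda>i j. 0)" for A
    proof -
      have "msq d A \<le> (\<Sum>i<d. \<Sum>j<d. 2 * (m i j)\<^sup>2 + 2 * (m i j - A i j)\<^sup>2)"
        unfolding msq_def
      proof (intro sum_mono)
        fix i j
        \<comment> \<open>This square is the right side minus the left side of the inequality
          below.\<close>
        have "0 \<le> (2 * m i j - A i j)\<^sup>2" by simp
        then show "(A i j)\<^sup>2 \<le> 2 * (m i j)\<^sup>2 + 2 * (m i j - A i j)\<^sup>2" by (simp add: power2_eq_square algebra_simps)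
      qed
      also have "\<dots> = 2 * msq d m + 2 * J A" by (simp add: msq_def J_def sum.distrib sum_distrib_left)
      finally show ?thesis using that by (simp add: J_def)
    qed
  qed
  then show ?thesis by simp
qed

lemma Inf_image_minimum:
  fixes f :: "'a \<Rightarrow> real"
  assumes "a \<in> A" "\<And>x. x \<in> A \<Longrightarrow> f a \<le> f x" shows "(INF x\<in>A. f x) = f a"
  by (rule cInf_eq_minimum) (use assms in auto)

text \<open>The rigidity constants are inverses of infima. A lower bound c obtained by compactness
  makes the infimum positive, so that its inverse can serve as a factor.\<close>

lemma inverse_INF_quotient:
  fixes a b :: "'a \<Rightarrow> real"
  assumes X: "X \<noteq> {}" and c: "c > 0" and p: "\<And>x. x \<in> X \<Longrightarrow> 0 < b x \<and> c * b x \<le> a x"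
  shows "0 < inverse (INF x\<in>X. a x / b x)" "x \<in> X \<Longrightarrow> b x \<le> inverse (INF x\<in>X. a x / b x) * a x"
proof -
  define I where "I = (INF x\<in>X. a x / b x)"
  have q: "c \<le> a x / b x" if "x \<in> X" for x using p[OF that] by (simp add: pos_le_divide_eq)
  have "c \<le> I" unfolding I_def by (rule cINF_greatest[OF X q])
  then have I0: "0 < I" using c by linarith
  then show "0 < inverse (INF x\<in>X. a x / b x)" by (simp add: I_def)
  assume x: "x \<in> X"
  have "I \<le> a x / b x" unfolding I_def by (rule cINF_lower[OF bdd_belowI2[OF q] x])
  then have "I * b x \<le> a x" using p[OF x] by (simp add: pos_le_divide_eq)
  then show "b x \<le> inverse (INF x\<in>X. a x / b x) * a x" using I0 unfolding I_def[symmetric] by (simp add: field_simps)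
qed

lemma loc_int_measurable:
  assumes "loc_int d f" shows "f \<in> borel_measurable (leb d)"
proof (rule borel_measurable_LIMSEQ_real)
  show "(\<lambda>x. indicator (bx d (real n)) x * f x) \<in> borel_measurable (leb d)" for n
    using assms by (intro borel_measurable_integrable) (simp add: loc_int_def set_integrable_def bx_def)
  fix x assume "x \<in> space (leb d)"
  then have "x \<in> Rn d" by simp
  then obtain N where N: "\<And>n. n \<ge> N \<Longrightarrow> x \<in> bx d (real n)" using bx_exhaust by metis
  show "(\<lambda>n. indicator (bx d (real n)) x * f x) \<longlonglongrightarrow> f x"
    by (rule tendsto_eventually) (use N in \<open>auto simp: eventually_sequentially intro!: exI[of _ N]\<close>)
qed

lemma sum_antisym_zero:
  fixes c :: "nat \<Rightarrow> nat \<Rightarrow> real"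
  assumes "\<And>i j. i < d \<Longrightarrow> j < d \<Longrightarrow> c i j = - c j i" shows "(\<Sum>i<d. \<Sum>j<d. c i j) = 0"
proof -
  have "(\<Sum>i<d. \<Sum>j<d. c i j) = (\<Sum>i<d. \<Sum>j<d. - c j i)" by (intro sum.cong refl assms) auto
  also have "\<dots> = - (\<Sum>i<d. \<Sum>j<d. c j i)" by (simp add: sum_negf)
  also have "(\<Sum>i<d. \<Sum>j<d. c j i) = (\<Sum>i<d. \<Sum>j<d. c i j)" by (rule sum.swap)
  finally show ?thesis by linarith
qed

lemma lin_eq_zero:
  assumes A: "msupp d A" and z: "\<And>x i. x \<in> Rn d \<Longrightarrow> i < d \<Longrightarrow> lin d A x i = 0" shows "A = (\<lambda>i j. 0)"
proof (intro ext)
  fix i j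
  show "A i j = 0"
  proof (cases "i < d \<and> j < d")
    case True
    \<comment> \<open>The j-th unit vector, as an extensional point.\<close>
    define x where "x = (\<lambda>k. if k < d then (if k = j then 1 else 0) else (undefined :: real))"
    have x: "x \<in> Rn d" by (auto simp: x_def Rn_def PiE_iff extensional_def)
    have "lin d A x i = (\<Sum>k<d. if k = j then A i k else 0)"
      unfolding lin_def by (intro sum.cong refl) (auto simp: x_def)
    then show ?thesis using z[OF x, of i] True by simp
  qed (use A in \<open>auto simp: msupp_def not_less\<close>)
qed

lemma lin_diff: "lin d (\<lambda>i j. A i j - S i j) x i = lin d A x i - lin d S x i"
  using lin_lc[of d A "-1" S x i] by simp

lemma skew_diff: "A \<in> skew d \<Longrightarrow> S \<in> skew d \<Longrightarrow> (\<lambda>i j. A i j - S i j) \<in> skew d"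
  using skew_lc[of A d S "-1"] by simp

lemma M_phi_diff: "A \<in> M_phi d \<phi> \<Longrightarrow> S \<in> M_phi d \<phi> \<Longrightarrow> (\<lambda>i j. A i j - S i j) \<in> M_phi d \<phi>"
  using M_phi_lc[of A d \<phi> S "-1"] by simp

lemma M_phi_skew: "A \<in> M_phi d \<phi> \<Longrightarrow> A \<in> skew d"
  unfolding M_phi_iff by (rule conjunct1)

lemma mdot_lc: "mdot d (\<lambda>i j. A i j + t * S i j) T = mdot d A T + t * mdot d S T"
  by (simp add: mdot_def sum.distrib sum_distrib_left algebra_simps)

lemma mdot_cont: "continuous_on S (\<lambda>A. mdot d A T)"
  unfolding mdot_def by (intro continuous_intros entry_cont)

lemma closed_M_phi_c: "closed (M_phi_c d \<phi>)"
proof -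
  have "M_phi_c d \<phi> = skew d \<inter> (\<Inter>B\<in>M_phi d \<phi>. {A. mdot d A B = 0})" unfolding M_phi_c_def by blast
  also have "closed \<dots>" by (intro closed_Int closed_skew closed_INT ballI closed_Collect_eq mdot_cont continuous_on_const)
  finally show ?thesis .
qed

subsection \<open>Affine fields\<close>

context pot
begin

lemma h1lim_cong:
  assumes "h1lim f g" "\<And>x. x \<in> Rn d \<Longrightarrow> f x = f' x" "\<And>x j. x \<in> Rn d \<Longrightarrow> j < d \<Longrightarrow> g j x = g' j x"
  shows "h1lim f' g'"
proof -
  obtain \<eta> where e: "\<forall>n. test_fun d (\<eta> n)" "L2c M \<eta> f" "\<forall>j<d. L2c M (\<lambda>n. pd j (\<eta> n)) (g j)" using assms(1) by (rule h1limE)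
  show ?thesis
  proof (rule h1limI)
    show "test_fun d (\<eta> n)" for n using e(1) by simp
    show "L2c M \<eta> f'" by (rule L2c_cong[OF e(2)]) (use assms(2) in auto)
    fix j assume j: "j < d"
    have "L2c M (\<lambda>n. pd j (\<eta> n)) (g j)" using e(3) j by simp
    then show "L2c M (\<lambda>n. pd j (\<eta> n)) (g' j)" by (rule L2c_cong) (use assms(3) j in auto)
  qed
qed

text \<open>A test function z against Lebesgue measure is \<open>z * exp \<phi>\<close> against the
  weighted one, and this is square-integrable thanks to its compact support; so the defining
  identity passes to the limit. It serves to identify the weak Jacobian of u minus a rigid
  field.\<close>

lemma h1lim_weak_pd:
  assumes h: "h1lim f g" and j: "j < d" shows "weak_pd d j f (g j)"
proof -
  obtain \<eta> where e: "\<forall>n. test_fun d (\<eta> n)" "L2c M \<eta> f" "\<forall>j<d. L2c M (\<lambda>n. pd j (\<eta> n)) (g j)" using h by (rule h1limE)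
  have li: "loc_int d k" if "sqi M k" for k
    using sq_int_trunc[OF sqi_trunc1[OF that]] by (simp add: loc_int_def set_integrable_def bx_def mult.commute)
  have tr: "(\<integral>x. k x * z x \<partial>leb d) = (\<integral>x. k x * (z x * exp (\<phi> x)) \<partial>M)" "sqi M (\<lambda>x. z x * exp (\<phi> x))"
    if k: "sqi M k" and z: "test_fun d z" for k z
  proof -
    have c: "continuous_on (Rn d) (\<lambda>x. z x * exp (\<phi> x))" by (intro continuous_intros test_fun_cont[OF z] Ck_cont[OF phiC2])
    show "sqi M (\<lambda>x. z x * exp (\<phi> x))" by (rule cc_sqi[OF c csup_mult1[OF test_funD(2)[OF z]]])
    have "(\<lambda>x. k x * (z x * exp (\<phi> x))) \<in> borel_measurable (leb d)"
      using sqiD(1)[OF k] cont_meas[OF c] by (simp add: meas_M)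
    from integral_M[OF this] have "(\<integral>x. k x * (z x * exp (\<phi> x)) \<partial>M) = (\<integral>x. rho x * (k x * (z x * exp (\<phi> x))) \<partial>leb d)" .
    also have "\<dots> = (\<integral>x. k x * z x \<partial>leb d)"
      by (rule Bochner_Integration.integral_cong[OF refl]) (simp add: rho_def exp_minus field_simps)
    finally show "(\<integral>x. k x * z x \<partial>leb d) = (\<integral>x. k x * (z x * exp (\<phi> x)) \<partial>M)" by simp
  qed
  have "(\<integral>x. f x * pd j \<psi> x \<partial>leb d) = - (\<integral>x. g j x * \<psi> x \<partial>leb d)" if t: "test_fun d \<psi>" for \<psi>
  proof -
    note tj = test_fun_pd[OF t j]
    have gl: "L2c M (\<lambda>n. pd j (\<eta> n)) (g j)" using e(3) j by simp
    have a: "(\<lambda>n. \<integral>x. \<eta> n x * (pd j \<psi> x * exp (\<phi> x)) \<partial>M) \<longlonglongrightarrow> (\<integral>x. f x * (pd j \<psi> x * exp (\<phi> x)) \<partial>M)"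
      by (rule L2c_inner[OF e(2) L2c_const[OF tr(2)[OF h1lim_sqi(1)[OF h] tj]]])
    have b: "(\<lambda>n. - (\<integral>x. pd j (\<eta> n) x * (\<psi> x * exp (\<phi> x)) \<partial>M)) \<longlonglongrightarrow> - (\<integral>x. g j x * (\<psi> x * exp (\<phi> x)) \<partial>M)"
      by (rule tendsto_minus[OF L2c_inner[OF gl L2c_const[OF tr(2)[OF h1lim_sqi(1)[OF h] t]]]])
    have "(\<integral>x. \<eta> n x * (pd j \<psi> x * exp (\<phi> x)) \<partial>M) = - (\<integral>x. pd j (\<eta> n) x * (\<psi> x * exp (\<phi> x)) \<partial>M)" for n
    proof -
      have tn: "test_fun d (\<eta> n)" using e(1) by simp
      have "(\<integral>x. pd j (\<eta> n) x * \<psi> x \<partial>leb d) = - (\<integral>x. \<eta> n x * pd j \<psi> x \<partial>leb d)"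
        by (rule ibp_leb[OF test_funD(1)[OF tn, of "Suc 0"] test_funD(1)[OF t, of "Suc 0"] test_funD(2)[OF t] j])
      then show ?thesis
        using tr(1)[OF test_fun_sqi[OF tn] tj] tr(1)[OF test_fun_sqi[OF test_fun_pd[OF tn j]] t] by simp
    qed
    then have "(\<integral>x. f x * (pd j \<psi> x * exp (\<phi> x)) \<partial>M) = - (\<integral>x. g j x * (\<psi> x * exp (\<phi> x)) \<partial>M)"
      using LIMSEQ_unique[OF a] b by simp
    then show ?thesis using tr(1)[OF h1lim_sqi(1)[OF h] tj] tr(1)[OF h1lim_sqi(2)[OF h j] t] by simp
  qed
  then show ?thesis using li[OF h1lim_sqi(1)[OF h]] li[OF h1lim_sqi(2)[OF h j]] by (simp add: weak_pd_def)
qed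

text \<open>Cut off, integrate by parts, and send the cut-offs to infinity; the three integrability
  assumptions dominate the three terms.\<close>

lemma ibp_global:
  assumes f: "Ck d (Suc k) f" and j: "j < d" and i1: "integrable M f" and i2: "integrable M (pd j f)"
    and i3: "integrable M (\<lambda>x. pd j \<phi> x * f x)"
  shows "(\<integral>x. pd j \<phi> x * f x \<partial>M) = (\<integral>x. pd j f x \<partial>M)"
proof -
  define \<kappa> where "\<kappa> = cuts d"
  note \<kappa>t = cuts_test_fun[of d, folded \<kappa>_def] and \<kappa>b = cuts_le_1[of d, folded \<kappa>_def]
  have \<kappa>m: "\<kappa> N \<in> borel_measurable M" "pd j (\<kappa> N) \<in> borel_measurable M" for N
    using cuts_meas[of d N] pd_cuts_meas[OF j, of N] by (simp_all add: meas_M \<kappa>_def)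
  obtain C where "\<forall>N x. \<forall>j<d. \<bar>pd j (\<kappa> N) x\<bar> \<le> C" using pd_cuts_bounded[of d] unfolding \<kappa>_def by blast
  then have \<kappa>jb: "\<bar>pd j (\<kappa> N) x\<bar> \<le> C" for N x using j by simp
  have lim: "(\<lambda>N. \<integral>x. h x * \<kappa> N x \<partial>M) \<longlonglongrightarrow> (\<integral>x. h x \<partial>M)" if hi: "integrable M h" for h
  proof (rule integral_dominated_convergence[where w = "\<lambda>x. \<bar>h x\<bar>"])
    show "AE x in M. (\<lambda>N. h x * \<kappa> N x) \<longlonglongrightarrow> h x"
      unfolding \<kappa>_def by (rule AE_I2, rule tendsto_eventually, rule eventually_mono[OF cuts_eventually(1)]) auto
    show "AE x in M. norm (h x * \<kappa> N x) \<le> \<bar>h x\<bar>" for N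
      using abs_mult_le[OF \<kappa>b] by (intro AE_I2) simp
  qed (use hi \<kappa>m(1) borel_measurable_integrable[OF hi] in \<open>auto intro: borel_measurable_times\<close>)
  have lim0: "(\<lambda>N. \<integral>x. f x * pd j (\<kappa> N) x \<partial>M) \<longlonglongrightarrow> (\<integral>x. 0 \<partial>M)"
  proof (rule integral_dominated_convergence[where w = "\<lambda>x. C * \<bar>f x\<bar>"])
    show "AE x in M. (\<lambda>N. f x * pd j (\<kappa> N) x) \<longlonglongrightarrow> 0"
      unfolding \<kappa>_def by (rule AE_I2, rule tendsto_eventually, rule eventually_mono[OF cuts_eventually(2)[OF _ j]]) auto
    show "AE x in M. norm (f x * pd j (\<kappa> N) x) \<le> C * \<bar>f x\<bar>" for N
      using abs_mult_le[OF \<kappa>jb] by (intro AE_I2) simp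
  qed (use i1 \<kappa>m(2) borel_measurable_integrable[OF i1] in \<open>auto intro: borel_measurable_times\<close>)
  have ib: "integrable M (\<lambda>x. h x * c x)" if "integrable M h" "c \<in> borel_measurable M" "\<And>x. \<bar>c x\<bar> \<le> B" for h c and B :: real
  proof (rule Bochner_Integration.integrable_bound)
    show "integrable M (\<lambda>x. B * \<bar>h x\<bar>)" using that by simp
    show "AE x in M. norm (h x * c x) \<le> norm (B * \<bar>h x\<bar>)"
      using abs_mult_le[OF that(3)] by (intro AE_I2) (simp add: order_trans[OF _ abs_ge_self])
  qed (use that borel_measurable_integrable[OF that(1)] in \<open>auto intro: borel_measurable_times\<close>)
  have f1: "Ck d (Suc 0) f" by (rule Ck_le[OF f]) simp
  have "(\<integral>x. pd j \<phi> x * f x * \<kappa> N x \<partial>M) = (\<integral>x. pd j f x * \<kappa> N x \<partial>M) + (\<integral>x. f x * pd j (\<kappa> N) x \<partial>M)" for N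
  proof -
    have k1: "Ck d (Suc 0) (\<kappa> N)" by (rule test_funD(1)[OF \<kappa>t])
    have "(\<integral>x. pd j \<phi> x * (f x * \<kappa> N x) \<partial>M) = (\<integral>x. pd j (\<lambda>x. f x * \<kappa> N x) x \<partial>M)"
      by (rule integral_phij[OF Ck_mult[OF f1 k1] csup_mult2[OF test_funD(2)[OF \<kappa>t]] j])
    also have "\<dots> = (\<integral>x. pd j f x * \<kappa> N x + f x * pd j (\<kappa> N) x \<partial>M)"
      by (rule Bochner_Integration.integral_cong[OF refl]) (simp add: pd_mult[OF f1 _ j k1])
    also have "\<dots> = (\<integral>x. pd j f x * \<kappa> N x \<partial>M) + (\<integral>x. f x * pd j (\<kappa> N) x \<partial>M)"
      by (rule Bochner_Integration.integral_add[OF ib[OF i2 \<kappa>m(1) \<kappa>b] ib[OF i1 \<kappa>m(2) \<kappa>jb]])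
    finally show ?thesis by (simp add: mult.assoc)
  qed
  then have "(\<lambda>N. \<integral>x. pd j \<phi> x * f x * \<kappa> N x \<partial>M) \<longlonglongrightarrow> (\<integral>x. pd j f x \<partial>M) + (\<integral>x. 0 \<partial>M)"
    using tendsto_add[OF lim[OF i2] lim0] by simp
  then show ?thesis using LIMSEQ_unique[OF lim[OF i3]] by simp
qed

lemma coord_integrable: "i < d \<Longrightarrow> integrable M (\<lambda>x. x i)" and coord_mean: "i < d \<Longrightarrow> (\<integral>x. x i \<partial>M) = 0"
  using centred[of i] coord_meas[of i d] by (auto simp: integrable_M integral_M has_bochner_integral_iff rho_def mult.commute)

text \<open>Square integrability of the coordinates is not assumed: it follows from the Poincare inequality
  applied to the bounded truncations \<open>x i / (1 + (x i)\<^sup>2 / n)\<close>.\<close>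

lemma coord_sqi:
  assumes i: "i < d" shows "sqi M (\<lambda>x. x i)"
proof -
  define c where "c n = 1 / real (Suc n)" for n
  have c0: "c n > 0" for n by (simp add: c_def)
  define f where "f n x = x i / (1 + c n * (x i)\<^sup>2)" for n and x :: point
  have den: "1 + c n * y\<^sup>2 > 0" for n y using c0[of n] by (intro add_pos_nonneg) auto
  define f' where "f' n j x = (if i = j then (1 - c n * (x i)\<^sup>2) / (1 + c n * (x i)\<^sup>2)\<^sup>2 else 0)" for n j and x :: point
  have der: "((\<lambda>t. f n (x(j := t))) has_real_derivative f' n j x) (at (x j))" for n j and x :: point
  proof (cases "i = j")
    case True
    have "((\<lambda>t. t / (1 + c n * t\<^sup>2)) has_real_derivative (1 * (1 + c n * (x j)\<^sup>2) - x j * (c n * (2 * x j))) / ((1 + c n * (x j)\<^sup>2) * (1 + c n * (x j)\<^sup>2))) (at (x j))"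
      using den[of n "x j"] by (auto intro!: derivative_eq_intros)
    moreover have "(1 * (1 + c n * (x j)\<^sup>2) - x j * (c n * (2 * x j))) / ((1 + c n * (x j)\<^sup>2) * (1 + c n * (x j)\<^sup>2)) = f' n j x"
      using True by (simp add: f'_def power2_eq_square algebra_simps)
    ultimately show ?thesis using True by (simp add: f_def)
  qed (simp add: f_def f'_def)
  have fc: "continuous_on (Rn d) (f n)" for n
    unfolding f_def using den[of n] by (intro continuous_intros) (metis less_irrefl)
  have f'c: "continuous_on (Rn d) (f' n j)" for n j
    unfolding f'_def using den[of n] by (cases "i = j") (auto intro!: continuous_intros simp: less_irrefl, metis less_irrefl)
  have C1: "Ck d (Suc 0) (f n)" for n
    by (rule Ck_SucI[where g = "f' n"]) (use fc der f'c in auto)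
  have pdf: "pd j (f n) x = f' n j x" for n j x by (rule pdI[OF der])
  have fle: "\<bar>f n x\<bar> \<le> \<bar>x i\<bar>" for n x
  proof -
    have "\<bar>x i\<bar> / (1 + c n * (x i)\<^sup>2) \<le> \<bar>x i\<bar> / 1" using c0[of n] den[of n "x i"] by (intro divide_left_mono) auto
    then show ?thesis using den[of n "x i"] by (simp add: f_def)
  qed
  have fb: "\<bar>f n x\<bar> \<le> 1 + 1 / c n" for n x
  proof (cases "\<bar>x i\<bar> \<le> 1")
    case True
    moreover have "0 < 1 / c n" using c0[of n] by simp
    ultimately show ?thesis using fle[of n x] by linarith
  next
    case False
    have "\<bar>x i\<bar> * 1 \<le> \<bar>x i\<bar> * \<bar>x i\<bar>" using False by (intro mult_left_mono) auto
    then have "\<bar>x i\<bar> \<le> (x i)\<^sup>2" by (simp add: power2_eq_square)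
    also have "\<dots> \<le> (1 / c n) * (1 + c n * (x i)\<^sup>2)" using c0[of n] by (simp add: field_simps)
    finally have "\<bar>f n x\<bar> \<le> 1 / c n" using den[of n "x i"] by (simp add: f_def pos_divide_le_eq)
    then show ?thesis by simp
  qed
  have f'b: "\<bar>f' n j x\<bar> \<le> (if i = j then 1 else 0)" for n j x
  proof -
    define a where "a = c n * (x i)\<^sup>2"
    have a: "a \<ge> 0" using c0[of n] by (simp add: a_def)
    have "\<bar>1 - a\<bar> \<le> 1 + a" using a by simp
    also have "\<dots> \<le> (1 + a)\<^sup>2" using a by (simp add: power2_eq_square algebra_simps)
    finally have "\<bar>(1 - a) / (1 + a)\<^sup>2\<bar> \<le> 1" using a by (simp add: divide_le_eq_1)
    then show ?thesis by (cases "i = j") (simp_all add: f'_def a_def)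
  qed
  have fs: "sqi M (f n)" for n
    by (rule sqi_bounded[OF fm, of _ "1 + 1 / c n"]) (use fb cont_meas[OF fc] in \<open>auto simp: meas_M\<close>)
  have f's: "sqi M (f' n j)" for n j
    by (rule sqi_bounded[OF fm, of _ "if i = j then 1 else 0"]) (use f'b cont_meas[OF f'c] in \<open>auto simp: meas_M\<close>)
  \<comment> \<open>The derivative of the truncation is at most 1 in absolute value, so its variance
    is at most CP. Its mean is at most the first absolute moment of the coordinate, which is finite.
    Neither bound depends on n, so Fatou's lemma applies.\<close>
  have bound: "(\<integral>x. (f n x)\<^sup>2 \<partial>M) \<le> CP + (\<integral>x. \<bar>x i\<bar> \<partial>M)\<^sup>2" for n
  proof -
    have "h1lim (f n) (\<lambda>j. pd j (f n))"
      by (rule C1_h1lim[OF C1 fs]) (use f's in \<open>simp add: pdf[abs_def]\<close>)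
    from h1lim_poincare[OF this] have "(\<integral>x. (f n x)\<^sup>2 \<partial>M) - (\<integral>x. f n x \<partial>M)\<^sup>2 \<le> CP * (\<Sum>j<d. \<integral>x. (f' n j x)\<^sup>2 \<partial>M)"
      by (simp add: variance_eq[OF fs] pdf)
    also have "\<dots> \<le> CP * (\<Sum>j<d. if i = j then 1 else 0)"
    proof (intro mult_left_mono sum_mono CP0)
      fix j
      have "(\<integral>x. (f' n j x)\<^sup>2 \<partial>M) \<le> (\<integral>x. (if i = j then 1 else 0) \<partial>M)"
      proof (rule integral_mono[OF sqiD(2)[OF f's]])
        show "(f' n j x)\<^sup>2 \<le> (if i = j then 1 else 0)" for x
          using f'b[of n j x] by (cases "i = j") (auto simp: abs_square_le_1)
      qed simp
      then show "(\<integral>x. (f' n j x)\<^sup>2 \<partial>M) \<le> (if i = j then 1 else 0)" by (simp add: measure_M split: if_splits)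
    qed
    also have "\<dots> = CP" using i by simp
    finally have a: "(\<integral>x. (f n x)\<^sup>2 \<partial>M) \<le> CP + (\<integral>x. f n x \<partial>M)\<^sup>2" by simp
    have "\<bar>\<integral>x. f n x \<partial>M\<bar> \<le> (\<integral>x. \<bar>f n x\<bar> \<partial>M)" by (rule integral_abs_bound)
    also have "\<dots> \<le> (\<integral>x. \<bar>x i\<bar> \<partial>M)"
      by (rule integral_mono[OF integrable_abs[OF sqi_integrable[OF fm fs]] integrable_abs[OF coord_integrable[OF i]] fle])
    finally have "(\<integral>x. f n x \<partial>M)\<^sup>2 \<le> (\<integral>x. \<bar>x i\<bar> \<partial>M)\<^sup>2" by (metis abs_ge_zero power2_abs power_mono)
    then show ?thesis using a by linarith
  qed
  have lim: "AE x in M. (\<lambda>n. f n x) \<longlonglongrightarrow> x i"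
  proof (rule AE_I2)
    fix x :: point
    have "c \<longlonglongrightarrow> 0" unfolding c_def using LIMSEQ_inverse_real_of_nat by (simp add: inverse_eq_divide)
    then have "(\<lambda>n. x i / (1 + c n * (x i)\<^sup>2)) \<longlonglongrightarrow> x i / (1 + 0 * (x i)\<^sup>2)" by (intro tendsto_intros) auto
    then show "(\<lambda>n. f n x) \<longlonglongrightarrow> x i" by (simp add: f_def)
  qed
  show ?thesis
    by (rule Fatou_sq(1)[OF fs _ lim, of 0 "CP + (\<integral>x. \<bar>x i\<bar> \<partial>M)\<^sup>2"]) (use bound coord_meas[OF i] in \<open>auto simp: meas_M\<close>)
qed

lemma one_sqi: "sqi M (\<lambda>_. c)"
  by (simp add: sqi_def)

lemma lin_sqi: "sqi M (\<lambda>x. lin d A x i)"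
  unfolding lin_def by (intro sqi_sum sqi_cmult coord_sqi) auto

lemma affine_sqi: "sqi M (\<lambda>x. affine_field d A b x i)"
  unfolding affine_field_def by (intro sqi_add lin_sqi one_sqi)

lemma affine_Ck: "Ck d k (\<lambda>x. affine_field d A b x i)"
  unfolding affine_field_def lin_def by (intro Ck_add Ck_sum Ck_cmult Ck_coord Ck_const)

lemma affine_pd: "j < d \<Longrightarrow> x \<in> Rn d \<Longrightarrow> pd j (\<lambda>x. affine_field d A b x i) x = A i j"
proof -
  assume j: "j < d" and x: "x \<in> Rn d"
  have c: "((\<lambda>t. (x(j := t)) k) has_real_derivative (if k = j then 1 else 0)) (at (x j))" for k
    by (cases "k = j") (auto intro!: derivative_eq_intros)
  have "((\<lambda>t. (\<Sum>k<d. A i k * (x(j := t)) k) + b i) has_real_derivative (\<Sum>k<d. A i k * (if k = j then 1 else 0)) + 0) (at (x j))"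
    by (intro DERIV_add DERIV_sum DERIV_cmult c DERIV_const)
  then have "pd j (\<lambda>x. affine_field d A b x i) x = (\<Sum>k<d. A i k * (if k = j then 1 else 0)) + 0"
    unfolding affine_field_def lin_def by (rule pdI)
  also have "(\<Sum>k<d. A i k * (if k = j then 1 else 0)) = (\<Sum>k<d. if k = j then A i k else 0)"
    by (intro sum.cong refl) simp
  finally show ?thesis using j by simp
qed

lemma affine_h1lim: "h1lim (\<lambda>x. affine_field d A b x i) (\<lambda>j x. A i j)"
proof (rule h1lim_cong)
  show "h1lim (\<lambda>x. affine_field d A b x i) (\<lambda>j. pd j (\<lambda>x. affine_field d A b x i))"
  proof (rule C1_h1lim[OF affine_Ck affine_sqi])
    fix j assume j: "j < d"
    have "sqi M (pd j (\<lambda>x. affine_field d A b x i)) = sqi M (\<lambda>_. A i j)"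
      by (rule sqi_cong) (use affine_pd[OF j] in simp)
    then show "sqi M (pd j (\<lambda>x. affine_field d A b x i))" using one_sqi by simp
  qed
qed (simp_all add: affine_pd)

lemma lin_mean: "(\<integral>x. lin d A x i \<partial>M) = 0"
proof -
  have "(\<integral>x. lin d A x i \<partial>M) = (\<Sum>j<d. \<integral>x. A i j * x j \<partial>M)"
    unfolding lin_def by (rule Bochner_Integration.integral_sum) (use coord_integrable in auto)
  then show ?thesis by (simp add: coord_mean)
qed

lemma affine_mean: "(\<integral>x. affine_field d A b x i \<partial>M) = b i"
  unfolding affine_field_def using lin_mean[of A i] sqi_integrable[OF fm lin_sqi] by (simp add: measure_M)

lemma phij_mult_sqi:
  assumes h: "h1lim f g" and j: "j < d" shows "sqi M (\<lambda>x. pd j \<phi> x * f x)"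
proof (rule sqi_bound[OF h1lim_grad_weight(1)[OF h]])
  show "(\<lambda>x. pd j \<phi> x * f x) \<in> borel_measurable M"
    using cont_meas[OF Ck_cont[OF phijC1[OF j]]] sqiD(1)[OF h1lim_sqi(1)[OF h]] by (simp add: meas_M)
  fix x
  have "(pd j \<phi> x)\<^sup>2 \<le> (gn x)\<^sup>2" unfolding gn_sq using j by (intro member_le_sum) auto
  then have "\<bar>pd j \<phi> x\<bar> \<le> gn x" using gn_nonneg[of x] by (metis abs_le_square_iff abs_of_nonneg)
  then show "\<bar>pd j \<phi> x * f x\<bar> \<le> 1 * \<bar>gn x * f x\<bar>" using gn_nonneg[of x] by (simp add: abs_mult mult_right_mono)
qed

lemma gdot_sqi:
  assumes "\<And>i. i < d \<Longrightarrow> h1lim (\<lambda>x. u x i) (G i)" shows "sqi M (gdot d \<phi> u)"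
  unfolding gdot_def[abs_def] grad_def by (intro sqi_sum phij_mult_sqi[OF assms]) auto

lemma gdot_bound:
  assumes h: "\<And>i. i < d \<Longrightarrow> h1lim (\<lambda>x. u x i) (G i)"
  shows "norm2 d \<phi> (gdot d \<phi> u) \<le> 8 * (\<Sum>i<d. \<Sum>j<d. \<integral>x. (G i j x)\<^sup>2 \<partial>M) + (Cphi - 1) * (\<Sum>i<d. \<integral>x. (u x i)\<^sup>2 \<partial>M)"
proof -
  have i1: "integrable M (\<lambda>x. (gn x * u x i)\<^sup>2)" if "i < d" for i by (rule sqiD(2)[OF h1lim_grad_weight(1)[OF h[OF that]]])
  have "norm2 d \<phi> (gdot d \<phi> u) \<le> (\<integral>x. (\<Sum>i<d. (gn x * u x i)\<^sup>2) \<partial>M)"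
    unfolding norm2_def
  proof (rule integral_mono[OF sqiD(2)[OF gdot_sqi[OF h]]])
    show "integrable M (\<lambda>x. \<Sum>i<d. (gn x * u x i)\<^sup>2)" by (rule Bochner_Integration.integrable_sum) (use i1 in auto)
    fix x
    have "(gdot d \<phi> u x)\<^sup>2 \<le> (\<Sum>i<d. (pd i \<phi> x)\<^sup>2) * (\<Sum>i<d. (u x i)\<^sup>2)"
      unfolding gdot_def grad_def by (rule Cauchy_Schwarz_ineq_sum)
    then show "(gdot d \<phi> u x)\<^sup>2 \<le> (\<Sum>i<d. (gn x * u x i)\<^sup>2)" by (simp add: gn_sq power_mult_distrib sum_distrib_left)
  qed auto
  also have "\<dots> = (\<Sum>i<d. \<integral>x. (gn x * u x i)\<^sup>2 \<partial>M)" by (rule Bochner_Integration.integral_sum) (use i1 in auto)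
  also have "\<dots> \<le> (\<Sum>i<d. 8 * (\<Sum>j<d. \<integral>x. (G i j x)\<^sup>2 \<partial>M) + (Cphi - 1) * (\<integral>x. (u x i)\<^sup>2 \<partial>M))"
    by (intro sum_mono h1lim_grad_weight(2)[OF h]) auto
  finally show ?thesis by (simp add: sum.distrib sum_distrib_left)
qed

text \<open>Integration by parts against \<open>x i\<close> recovers the translation part of a rigid field.\<close>

lemma gdot_affine_coord:
  assumes A: "A \<in> skew d" and i: "i < d"
  shows "(\<integral>x. gdot d \<phi> (affine_field d A b) x * x i \<partial>M) = b i"
proof -
  let ?w = "\<lambda>j x. affine_field d A b x j"
  \<comment> \<open>The diagonal of a skew matrix is zero, so no component of the field depends on
    its own variable, and only the derivative of \<open>x i\<close> survives.\<close>
  have pt: "pd j (\<lambda>x. ?w j x * x i) x = (if j = i then ?w j x else 0)" if x: "x \<in> Rn d" and j: "j < d" for j x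
    using pd_mult[OF affine_Ck[of "Suc 0"] x j Ck_coord[of d "Suc 0" i], of A b j] affine_pd[OF j x, of A b j] skew_diag[OF A, of j]
    by (simp add: pd_coord)
  have i3: "integrable M (\<lambda>x. pd j \<phi> x * (?w j x * x i))" if j: "j < d" for j
    using sqi_mult_integrable[OF phij_mult_sqi[OF affine_h1lim j] coord_sqi[OF i], of A b j] by (simp add: mult.assoc)
  have i1: "integrable M (\<lambda>x. ?w j x * x i)" for j by (rule sqi_mult_integrable[OF affine_sqi coord_sqi[OF i]])
  have i4: "integrable M (\<lambda>x. if j = i then ?w j x else 0)" for j using sqi_integrable[OF fm affine_sqi] by (cases "j = i") auto
  have i2: "integrable M (pd j (\<lambda>x. ?w j x * x i))" if j: "j < d" for j
  proof -
    have "integrable M (pd j (\<lambda>x. ?w j x * x i)) = integrable M (\<lambda>x. if j = i then ?w j x else 0)"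
      by (rule Bochner_Integration.integrable_cong[OF refl]) (use pt[OF _ j] in simp)
    then show ?thesis using i4 by simp
  qed
  have "(\<integral>x. gdot d \<phi> (affine_field d A b) x * x i \<partial>M) = (\<integral>x. (\<Sum>j<d. pd j \<phi> x * (?w j x * x i)) \<partial>M)"
    by (simp add: gdot_def grad_def sum_distrib_right mult.assoc)
  also have "\<dots> = (\<Sum>j<d. \<integral>x. pd j \<phi> x * (?w j x * x i) \<partial>M)" by (rule Bochner_Integration.integral_sum) (use i3 in auto)
  also have "\<dots> = (\<Sum>j<d. \<integral>x. pd j (\<lambda>x. ?w j x * x i) x \<partial>M)"
    by (intro sum.cong refl ibp_global[of "Suc 0"] Ck_mult affine_Ck Ck_coord i1 i2 i3) auto
  also have "\<dots> = (\<Sum>j<d. \<integral>x. (if j = i then ?w j x else 0) \<partial>M)"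
    by (intro sum.cong refl Bochner_Integration.integral_cong pt) auto
  also have "\<dots> = (\<Sum>j<d. if j = i then b i else 0)" by (intro sum.cong refl) (simp add: affine_mean)
  also have "\<dots> = b i" using i by simp
  finally show ?thesis .
qed

text \<open>The kernel of the rigidity form. Testing against the coordinates gives b = 0; what
  remains is a continuous function vanishing almost everywhere, hence everywhere on
  \<open>Rn d\<close>, which is the defining condition of \<open>M_phi\<close>.\<close>

lemma gdot_affine_zero:
  assumes A: "A \<in> skew d" and b: "b \<in> vecs d" and z: "norm2 d \<phi> (gdot d \<phi> (affine_field d A b)) = 0"
  shows "b = (\<lambda>i. 0)" "A \<in> M_phi d \<phi>"
proof -
  have s: "sqi M (gdot d \<phi> (affine_field d A b))" by (rule gdot_sqi[OF affine_h1lim])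
  have ae: "AE x in M. gdot d \<phi> (affine_field d A b) x = 0"
    using z integral_nonneg_eq_0_iff_AE[OF sqiD(2)[OF s]] unfolding norm2_def by simp
  show b0: "b = (\<lambda>i. 0)"
  proof
    fix i show "b i = 0"
    proof (cases "i < d")
      case True
      have "(\<integral>x. gdot d \<phi> (affine_field d A b) x * x i \<partial>M) = 0"
        by (rule integral_eq_zero_AE) (use ae in eventually_elim, simp)
      then show ?thesis using gdot_affine_coord[OF A True] by simp
    qed (use b in \<open>simp add: vecs_def\<close>)
  qed
  have e: "affine_field d A b = lin d A" by (simp add: affine_field_def[abs_def] b0)
  have c: "continuous_on (Rn d) (gdot d \<phi> (affine_field d A b))"
    unfolding gdot_def[abs_def] grad_def by (intro continuous_intros Ck_cont[OF phijC1] Ck_cont[OF affine_Ck]) auto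
  have "gdot d \<phi> (lin d A) x = 0" if "x \<in> Rn d" for x
    using continuous_AE_zero[OF c ae[unfolded AE_M_iff] that] unfolding e .
  then show "A \<in> M_phi d \<phi>" unfolding M_phi_iff using A by blast
qed

lemma quadratic_expand:
  assumes "\<And>a. a \<in> I \<Longrightarrow> sqi M (f a)"
  shows "(\<integral>x. (\<Sum>a\<in>I. c a * f a x)\<^sup>2 \<partial>M) = (\<Sum>a\<in>I. \<Sum>b\<in>I. c a * c b * (\<integral>x. f a x * f b x \<partial>M))"
proof -
  have i: "integrable M (\<lambda>x. (c a * f a x) * (c b * f b x))" if "a \<in> I" "b \<in> I" for a b
    by (intro sqi_mult_integrable sqi_cmult assms that)
  have "(\<integral>x. (\<Sum>a\<in>I. c a * f a x)\<^sup>2 \<partial>M) = (\<integral>x. (\<Sum>a\<in>I. \<Sum>b\<in>I. (c a * f a x) * (c b * f b x)) \<partial>M)"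
    by (simp add: power2_eq_square sum_product)
  also have "\<dots> = (\<Sum>a\<in>I. \<integral>x. (\<Sum>b\<in>I. (c a * f a x) * (c b * f b x)) \<partial>M)"
    by (rule Bochner_Integration.integral_sum) (intro Bochner_Integration.integrable_sum i)
  also have "\<dots> = (\<Sum>a\<in>I. \<Sum>b\<in>I. \<integral>x. (c a * f a x) * (c b * f b x) \<partial>M)"
    by (intro sum.cong refl Bochner_Integration.integral_sum i)
  also have "\<dots> = (\<Sum>a\<in>I. \<Sum>b\<in>I. c a * c b * (\<integral>x. f a x * f b x \<partial>M))"
  proof (intro sum.cong refl)
    fix a b
    have "(\<integral>x. (c a * f a x) * (c b * f b x) \<partial>M) = (\<integral>x. (c a * c b) * (f a x * f b x) \<partial>M)" by (simp add: mult_ac)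
    then show "(\<integral>x. (c a * f a x) * (c b * f b x) \<partial>M) = c a * c b * (\<integral>x. f a x * f b x \<partial>M)" by simp
  qed
  finally show ?thesis .
qed

lemma gdot_quadratic_cont: "continuous_on UNIV (\<lambda>p. norm2 d \<phi> (gdot d \<phi> (affine_field d (fst p) (snd p))))"
proof -
  \<comment> \<open>Column d carries the translation part, so the form becomes a quadratic
    polynomial in finitely many coefficients.\<close>
  define I where "I = {..<d} \<times> {..<Suc d}"
  define f where "f a x = pd (fst a) \<phi> x * (if snd a < d then x (snd a) else 1)" for a :: "nat \<times> nat" and x
  define c where "c p a = (if snd a < d then fst p (fst a) (snd a) else snd p (fst a))" for p :: "mat \<times> (nat \<Rightarrow> real)" and a :: "nat \<times> nat"
  have e: "gdot d \<phi> (affine_field d (fst p) (snd p)) x = (\<Sum>a\<in>I. c p a * f a x)" for p x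
  proof -
    have "(\<Sum>a\<in>I. c p a * f a x) = (\<Sum>i<d. \<Sum>j<Suc d. c p (i, j) * f (i, j) x)"
      unfolding I_def sum.cartesian_product by (intro sum.cong refl) (simp add: split_beta)
    also have "\<dots> = (\<Sum>i<d. pd i \<phi> x * affine_field d (fst p) (snd p) x i)"
      by (intro sum.cong refl) (simp add: c_def f_def affine_field_def lin_def sum_distrib_left algebra_simps)
    finally show ?thesis by (simp add: gdot_def grad_def)
  qed
  have fs: "sqi M (f a)" if "a \<in> I" for a
  proof -
    have i: "fst a < d" using that by (auto simp: I_def)
    \<comment> \<open>All components of this affine field equal the coordinate \<open>snd a\<close>,
      or the constant 1 when \<open>snd a\<close> is d; component 0 supplies the square
      integrability of \<open>f a\<close>.\<close>
    define A where "A = (\<lambda>(i::nat) (j::nat). if snd a < d \<and> j = snd a then 1 else 0 :: real)"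
    define b where "b = (\<lambda>(i::nat). if snd a < d then 0 else 1 :: real)"
    have "affine_field d A b x 0 = (if snd a < d then x (snd a) else 1)" for x
    proof (cases "snd a < d")
      case True
      then have "(\<Sum>j<d. A 0 j * x j) = (\<Sum>j<d. if j = snd a then x j else 0)" by (intro sum.cong refl) (simp add: A_def)
      then show ?thesis using True by (simp add: affine_field_def lin_def b_def)
    qed (simp add: affine_field_def lin_def A_def b_def)
    then show ?thesis using phij_mult_sqi[OF affine_h1lim i, of A b 0] by (simp add: f_def[abs_def])
  qed
  have "norm2 d \<phi> (gdot d \<phi> (affine_field d (fst p) (snd p))) = (\<Sum>a\<in>I. \<Sum>b\<in>I. c p a * c p b * (\<integral>x. f a x * f b x \<partial>M))" for p
    unfolding norm2_def e by (rule quadratic_expand[OF fs])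
  moreover have "continuous_on UNIV (\<lambda>p. c p a)" for a
    unfolding c_def using cont_entry[OF continuous_on_fst[OF continuous_on_id]]
      continuous_on_product_then_coordinatewise[OF continuous_on_snd[OF continuous_on_id]]
    by (cases "snd a < d") simp_all
  ultimately show ?thesis by (simp only:) (intro continuous_intros)
qed

lemma gdot_affine_scale: "gdot d \<phi> (affine_field d (\<lambda>i j. t * A i j) (\<lambda>i. t * b i)) x = t * gdot d \<phi> (affine_field d A b) x"
  by (simp add: gdot_def affine_field_def lin_def sum_distrib_left algebra_simps)

text \<open>Serves both rigidity constants: V is the complement of the symmetries, for the scalar
  product of matrices or for that of the fields. Either one meets \<open>M_phi\<close> only in zero,
  so by \<open>gdot_affine_zero\<close> the form is positive away from zero.\<close>

lemma rigidity_lower_bound: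
  assumes cl: "closed V" and V: "\<And>A. A \<in> V \<Longrightarrow> A \<in> skew d" "\<And>A t. A \<in> V \<Longrightarrow> (\<lambda>i j. t * A i j) \<in> V"
    and disj: "\<And>A. A \<in> V \<Longrightarrow> A \<in> M_phi d \<phi> \<Longrightarrow> A = (\<lambda>i j. 0)"
  shows "\<exists>c>0. \<forall>A\<in>V. \<forall>b\<in>vecs d. c * (msq d A + vsq d b) \<le> norm2 d \<phi> (gdot d \<phi> (affine_field d A b))"
proof -
  define Q where "Q p = norm2 d \<phi> (gdot d \<phi> (affine_field d (fst p) (snd p)))" for p
  have "\<exists>c>0. \<forall>(A, b)\<in>V \<times> vecs d. c * (msq d A + vsq d b) \<le> Q (A, b)"
  proof (rule unit_lower_bound)
    show "closed (V \<times> vecs d)" by (intro closed_Times cl closed_vecs)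
    show "continuous_on UNIV Q" unfolding Q_def by (rule gdot_quadratic_cont)
    show "msupp d A \<and> b \<in> vecs d" if "(A, b) \<in> V \<times> vecs d" for A b using that skew_msupp[OF V(1)] by auto
    show "((\<lambda>i j. t * A i j), (\<lambda>i. t * b i)) \<in> V \<times> vecs d" if "(A, b) \<in> V \<times> vecs d" for A b t
      using that V(2) by (auto simp: vecs_def)
    show "Q ((\<lambda>i j. t * A i j), (\<lambda>i. t * b i)) = t\<^sup>2 * Q (A, b)" for A b t
      unfolding Q_def norm2_def fst_conv snd_conv gdot_affine_scale power_mult_distrib by simp
    fix A b assume Ab: "(A, b) \<in> V \<times> vecs d" and nz: "msq d A + vsq d b \<noteq> 0"
    have A: "A \<in> V" and b: "b \<in> vecs d" using Ab by auto
    have "Q (A, b) \<noteq> 0"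
    proof
      assume "Q (A, b) = 0"
      then have z: "norm2 d \<phi> (gdot d \<phi> (affine_field d A b)) = 0" by (simp add: Q_def)
      have "b = (\<lambda>i. 0)" "A = (\<lambda>i j. 0)"
        using gdot_affine_zero[OF V(1)[OF A] b z] disj[OF A] by auto
      then show False using nz by (simp add: msq_def vsq_def)
    qed
    moreover have "0 \<le> Q (A, b)" by (simp add: Q_def norm2_def)
    ultimately show "Q (A, b) > 0" by simp
  qed
  then obtain c where c: "c > 0" "\<forall>(A, b)\<in>V \<times> vecs d. c * (msq d A + vsq d b) \<le> Q (A, b)" by (elim exE conjE)
  have "c * (msq d A + vsq d b) \<le> norm2 d \<phi> (gdot d \<phi> (affine_field d A b))" if "A \<in> V" "b \<in> vecs d" for A b
    using c(2) that by (auto simp: Q_def)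
  then show ?thesis using c(1) by blast
qed

section \<open>Norms and scalar products as sums over components\<close>

lemma vnorm2_sum: "(\<And>i. i < d \<Longrightarrow> sqi M (\<lambda>x. u x i)) \<Longrightarrow> vnorm2 d \<phi> u = (\<Sum>i<d. \<integral>x. (u x i)\<^sup>2 \<partial>M)"
  unfolding vnorm2_def vsq_def by (rule Bochner_Integration.integral_sum) (auto dest: sqiD(2))

lemma vinner_sum:
  assumes "\<And>i. i < d \<Longrightarrow> sqi M (\<lambda>x. u x i)" "\<And>i. i < d \<Longrightarrow> sqi M (\<lambda>x. v x i)"
  shows "vinner d \<phi> u v = (\<Sum>i<d. \<integral>x. u x i * v x i \<partial>M)"
  unfolding vinner_def by (rule Bochner_Integration.integral_sum) (intro sqi_mult_integrable assms; simp)

lemma mnorm2_sum: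
  assumes "\<And>i j. i < d \<Longrightarrow> j < d \<Longrightarrow> sqi M (\<lambda>x. G x i j)"
  shows "mnorm2 d \<phi> G = (\<Sum>i<d. \<Sum>j<d. \<integral>x. (G x i j)\<^sup>2 \<partial>M)"
proof -
  have i: "integrable M (\<lambda>x. (G x i j)\<^sup>2)" if "i < d" "j < d" for i j by (rule sqiD(2)[OF assms[OF that]])
  have "mnorm2 d \<phi> G = (\<Sum>i<d. \<integral>x. (\<Sum>j<d. (G x i j)\<^sup>2) \<partial>M)"
    unfolding mnorm2_def msq_def by (rule Bochner_Integration.integral_sum) (intro Bochner_Integration.integrable_sum i; simp)
  also have "\<dots> = (\<Sum>i<d. \<Sum>j<d. \<integral>x. (G x i j)\<^sup>2 \<partial>M)"
    by (intro sum.cong refl Bochner_Integration.integral_sum i) auto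
  finally show ?thesis .
qed

lemma diff_lin_sqi: "sqi M f \<Longrightarrow> sqi M (\<lambda>x. f x - lin d A x i)"
  by (intro sqi_diff lin_sqi)

lemma vnorm2_lin_cont:
  assumes u: "\<And>i. i < d \<Longrightarrow> sqi M (\<lambda>x. u x i)"
  shows "continuous_on UNIV (\<lambda>A. vnorm2 d \<phi> (\<lambda>x i. u x i - lin d A x i))"
proof -
  \<comment> \<open>Index d stands for u itself, so the difference is a finite linear combination of
    fixed functions, with coefficients continuous in A.\<close>
  define f where "f i j x = (if j < d then x j else u x i)" for i j and x :: point
  define c where "c A i j = (if j < d then - A i j else 1)" for A :: mat and i j
  have fs: "sqi M (f i j)" if "i < d" for i j
    using u[OF that] coord_sqi[of j] by (cases "j < d") (simp_all add: f_def[abs_def])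
  have e: "u x i - lin d A x i = (\<Sum>j\<in>{..<Suc d}. c A i j * f i j x)" for A x i
    by (simp add: c_def f_def lin_def sum_negf)
  have "vnorm2 d \<phi> (\<lambda>x i. u x i - lin d A x i)
    = (\<Sum>i<d. \<Sum>j\<in>{..<Suc d}. \<Sum>k\<in>{..<Suc d}. c A i j * c A i k * (\<integral>x. f i j x * f i k x \<partial>M))" for A
  proof -
    have "vnorm2 d \<phi> (\<lambda>x i. u x i - lin d A x i) = (\<Sum>i<d. \<integral>x. (u x i - lin d A x i)\<^sup>2 \<partial>M)"
      by (rule vnorm2_sum) (intro diff_lin_sqi u)
    also have "\<dots> = (\<Sum>i<d. \<Sum>j\<in>{..<Suc d}. \<Sum>k\<in>{..<Suc d}. c A i j * c A i k * (\<integral>x. f i j x * f i k x \<partial>M))"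
      unfolding e by (intro sum.cong refl quadratic_expand fs) simp
    finally show ?thesis .
  qed
  moreover have "continuous_on UNIV (\<lambda>A. c A i j)" for i j
    unfolding c_def by (cases "j < d") (simp_all add: continuous_on_minus[OF entry_cont])
  ultimately show ?thesis by (simp only:) (intro continuous_intros)
qed

subsection \<open>Projections onto rigid fields\<close>

text \<open>A linear field that vanishes in L2 vanishes at every point, as the density is positive
  and the field continuous, and then A = 0. The bound gives coercivity for
  \<open>rot_projection\<close> and uniqueness for \<open>P_phi_eq\<close>.\<close>

lemma lin_lower_bound: "\<exists>c>0. \<forall>A\<in>skew d. c * msq d A \<le> vnorm2 d \<phi> (lin d A)"
proof -
  define Q where "Q p = vnorm2 d \<phi> (lin d (fst p))" for p :: "mat \<times> (nat \<Rightarrow> real)"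
  have "\<exists>c>0. \<forall>(A, b)\<in>skew d \<times> {\<lambda>i. 0}. c * (msq d A + vsq d b) \<le> Q (A, b)"
  proof (rule unit_lower_bound)
    have "{\<lambda>i. 0} = {b :: nat \<Rightarrow> real. \<forall>i. b i = 0}" by (auto simp: fun_eq_iff)
    also have "closed \<dots>" by (intro closed_Collect_all closed_Collect_eq continuous_intros)
    finally show "closed (skew d \<times> {(\<lambda>i. 0) :: nat \<Rightarrow> real})" by (rule closed_Times[OF closed_skew])
    have "continuous_on UNIV (\<lambda>A. vnorm2 d \<phi> (\<lambda>x i. (\<lambda>x i. 0) x i - lin d A x i))" by (rule vnorm2_lin_cont) simp
    then have "continuous_on UNIV (\<lambda>A. vnorm2 d \<phi> (lin d A))" by (simp add: vnorm2_def vsq_def)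
    then show "continuous_on UNIV Q" unfolding Q_def
      by (rule continuous_on_compose2[OF _ continuous_on_fst[OF continuous_on_id]]) simp
    show "msupp d A \<and> b \<in> vecs d" if "(A, b) \<in> skew d \<times> {\<lambda>i. 0}" for A b using that skew_msupp[of A d] by (auto simp: vecs_def)
    show "((\<lambda>i j. t * A i j), (\<lambda>i. t * b i)) \<in> skew d \<times> {\<lambda>i. 0}" if "(A, b) \<in> skew d \<times> {\<lambda>i. 0}" for A b t
      using that skew_lc[OF skew_zero, of A d t] by auto
    show "Q ((\<lambda>i j. t * A i j), (\<lambda>i. t * b i)) = t\<^sup>2 * Q (A, b)" for A b t
    proof -
      have "vsq d (lin d (\<lambda>i j. t * A i j) x) = t\<^sup>2 * vsq d (lin d A x)" for x
        using lin_lc[of d "\<lambda>i j. 0" t A x] by (simp add: vsq_def power_mult_distrib sum_distrib_left)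
      then show ?thesis by (simp add: Q_def vnorm2_def)
    qed
    fix A b assume Ab: "(A, b) \<in> skew d \<times> {\<lambda>i. 0}" and nz: "msq d A + vsq d b \<noteq> 0"
    have A: "A \<in> skew d" and b: "b = (\<lambda>i. 0)" using Ab by auto
    have s: "vnorm2 d \<phi> (lin d A) = (\<Sum>i<d. \<integral>x. (lin d A x i)\<^sup>2 \<partial>M)" by (rule vnorm2_sum) (rule lin_sqi)
    have "vnorm2 d \<phi> (lin d A) \<noteq> 0"
    proof
      assume z: "vnorm2 d \<phi> (lin d A) = 0"
      have "lin d A x i = 0" if x: "x \<in> Rn d" and i: "i < d" for x i
      proof -
        have "(\<integral>x. (lin d A x i)\<^sup>2 \<partial>M) = 0" using z i unfolding s by (subst (asm) sum_nonneg_eq_0_iff) auto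
        then have "AE x in M. lin d A x i = 0"
          using integral_nonneg_eq_0_iff_AE[OF sqiD(2)[OF lin_sqi[of A i]]] by simp
        then have "AE x in leb d. lin d A x i = 0" unfolding AE_M_iff .
        moreover have "continuous_on (Rn d) (\<lambda>x. lin d A x i)" unfolding lin_def by (intro continuous_intros)
        ultimately show ?thesis using continuous_AE_zero x by blast
      qed
      then have "A = (\<lambda>i j. 0)" by (rule lin_eq_zero[OF skew_msupp[OF A]])
      then show False using nz by (simp add: b msq_def vsq_def)
    qed
    moreover have "0 \<le> vnorm2 d \<phi> (lin d A)" unfolding s by (simp add: sum_nonneg)
    ultimately show "Q (A, b) > 0" by (simp add: Q_def)
  qed
  then obtain c where c: "c > 0" "\<forall>(A, b)\<in>skew d \<times> {\<lambda>i. 0}. c * (msq d A + vsq d b) \<le> Q (A, b)" by (elim exE conjE)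
  have "c * msq d A \<le> vnorm2 d \<phi> (lin d A)" if "A \<in> skew d" for A
    using c(2) that by (auto simp: Q_def vsq_def)
  then show ?thesis using c(1) by blast
qed

lemma vnorm2_nonneg: "0 \<le> vnorm2 d \<phi> u"
  unfolding vnorm2_def by (rule integral_nonneg_AE) (simp add: vsq_nonneg)

lemma norm2_nonneg: "0 \<le> norm2 d \<phi> f"
  by (simp add: norm2_def)

lemma lin_vnorm2_zero: "A \<in> skew d \<Longrightarrow> vnorm2 d \<phi> (lin d A) = 0 \<Longrightarrow> A = (\<lambda>i j. 0)"
proof -
  assume A: "A \<in> skew d" and z: "vnorm2 d \<phi> (lin d A) = 0"
  obtain c where c: "c > 0" "\<forall>A\<in>skew d. c * msq d A \<le> vnorm2 d \<phi> (lin d A)" using lin_lower_bound by blast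
  then have "c * msq d A \<le> 0" using A z by fastforce
  then have "msq d A = 0" using c(1) msq_nonneg[of d A] by (simp add: mult_le_0_iff)
  then show ?thesis using msq_zero_iff[OF skew_msupp[OF A]] by simp
qed

lemma vnorm2_expand:
  assumes u: "\<And>i. i < d \<Longrightarrow> sqi M (\<lambda>x. u x i)"
  shows "vnorm2 d \<phi> (\<lambda>x i. u x i - lin d (\<lambda>i j. A i j + t * S i j) x i)
    = vnorm2 d \<phi> (\<lambda>x i. u x i - lin d A x i) + 2 * t * - vinner d \<phi> (\<lambda>x i. u x i - lin d A x i) (lin d S) + t\<^sup>2 * vnorm2 d \<phi> (lin d S)"
proof -
  have s: "sqi M (\<lambda>x. u x i - lin d A x i)" if "i < d" for i by (rule diff_lin_sqi[OF u[OF that]])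
  have s2: "sqi M (\<lambda>x. u x i - lin d (\<lambda>i j. A i j + t * S i j) x i)" if "i < d" for i by (rule diff_lin_sqi[OF u[OF that]])
  have one: "(\<integral>x. (u x i - lin d (\<lambda>i j. A i j + t * S i j) x i)\<^sup>2 \<partial>M) = (\<integral>x. (u x i - lin d A x i)\<^sup>2 \<partial>M)
     + 2 * t * - (\<integral>x. (u x i - lin d A x i) * lin d S x i \<partial>M) + t\<^sup>2 * (\<integral>x. (lin d S x i)\<^sup>2 \<partial>M)" if i: "i < d" for i
  proof -
    have "(\<integral>x. (u x i - lin d (\<lambda>i j. A i j + t * S i j) x i)\<^sup>2 \<partial>M)
      = (\<integral>x. (u x i - lin d A x i)\<^sup>2 + 2 * t * - ((u x i - lin d A x i) * lin d S x i) + t\<^sup>2 * (lin d S x i)\<^sup>2 \<partial>M)"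
      by (intro Bochner_Integration.integral_cong refl) (simp add: lin_lc power2_eq_square algebra_simps)
    then show ?thesis
      using sqiD(2)[OF s[OF i]] sqiD(2)[OF lin_sqi[of S i]] sqi_mult_integrable[OF s[OF i] lin_sqi[of S i]] by simp
  qed
  have "vnorm2 d \<phi> (\<lambda>x i. u x i - lin d (\<lambda>i j. A i j + t * S i j) x i) = (\<Sum>i<d. \<integral>x. (u x i - lin d (\<lambda>i j. A i j + t * S i j) x i)\<^sup>2 \<partial>M)"
    by (rule vnorm2_sum[OF s2])
  also have "\<dots> = (\<Sum>i<d. (\<integral>x. (u x i - lin d A x i)\<^sup>2 \<partial>M)
     + 2 * t * - (\<integral>x. (u x i - lin d A x i) * lin d S x i \<partial>M) + t\<^sup>2 * (\<integral>x. (lin d S x i)\<^sup>2 \<partial>M))"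
    by (intro sum.cong refl one) auto
  also have "\<dots> = (\<Sum>i<d. \<integral>x. (u x i - lin d A x i)\<^sup>2 \<partial>M) + 2 * t * - (\<Sum>i<d. \<integral>x. (u x i - lin d A x i) * lin d S x i \<partial>M) + t\<^sup>2 * (\<Sum>i<d. \<integral>x. (lin d S x i)\<^sup>2 \<partial>M)"
    by (simp add: sum.distrib sum_subtractf sum_distrib_left sum_negf)
  also have "(\<Sum>i<d. \<integral>x. (u x i - lin d A x i)\<^sup>2 \<partial>M) = vnorm2 d \<phi> (\<lambda>x i. u x i - lin d A x i)"
    by (rule vnorm2_sum[symmetric]) (rule s)
  also have "(\<Sum>i<d. \<integral>x. (u x i - lin d A x i) * lin d S x i \<partial>M) = vinner d \<phi> (\<lambda>x i. u x i - lin d A x i) (lin d S)"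
    by (rule vinner_sum[symmetric]) (rule s lin_sqi; assumption?)+
  also have "(\<Sum>i<d. \<integral>x. (lin d S x i)\<^sup>2 \<partial>M) = vnorm2 d \<phi> (lin d S)"
    by (rule vnorm2_sum[symmetric]) (rule lin_sqi)
  finally show ?thesis .
qed

lemma rot_projection:
  assumes u: "\<And>i. i < d \<Longrightarrow> sqi M (\<lambda>x. u x i)"
  shows "\<exists>A\<in>M_phi d \<phi>. \<forall>S\<in>M_phi d \<phi>. vinner d \<phi> (\<lambda>x i. u x i - lin d A x i) (lin d S) = 0"
proof -
  obtain c where c: "c > 0" "\<forall>A\<in>skew d. c * msq d A \<le> vnorm2 d \<phi> (lin d A)" using lin_lower_bound by blast
  have "\<exists>A\<in>M_phi d \<phi>. \<forall>S\<in>M_phi d \<phi>. - vinner d \<phi> (\<lambda>x i. u x i - lin d A x i) (lin d S) = 0"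
  proof (rule riesz_fd[where d = d and J = "\<lambda>A. vnorm2 d \<phi> (\<lambda>x i. u x i - lin d A x i)" and q = "\<lambda>S. vnorm2 d \<phi> (lin d S)" and r = "4 * vnorm2 d \<phi> u / c"])
    show "msupp d A" if "A \<in> M_phi d \<phi>" for A by (rule skew_msupp[OF M_phi_skew[OF that]])
    show "continuous_on UNIV (\<lambda>A. vnorm2 d \<phi> (\<lambda>x i. u x i - lin d A x i))" by (rule vnorm2_lin_cont[OF u])
    fix A assume A: "A \<in> M_phi d \<phi>" and le: "vnorm2 d \<phi> (\<lambda>x i. u x i - lin d A x i) \<le> vnorm2 d \<phi> (\<lambda>x i. u x i - lin d (\<lambda>i j. 0) x i)"
    \<comment> \<open>If A does no worse than 0, then \<open>\<parallel>A x\<parallel>^2 \<le> 2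
      \<parallel>u\<parallel>^2 + 2 \<parallel>u - A x\<parallel>^2 \<le> 4
      \<parallel>u\<parallel>^2\<close>; this explains the radius.\<close>
    have "vnorm2 d \<phi> (lin d A) = (\<Sum>i<d. \<integral>x. (u x i + - (u x i - lin d A x i))\<^sup>2 \<partial>M)"
      by (simp add: vnorm2_sum[OF lin_sqi])
    also have "\<dots> \<le> (\<Sum>i<d. 2 * (\<integral>x. (u x i)\<^sup>2 \<partial>M) + 2 * (\<integral>x. (- (u x i - lin d A x i))\<^sup>2 \<partial>M))"
      by (intro sum_mono integral_sq_sum_le u sqi_uminus diff_lin_sqi) auto
    also have "\<dots> = 2 * (\<Sum>i<d. \<integral>x. (u x i)\<^sup>2 \<partial>M) + 2 * (\<Sum>i<d. \<integral>x. (u x i - lin d A x i)\<^sup>2 \<partial>M)"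
      unfolding power2_minus by (simp add: sum.distrib sum_distrib_left)
    also have "\<dots> = 2 * vnorm2 d \<phi> u + 2 * vnorm2 d \<phi> (\<lambda>x i. u x i - lin d A x i)"
      using vnorm2_sum[OF u] vnorm2_sum[of "\<lambda>x i. u x i - lin d A x i", OF diff_lin_sqi[OF u]] by simp
    also have "\<dots> \<le> 4 * vnorm2 d \<phi> u" using le by simp
    finally have "c * msq d A \<le> 4 * vnorm2 d \<phi> u" using c(2) M_phi_skew[OF A] by fastforce
    then show "msq d A \<le> 4 * vnorm2 d \<phi> u / c" using c(1) by (simp add: pos_le_divide_eq mult.commute)
  qed (intro closed_M_phi M_phi_zero M_phi_lc vnorm2_expand[OF u]; assumption)+
  then show ?thesis by simp
qed

text \<open>Two fields satisfying the description of \<open>P_phi\<close> differ by an element of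
  \<open>Rot_phi\<close> that is orthogonal to itself, and such an element is zero by
  \<open>lin_vnorm2_zero\<close>.\<close>

lemma P_phi_eq:
  assumes u: "\<And>i. i < d \<Longrightarrow> sqi M (\<lambda>x. u x i)" and A: "A \<in> M_phi d \<phi>"
    and orth: "\<forall>S\<in>M_phi d \<phi>. vinner d \<phi> (\<lambda>x i. u x i - lin d A x i) (lin d S) = 0"
  shows "P_phi d \<phi> u = lin d A"
  unfolding P_phi_def
proof (rule the_equality)
  show "lin d A \<in> Rot_phi d \<phi> \<and> (\<forall>S\<in>Rot_phi d \<phi>. vinner d \<phi> (\<lambda>x i. u x i - lin d A x i) S = 0)"
    using A orth unfolding Rot_phi_eq by blast
  fix R assume R: "R \<in> Rot_phi d \<phi> \<and> (\<forall>S\<in>Rot_phi d \<phi>. vinner d \<phi> (\<lambda>x i. u x i - R x i) S = 0)"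
  then obtain A' where A': "A' \<in> M_phi d \<phi>" "R = lin d A'" unfolding Rot_phi_eq by blast
  define T where "T = (\<lambda>i j. A i j - A' i j)"
  have T: "T \<in> M_phi d \<phi>" unfolding T_def by (rule M_phi_diff[OF A A'(1)])
  have "lin d T \<in> Rot_phi d \<phi>" unfolding Rot_phi_eq using T by blast
  then have o1: "vinner d \<phi> (\<lambda>x i. u x i - lin d A' x i) (lin d T) = 0" using R A'(2) by blast
  have o2: "vinner d \<phi> (\<lambda>x i. u x i - lin d A x i) (lin d T) = 0" using orth T by blast
  have "vnorm2 d \<phi> (lin d T) = (\<Sum>i<d. (\<integral>x. (u x i - lin d A' x i) * lin d T x i \<partial>M) - (\<integral>x. (u x i - lin d A x i) * lin d T x i \<partial>M))"
    unfolding vnorm2_sum[OF lin_sqi]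
  proof (rule sum.cong[OF refl])
    fix i assume "i \<in> {..<d}"
    then have i: "i < d" by simp
    have "(\<integral>x. (lin d T x i)\<^sup>2 \<partial>M) = (\<integral>x. (u x i - lin d A' x i) * lin d T x i - (u x i - lin d A x i) * lin d T x i \<partial>M)"
      by (intro Bochner_Integration.integral_cong refl) (simp add: T_def lin_diff power2_eq_square algebra_simps)
    then show "(\<integral>x. (lin d T x i)\<^sup>2 \<partial>M) = (\<integral>x. (u x i - lin d A' x i) * lin d T x i \<partial>M) - (\<integral>x. (u x i - lin d A x i) * lin d T x i \<partial>M)"
      using sqi_mult_integrable[OF diff_lin_sqi[OF u[OF i]] lin_sqi] by simp
  qed
  also have "\<dots> = 0"
    using o1 o2 vinner_sum[of "\<lambda>x i. u x i - lin d A' x i" "lin d T", OF diff_lin_sqi[OF u] lin_sqi]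
      vinner_sum[of "\<lambda>x i. u x i - lin d A x i" "lin d T", OF diff_lin_sqi[OF u] lin_sqi] by (simp add: sum_subtractf)
  finally have T0: "T = (\<lambda>i j. 0)" by (rule lin_vnorm2_zero[OF M_phi_skew[OF T]])
  have "A' i j = A i j" for i j using fun_cong[OF fun_cong[OF T0], of i j] by (simp add: T_def)
  then have "A' = A" by (intro ext)
  then show "R = lin d A" using A'(2) by simp
qed

lemma P_phi_minimal:
  assumes u: "\<And>i. i < d \<Longrightarrow> sqi M (\<lambda>x. u x i)" and R: "R \<in> Rot_phi d \<phi>"
  shows "P_phi d \<phi> u \<in> Rot_phi d \<phi>" "vnorm2 d \<phi> (\<lambda>x i. u x i - P_phi d \<phi> u x i) \<le> vnorm2 d \<phi> (\<lambda>x i. u x i - R x i)"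
proof -
  obtain A where A: "A \<in> M_phi d \<phi>" "\<forall>S\<in>M_phi d \<phi>. vinner d \<phi> (\<lambda>x i. u x i - lin d A x i) (lin d S) = 0"
    using rot_projection[of u, OF u] by blast
  have P: "P_phi d \<phi> u = lin d A" by (rule P_phi_eq[OF u A])
  then show "P_phi d \<phi> u \<in> Rot_phi d \<phi>" using A(1) unfolding Rot_phi_eq by blast
  obtain B where B: "B \<in> M_phi d \<phi>" "R = lin d B" using R unfolding Rot_phi_eq by blast
  define S where "S = (\<lambda>i j. B i j - A i j)"
  have S: "S \<in> M_phi d \<phi>" unfolding S_def by (rule M_phi_diff[OF B(1) A(1)])
  have "vnorm2 d \<phi> (\<lambda>x i. u x i - lin d (\<lambda>i j. A i j + 1 * S i j) x i) = vnorm2 d \<phi> (\<lambda>x i. u x i - lin d A x i)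
    + 2 * 1 * - vinner d \<phi> (\<lambda>x i. u x i - lin d A x i) (lin d S) + 1\<^sup>2 * vnorm2 d \<phi> (lin d S)"
    by (rule vnorm2_expand[OF u])
  moreover have "(\<lambda>i j. A i j + 1 * S i j) = B" by (simp add: S_def)
  ultimately show "vnorm2 d \<phi> (\<lambda>x i. u x i - P_phi d \<phi> u x i) \<le> vnorm2 d \<phi> (\<lambda>x i. u x i - R x i)"
    using A(2) S vnorm2_nonneg[of "lin d S"] by (simp add: P B(2))
qed

lemma M_phi_projection: "\<exists>A\<in>M_phi d \<phi>. \<forall>S\<in>M_phi d \<phi>. mdot d (\<lambda>i j. m i j - A i j) S = 0"
proof (rule mdot_projection)
  show "msupp d A" if "A \<in> M_phi d \<phi>" for A by (rule skew_msupp[OF M_phi_skew[OF that]])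
qed (rule closed_M_phi M_phi_zero M_phi_lc; assumption?)+

text \<open>Against a constant matrix only the mean m of G counts, so the L2 projection of G is the
  projection of m in a finite-dimensional space.\<close>

lemma MP_phi_props:
  assumes G: "\<And>i j. i < d \<Longrightarrow> j < d \<Longrightarrow> sqi M (\<lambda>x. G x i j)"
  defines "m \<equiv> \<lambda>i j. \<integral>x. G x i j \<partial>M"
  shows "MP_phi d \<phi> G \<in> M_phi d \<phi>" "\<And>S. S \<in> M_phi d \<phi> \<Longrightarrow> mdot d (\<lambda>i j. m i j - MP_phi d \<phi> G i j) S = 0"
proof -
  have mi: "minner d \<phi> (\<lambda>x i j. G x i j - A i j) (\<lambda>x. B) = mdot d (\<lambda>i j. m i j - A i j) B" for A B :: mat
  proof -
    have i: "integrable M (\<lambda>x. (G x i j - A i j) * B i j)" if "i < d" "j < d" for i j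
      using sqi_integrable[OF fm G[OF that]] by simp
    have "minner d \<phi> (\<lambda>x i j. G x i j - A i j) (\<lambda>x. B) = (\<Sum>i<d. \<integral>x. (\<Sum>j<d. (G x i j - A i j) * B i j) \<partial>M)"
      unfolding minner_def mdot_def by (rule Bochner_Integration.integral_sum) (intro Bochner_Integration.integrable_sum i; simp)
    also have "\<dots> = (\<Sum>i<d. \<Sum>j<d. \<integral>x. (G x i j - A i j) * B i j \<partial>M)"
      by (intro sum.cong refl Bochner_Integration.integral_sum i) auto
    also have "\<dots> = mdot d (\<lambda>i j. m i j - A i j) B"
      unfolding mdot_def m_def by (intro sum.cong refl) (use sqi_integrable[OF fm G] in \<open>simp add: measure_M\<close>)
    finally show ?thesis .
  qed
  obtain A where A: "A \<in> M_phi d \<phi>" "\<forall>S\<in>M_phi d \<phi>. mdot d (\<lambda>i j. m i j - A i j) S = 0"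
    using M_phi_projection[of m] by (elim bexE)
  have "MP_phi d \<phi> G = A" unfolding MP_phi_def mi
  proof (rule the_equality)
    show "A \<in> M_phi d \<phi> \<and> (\<forall>B\<in>M_phi d \<phi>. mdot d (\<lambda>i j. m i j - A i j) B = 0)" using A by blast
    fix A' assume A': "A' \<in> M_phi d \<phi> \<and> (\<forall>B\<in>M_phi d \<phi>. mdot d (\<lambda>i j. m i j - A' i j) B = 0)"
    define T where "T = (\<lambda>i j. A i j - A' i j)"
    have T: "T \<in> M_phi d \<phi>" unfolding T_def using M_phi_diff[OF A(1)] A' by blast
    have "mdot d (\<lambda>i j. m i j - A' i j) T = 0" "mdot d (\<lambda>i j. m i j - A i j) T = 0" using A A' T by blast+
    then have "mdot d T T = 0" unfolding mdot_diff_left T_def[symmetric]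
      using mdot_diff_left[of d A A' T] by (simp add: T_def)
    then have T0: "T = (\<lambda>i j. 0)" using msq_zero_iff[OF skew_msupp[OF M_phi_skew[OF T]]] by (simp add: mdot_self)
    have "A' i j = A i j" for i j using fun_cong[OF fun_cong[OF T0], of i j] by (simp add: T_def)
    then show "A' = A" by (intro ext)
  qed
  then show "MP_phi d \<phi> G \<in> M_phi d \<phi>" "\<And>S. S \<in> M_phi d \<phi> \<Longrightarrow> mdot d (\<lambda>i j. m i j - MP_phi d \<phi> G i j) S = 0"
    using A by auto
qed

lemma mnorm2_split:
  assumes G: "\<And>i j. i < d \<Longrightarrow> j < d \<Longrightarrow> sqi M (\<lambda>x. G x i j)"
  defines "m \<equiv> \<lambda>i j. \<integral>x. G x i j \<partial>M"
  shows "mnorm2 d \<phi> (\<lambda>x i j. G x i j - S i j) = mnorm2 d \<phi> (\<lambda>x i j. G x i j - m i j) + msq d (\<lambda>i j. m i j - S i j)"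
proof -
  have s: "sqi M (\<lambda>x. G x i j - c)" if "i < d" "j < d" for i j c by (intro sqi_diff G that one_sqi)
  have "(\<integral>x. (G x i j - S i j)\<^sup>2 \<partial>M) = (\<integral>x. (G x i j - m i j)\<^sup>2 \<partial>M) + (m i j - S i j)\<^sup>2" if ij: "i < d" "j < d" for i j
  proof -
    have "(\<integral>x. (G x i j - S i j)\<^sup>2 \<partial>M) = (\<integral>x. (G x i j - m i j)\<^sup>2 + 2 * (m i j - S i j) * (G x i j - m i j) + (m i j - S i j)\<^sup>2 \<partial>M)"
      by (intro Bochner_Integration.integral_cong refl) (simp add: power2_eq_square algebra_simps)
    also have "\<dots> = (\<integral>x. (G x i j - m i j)\<^sup>2 \<partial>M) + 2 * (m i j - S i j) * (\<integral>x. G x i j - m i j \<partial>M) + (m i j - S i j)\<^sup>2"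
      using sqiD(2)[OF s[OF ij]] sqi_integrable[OF fm s[OF ij]] by (simp add: measure_M)
    also have "(\<integral>x. G x i j - m i j \<partial>M) = 0"
      using sqi_integrable[OF fm G[OF ij]] by (simp add: m_def measure_M)
    finally show ?thesis by simp
  qed
  then show ?thesis
    using mnorm2_sum[of "\<lambda>x i j. G x i j - S i j", OF s] mnorm2_sum[of "\<lambda>x i j. G x i j - m i j", OF s]
    by (simp add: msq_def sum.distrib)
qed

lemma MP_phi_minimal:
  assumes G: "\<And>i j. i < d \<Longrightarrow> j < d \<Longrightarrow> sqi M (\<lambda>x. G x i j)" and S: "S \<in> M_phi d \<phi>"
  shows "mnorm2 d \<phi> (\<lambda>x i j. G x i j - MP_phi d \<phi> G i j) \<le> mnorm2 d \<phi> (\<lambda>x i j. G x i j - S i j)"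
proof -
  define m where "m = (\<lambda>i j. \<integral>x. G x i j \<partial>M)"
  define A where "A = MP_phi d \<phi> G"
  have P1: "A \<in> M_phi d \<phi>" unfolding A_def by (rule MP_phi_props(1)) (rule G)
  have P2: "mdot d (\<lambda>i j. m i j - A i j) S' = 0" if "S' \<in> M_phi d \<phi>" for S'
    unfolding A_def m_def by (rule MP_phi_props(2)[OF _ that]) (rule G)
  define T where "T = (\<lambda>i j. A i j - S i j)"
  have T: "T \<in> M_phi d \<phi>" unfolding T_def by (rule M_phi_diff[OF P1 S])
  have "msq d (\<lambda>i j. m i j - S i j) = msq d (\<lambda>i j. m i j - A i j) + 2 * mdot d (\<lambda>i j. m i j - A i j) T + msq d T"
    unfolding msq_def mdot_def sum_distrib_left sum.distrib[symmetric]
    by (intro sum.cong refl) (simp add: T_def power2_eq_square algebra_simps)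
  then have le: "msq d (\<lambda>i j. m i j - A i j) \<le> msq d (\<lambda>i j. m i j - S i j)"
    using P2[OF T] msq_nonneg[of d T] by simp
  have sp: "mnorm2 d \<phi> (\<lambda>x i j. G x i j - B i j) = mnorm2 d \<phi> (\<lambda>x i j. G x i j - m i j) + msq d (\<lambda>i j. m i j - B i j)" for B :: mat
    unfolding m_def by (rule mnorm2_split) (rule G)
  show ?thesis unfolding A_def[symmetric] sp[of A] sp[of S] using le by simp
qed

subsection \<open>Rigidity constants\<close>

lemma M_phi_c_zero: "(\<lambda>i j. 0) \<in> M_phi_c d \<phi>"
  by (simp add: M_phi_c_def skew_zero mdot_def)

lemma C_RD_bound:
  assumes ne: "M_phi_c d \<phi> \<noteq> {\<lambda>i j. 0}"
  shows "0 \<le> C_RD d \<phi>"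
    "\<And>A b. A \<in> M_phi_c d \<phi> \<Longrightarrow> b \<in> vecs d \<Longrightarrow> msq d A + vsq d b \<le> C_RD d \<phi> * norm2 d \<phi> (gdot d \<phi> (affine_field d A b))"
proof -
  define X where "X = M_phi_c d \<phi> \<times> vecs d - {(\<lambda>i j. 0, \<lambda>i. 0)}"
  have sk: "A \<in> skew d" if "A \<in> M_phi_c d \<phi>" for A using that unfolding M_phi_c_def by blast
  have "\<exists>c>0. \<forall>A\<in>M_phi_c d \<phi>. \<forall>b\<in>vecs d. c * (msq d A + vsq d b) \<le> norm2 d \<phi> (gdot d \<phi> (affine_field d A b))"
  proof (rule rigidity_lower_bound[OF closed_M_phi_c sk])
    show "(\<lambda>i j. t * A i j) \<in> M_phi_c d \<phi>" if "A \<in> M_phi_c d \<phi>" for A t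
      using that skew_lc[OF skew_zero sk[OF that], of t] mdot_lc[of d "\<lambda>i j. 0" t A] by (simp add: M_phi_c_def mdot_def)
    fix A assume A: "A \<in> M_phi_c d \<phi>" "A \<in> M_phi d \<phi>"
    then have "mdot d A A = 0" unfolding M_phi_c_def by blast
    then show "A = (\<lambda>i j. 0)" using msq_zero_iff[OF skew_msupp[OF sk[OF A(1)]]] by (simp add: mdot_self)
  qed
  then obtain c where c: "c > 0" "\<And>A b. A \<in> M_phi_c d \<phi> \<Longrightarrow> b \<in> vecs d \<Longrightarrow> c * (msq d A + vsq d b) \<le> norm2 d \<phi> (gdot d \<phi> (affine_field d A b))" by blast
  have pos: "msq d A + vsq d b > 0" if Ab: "(A, b) \<in> X" for A b
  proof -
    have A: "A \<in> M_phi_c d \<phi>" and b: "b \<in> vecs d" using Ab by (auto simp: X_def)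
    have "msq d A \<noteq> 0 \<or> vsq d b \<noteq> 0"
      using Ab msq_zero_iff[OF skew_msupp[OF sk[OF A]]] vsq_zero_iff[OF b] by (auto simp: X_def)
    then show ?thesis using msq_nonneg[of d A] vsq_nonneg[of d b] by linarith
  qed
  have Xne: "X \<noteq> {}"
  proof -
    obtain A where "A \<in> M_phi_c d \<phi>" "A \<noteq> (\<lambda>i j. 0)" using ne M_phi_c_zero by blast
    then have "(A, \<lambda>i. 0) \<in> X" by (simp add: X_def vecs_def)
    then show ?thesis by blast
  qed
  define na where "na = (\<lambda>(A, b). norm2 d \<phi> (gdot d \<phi> (affine_field d A b)))"
  define nb where "nb = (\<lambda>(A, b). msq d A + vsq d b)"
  have "C_RD d \<phi> = inverse (INF p\<in>X. na p / nb p)"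
    unfolding C_RD_def X_def na_def nb_def using ne by (simp add: case_prod_beta)
  moreover have "0 < nb p \<and> c * nb p \<le> na p" if "p \<in> X" for p
    using that pos c(2) by (auto simp: na_def nb_def X_def)
  ultimately have C: "0 < C_RD d \<phi>" "p \<in> X \<Longrightarrow> nb p \<le> C_RD d \<phi> * na p" for p
    using inverse_INF_quotient[OF Xne c(1), of nb na] by simp_all
  then show "0 \<le> C_RD d \<phi>" by simp
  fix A b assume A: "A \<in> M_phi_c d \<phi>" and b: "b \<in> vecs d"
  show "msq d A + vsq d b \<le> C_RD d \<phi> * norm2 d \<phi> (gdot d \<phi> (affine_field d A b))"
  proof (cases "(A, b) \<in> X")
    case True
    then show ?thesis using C(2) by (force simp: na_def nb_def)
  next
    case False
    then have "A = (\<lambda>i j. 0)" "b = (\<lambda>i. 0)" using A b by (auto simp: X_def)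
    then have "msq d A + vsq d b = 0" by (simp add: msq_def vsq_def)
    then show ?thesis using norm2_nonneg C(1) by simp
  qed
qed

text \<open>\<open>C_RV\<close> is normalised by the norm of the field, the compactness bound by
  \<open>msq d A + vsq d b\<close>; this comparison, which rests on finite second moments, links the
  two.\<close>

lemma affine_vnorm2_bound:
  "\<exists>C>0. \<forall>A b. vnorm2 d \<phi> (affine_field d A b) \<le> C * (msq d A + vsq d b)"
proof -
  define X where "X = (\<Sum>j<d. \<integral>x. (x j)\<^sup>2 \<partial>M)"
  have X0: "0 \<le> X" by (simp add: X_def sum_nonneg)
  have "vnorm2 d \<phi> (affine_field d A b) \<le> (2 * X + 2) * (msq d A + vsq d b)" for A b
  proof -
    have l: "(\<integral>x. (lin d A x i)\<^sup>2 \<partial>M) \<le> (\<Sum>j<d. (A i j)\<^sup>2) * X" for i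
    proof -
      have "(\<integral>x. (lin d A x i)\<^sup>2 \<partial>M) \<le> (\<integral>x. (\<Sum>j<d. (A i j)\<^sup>2) * (\<Sum>j<d. (x j)\<^sup>2) \<partial>M)"
      proof (rule integral_mono[OF sqiD(2)[OF lin_sqi]])
        show "integrable M (\<lambda>x. (\<Sum>j<d. (A i j)\<^sup>2) * (\<Sum>j<d. (x j)\<^sup>2))"
          by (intro integrable_mult_right Bochner_Integration.integrable_sum sqiD(2)[OF coord_sqi]) auto
        show "(lin d A x i)\<^sup>2 \<le> (\<Sum>j<d. (A i j)\<^sup>2) * (\<Sum>j<d. (x j)\<^sup>2)" for x
          unfolding lin_def by (rule Cauchy_Schwarz_ineq_sum)
      qed
      also have "\<dots> = (\<Sum>j<d. (A i j)\<^sup>2) * X"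
      proof -
        have "(\<integral>x. (\<Sum>j<d. (x j)\<^sup>2) \<partial>M) = X" unfolding X_def
          by (rule Bochner_Integration.integral_sum) (use sqiD(2)[OF coord_sqi] in auto)
        then show ?thesis by simp
      qed
      finally show ?thesis .
    qed
    have "vnorm2 d \<phi> (affine_field d A b) = (\<Sum>i<d. \<integral>x. (lin d A x i + b i)\<^sup>2 \<partial>M)"
      unfolding vnorm2_sum[OF affine_sqi] by (simp add: affine_field_def)
    also have "\<dots> \<le> (\<Sum>i<d. 2 * (\<integral>x. (lin d A x i)\<^sup>2 \<partial>M) + 2 * (\<integral>x. (b i)\<^sup>2 \<partial>M))"
      by (intro sum_mono integral_sq_sum_le lin_sqi one_sqi)
    also have "\<dots> \<le> (\<Sum>i<d. 2 * ((\<Sum>j<d. (A i j)\<^sup>2) * X) + 2 * (b i)\<^sup>2)"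
      by (intro sum_mono add_mono mult_left_mono l) (simp_all add: measure_M)
    also have "\<dots> = 2 * X * msq d A + 2 * vsq d b"
      by (simp add: msq_def vsq_def sum.distrib sum_distrib_left sum_distrib_right mult_ac)
    also have "\<dots> \<le> (2 * X + 2) * (msq d A + vsq d b)"
      using X0 msq_nonneg[of d A] vsq_nonneg[of d b] by (simp add: algebra_simps)
    finally show ?thesis .
  qed
  then show ?thesis using X0 by (intro exI[of _ "2 * X + 2"]) auto
qed

lemma Rot_phi_c_iff: "A \<in> skew d \<Longrightarrow> lin d A \<in> Rot_phi_c d \<phi> \<longleftrightarrow> (\<forall>S\<in>M_phi d \<phi>. vinner d \<phi> (lin d A) (lin d S) = 0)"
  unfolding Rot_phi_c_def Rot_phi_eq Rot_def by blast

lemma vinner_lin_lc: "vinner d \<phi> (lin d (\<lambda>i j. A i j + t * B i j)) (lin d S) = vinner d \<phi> (lin d A) (lin d S) + t * vinner d \<phi> (lin d B) (lin d S)"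
proof -
  have "vinner d \<phi> (lin d (\<lambda>i j. A i j + t * B i j)) (lin d S) = (\<Sum>i<d. (\<integral>x. lin d A x i * lin d S x i \<partial>M) + t * (\<integral>x. lin d B x i * lin d S x i \<partial>M))"
    unfolding vinner_sum[OF lin_sqi lin_sqi]
  proof (intro sum.cong refl)
    fix i
    have "(\<integral>x. lin d (\<lambda>i j. A i j + t * B i j) x i * lin d S x i \<partial>M) = (\<integral>x. lin d A x i * lin d S x i + t * (lin d B x i * lin d S x i) \<partial>M)"
      by (intro Bochner_Integration.integral_cong refl) (simp add: lin_lc algebra_simps)
    then show "(\<integral>x. lin d (\<lambda>i j. A i j + t * B i j) x i * lin d S x i \<partial>M) = (\<integral>x. lin d A x i * lin d S x i \<partial>M) + t * (\<integral>x. lin d B x i * lin d S x i \<partial>M)"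
      using sqi_mult_integrable[OF lin_sqi lin_sqi] by simp
  qed
  then show ?thesis unfolding vinner_sum[OF lin_sqi lin_sqi] by (simp add: sum.distrib sum_distrib_left)
qed

lemma vinner_lin_cont: "continuous_on UNIV (\<lambda>A. vinner d \<phi> (lin d A) (lin d S))"
proof -
  have "vinner d \<phi> (lin d A) (lin d S) = (\<Sum>i<d. \<Sum>j<d. A i j * (\<integral>x. x j * lin d S x i \<partial>M))" for A
    unfolding vinner_sum[OF lin_sqi lin_sqi]
  proof (intro sum.cong refl)
    fix i
    have "(\<integral>x. lin d A x i * lin d S x i \<partial>M) = (\<integral>x. (\<Sum>j<d. A i j * (x j * lin d S x i)) \<partial>M)"
      by (intro Bochner_Integration.integral_cong refl) (simp add: lin_def[of d A] sum_distrib_right mult.assoc)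
    also have "\<dots> = (\<Sum>j<d. \<integral>x. A i j * (x j * lin d S x i) \<partial>M)"
      by (rule Bochner_Integration.integral_sum) (intro integrable_mult_right sqi_mult_integrable coord_sqi lin_sqi; simp)
    finally show "(\<integral>x. lin d A x i * lin d S x i \<partial>M) = (\<Sum>j<d. A i j * (\<integral>x. x j * lin d S x i \<partial>M))" by simp
  qed
  then show ?thesis by (simp only:) (intro continuous_intros entry_cont)
qed

lemma zero_Rot_phi_c: "(\<lambda>x i. 0) \<in> Rot_phi_c d \<phi>"
  using Rot_phi_c_iff[OF skew_zero] by (simp add: vinner_def)

lemma C_RV_bound:
  assumes ne: "Rot_phi_c d \<phi> \<noteq> {\<lambda>x i. 0}"
  shows "0 \<le> C_RV d \<phi>"
    "\<And>A b. A \<in> skew d \<Longrightarrow> lin d A \<in> Rot_phi_c d \<phi> \<Longrightarrow> b \<in> vecs d \<Longrightarrow>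
      vnorm2 d \<phi> (affine_field d A b) \<le> C_RV d \<phi> * norm2 d \<phi> (gdot d \<phi> (affine_field d A b))"
proof -
  define V where "V = {A \<in> skew d. lin d A \<in> Rot_phi_c d \<phi>}"
  define X where "X = {affine_field d A b | A b. A \<in> skew d \<and> lin d A \<in> Rot_phi_c d \<phi> \<and> b \<in> vecs d} - {\<lambda>x i. 0}"
  have "V = skew d \<inter> (\<Inter>S\<in>M_phi d \<phi>. {A. vinner d \<phi> (lin d A) (lin d S) = 0})"
    unfolding V_def using Rot_phi_c_iff by blast
  also have "closed \<dots>"
    by (intro closed_Int closed_skew closed_INT ballI closed_Collect_eq continuous_on_subset[OF vinner_lin_cont] continuous_on_const) auto
  finally have clV: "closed V" .
  have "\<exists>c>0. \<forall>A\<in>V. \<forall>b\<in>vecs d. c * (msq d A + vsq d b) \<le> norm2 d \<phi> (gdot d \<phi> (affine_field d A b))"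
  proof (rule rigidity_lower_bound[OF clV])
    show "A \<in> skew d" if "A \<in> V" for A using that by (simp add: V_def)
    show "(\<lambda>i j. t * A i j) \<in> V" if A: "A \<in> V" for A t
    proof -
      have A1: "A \<in> skew d" "lin d A \<in> Rot_phi_c d \<phi>" using A by (auto simp: V_def)
      have t: "(\<lambda>i j. t * A i j) \<in> skew d" using skew_lc[OF skew_zero A1(1), of t] by simp
      have "vinner d \<phi> (lin d (\<lambda>i j. t * A i j)) (lin d S) = 0" if S: "S \<in> M_phi d \<phi>" for S
      proof -
        have "vinner d \<phi> (lin d A) (lin d S) = 0" using A1(2) Rot_phi_c_iff[OF A1(1)] S by blast
        then show ?thesis using vinner_lin_lc[of "\<lambda>i j. 0" t A S] by (simp add: vinner_def)
      qed
      then show ?thesis unfolding V_def using t Rot_phi_c_iff[OF t] by blast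
    qed
    fix A assume A: "A \<in> V" "A \<in> M_phi d \<phi>"
    have sk: "A \<in> skew d" using A by (simp add: V_def)
    have "vinner d \<phi> (lin d A) (lin d A) = 0" using A Rot_phi_c_iff[OF sk] unfolding V_def by blast
    then have "vnorm2 d \<phi> (lin d A) = 0" by (simp add: vinner_def vnorm2_def vsq_def power2_eq_square)
    then show "A = (\<lambda>i j. 0)" by (rule lin_vnorm2_zero[OF sk])
  qed
  then obtain c where c: "c > 0" "\<And>A b. A \<in> V \<Longrightarrow> b \<in> vecs d \<Longrightarrow> c * (msq d A + vsq d b) \<le> norm2 d \<phi> (gdot d \<phi> (affine_field d A b))" by blast
  obtain C where C: "C > 0" "\<And>A b. vnorm2 d \<phi> (affine_field d A b) \<le> C * (msq d A + vsq d b)" using affine_vnorm2_bound by blast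
  have pos: "0 < vnorm2 d \<phi> w \<and> c / C * vnorm2 d \<phi> w \<le> norm2 d \<phi> (gdot d \<phi> w)" if w: "w \<in> X" for w
  proof -
    obtain A b where Ab: "w = affine_field d A b" "A \<in> skew d" "lin d A \<in> Rot_phi_c d \<phi>" "b \<in> vecs d" and w0: "w \<noteq> (\<lambda>x i. 0)"
      using w unfolding X_def by blast
    have AV: "A \<in> V" using Ab by (simp add: V_def)
    have "msq d A \<noteq> 0 \<or> vsq d b \<noteq> 0"
    proof (rule ccontr)
      assume "\<not> ?thesis"
      then have "A = (\<lambda>i j. 0)" "b = (\<lambda>i. 0)" using msq_zero_iff[OF skew_msupp[OF Ab(2)]] vsq_zero_iff[OF Ab(4)] by auto
      then have "w = (\<lambda>x i. 0)" by (simp add: Ab(1) affine_field_def[abs_def])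
      then show False using w0 by simp
    qed
    then have n: "msq d A + vsq d b > 0" using msq_nonneg[of d A] vsq_nonneg[of d b] by linarith
    have g: "norm2 d \<phi> (gdot d \<phi> w) > 0"
      using c(2)[OF AV Ab(4)] mult_pos_pos[OF c(1) n] unfolding Ab(1) by linarith
    \<comment> \<open>A field of norm 0 vanishes almost everywhere, and then so does
      \<open>gdot d \<phi> w\<close>, contradicting \<open>g\<close>.\<close>
    have "vnorm2 d \<phi> w \<noteq> 0"
    proof
      assume z: "vnorm2 d \<phi> w = 0"
      have "AE x in M. w x i = 0" if i: "i < d" for i
      proof -
        have "(\<integral>x. (w x i)\<^sup>2 \<partial>M) = 0"
          using z i unfolding Ab(1) vnorm2_sum[OF affine_sqi] by (subst (asm) sum_nonneg_eq_0_iff) auto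
        then show ?thesis unfolding Ab(1)
          using integral_nonneg_eq_0_iff_AE[OF sqiD(2)[OF affine_sqi[of A b i]]] by simp
      qed
      then have "AE x in M. \<forall>i\<in>{..<d}. w x i = 0" by (intro AE_finite_allI) auto
      then have "AE x in M. (gdot d \<phi> w x)\<^sup>2 = 0" by eventually_elim (simp add: gdot_def)
      then have "norm2 d \<phi> (gdot d \<phi> w) = 0" unfolding norm2_def by (rule integral_eq_zero_AE)
      then show False using g by simp
    qed
    then have v: "vnorm2 d \<phi> w > 0" using vnorm2_nonneg[of w] by linarith
    have "c * vnorm2 d \<phi> w \<le> c * (C * (msq d A + vsq d b))" using C(2)[of A b] c(1) unfolding Ab(1) by (intro mult_left_mono) auto
    also have "\<dots> \<le> C * norm2 d \<phi> (gdot d \<phi> w)"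
      using mult_left_mono[OF c(2)[OF AV Ab(4)], of C] C(1) unfolding Ab(1) by (simp add: mult_ac)
    finally have "c / C * vnorm2 d \<phi> w \<le> norm2 d \<phi> (gdot d \<phi> w)" using C(1) by (simp add: field_simps)
    then show ?thesis using v by blast
  qed
  have Xne: "X \<noteq> {}"
  proof -
    obtain R where R: "R \<in> Rot_phi_c d \<phi>" "R \<noteq> (\<lambda>x i. 0)" using ne zero_Rot_phi_c by blast
    then obtain A where A: "A \<in> skew d" "R = lin d A" unfolding Rot_phi_c_def Rot_def by blast
    have "R = affine_field d A (\<lambda>i. 0)" by (simp add: A(2) affine_field_def[abs_def])
    moreover have "(\<lambda>i. 0) \<in> vecs d" by (simp add: vecs_def)
    ultimately have "R \<in> {affine_field d A b |A b. A \<in> skew d \<and> lin d A \<in> Rot_phi_c d \<phi> \<and> b \<in> vecs d}"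
      using R(1) A by (intro CollectI exI[of _ A] exI[of _ "\<lambda>i. 0"]) simp
    then have "R \<in> X" using R(2) by (simp add: X_def)
    then show ?thesis by blast
  qed
  have "c / C > 0" using c(1) C(1) by simp
  note q = inverse_INF_quotient[OF Xne this pos]
  have "C_RV d \<phi> = inverse (INF w\<in>X. norm2 d \<phi> (gdot d \<phi> w) / vnorm2 d \<phi> w)"
    unfolding C_RV_def X_def using ne by simp
  then have CX: "0 < C_RV d \<phi>" "\<And>w. w \<in> X \<Longrightarrow> vnorm2 d \<phi> w \<le> C_RV d \<phi> * norm2 d \<phi> (gdot d \<phi> w)" using q by simp_all
  then show "0 \<le> C_RV d \<phi>" by simp
  fix A b assume Ab: "A \<in> skew d" "lin d A \<in> Rot_phi_c d \<phi>" "b \<in> vecs d"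
  define w where "w = affine_field d A b"
  show "vnorm2 d \<phi> (affine_field d A b) \<le> C_RV d \<phi> * norm2 d \<phi> (gdot d \<phi> (affine_field d A b))"
    unfolding w_def[symmetric]
  proof (cases "w \<in> X")
    case True
    then show "vnorm2 d \<phi> w \<le> C_RV d \<phi> * norm2 d \<phi> (gdot d \<phi> w)" by (rule CX(2))
  next
    case False
    then have "w = (\<lambda>x i. 0)" unfolding X_def w_def using Ab by blast
    then have "vnorm2 d \<phi> w = 0" by (simp add: vnorm2_def vsq_def)
    then show "vnorm2 d \<phi> w \<le> C_RV d \<phi> * norm2 d \<phi> (gdot d \<phi> w)" using norm2_nonneg CX(1) by simp
  qed
qed

subsection \<open>The two inequalities\<close>

text \<open>The summand 1 is for the symmetric part of the derivative, \<open>4 * CB\<close> for the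
  fluctuation of its skew part.\<close>

definition CK :: real where "CK = 1 + 4 * CB"

text \<open>From \<open>gdot_bound\<close> applied to the remainder: 8 times the derivative bound
  \<open>CK\<close>, plus \<open>Cphi - 1\<close> times the Poincare bound
  \<open>CP * CK\<close>.\<close>

definition KG :: real where "KG = (8 + (Cphi - 1) * CP) * CK"

text \<open>Symmetries of \<phi> are invisible to \<open>gdot\<close>, so the estimate for the whole
  rigid part is also one for its transversal component.\<close>

lemma gdot_affine_diff:
  assumes S: "S \<in> M_phi d \<phi>" and x: "x \<in> Rn d"
  shows "gdot d \<phi> (affine_field d (\<lambda>i j. A i j - S i j) b) x = gdot d \<phi> (affine_field d A b) x"
proof -
  have "gdot d \<phi> (affine_field d (\<lambda>i j. A i j - S i j) b) x = gdot d \<phi> (affine_field d A b) x - gdot d \<phi> (lin d S) x"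
    by (simp add: gdot_def affine_field_def lin_diff sum_subtractf[symmetric] algebra_simps)
  then show ?thesis using S x by (simp add: M_phi_iff)
qed

text \<open>The parameter is left free because the two final inequalities use different values: 1 in
  \<open>precised_korn\<close>, \<open>2/5\<close> in \<open>precised_poincare_korn\<close>.\<close>

lemma integral_sq_diff_young:
  assumes f: "sqi M f" and g: "sqi M g" and s: "s > 0"
  shows "(\<integral>x. (f x - g x)\<^sup>2 \<partial>M) \<le> (1 + s) * (\<integral>x. (f x)\<^sup>2 \<partial>M) + (1 + 1 / s) * (\<integral>x. (g x)\<^sup>2 \<partial>M)"
proof -
  have "(\<integral>x. (f x - g x)\<^sup>2 \<partial>M) \<le> (\<integral>x. (1 + s) * (f x)\<^sup>2 + (1 + 1 / s) * (g x)\<^sup>2 \<partial>M)"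
  proof (rule integral_mono[OF sqiD(2)[OF sqi_diff[OF f g]]])
    show "integrable M (\<lambda>x. (1 + s) * (f x)\<^sup>2 + (1 + 1 / s) * (g x)\<^sup>2)" using f g by (simp add: sqi_def)
    fix x
    have "0 \<le> (s * f x + g x)\<^sup>2 / s" using s by simp
    also have "\<dots> = (1 + s) * (f x)\<^sup>2 + (1 + 1 / s) * (g x)\<^sup>2 - (f x - g x)\<^sup>2"
      using s by (simp add: power2_eq_square field_simps)
    finally show "(f x - g x)\<^sup>2 \<le> (1 + s) * (f x)\<^sup>2 + (1 + 1 / s) * (g x)\<^sup>2" by simp
  qed
  then show ?thesis using f g by (simp add: sqi_def)
qed

section \<open>Splitting a Sobolev field into a rigid part and a remainder\<close>

context
  fixes u :: vfield
  assumes u: "u \<in> H1 d \<phi>"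
begin

abbreviation (input) "Gf \<equiv> \<lambda>i j x. D d u x i j"

lemma u_sqi: "i < d \<Longrightarrow> sqi M (\<lambda>x. u x i)"
  using u by (simp add: H1_def sq_int_def sqi_def)

lemma D_sqi: "i < d \<Longrightarrow> j < d \<Longrightarrow> sqi M (Gf i j)"
  using u by (simp add: H1_def sq_int_def sqi_def)

lemma u_h1lim: "i < d \<Longrightarrow> h1lim (\<lambda>x. u x i) (Gf i)"
proof -
  assume i: "i < d"
  have "\<exists>G. weak_jacobian d u G" using u unfolding H1_def by blast
  then have w: "weak_jacobian d u (D d u)" unfolding D_def by (rule someI_ex)
  show ?thesis
  proof (rule weak_h1lim)
    show "sqi M (\<lambda>x. u x i)" by (rule u_sqi[OF i])
    show "sqi M (Gf i j)" if "j < d" for j by (rule D_sqi[OF i that])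
    show "weak_pd d j (\<lambda>x. u x i) (Gf i j)" if "j < d" for j using w i that unfolding weak_jacobian_def by blast
  qed
qed

lemma diff_affine_h1lim: "i < d \<Longrightarrow> h1lim (\<lambda>x. u x i - affine_field d A b x i) (\<lambda>j x. Gf i j x - A i j)"
proof -
  assume i: "i < d"
  have "h1lim (\<lambda>x. u x i + affine_field d (\<lambda>i j. - A i j) (\<lambda>i. - b i) x i) (\<lambda>j x. Gf i j x + - A i j)"
    by (rule h1lim_add[OF u_h1lim[OF i] affine_h1lim])
  then show "h1lim (\<lambda>x. u x i - affine_field d A b x i) (\<lambda>j x. Gf i j x - A i j)"
    by (rule h1lim_cong) (simp_all add: affine_field_def lin_def sum_negf)
qed

text \<open>\<open>D\<close> of the difference is a new choice of version, made independently of the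
  one for u. By uniqueness it agrees almost everywhere with \<open>D d u x i j - S i j\<close>,
  which is enough for the norm.\<close>

lemma D_diff_rot:
  assumes S: "S \<in> skew d" shows "mnorm2 d \<phi> (D d (\<lambda>x i. u x i - lin d S x i)) = mnorm2 d \<phi> (\<lambda>x i j. D d u x i j - S i j)"
proof -
  define G' where "G' = D d (\<lambda>x i. u x i - lin d S x i)"
  have e: "lin d S x i = affine_field d S (\<lambda>i. 0) x i" for x i by (simp add: affine_field_def)
  have w1: "weak_pd d j (\<lambda>x. u x i - lin d S x i) (\<lambda>x. D d u x i j - S i j)" if "i < d" "j < d" for i j
    unfolding e by (rule h1lim_weak_pd[OF diff_affine_h1lim[OF that(1)] that(2)])
  then have "\<exists>G. weak_jacobian d (\<lambda>x i. u x i - lin d S x i) G"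
    unfolding weak_jacobian_def by (intro exI[of _ "\<lambda>x i j. D d u x i j - S i j"]) blast
  then have "weak_jacobian d (\<lambda>x i. u x i - lin d S x i) G'" unfolding G'_def D_def by (rule someI_ex)
  then have w2: "weak_pd d j (\<lambda>x. u x i - lin d S x i) (\<lambda>x. G' x i j)" if "i < d" "j < d" for i j
    using that unfolding weak_jacobian_def by blast
  have ae: "AE x in M. G' x i j = D d u x i j - S i j" if "i < d" "j < d" for i j
    unfolding AE_M_iff by (rule weak_pd_unique[OF w2[OF that] w1[OF that]])
  have m: "(\<lambda>x. D d u x i j - S i j) \<in> borel_measurable M" "(\<lambda>x. G' x i j) \<in> borel_measurable M" if "i < d" "j < d" for i j
    using w1[OF that] w2[OF that] loc_int_measurable unfolding weak_pd_def meas_M by blast+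
  have "AE x in M. \<forall>i\<in>{..<d}. \<forall>j\<in>{..<d}. G' x i j = D d u x i j - S i j"
    by (intro AE_finite_allI ae) auto
  then have "AE x in M. msq d (G' x) = msq d (\<lambda>i j. D d u x i j - S i j)"
    by eventually_elim (simp add: msq_def)
  then show ?thesis unfolding mnorm2_def G'_def[symmetric]
    by (rule integral_cong_AE[rotated 2]) (unfold msq_def, (intro borel_measurable_sum borel_measurable_power m; simp)+)
qed

lemma INF_vnorm2:
  "(INF R\<in>Rot_phi d \<phi>. vnorm2 d \<phi> (\<lambda>x i. u x i - R x i)) = vnorm2 d \<phi> (\<lambda>x i. u x i - P_phi d \<phi> u x i)"
proof (rule Inf_image_minimum)
  have "lin d (\<lambda>i j. 0) \<in> Rot_phi d \<phi>" unfolding Rot_phi_eq using M_phi_zero by blast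
  from P_phi_minimal(1)[of u, OF u_sqi this] show "P_phi d \<phi> u \<in> Rot_phi d \<phi>" .
qed (rule P_phi_minimal(2)[of u, OF u_sqi])

lemma INF_mnorm2:
  "(INF R\<in>Rot_phi d \<phi>. mnorm2 d \<phi> (D d (\<lambda>x i. u x i - R x i))) = mnorm2 d \<phi> (\<lambda>x i j. D d u x i j - MP_phi d \<phi> (D d u) i j)"
proof -
  have "(INF R\<in>Rot_phi d \<phi>. mnorm2 d \<phi> (D d (\<lambda>x i. u x i - R x i))) = (INF S\<in>M_phi d \<phi>. mnorm2 d \<phi> (D d (\<lambda>x i. u x i - lin d S x i)))"
    unfolding Rot_phi_eq image_image ..
  also have "\<dots> = (INF S\<in>M_phi d \<phi>. mnorm2 d \<phi> (\<lambda>x i j. D d u x i j - S i j))"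
    by (intro arg_cong[where f = Inf] image_cong refl D_diff_rot M_phi_skew)
  also have "\<dots> = mnorm2 d \<phi> (\<lambda>x i j. D d u x i j - MP_phi d \<phi> (D d u) i j)"
  proof (rule Inf_image_minimum)
    show "MP_phi d \<phi> (D d u) \<in> M_phi d \<phi>" by (rule MP_phi_props(1)) (rule D_sqi)
    show "mnorm2 d \<phi> (\<lambda>x i j. D d u x i j - MP_phi d \<phi> (D d u) i j) \<le> mnorm2 d \<phi> (\<lambda>x i j. D d u x i j - S i j)"
      if "S \<in> M_phi d \<phi>" for S by (rule MP_phi_minimal[OF _ that]) (rule D_sqi)
  qed
  finally show ?thesis .
qed

text \<open>Entries from index d on are set to zero so that the pair lies in \<open>skew d\<close>
  and \<open>vecs d\<close>.\<close>

definition "rigA = (\<lambda>i j. if i < d \<and> j < d then \<integral>x. anti Gf i j x \<partial>M else 0)"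
definition "rigb = (\<lambda>i. if i < d then \<integral>x. u x i \<partial>M else 0)"

lemma rigA_skew: "rigA \<in> skew d"
proof (rule skewI)
  show "rigA i j = - rigA j i" for i j
  proof -
    have "(\<integral>x. anti Gf i j x \<partial>M) = (\<integral>x. - anti Gf j i x \<partial>M)"
      by (intro Bochner_Integration.integral_cong refl) (simp add: anti_def field_simps)
    then show ?thesis by (auto simp: rigA_def)
  qed
qed (auto simp: msupp_def rigA_def)

lemma rigb_vecs: "rigb \<in> vecs d"
  by (simp add: rigb_def vecs_def)

lemma Ds_norm: "mnorm2 d \<phi> (Ds d u) = (\<Sum>i<d. \<Sum>j<d. \<integral>x. (symm Gf i j x)\<^sup>2 \<partial>M)"
proof -
  have e: "Ds d u x i j = symm Gf i j x" for x i j by (simp add: Ds_def symm_def)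
  have "sqi M (symm Gf i j)" if "i < d" "j < d" for i j
    using sqi_cmult[OF sqi_add[OF D_sqi[OF that] D_sqi[OF that(2,1)]], of "1/2"] by (simp add: symm_def[abs_def])
  then show ?thesis using mnorm2_sum[of "Ds d u"] unfolding e by blast
qed

text \<open>Pythagoras: in the sum over i and j the products of the symmetric part with the skew
  \<open>anti Gf - rigA\<close> cancel, so the two norms simply add, and \<open>korn\<close> bounds
  the second.\<close>

lemma korn_defect: "mnorm2 d \<phi> (\<lambda>x i j. D d u x i j - rigA i j) \<le> CK * mnorm2 d \<phi> (Ds d u)"
proof -
  have ss: "sqi M (symm Gf i j)" if "i < d" "j < d" for i j
    using sqi_cmult[OF sqi_add[OF D_sqi[OF that] D_sqi[OF that(2,1)]], of "1/2"] by (simp add: symm_def[abs_def])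
  have sa: "sqi M (\<lambda>x. anti Gf i j x - rigA i j)" if "i < d" "j < d" for i j
    using sqi_diff[OF sqi_cmult[OF sqi_diff[OF D_sqi[OF that] D_sqi[OF that(2,1)]], of "1/2"] one_sqi[of "rigA i j"]] by (simp add: anti_def[abs_def])
  define c where "c i j = (\<integral>x. symm Gf i j x * (anti Gf i j x - rigA i j) \<partial>M)" for i j
  have c0: "(\<Sum>i<d. \<Sum>j<d. c i j) = 0"
  proof (rule sum_antisym_zero)
    fix i j
    have "c i j = (\<integral>x. - (symm Gf j i x * (anti Gf j i x - rigA j i)) \<partial>M)"
      unfolding c_def by (intro Bochner_Integration.integral_cong refl)
        (simp add: symm_def anti_def skewD[OF rigA_skew, of i j] field_simps)
    then show "c i j = - c j i" by (simp add: c_def)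
  qed
  have one: "(\<integral>x. (Gf i j x - rigA i j)\<^sup>2 \<partial>M) = (\<integral>x. (symm Gf i j x)\<^sup>2 \<partial>M) + 2 * c i j + (\<integral>x. (anti Gf i j x - rigA i j)\<^sup>2 \<partial>M)" if "i < d" "j < d" for i j
  proof -
    have "Gf i j x - rigA i j = symm Gf i j x + (anti Gf i j x - rigA i j)" for x by (simp add: symm_def anti_def field_simps)
    then have "(\<integral>x. (Gf i j x - rigA i j)\<^sup>2 \<partial>M) = (\<integral>x. (symm Gf i j x)\<^sup>2 + 2 * (symm Gf i j x * (anti Gf i j x - rigA i j)) + (anti Gf i j x - rigA i j)\<^sup>2 \<partial>M)"
      by (simp only: power2_sum mult.assoc add_ac)
    then show ?thesis
      using sqiD(2)[OF ss[OF that]] sqiD(2)[OF sa[OF that]] sqi_mult_integrable[OF ss[OF that] sa[OF that]] by (simp add: c_def)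
  qed
  have "mnorm2 d \<phi> (\<lambda>x i j. D d u x i j - rigA i j) = (\<Sum>i<d. \<Sum>j<d. \<integral>x. (Gf i j x - rigA i j)\<^sup>2 \<partial>M)"
    by (rule mnorm2_sum) (intro sqi_diff D_sqi one_sqi)
  also have "\<dots> = (\<Sum>i<d. \<Sum>j<d. (\<integral>x. (symm Gf i j x)\<^sup>2 \<partial>M) + 2 * c i j + (\<integral>x. (anti Gf i j x - rigA i j)\<^sup>2 \<partial>M))"
    by (intro sum.cong refl one) auto
  also have "\<dots> = mnorm2 d \<phi> (Ds d u) + (\<Sum>i<d. \<Sum>j<d. \<integral>x. (anti Gf i j x - rigA i j)\<^sup>2 \<partial>M)"
    using c0 by (simp add: Ds_norm sum.distrib sum_distrib_left[symmetric])
  finally have split: "mnorm2 d \<phi> (\<lambda>x i j. D d u x i j - rigA i j) = \<dots>" .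
  have "(\<Sum>i<d. \<Sum>j<d. \<integral>x. (anti Gf i j x - rigA i j)\<^sup>2 \<partial>M) = (\<Sum>i<d. \<Sum>j<d. \<integral>x. (anti Gf i j x - (\<integral>x. anti Gf i j x \<partial>M))\<^sup>2 \<partial>M)"
    by (intro sum.cong refl) (simp add: rigA_def)
  also have "\<dots> \<le> 4 * CB * mnorm2 d \<phi> (Ds d u)" unfolding Ds_norm
    by (rule korn[of "\<lambda>i x. u x i" "\<lambda>i j x. D d u x i j"]) (rule u_h1lim)
  finally show ?thesis unfolding split CK_def distrib_right mult_1 by (rule add_left_mono)
qed

abbreviation (input) "vf \<equiv> \<lambda>x i. u x i - affine_field d rigA rigb x i"

lemma vf_sqi: "i < d \<Longrightarrow> sqi M (\<lambda>x. vf x i)"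
  using h1lim_sqi(1)[OF diff_affine_h1lim[of i rigA rigb]] .

lemma vf_vnorm2: "vnorm2 d \<phi> vf = (\<Sum>i<d. \<integral>x. (vf x i)\<^sup>2 \<partial>M)"
  by (rule vnorm2_sum) (rule vf_sqi)

text \<open>\<open>rigb\<close> is the mean of u and the coordinates have mean 0, so each component
  of the remainder has mean 0 and the Poincare inequality applies to it directly.\<close>

lemma vf_norm: "vnorm2 d \<phi> vf \<le> CP * CK * mnorm2 d \<phi> (Ds d u)"
proof -
  have "(\<integral>x. (vf x i)\<^sup>2 \<partial>M) \<le> CP * (\<Sum>j<d. \<integral>x. (Gf i j x - rigA i j)\<^sup>2 \<partial>M)" if i: "i < d" for i
  proof -
    have "(\<integral>x. vf x i \<partial>M) = 0"
      using sqi_integrable[OF fm u_sqi[OF i]] sqi_integrable[OF fm affine_sqi[of rigA rigb i]] affine_mean[of rigA rigb i] i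
      by (simp add: rigb_def)
    then show ?thesis using h1lim_poincare[OF diff_affine_h1lim[OF i, of rigA rigb]] by simp
  qed
  then have "vnorm2 d \<phi> vf \<le> (\<Sum>i<d. CP * (\<Sum>j<d. \<integral>x. (Gf i j x - rigA i j)\<^sup>2 \<partial>M))"
    unfolding vf_vnorm2 by (intro sum_mono) auto
  also have "\<dots> = CP * mnorm2 d \<phi> (\<lambda>x i j. D d u x i j - rigA i j)"
  proof -
    have "mnorm2 d \<phi> (\<lambda>x i j. D d u x i j - rigA i j) = (\<Sum>i<d. \<Sum>j<d. \<integral>x. (Gf i j x - rigA i j)\<^sup>2 \<partial>M)"
      by (rule mnorm2_sum) (intro sqi_diff D_sqi one_sqi)
    then show ?thesis by (simp add: sum_distrib_left)
  qed
  also have "\<dots> \<le> CP * (CK * mnorm2 d \<phi> (Ds d u))" by (rule mult_left_mono[OF korn_defect CP0])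
  finally show ?thesis by (simp add: mult.assoc)
qed

lemma gdot_vf_sqi: "sqi M (gdot d \<phi> vf)"
  by (rule gdot_sqi[of vf "\<lambda>i j x. Gf i j x - rigA i j"]) (rule diff_affine_h1lim)

lemma gdot_u_sqi: "sqi M (gdot d \<phi> u)"
  by (rule gdot_sqi[of u "\<lambda>i j x. Gf i j x"]) (rule u_h1lim)

lemma gdot_vf_norm: "norm2 d \<phi> (gdot d \<phi> vf) \<le> KG * mnorm2 d \<phi> (Ds d u)"
proof -
  have m: "mnorm2 d \<phi> (\<lambda>x i j. D d u x i j - rigA i j) = (\<Sum>i<d. \<Sum>j<d. \<integral>x. (Gf i j x - rigA i j)\<^sup>2 \<partial>M)"
    by (rule mnorm2_sum) (intro sqi_diff D_sqi one_sqi)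
  have "norm2 d \<phi> (gdot d \<phi> vf) \<le> 8 * mnorm2 d \<phi> (\<lambda>x i j. D d u x i j - rigA i j) + (Cphi - 1) * vnorm2 d \<phi> vf"
    unfolding m vf_vnorm2
    by (rule gdot_bound[of vf "\<lambda>i j x. Gf i j x - rigA i j"]) (rule diff_affine_h1lim)
  also have "\<dots> \<le> 8 * (CK * mnorm2 d \<phi> (Ds d u)) + (Cphi - 1) * (CP * CK * mnorm2 d \<phi> (Ds d u))"
    using korn_defect vf_norm Cphi8 by (intro add_mono mult_left_mono) auto
  finally show ?thesis by (simp add: KG_def algebra_simps)
qed

lemma gdot_w_norm:
  assumes s: "s > 0"
  shows "norm2 d \<phi> (gdot d \<phi> (affine_field d rigA rigb)) \<le> (1 + s) * norm2 d \<phi> (gdot d \<phi> u) + (1 + 1 / s) * (KG * mnorm2 d \<phi> (Ds d u))"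
proof -
  have "gdot d \<phi> (affine_field d rigA rigb) x = gdot d \<phi> u x - gdot d \<phi> vf x" for x
    by (simp add: gdot_def sum_subtractf[symmetric] algebra_simps)
  then have "norm2 d \<phi> (gdot d \<phi> (affine_field d rigA rigb)) \<le> (1 + s) * norm2 d \<phi> (gdot d \<phi> u) + (1 + 1 / s) * norm2 d \<phi> (gdot d \<phi> vf)"
    using integral_sq_diff_young[OF gdot_u_sqi gdot_vf_sqi s] by (simp add: norm2_def)
  also have "\<dots> \<le> (1 + s) * norm2 d \<phi> (gdot d \<phi> u) + (1 + 1 / s) * (KG * mnorm2 d \<phi> (Ds d u))"
    using s by (intro add_left_mono mult_left_mono gdot_vf_norm) auto
  finally show ?thesis .
qed

text \<open>Split \<open>rigA\<close> into A1 in \<open>M_phi\<close> and A2 orthogonal to it;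
  \<open>gdot\<close> ignores A1, so \<open>C_RD\<close> controls A2. The mean of \<open>D u\<close>
  differs from \<open>rigA\<close> by a symmetric matrix, orthogonal to the skew A2, so the squares
  add up exactly and the factor 2 comes only from Young's inequality with s = 1.\<close>

theorem precised_korn:
  "mnorm2 d \<phi> (\<lambda>x i j. D d u x i j - MP_phi d \<phi> (D d u) i j)
    \<le> (CK + 2 * C_RD d \<phi> * KG) * mnorm2 d \<phi> (Ds d u) + 2 * C_RD d \<phi> * norm2 d \<phi> (gdot d \<phi> u)"
proof -
  obtain A1 where A1: "A1 \<in> M_phi d \<phi>" "\<forall>S\<in>M_phi d \<phi>. mdot d (\<lambda>i j. rigA i j - A1 i j) S = 0"
    using M_phi_projection[of rigA] by (elim bexE)
  define A2 where "A2 = (\<lambda>i j. rigA i j - A1 i j)"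
  have A2s: "A2 \<in> skew d" unfolding A2_def by (rule skew_diff[OF rigA_skew M_phi_skew[OF A1(1)]])
  have A2: "A2 \<in> M_phi_c d \<phi>" using A2s A1(2) unfolding M_phi_c_def A2_def by blast
  define m where "m = (\<lambda>i j. \<integral>x. D d u x i j \<partial>M)"
  have "mdot d (\<lambda>i j. m i j - rigA i j) A2 = 0"
    unfolding mdot_def
  proof (rule sum_antisym_zero)
    fix i j assume ij: "i < d" "j < d"
    have "(\<integral>x. anti Gf i j x \<partial>M) = (m i j - m j i) / 2"
      using sqi_integrable[OF fm D_sqi[OF ij]] sqi_integrable[OF fm D_sqi[OF ij(2,1)]] by (simp add: anti_def m_def)
    moreover have "(\<integral>x. anti Gf j i x \<partial>M) = (m j i - m i j) / 2"
      using sqi_integrable[OF fm D_sqi[OF ij]] sqi_integrable[OF fm D_sqi[OF ij(2,1)]] by (simp add: anti_def m_def)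
    ultimately have "m i j - rigA i j = m j i - rigA j i" using ij by (simp add: rigA_def field_simps)
    then show "(m i j - rigA i j) * A2 i j = - ((m j i - rigA j i) * A2 j i)" using skewD[OF A2s, of i j] by simp
  qed
  then have "msq d (\<lambda>i j. m i j - A1 i j) = msq d (\<lambda>i j. m i j - rigA i j) + msq d A2"
  proof -
    have "msq d (\<lambda>i j. m i j - A1 i j) = msq d (\<lambda>i j. m i j - rigA i j) + 2 * mdot d (\<lambda>i j. m i j - rigA i j) A2 + msq d A2"
      unfolding msq_def mdot_def sum_distrib_left sum.distrib[symmetric]
      by (intro sum.cong refl) (simp add: A2_def power2_eq_square algebra_simps)
    then show "mdot d (\<lambda>i j. m i j - rigA i j) A2 = 0 \<Longrightarrow> ?thesis" by simp
  qed
  then have e: "mnorm2 d \<phi> (\<lambda>x i j. D d u x i j - A1 i j) = mnorm2 d \<phi> (\<lambda>x i j. D d u x i j - rigA i j) + msq d A2"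
  proof -
    have "mnorm2 d \<phi> (\<lambda>x i j. D d u x i j - B i j) = mnorm2 d \<phi> (\<lambda>x i j. D d u x i j - m i j) + msq d (\<lambda>i j. m i j - B i j)" for B :: mat
      unfolding m_def by (rule mnorm2_split) (rule D_sqi)
    note sp = this[of A1] this[of rigA]
    assume "msq d (\<lambda>i j. m i j - A1 i j) = msq d (\<lambda>i j. m i j - rigA i j) + msq d A2"
    then show ?thesis using sp by linarith
  qed
  have A2b: "msq d A2 \<le> C_RD d \<phi> * (2 * norm2 d \<phi> (gdot d \<phi> u) + 2 * (KG * mnorm2 d \<phi> (Ds d u)))"
  proof (cases "M_phi_c d \<phi> = {\<lambda>i j. 0}")
    case True
    then have "A2 = (\<lambda>i j. 0)" using A2 by blast
    then show ?thesis using True by (simp add: C_RD_def msq_def)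
  next
    case False
    note CR = C_RD_bound[OF False]
    have "msq d A2 \<le> msq d A2 + vsq d rigb" using vsq_nonneg[of d rigb] by simp
    also have "\<dots> \<le> C_RD d \<phi> * norm2 d \<phi> (gdot d \<phi> (affine_field d A2 rigb))" by (rule CR(2)[OF A2 rigb_vecs])
    also have "norm2 d \<phi> (gdot d \<phi> (affine_field d A2 rigb)) = norm2 d \<phi> (gdot d \<phi> (affine_field d rigA rigb))"
      unfolding norm2_def A2_def by (intro Bochner_Integration.integral_cong refl) (simp add: gdot_affine_diff[OF A1(1)])
    also have "C_RD d \<phi> * \<dots> \<le> C_RD d \<phi> * (2 * norm2 d \<phi> (gdot d \<phi> u) + 2 * (KG * mnorm2 d \<phi> (Ds d u)))"
      using gdot_w_norm[of 1] by (intro mult_left_mono CR(1)) simp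
    finally show ?thesis .
  qed
  have "mnorm2 d \<phi> (\<lambda>x i j. D d u x i j - MP_phi d \<phi> (D d u) i j) \<le> mnorm2 d \<phi> (\<lambda>x i j. D d u x i j - A1 i j)"
    by (rule MP_phi_minimal[OF _ A1(1)]) (rule D_sqi)
  also have "\<dots> \<le> CK * mnorm2 d \<phi> (Ds d u) + C_RD d \<phi> * (2 * norm2 d \<phi> (gdot d \<phi> u) + 2 * (KG * mnorm2 d \<phi> (Ds d u)))"
    unfolding e by (rule add_mono[OF korn_defect A2b])
  finally show ?thesis by (simp add: algebra_simps)
qed

text \<open>With \<open>s = 2/5\<close> in Young's inequality, \<open>(1 + s)\<^sup>2 \<le> 2\<close>, which produces the factor \<open>2 * C_RV\<close>.\<close>

theorem precised_poincare_korn: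
  assumes c: "Rot_phi_c d \<phi> \<noteq> {\<lambda>x i. 0} \<or> (\<forall>i<d. mean d \<phi> (\<lambda>x. u x i) = 0)"
  shows "vnorm2 d \<phi> (\<lambda>x i. u x i - P_phi d \<phi> u x i)
    \<le> (7/2 * (CP * CK) + 49/10 * C_RV d \<phi> * KG) * mnorm2 d \<phi> (Ds d u) + 2 * C_RV d \<phi> * norm2 d \<phi> (gdot d \<phi> u)"
proof -
  define S2 where "S2 = mnorm2 d \<phi> (Ds d u)"
  define gu where "gu = norm2 d \<phi> (gdot d \<phi> u)"
  obtain A3 where A3: "A3 \<in> M_phi d \<phi>" "\<forall>S\<in>M_phi d \<phi>. vinner d \<phi> (\<lambda>x i. lin d rigA x i - lin d A3 x i) (lin d S) = 0"
    using rot_projection[of "lin d rigA", OF lin_sqi] by blast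
  define A4 where "A4 = (\<lambda>i j. rigA i j - A3 i j)"
  have A4s: "A4 \<in> skew d" unfolding A4_def by (rule skew_diff[OF rigA_skew M_phi_skew[OF A3(1)]])
  have A4l: "lin d A4 = (\<lambda>x i. lin d rigA x i - lin d A3 x i)" by (intro ext) (simp add: A4_def lin_diff)
  have A4: "lin d A4 \<in> Rot_phi_c d \<phi>" unfolding Rot_phi_c_iff[OF A4s] using A3(2) unfolding A4l .
  have gu0: "0 \<le> gu" unfolding gu_def by (rule norm2_nonneg)
  have ab: "vnorm2 d \<phi> (affine_field d A4 rigb) \<le> C_RV d \<phi> * (7/5 * gu + 7/2 * (KG * S2)) \<and> 0 \<le> C_RV d \<phi>"
  proof (cases "Rot_phi_c d \<phi> = {\<lambda>x i. 0}")
    case True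
    have "lin d A4 = (\<lambda>x i. 0)" using A4 True by blast
    \<comment> \<open>Here \<open>C_RV\<close> is 0 and gives no control of the translation part,
      which is 0 by the assumption on the mean.\<close>
    moreover have "rigb = (\<lambda>i. 0)" using c True by (auto simp: rigb_def mean_def)
    ultimately have "vnorm2 d \<phi> (affine_field d A4 rigb) = 0" by (simp add: vnorm2_def vsq_def affine_field_def)
    then show ?thesis using True by (simp add: C_RV_def)
  next
    case False
    note CR = C_RV_bound[OF False]
    have "vnorm2 d \<phi> (affine_field d A4 rigb) \<le> C_RV d \<phi> * norm2 d \<phi> (gdot d \<phi> (affine_field d A4 rigb))"
      by (rule CR(2)[OF A4s A4 rigb_vecs])
    also have "norm2 d \<phi> (gdot d \<phi> (affine_field d A4 rigb)) = norm2 d \<phi> (gdot d \<phi> (affine_field d rigA rigb))"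
      unfolding norm2_def A4_def by (intro Bochner_Integration.integral_cong refl) (simp add: gdot_affine_diff[OF A3(1)])
    also have "C_RV d \<phi> * \<dots> \<le> C_RV d \<phi> * (7/5 * gu + 7/2 * (KG * S2))"
      using gdot_w_norm[of "2/5"] by (intro mult_left_mono CR(1)) (simp add: gu_def S2_def)
    finally show ?thesis using CR(1) by blast
  qed
  have "vnorm2 d \<phi> (\<lambda>x i. u x i - P_phi d \<phi> u x i) \<le> vnorm2 d \<phi> (\<lambda>x i. u x i - lin d A3 x i)"
    by (rule P_phi_minimal(2)[of u, OF u_sqi]) (use A3(1) in \<open>auto simp: Rot_phi_eq\<close>)
  also have "\<dots> = (\<Sum>i<d. \<integral>x. (affine_field d A4 rigb x i - - vf x i)\<^sup>2 \<partial>M)"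
  proof -
    have e: "u x i - lin d A3 x i = affine_field d A4 rigb x i - - vf x i" for x i
      by (simp add: affine_field_def A4l)
    have "vnorm2 d \<phi> (\<lambda>x i. u x i - lin d A3 x i) = (\<Sum>i<d. \<integral>x. (u x i - lin d A3 x i)\<^sup>2 \<partial>M)"
      by (rule vnorm2_sum) (intro diff_lin_sqi u_sqi)
    then show ?thesis unfolding e .
  qed
  \<comment> \<open>The affine part and the remainder need not be orthogonal in the weighted
    product, so unlike in \<open>precised_korn\<close> Young's inequality is needed a second
    time.\<close>
  also have "\<dots> \<le> (\<Sum>i<d. (1 + 2/5) * (\<integral>x. (affine_field d A4 rigb x i)\<^sup>2 \<partial>M) + (1 + 1 / (2/5)) * (\<integral>x. (- vf x i)\<^sup>2 \<partial>M))"
    by (intro sum_mono integral_sq_diff_young affine_sqi sqi_uminus vf_sqi) auto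
  also have "\<dots> = 7/5 * vnorm2 d \<phi> (affine_field d A4 rigb) + 7/2 * vnorm2 d \<phi> vf"
    unfolding power2_minus vnorm2_sum[OF affine_sqi] vf_vnorm2 by (simp add: sum.distrib sum_distrib_left)
  also have "\<dots> \<le> 7/5 * (C_RV d \<phi> * (7/5 * gu + 7/2 * (KG * S2))) + 7/2 * (CP * CK * S2)"
    using ab vf_norm by (intro add_mono mult_left_mono) (auto simp: S2_def)
  also have "\<dots> \<le> (7/2 * (CP * CK) + 49/10 * C_RV d \<phi> * KG) * S2 + 2 * C_RV d \<phi> * gu"
  proof -
    \<comment> \<open>\<open>49/25 = (7/5)^2\<close> has one factor from each use of Young's
      inequality; \<open>49/10 = 7/5 * 7/2\<close> is the resulting coefficient of
      \<open>KG\<close>.\<close>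
    have "49/25 * (C_RV d \<phi> * gu) \<le> 2 * (C_RV d \<phi> * gu)" using ab gu0 by (intro mult_right_mono) auto
    then show ?thesis by (simp add: algebra_simps)
  qed
  finally show ?thesis by (simp only: S2_def gu_def)
qed

end

end

text \<open>The bounding functions are quantified before the dimension and the potential; this order
  expresses that the constants depend on nothing but the five arguments, uniformly in d. The guard
  before the Poincare-Korn inequality leaves out the case where \<open>C_RV\<close> is 0 and u has
  nonzero mean, since constant fields would violate it.\<close>

theorem theorem2:
  shows "\<exists>(B_PK :: real \<Rightarrow> real \<Rightarrow> real \<Rightarrow> real \<Rightarrow> real \<Rightarrow> real)
          (B_K :: real \<Rightarrow> real \<Rightarrow> real \<Rightarrow> real \<Rightarrow> real \<Rightarrow> real).
    \<forall>(d :: nat) (\<phi> :: point \<Rightarrow> real) (C_P :: real) (C_phi :: real) (C_phi' :: real).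
      2 \<le> d \<longrightarrow>
      has_bochner_integral (leb d) (\<lambda>x. exp (- \<phi> x)) 1 \<longrightarrow>
      (\<forall>i<d. has_bochner_integral (leb d) (\<lambda>x. x i * exp (- \<phi> x)) 0) \<longrightarrow>
      Ck d 2 \<phi> \<longrightarrow>
      (\<forall>\<epsilon>>0. \<exists>C. \<forall>x\<in>Rn d. sqrt (msq d (hess \<phi> x)) \<le> \<epsilon> * vsq d (grad \<phi> x) + C) \<longrightarrow>
      optimal_poincare d \<phi> C_P \<longrightarrow>
      8 < C_phi \<longrightarrow> C_phi < C_phi' \<longrightarrow>
      (\<forall>x\<in>Rn d. 4 * sqrt (real d) * sqrt (msq d (hess \<phi> x)) \<le> vsq d (grad \<phi> x) + C_phi - 1) \<longrightarrow>
      (\<forall>x\<in>Rn d. 4 * sqrt (msq d (hess \<phi> x)) \<le> (vsq d (grad \<phi> x) + C_phi') / sqrt C_phi) \<longrightarrow>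
      (\<exists>C_PK' C_K'.
        C_PK' \<le> B_PK C_P C_phi C_phi' (C_RD d \<phi>) (C_RV d \<phi>) \<and>
        C_K' \<le> B_K C_P C_phi C_phi' (C_RD d \<phi>) (C_RV d \<phi>) \<and>
        (\<forall>u\<in>H1 d \<phi>.
          (INF R\<in>Rot_phi d \<phi>. vnorm2 d \<phi> (\<lambda>x i. u x i - R x i))
            = vnorm2 d \<phi> (\<lambda>x i. u x i - P_phi d \<phi> u x i) \<and>
          (Rot_phi_c d \<phi> \<noteq> {\<lambda>x i. 0} \<or> (\<forall>i<d. mean d \<phi> (\<lambda>x. u x i) = 0) \<longrightarrow>
            vnorm2 d \<phi> (\<lambda>x i. u x i - P_phi d \<phi> u x i)
              \<le> C_PK' * mnorm2 d \<phi> (Ds d u) + 2 * C_RV d \<phi> * norm2 d \<phi> (gdot d \<phi> u)) \<and>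
          (INF R\<in>Rot_phi d \<phi>. mnorm2 d \<phi> (D d (\<lambda>x i. u x i - R x i)))
            = mnorm2 d \<phi> (\<lambda>x i j. D d u x i j - MP_phi d \<phi> (D d u) i j) \<and>
          mnorm2 d \<phi> (\<lambda>x i j. D d u x i j - MP_phi d \<phi> (D d u) i j)
            \<le> C_K' * mnorm2 d \<phi> (Ds d u) + 2 * C_RD d \<phi> * norm2 d \<phi> (gdot d \<phi> u)))"
proof (intro exI allI impI)
  fix d :: nat and \<phi> :: "point \<Rightarrow> real" and C_P C_phi C_phi' :: real
  assume mass: "has_bochner_integral (leb d) (\<lambda>x. exp (- \<phi> x)) 1"
    and cent: "\<forall>i<d. has_bochner_integral (leb d) (\<lambda>x. x i * exp (- \<phi> x)) 0"
    and C2: "Ck d 2 \<phi>" and opt: "optimal_poincare d \<phi> C_P" and C8: "8 < C_phi" and C': "C_phi < C_phi'"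
    and h1: "\<forall>x\<in>Rn d. 4 * sqrt (real d) * sqrt (msq d (hess \<phi> x)) \<le> vsq d (grad \<phi> x) + C_phi - 1"
    and h2: "\<forall>x\<in>Rn d. 4 * sqrt (msq d (hess \<phi> x)) \<le> (vsq d (grad \<phi> x) + C_phi') / sqrt C_phi"
  \<comment> \<open>The truncation only spares a proof that the optimal Poincare constant is nonnegative.\<close>
  define P where "P = max C_P 0"
  interpret pot d \<phi> P C_phi C_phi'
  proof
    show "poincare d \<phi> P"
      unfolding poincare_def
    proof (intro allI impI)
      fix f assume f: "test_fun d f"
      have "0 \<le> vnorm2 d \<phi> (grad f)" unfolding vnorm2_def by (rule integral_nonneg_AE) (simp add: vsq_nonneg)
      then have "C_P * vnorm2 d \<phi> (grad f) \<le> P * vnorm2 d \<phi> (grad f)" unfolding P_def by (rule mult_right_mono[rotated]) simp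
      then show "norm2 d \<phi> (\<lambda>x. f x - mean d \<phi> f) \<le> P * vnorm2 d \<phi> (grad f)"
        using opt f unfolding optimal_poincare_def poincare_def by fastforce
    qed
  qed (use mass cent C2 C8 C' h1 h2 in \<open>auto simp: P_def\<close>)
  let ?PK = "7/2 * (P * CK) + 49/10 * C_RV d \<phi> * KG" and ?K = "CK + 2 * C_RD d \<phi> * KG"
  \<comment> \<open>Outside the locale \<open>CK\<close> and \<open>KG\<close> take only the
    Poincare constant and the two Hessian constants as arguments, so these functions involve neither
    d nor \<phi>.\<close>
  show "?PK \<le> (\<lambda>C c c' D V. 7/2 * (max C 0 * pot.CK (max C 0) c c') + 49/10 * V * pot.KG (max C 0) c c')
      C_P C_phi C_phi' (C_RD d \<phi>) (C_RV d \<phi>) \<and>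
    ?K \<le> (\<lambda>C c c' D V. pot.CK (max C 0) c c' + 2 * D * pot.KG (max C 0) c c')
      C_P C_phi C_phi' (C_RD d \<phi>) (C_RV d \<phi>) \<and>
    (\<forall>u\<in>H1 d \<phi>.
          (INF R\<in>Rot_phi d \<phi>. vnorm2 d \<phi> (\<lambda>x i. u x i - R x i))
            = vnorm2 d \<phi> (\<lambda>x i. u x i - P_phi d \<phi> u x i) \<and>
          (Rot_phi_c d \<phi> \<noteq> {\<lambda>x i. 0} \<or> (\<forall>i<d. mean d \<phi> (\<lambda>x. u x i) = 0) \<longrightarrow>
            vnorm2 d \<phi> (\<lambda>x i. u x i - P_phi d \<phi> u x i)
              \<le> ?PK * mnorm2 d \<phi> (Ds d u) + 2 * C_RV d \<phi> * norm2 d \<phi> (gdot d \<phi> u)) \<and>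
          (INF R\<in>Rot_phi d \<phi>. mnorm2 d \<phi> (D d (\<lambda>x i. u x i - R x i)))
            = mnorm2 d \<phi> (\<lambda>x i j. D d u x i j - MP_phi d \<phi> (D d u) i j) \<and>
          mnorm2 d \<phi> (\<lambda>x i j. D d u x i j - MP_phi d \<phi> (D d u) i j)
            \<le> ?K * mnorm2 d \<phi> (Ds d u) + 2 * C_RD d \<phi> * norm2 d \<phi> (gdot d \<phi> u))"
    using INF_vnorm2 precised_poincare_korn INF_mnorm2 precised_korn by (simp add: P_def)
qed

end
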